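(* Let $\{V(\mathbf t):\mathbf t\in\mathbb Z^2\}$ be a stationary random field with mean $\mu$, and let $T=\{(t_1,t_2)\in\mathbb Z^2:1\le t_k\le d_k,\ k=1,2\}$. Suppose that from spatial data $\{Y(\mathbf t):\mathbf t\in T\}$ we have an estimator $\{\widehat V(\mathbf t):\mathbf t\in T\}$ of $\{V(\mathbf t):\mathbf t\in T\}$ such that $$\frac1{|T|}\sum_{\mathbf t\in T}\big(V(\mathbf t)-\widehat V(\mathbf t)\big)^2=o_p(\alpha_T^{-1}),\qquad\alpha_T\to\infty.$$ Assume that the kernel used in the spectral density estimator $\widehat f_T$ and the kernel used in the weights $p_{\mathbf s,T}$ both satisfy conditions (K1) and (K2) (stated in the context). A subscript $V$ or $\widehat V$ indicates whether a quantity is computed from $V$ or from $\widehat V$. Then, as $T\to\infty$: (a) Assume (P1), (P2), (K1), and either [(K3), (P4) for some $0<v\le1/2$, and $|\mathbf h_T|+|\mathbf h_T|^{-1}|T|^{-v}\to0$] or [(K4), (P3), $V$ is $p$-stable for some $p\ge2$ and satisfies the geometric-moment contraction condition, $\mathbb E(|V(\mathbf 0)|^\phi)<\infty$ for some $4<\phi\le8$, and $|\mathbf h_T|\to0$, $(|\mathbf h_T||T|^\eta)^{-1}=O(1)$ for some $0<\eta<\frac{\phi-4}\phi$]. If $|\mathbf h_T|^{-1}=O(\alpha_T)$, then $$\sup_{\mathbf j\in T}\big|\widehat f_V(\lambda_{\mathbf j})-\widehat f_{\widehat V}(\lambda_{\mathbf j})\big|=o_p(1).$$ (b) Assume (P1),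 (P2), (P3), and either that $V$ is a linear field of order $r$ with some $r>1/2$, or that $V$ satisfies the geometric-moment contraction condition with $\mathbb E(|V(\mathbf 0)|^{16})<\infty$. Let $q=4+\epsilon$ with $\epsilon\in(0,1)$ be such that $\frac1{|N|}\sum_{\mathbf j\in N}\frac{I_V^q(\mathbf j)}{f^q(\lambda_{\mathbf j})}<C_2+o_p(1)$ for some constant $C_2$. If $|T|^{\frac{q-1}q}=O(\alpha_T)$, then (i) $\frac1{|N|}\sum_{\mathbf j\in N}\frac{x_V(\mathbf j)-x_{\widehat V}(\mathbf j)+y_V(\mathbf j)-y_{\widehat V}(\mathbf j)}{\sqrt{f(\lambda_{\mathbf j})}}=o_p(1)$; (ii) $\frac1{|N|}\sum_{\mathbf j\in N}\frac{I_V(\mathbf j)-I_{\widehat V}(\mathbf j)}{f(\lambda_{\mathbf j})}=o_p(1)$; (iii) $\frac1{|N|}\sum_{\mathbf j\in N}\frac{I_V^2(\mathbf j)-I_{\widehat V}^2(\mathbf j)}{f^2(\lambda_{\mathbf j})}=o_p(1)$; (iv) $\frac1{|N|}\sum_{\mathbf j\in N}\frac{I_V^q(\mathbf j)-I_{\widehat V}^q(\mathbf j)}{f^q(\lambda_{\mathbf j})}=o_p(1)$. (c) Assume (P1), (P2), (P3), and either that $V$ is a linear field of order $r$ with some $r>1/2$, or that $V$ satisfies the geometric-moment contraction condition with $\mathbb E(|V(\mathbf 0)|^{16})<\infty$; assume also $(|\mathbf h_T|^4|T|)^{-1}=o(1)$, that the kernel $K$ defining the weights satisfies (K1) and (K5),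 and that $\frac1{|T||\mathbf h_T|}\sum_{\mathbf j\in\mathbb Z^2}K^2\big(\frac{2\pi j_1}{h_{T1}d_1},\frac{2\pi j_2}{h_{T2}d_2}\big)=O(1)$. Let $q=4+\epsilon$ with $\epsilon\in(0,1)$ be such that $\sup_{\mathbf j\in N}\sum_{\mathbf s\in\mathbb Z^2}p_{\mathbf s,T}I_V^q(\mathbf j+\mathbf s)\le C_2+o_p(1)$ for some constant $C_2$. If $\big(|T|^{q-1}/|\mathbf h_T|\big)^{1/q}=O(\alpha_T)$, then (i) $\sup_{\mathbf k\in N}\big|\sum_{\mathbf j\in\mathbb Z^2}p_{\mathbf j,T}[x_V(\mathbf k+\mathbf j)-x_{\widehat V}(\mathbf k+\mathbf j)+y_V(\mathbf k+\mathbf j)-y_{\widehat V}(\mathbf k+\mathbf j)]\big|=o_p(1)$; (ii) $\sup_{\mathbf k\in N}\big|\sum_{\mathbf j\in\mathbb Z^2}p_{\mathbf j,T}(I_V(\mathbf k+\mathbf j)-I_{\widehat V}(\mathbf k+\mathbf j))\big|=o_p(1)$; (iii) $\sup_{\mathbf k\in N}\sum_{\mathbf j\in\mathbb Z^2}p_{\mathbf j,T}(I_V^2(\mathbf k+\mathbf j)-I_{\widehat V}^2(\mathbf k+\mathbf j))=o_p(1)$; (iv) $\sup_{\mathbf k\in N}\sum_{\mathbf j\in\mathbb Z^2}p_{\mathbf j,T}(I_V^q(\mathbf k+\mathbf j)-I_{\widehat V}^q(\mathbf k+\mathbf j))=o_p(1)$.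
   Context: Notation: for a vector $\mathbf a=(a_1,a_2)$, $|\mathbf a|=|a_1||a_2|$ (product of absolute values; in particular $|\mathbf h_T|=|h_{T1}h_{T2}|$) and $\|\mathbf a\|=\max_i|a_i|$; $|T|=d_1d_2$; $T\to\infty$ means $d_1,d_2\to\infty$; $\mathbf a'\mathbf b$ is the dot product; $\|X\|_p=(\mathbb E|X|^p)^{1/p}$; $a\asymp b$ means $a=O(b)$ and $b=O(a)$; $\gamma(\mathbf j)=\mathrm{Cov}(V(\mathbf 0),V(\mathbf j))$; $f(\lambda)=\frac1{4\pi^2}\sum_{\mathbf j\in\mathbb Z^2}e^{-i\lambda'\mathbf j}\gamma(\mathbf j)$ is the spectral density of $V$. Standing assumption on the bandwidth: $\mathbf h_T=(h_{T1},h_{T2})\in\mathbb R^2$ satisfies $h_{Tk}\to0$, $h_{T1}\asymp h_{T2}$ and $h_{Tk}d_k\to\infty$ for $k=1,2$. For $W\in\{V,\widehat V\}$ and $\mathbf j\in\mathbb Z^2$: $\lambda_{\mathbf j}=(\lambda_{j1},\lambda_{j2})=(2\pi j_1/d_1,2\pi j_2/d_2)$, $x_W(\mathbf j)=|T|^{-1/2}\sum_{\mathbf t\in T}W(\mathbf t)\cos(-\lambda_{\mathbf j}'\mathbf t)$, $y_W(\mathbf j)=|T|^{-1/2}\sum_{\mathbf t\in T}W(\mathbf t)\sin(-\lambda_{\mathbf j}'\mathbf t)$; $I_W(\mathbf j)=0$ if $\mathbf j\in\{(c_1d_1,c_2d_2):(c_1,c_2)\in\mathbb Z^2\}$ and $I_W(\mathbf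 j)=x_W^2(\mathbf j)+y_W^2(\mathbf j)$ otherwise. Kernel spectral density estimator (the subscript $T$ being suppressed in $\widehat f_W$): $$\widehat f_W(\lambda)=\frac1{4\pi^2}\sum_{\mathbf j\in\mathbb Z^2}\left(\frac{K\big(\frac{\lambda_1-\lambda_{j1}}{h_{T1}},\frac{\lambda_2-\lambda_{j2}}{h_{T2}}\big)}{\sum_{\mathbf k\in\mathbb Z^2}K\big(\frac{\lambda_{k1}}{h_{T1}},\frac{\lambda_{k2}}{h_{T2}}\big)}\right)I_W(\mathbf j).$$ Weights: $p_{\mathbf s,T}=K\big(\frac{2\pi s_1}{h_{T1}d_1},\frac{2\pi s_2}{h_{T2}d_2}\big)\Big/\sum_{\mathbf j\in\mathbb Z^2}K\big(\frac{2\pi j_1}{h_{T1}d_1},\frac{2\pi j_2}{h_{T2}d_2}\big)$. The index set $N\subset T$: if $d_1,d_2$ are both odd, $N=\{1\le t_1\le d_1,\ 1\le t_2\le\frac{d_2-1}2\}\cup\{1\le t_1\le\frac{d_1-1}2,\ t_2=d_2\}$. If $d_1$ is odd and $d_2$ even, $N=\{1\le t_1\le d_1,\ 1\le t_2\le\frac{d_2}2-1\}\cup\{1\le t_1\le\frac{d_1-1}2,\ t_2\in\{\frac{d_2}2,d_2\}\}$; if $d_1$ is even and $d_2$ odd, the same with the roles of the two coordinates interchanged. If both are even, $N=\{1\le t_1\le d_1,\ 1\le t_2\le\frac{d_2}2-1\}\cup\{1\le t_1\le\frac{d_1}2-1,\ t_2\in\{\frac{d_2}2,d_2\}\}$. Conditions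 on the lattice and field: (P1) there exist $0<\xi\le1/2$ and $c_1,c_2>0$ such that, for all sufficiently large $|T|$, $d_1>c_1|T|^\xi$ and $d_2>c_2|T|^\xi$. (P2) $V$ is stationary with $\sum_{\mathbf j\in\mathbb Z^2}|\gamma(\mathbf j)|<\infty$. (P3) $f(\lambda)\ge c$ for some $c>0$ and all $\lambda\in[0,2\pi]^2$. (P4) (with parameter $v$) $R_V(\mathbf r)=|T|^{-1}\sum_{\mathbf j,\mathbf j+\mathbf r\in T}(V(\mathbf j)-\mu)(V(\mathbf j+\mathbf r)-\mu)$ satisfies $|R_V(\mathbf r)-\mathbb E(R_V(\mathbf r))|=O_p(|T|^{-v})$ uniformly in $\mathbf r\in\mathbb Z^2$. Linear field of order $r\ge0$: $V$ is real-valued and $V(\mathbf j)-\mu=\sum_{\mathbf s\in\mathbb Z^2}a_{\mathbf s}\varepsilon_{\mathbf j-\mathbf s}$, with $\{\varepsilon_{\mathbf i}\}$ i.i.d., $\mathbb E(\varepsilon_{\mathbf 0})=0$, $\mathbb E(\varepsilon_{\mathbf 0}^8)<\infty$, $\sum_{\mathbf s}|a_{\mathbf s}||\mathbf s|^r<\infty$, and there exist $\delta,u_0>0$ such that $|\mathbb E\exp(iu\varepsilon_{\mathbf 0})|\le1-\delta$ for all real $|u|>u_0$. Couplings: suppose $V(\mathbf j)-\mu=G(\varepsilon_{\mathbf j-\mathbf s}:\mathbf s\in\mathbb Z^2)$ for all $\mathbf j\in\mathbb Z^2$, with $G$ measurable and $\{\varepsilon_{\mathbf i}\}_{\mathbf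 i\in\mathbb Z^2}$ i.i.d., and let $\{\widetilde\varepsilon_{\mathbf i}\}$ be an i.i.d. (independent) copy. $p$-stability: $V(\mathbf j)\in\mathbb L^p$ and $\sum_{\mathbf j\in\mathbb Z^2}\|V(\mathbf j)-\widetilde V(\mathbf j)\|_p<\infty$, where $\widetilde V(\mathbf j)-\mu=G(\varepsilon^*_{\mathbf j-\mathbf s}:\mathbf s\in\mathbb Z^2)$, $\varepsilon^*_{\mathbf i}=\varepsilon_{\mathbf i}$ for $\mathbf i\ne\mathbf 0$, $\varepsilon^*_{\mathbf 0}=\widetilde\varepsilon_{\mathbf 0}$. Geometric-moment contraction condition: there exist $\alpha>0$, $C>0$, $0<\rho=\rho(\alpha)<1$ with $\mathbb E(|V(\mathbf j)-\widetilde V^\dagger(\mathbf j)|^\alpha)\le C\rho^{\|\mathbf j\|}$ for all $\mathbf j\in\mathbb Z^2$, where $\widetilde V^\dagger(\mathbf j)-\mu=G(\varepsilon^\dagger_{\mathbf j-\mathbf s}:\mathbf s\in\mathbb Z^2)$, $\varepsilon^\dagger_{\mathbf j-\mathbf s}=\varepsilon_{\mathbf j-\mathbf s}$ if $\|\mathbf s\|<\|\mathbf j\|$ and $\varepsilon^\dagger_{\mathbf j-\mathbf s}=\widetilde\varepsilon_{\mathbf j-\mathbf s}$ if $\|\mathbf s\|\ge\|\mathbf j\|$. Conditions on the kernel $K:\mathbb R^2\to\mathbb R$, with $k(\mathbf x)=\int_{\mathbb R^2}K(\lambda)\exp(i\mathbf x'\lambda)\,d\lambda$ and $K_{\mathbf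 h}(\lambda)=\frac1{|\mathbf h_T|}\sum_{\mathbf j\in\mathbb Z^2}K\big(\frac{\lambda_1+2\pi j_1}{h_{T1}},\frac{\lambda_2+2\pi j_2}{h_{T2}}\big)$: (K1) $K$ is real, positive (i.e. $K\ge0$), even, $\int_{\mathbb R^2}K=1$, and $\frac{4\pi^2}{|\mathbf h_T||T|}\sum_{\mathbf j\in\mathbb Z^2}K\big(\frac{2\pi j_1}{h_{T1}d_1},\frac{2\pi j_2}{h_{T2}d_2}\big)=1+o(1)$. (K2) $\sup_{\lambda\in[0,2\pi]^2}|K_{\mathbf h}(\lambda)|=O(|\mathbf h_T|^{-1})$. (K3) $\int_{\mathbb R^2}|K|<\infty$ and $|k(\mathbf x)|\le\widetilde k(\mathbf x)$ for an even function $\widetilde k$, monotonically decreasing with respect to $\|\mathbf x\|$ on $[0,\infty)^2$ (i.e. $\widetilde k(\mathbf x)\ge\widetilde k(\mathbf y)$ if $\|\mathbf x\|\le\|\mathbf y\|$), with $\int_{\mathbb R_+^2}\widetilde k<\infty$. (K4) $k$ is Lipschitz continuous with support $[-1,1]^2$. (K5) for some constant $L_K>0$, $|\mathbf h_T|^{3/2}|K_{\mathbf h}(\lambda_{\mathbf s})-K_{\mathbf h}(\lambda_{\mathbf t})|\le L_K\|\lambda_{\mathbf s}-\lambda_{\mathbf t}\|$ uniformly in $\lambda_{\mathbf s}=(\frac{2\pi s_1}{d_1},\frac{2\pi s_2}{d_2})$, $\lambda_{\mathbf t}=(\frac{2\pi t_1}{d_1},\frac{2\pi t_2}{d_2})$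.
   Formalization: In the first alternative of (a), condition (K3) additionally requires the kernel K to be continuous; without this, K could be altered on the countable set of lattice points where the estimator evaluates it, leaving (K1)-(K3) intact, and the claim can fail. *)

theory Defs
  imports "HOL-Probability.Probability" "HOL-Library.Landau_Symbols"
begin

text \<open>
  A sequence \<open>d :: nat \<Rightarrow> nat \<times> nat\<close> of side lengths gives the sampling regions; every quantity
  carrying an index \<open>T\<close> on paper is a sequence indexed by the same natural number.
  Realisations of a random field are functions \<open>W :: int \<times> int \<Rightarrow> real\<close>.
\<close>

definition rvec :: "int \<times> int \<Rightarrow> real \<times> real" where
  "rvec j = (real_of_int (fst j), real_of_int (snd j))"

text \<open>The notation \<open>|a|\<close> for a vector: the product of the absolute values of the entries.\<close>

definition vabs :: "real \<times> real \<Rightarrow> real" where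
  "vabs a = \<bar>fst a\<bar> * \<bar>snd a\<bar>"

definition vmax :: "real \<times> real \<Rightarrow> real" where
  "vmax a = max \<bar>fst a\<bar> \<bar>snd a\<bar>"

definition vdiv :: "real \<times> real \<Rightarrow> real \<times> real \<Rightarrow> real \<times> real" where
  "vdiv x h = (fst x / fst h, snd x / snd h)"

definition grid :: "nat \<times> nat \<Rightarrow> (int \<times> int) set" where
  "grid d = {1..int (fst d)} \<times> {1..int (snd d)}"

definition gsize :: "nat \<times> nat \<Rightarrow> real" where
  "gsize d = real (fst d) * real (snd d)"

definition half_grid :: "nat \<times> nat \<Rightarrow> (int \<times> int) set" where
  "half_grid d = (let d1 = int (fst d); d2 = int (snd d) in
     if odd d1 \<and> odd d2 then
       {1..d1} \<times> {1..(d2 - 1) div 2} \<union> {1..(d1 - 1) div 2} \<times> {d2}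
     else if odd d1 then
       {1..d1} \<times> {1..d2 div 2 - 1} \<union> {1..(d1 - 1) div 2} \<times> {d2 div 2, d2}
     else if odd d2 then
       {1..d1 div 2 - 1} \<times> {1..d2} \<union> {d1 div 2, d1} \<times> {1..(d2 - 1) div 2}
     else
       {1..d1} \<times> {1..d2 div 2 - 1} \<union> {1..d1 div 2 - 1} \<times> {d2 div 2, d2})"

definition small_op :: "'w measure \<Rightarrow> (nat \<Rightarrow> real) \<Rightarrow> (nat \<Rightarrow> 'w \<Rightarrow> real) \<Rightarrow> bool" where
  "small_op M a X \<longleftrightarrow> (\<forall>n. X n \<in> borel_measurable M) \<and>
     (\<forall>\<epsilon>>0. (\<lambda>n. measure M {\<omega> \<in> space M. \<bar>X n \<omega>\<bar> > \<epsilon> * \<bar>a n\<bar>}) \<longlonglongrightarrow> 0)"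

definition big_op :: "'w measure \<Rightarrow> (nat \<Rightarrow> real) \<Rightarrow> (nat \<Rightarrow> 'w \<Rightarrow> real) \<Rightarrow> bool" where
  "big_op M a X \<longleftrightarrow> (\<forall>n. X n \<in> borel_measurable M) \<and>
     (\<forall>\<epsilon>>0. \<exists>C. \<forall>\<^sub>F n in sequentially.
        measure M {\<omega> \<in> space M. \<bar>X n \<omega>\<bar> > C * \<bar>a n\<bar>} < \<epsilon>)"

definition covar :: "'w measure \<Rightarrow> ('w \<Rightarrow> real) \<Rightarrow> ('w \<Rightarrow> real) \<Rightarrow> real" where
  "covar M X Y = (LINT \<omega>|M. (X \<omega> - (LINT \<omega>|M. X \<omega>)) * (Y \<omega> - (LINT \<omega>|M. Y \<omega>)))"

text \<open>
  Second-order stationarity, which is all that a spectral density needs; a strictly stationary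
  field with finite second moments is an instance.
\<close>

definition stationary_field ::
    "'w measure \<Rightarrow> (int \<times> int \<Rightarrow> 'w \<Rightarrow> real) \<Rightarrow> real \<Rightarrow> bool" where
  "stationary_field M V \<mu> \<longleftrightarrow>
     (\<forall>t. V t \<in> borel_measurable M) \<and>
     (\<forall>t. integrable M (\<lambda>\<omega>. (V t \<omega>)\<^sup>2)) \<and>
     (\<forall>t. (LINT \<omega>|M. V t \<omega>) = \<mu>) \<and>
     (\<forall>s t. covar M (V s) (V (s + t)) = covar M (V 0) (V t))"

definition autocov :: "'w measure \<Rightarrow> (int \<times> int \<Rightarrow> 'w \<Rightarrow> real) \<Rightarrow> int \<times> int \<Rightarrow> real" where
  "autocov M V j = covar M (V 0) (V j)"

text \<open>The series is real because \<open>autocov\<close> is even; \<open>Re\<close> only adjusts the type.\<close>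

definition spec_dens :: "'w measure \<Rightarrow> (int \<times> int \<Rightarrow> 'w \<Rightarrow> real) \<Rightarrow> real \<times> real \<Rightarrow> real" where
  "spec_dens M V l = Re (1 / (4 * complex_of_real pi ^ 2) *
     (\<Sum>\<^sub>\<infinity>j. exp (- (\<i> * complex_of_real (l \<bullet> rvec j))) * complex_of_real (autocov M V j)))"

definition freq :: "nat \<times> nat \<Rightarrow> int \<times> int \<Rightarrow> real \<times> real" where
  "freq d j = (2 * pi * real_of_int (fst j) / real (fst d), 2 * pi * real_of_int (snd j) / real (snd d))"

definition xcoef :: "nat \<times> nat \<Rightarrow> (int \<times> int \<Rightarrow> real) \<Rightarrow> int \<times> int \<Rightarrow> real" where
  "xcoef d W j = (1 / sqrt (gsize d)) * (\<Sum>t\<in>grid d. W t * cos (- (freq d j \<bullet> rvec t)))"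

definition ycoef :: "nat \<times> nat \<Rightarrow> (int \<times> int \<Rightarrow> real) \<Rightarrow> int \<times> int \<Rightarrow> real" where
  "ycoef d W j = (1 / sqrt (gsize d)) * (\<Sum>t\<in>grid d. W t * sin (- (freq d j \<bullet> rvec t)))"

definition pgram :: "nat \<times> nat \<Rightarrow> (int \<times> int \<Rightarrow> real) \<Rightarrow> int \<times> int \<Rightarrow> real" where
  "pgram d W j = (if \<exists>c1 c2. j = (c1 * int (fst d), c2 * int (snd d)) then 0
                  else (xcoef d W j)\<^sup>2 + (ycoef d W j)\<^sup>2)"

definition fhat :: "(real \<times> real \<Rightarrow> real) \<Rightarrow> real \<times> real \<Rightarrow> nat \<times> nat \<Rightarrow>
    (int \<times> int \<Rightarrow> real) \<Rightarrow> real \<times> real \<Rightarrow> real" where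
  "fhat K h d W l = 1 / (4 * pi\<^sup>2) *
     (\<Sum>\<^sub>\<infinity>j. K (vdiv (l - freq d j) h) / (\<Sum>\<^sub>\<infinity>k. K (vdiv (freq d k) h)) * pgram d W j)"

definition lattice_pt :: "real \<times> real \<Rightarrow> nat \<times> nat \<Rightarrow> int \<times> int \<Rightarrow> real \<times> real" where
  "lattice_pt h d j = (2 * pi * real_of_int (fst j) / (fst h * real (fst d)),
                       2 * pi * real_of_int (snd j) / (snd h * real (snd d)))"

definition weight :: "(real \<times> real \<Rightarrow> real) \<Rightarrow> real \<times> real \<Rightarrow> nat \<times> nat \<Rightarrow> int \<times> int \<Rightarrow> real" where
  "weight K h d s = K (lattice_pt h d s) / (\<Sum>\<^sub>\<infinity>j. K (lattice_pt h d j))"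

definition bandwidth_cond :: "(nat \<Rightarrow> nat \<times> nat) \<Rightarrow> (nat \<Rightarrow> real \<times> real) \<Rightarrow> bool" where
  "bandwidth_cond d h \<longleftrightarrow>
     (\<lambda>n. fst (h n)) \<longlonglongrightarrow> 0 \<and> (\<lambda>n. snd (h n)) \<longlonglongrightarrow> 0 \<and>
     (\<lambda>n. fst (h n)) \<in> \<Theta>(\<lambda>n. snd (h n)) \<and>
     filterlim (\<lambda>n. fst (h n) * real (fst (d n))) at_top sequentially \<and>
     filterlim (\<lambda>n. snd (h n) * real (snd (d n))) at_top sequentially"

definition P1 :: "(nat \<Rightarrow> nat \<times> nat) \<Rightarrow> bool" where
  "P1 d \<longleftrightarrow> (\<exists>\<xi> c1 c2. 0 < \<xi> \<and> \<xi> \<le> 1 / 2 \<and> c1 > 0 \<and> c2 > 0 \<and>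
     (\<forall>\<^sub>F n in sequentially. real (fst (d n)) > c1 * gsize (d n) powr \<xi> \<and>
                             real (snd (d n)) > c2 * gsize (d n) powr \<xi>))"

definition P2 :: "'w measure \<Rightarrow> (int \<times> int \<Rightarrow> 'w \<Rightarrow> real) \<Rightarrow> real \<Rightarrow> bool" where
  "P2 M V \<mu> \<longleftrightarrow> stationary_field M V \<mu> \<and> (\<lambda>j. \<bar>autocov M V j\<bar>) summable_on UNIV"

definition P3 :: "'w measure \<Rightarrow> (int \<times> int \<Rightarrow> 'w \<Rightarrow> real) \<Rightarrow> bool" where
  "P3 M V \<longleftrightarrow> (\<exists>c>0. \<forall>l \<in> {0..2 * pi} \<times> {0..2 * pi}. spec_dens M V l \<ge> c)"

definition sample_acov :: "nat \<times> nat \<Rightarrow> real \<Rightarrow> (int \<times> int \<Rightarrow> real) \<Rightarrow> int \<times> int \<Rightarrow> real" where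
  "sample_acov d \<mu> W r =
     (1 / gsize d) * (\<Sum>j \<in> {j. j \<in> grid d \<and> j + r \<in> grid d}. (W j - \<mu>) * (W (j + r) - \<mu>))"

text \<open>
  Uniformity in the lag is read as a bound on the supremum over all lags. That supremum is a
  maximum, since \<open>sample_acov\<close> vanishes at all but finitely many lags.
\<close>

definition P4 :: "'w measure \<Rightarrow> (int \<times> int \<Rightarrow> 'w \<Rightarrow> real) \<Rightarrow> real \<Rightarrow> (nat \<Rightarrow> nat \<times> nat) \<Rightarrow> real \<Rightarrow> bool" where
  "P4 M V \<mu> d v \<longleftrightarrow> big_op M (\<lambda>n. gsize (d n) powr (- v))
     (\<lambda>n \<omega>. SUP r. \<bar>sample_acov (d n) \<mu> (\<lambda>t. V t \<omega>) r
                     - (LINT \<omega>'|M. sample_acov (d n) \<mu> (\<lambda>t. V t \<omega>') r)\<bar>)"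

definition iid_field :: "'w measure \<Rightarrow> (int \<times> int \<Rightarrow> 'w \<Rightarrow> real) \<Rightarrow> bool" where
  "iid_field M e \<longleftrightarrow> prob_space.indep_vars M (\<lambda>_. borel) e UNIV \<and>
     (\<forall>i. distr M borel (e i) = distr M borel (e 0))"

text \<open>
  The moving average is the mean-square limit of its finite partial sums. In the weight
  \<open>|s|^r\<close> the case distinction implements \<open>0^0 = 1\<close>, whereas \<open>0 powr 0 = 0\<close>.
\<close>

definition linear_field :: "'w measure \<Rightarrow> (int \<times> int \<Rightarrow> 'w \<Rightarrow> real) \<Rightarrow> real \<Rightarrow> real \<Rightarrow> bool" where
  "linear_field M V \<mu> r \<longleftrightarrow> r \<ge> 0 \<and> (\<exists>a e. iid_field M e \<and>
     (\<forall>j. ((\<lambda>F. LINT \<omega>|M. (V j \<omega> - \<mu> - (\<Sum>s\<in>F. a s * e (j - s) \<omega>))\<^sup>2) \<longlongrightarrow> 0)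
            (finite_subsets_at_top UNIV)) \<and>
     (LINT \<omega>|M. e 0 \<omega>) = 0 \<and>
     integrable M (\<lambda>\<omega>. (e 0 \<omega>) ^ 8) \<and>
     (\<lambda>s. \<bar>a s\<bar> * (if r = 0 then 1 else vabs (rvec s) powr r)) summable_on UNIV \<and>
     (\<exists>\<delta>>0. \<exists>u0>0. \<forall>u. \<bar>u\<bar> > u0 \<longrightarrow> cmod (char (distr M borel (e 0)) u) \<le> 1 - \<delta>))"

definition innovation_rep :: "'w measure \<Rightarrow> (int \<times> int \<Rightarrow> 'w \<Rightarrow> real) \<Rightarrow> real \<Rightarrow>
    ((int \<times> int \<Rightarrow> real) \<Rightarrow> real) \<Rightarrow> (int \<times> int \<Rightarrow> 'w \<Rightarrow> real) \<Rightarrow> bool" where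
  "innovation_rep M V \<mu> G e \<longleftrightarrow> iid_field M e \<and>
     G \<in> borel_measurable (Pi\<^sub>M UNIV (\<lambda>_. borel)) \<and>
     (\<forall>j. AE \<omega> in M. V j \<omega> - \<mu> = G (\<lambda>s. e (j - s) \<omega>))"

text \<open>
  The couplings live on \<open>M \<Otimes>\<^sub>M M\<close>: there \<open>e i (fst \<omega>)\<close> is the original innovation and
  \<open>e i (snd \<omega>)\<close> its independent copy, so \<open>M\<close> itself need not carry the copy.
\<close>

definition coupled_star :: "real \<Rightarrow> ((int \<times> int \<Rightarrow> real) \<Rightarrow> real) \<Rightarrow> (int \<times> int \<Rightarrow> 'w \<Rightarrow> real) \<Rightarrow>
    int \<times> int \<Rightarrow> 'w \<times> 'w \<Rightarrow> real" where
  "coupled_star \<mu> G e j \<omega> =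
     \<mu> + G (\<lambda>s. if j - s = 0 then e (j - s) (snd \<omega>) else e (j - s) (fst \<omega>))"

definition coupled_dagger :: "real \<Rightarrow> ((int \<times> int \<Rightarrow> real) \<Rightarrow> real) \<Rightarrow> (int \<times> int \<Rightarrow> 'w \<Rightarrow> real) \<Rightarrow>
    int \<times> int \<Rightarrow> 'w \<times> 'w \<Rightarrow> real" where
  "coupled_dagger \<mu> G e j \<omega> =
     \<mu> + G (\<lambda>s. if vmax (rvec s) < vmax (rvec j) then e (j - s) (fst \<omega>) else e (j - s) (snd \<omega>))"

definition Lp_norm :: "'w measure \<Rightarrow> real \<Rightarrow> ('w \<Rightarrow> real) \<Rightarrow> real" where
  "Lp_norm M p X = (LINT \<omega>|M. \<bar>X \<omega>\<bar> powr p) powr (1 / p)"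

text \<open>
  The norms in the sum are finite: \<open>coupled_star\<close> at \<open>j\<close> has the law of \<open>V j\<close>, which is in \<open>L\<^sup>p\<close>.
\<close>

definition p_stable :: "'w measure \<Rightarrow> (int \<times> int \<Rightarrow> 'w \<Rightarrow> real) \<Rightarrow> real \<Rightarrow>
    ((int \<times> int \<Rightarrow> real) \<Rightarrow> real) \<Rightarrow> (int \<times> int \<Rightarrow> 'w \<Rightarrow> real) \<Rightarrow> real \<Rightarrow> bool" where
  "p_stable M V \<mu> G e p \<longleftrightarrow>
     (\<forall>j. integrable M (\<lambda>\<omega>. \<bar>V j \<omega>\<bar> powr p)) \<and>
     (\<lambda>j. Lp_norm (M \<Otimes>\<^sub>M M) p (\<lambda>\<omega>. V j (fst \<omega>) - coupled_star \<mu> G e j \<omega>)) summable_on UNIV"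

definition gmc :: "'w measure \<Rightarrow> (int \<times> int \<Rightarrow> 'w \<Rightarrow> real) \<Rightarrow> real \<Rightarrow>
    ((int \<times> int \<Rightarrow> real) \<Rightarrow> real) \<Rightarrow> (int \<times> int \<Rightarrow> 'w \<Rightarrow> real) \<Rightarrow> bool" where
  "gmc M V \<mu> G e \<longleftrightarrow> (\<exists>a>0. \<exists>C>0. \<exists>\<rho>. 0 < \<rho> \<and> \<rho> < 1 \<and>
     (\<forall>j. integrable (M \<Otimes>\<^sub>M M) (\<lambda>\<omega>. \<bar>V j (fst \<omega>) - coupled_dagger \<mu> G e j \<omega>\<bar> powr a) \<and>
          (LINT \<omega>|(M \<Otimes>\<^sub>M M). \<bar>V j (fst \<omega>) - coupled_dagger \<mu> G e j \<omega>\<bar> powr a)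
            \<le> C * \<rho> powr vmax (rvec j)))"

definition kernel_ft :: "(real \<times> real \<Rightarrow> real) \<Rightarrow> real \<times> real \<Rightarrow> complex" where
  "kernel_ft K x = (LINT l|lborel. complex_of_real (K l) * exp (\<i> * complex_of_real (x \<bullet> l)))"

definition shifted_pt :: "real \<times> real \<Rightarrow> real \<times> real \<Rightarrow> int \<times> int \<Rightarrow> real \<times> real" where
  "shifted_pt h l j = vdiv (l + (2 * pi) *\<^sub>R rvec j) h"

definition K_per :: "(real \<times> real \<Rightarrow> real) \<Rightarrow> real \<times> real \<Rightarrow> real \<times> real \<Rightarrow> real" where
  "K_per K h l = (1 / vabs h) * (\<Sum>\<^sub>\<infinity>j. K (shifted_pt h l j))"

definition K1 :: "(nat \<Rightarrow> nat \<times> nat) \<Rightarrow> (nat \<Rightarrow> real \<times> real) \<Rightarrow> (real \<times> real \<Rightarrow> real) \<Rightarrow> bool" where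
  "K1 d h K \<longleftrightarrow> (\<forall>x. K x \<ge> 0) \<and> (\<forall>x. K (- x) = K x) \<and> has_bochner_integral lborel K 1 \<and>
     (\<lambda>n. 4 * pi\<^sup>2 / (vabs (h n) * gsize (d n)) * (\<Sum>\<^sub>\<infinity>j. K (lattice_pt (h n) (d n) j)))
        \<longlonglongrightarrow> 1"

text \<open>
  Convergence of the series is stated explicitly, because \<open>infsum\<close> is \<open>0\<close> on divergent series.
  In \<open>K1\<close> and \<open>K5\<close> it follows, for large \<open>n\<close>, from the limit in \<open>K1\<close> being nonzero.
\<close>

definition K2 :: "(nat \<Rightarrow> real \<times> real) \<Rightarrow> (real \<times> real \<Rightarrow> real) \<Rightarrow> bool" where
  "K2 h K \<longleftrightarrow> (\<exists>C. \<forall>\<^sub>F n in sequentially. \<forall>l \<in> {0..2 * pi} \<times> {0..2 * pi}.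
     (\<lambda>j. K (shifted_pt (h n) l j)) summable_on UNIV \<and>
     \<bar>K_per K (h n) l\<bar> \<le> C * (1 / vabs (h n)))"

text \<open>
  \<open>kernel_ft K\<close> is integrable here and determines \<open>K\<close> only almost everywhere, while the estimator
  evaluates \<open>K\<close> on a countable set; \<open>K\<close> is therefore taken to be the continuous representative.
  Evenness of the majorant is evenness in each coordinate, so that its behaviour on the quadrant
  \<open>[0,\<infinity>)\<^sup>2\<close> determines it everywhere.
\<close>

definition K3 :: "(real \<times> real \<Rightarrow> real) \<Rightarrow> bool" where
  "K3 K \<longleftrightarrow> continuous_on UNIV K \<and> integrable lborel (\<lambda>x. \<bar>K x\<bar>) \<and>
     (\<exists>kt :: real \<times> real \<Rightarrow> real.
        (\<forall>x. cmod (kernel_ft K x) \<le> kt x) \<and>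
        (\<forall>x1 x2. kt (- x1, x2) = kt (x1, x2) \<and> kt (x1, - x2) = kt (x1, x2)) \<and>
        (\<forall>x \<in> {0..} \<times> {0..}. \<forall>y \<in> {0..} \<times> {0..}. vmax x \<le> vmax y \<longrightarrow> kt y \<le> kt x) \<and>
        set_integrable lborel ({0..} \<times> {0..}) kt)"

definition K4 :: "(real \<times> real \<Rightarrow> real) \<Rightarrow> bool" where
  "K4 K \<longleftrightarrow> (\<exists>L. L-lipschitz_on UNIV (kernel_ft K)) \<and>
     closure {x. kernel_ft K x \<noteq> 0} = {-1..1} \<times> {-1..1}"

definition K5 :: "(nat \<Rightarrow> nat \<times> nat) \<Rightarrow> (nat \<Rightarrow> real \<times> real) \<Rightarrow> (real \<times> real \<Rightarrow> real) \<Rightarrow> bool" where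
  "K5 d h K \<longleftrightarrow> (\<exists>L>0. \<forall>\<^sub>F n in sequentially. \<forall>s t.
     vabs (h n) powr (3 / 2) * \<bar>K_per K (h n) (freq (d n) s) - K_per K (h n) (freq (d n) t)\<bar>
       \<le> L * vmax (freq (d n) s - freq (d n) t))"

end

theory Submission
  imports Defs
begin

text \<open>
  Write \<open>\<Delta> = V - V'\<close> for the estimation error, where \<open>V'\<close> is the estimated field, and \<open>m\<close> for its mean
  square over the grid. The square root of a periodogram ordinate is a Euclidean norm of the pair of
  Fourier coefficients, so the square roots of the ordinates of \<open>V\<close> and \<open>V'\<close> differ by at most the
  square root of the ordinate of \<open>\<Delta>\<close>, and Parseval's identity bounds the sum of the ordinates of
  \<open>\<Delta>\<close> over all Fourier frequencies by \<open>|T| m\<close>. Elementary analysis turns this into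
  \<open>|a^p - b^p| \<le> \<eta> (2 + a^q) + C\<^sub>\<eta> e^q\<close> for every \<open>\<eta> > 0\<close> and \<open>0 < p \<le> q\<close>, where \<open>a\<close>, \<open>b\<close>, \<open>e\<close> are the
  ordinates of \<open>V\<close>, \<open>V'\<close> and \<open>\<Delta>\<close> (lemma \<open>powr_perturb\<close>). After averaging with probability weights, the
  first term is \<open>\<eta>\<close> times a quantity that is bounded in probability as soon as the averaged
  \<open>q\<close>-th powers \<open>a^q\<close> are, and the second term tends to \<open>0\<close> in probability by the rate assumed for \<open>m\<close>; letting
  \<open>\<eta> \<rightarrow> 0\<close> gives every assertion. The locale \<open>perturbed_averages\<close> carries this argument out once.

  For the second and the third conjunct the required bound on averages of \<open>a^q\<close> is a hypothesis of the theorem. The rates for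
  \<open>\<alpha>\<close> are exactly those at which the error term vanishes: with uniform weights over the index set
  \<open>N\<close>, which has at least \<open>|T| / 8\<close> elements, and with a spectral density bounded below, the average of \<open>e^q\<close> is at
  most a constant times \<open>|T|^{-1} (|T| m)^q\<close>, and with kernel weights, which after folding modulo the grid are at most
  a constant over \<open>|h| |T|\<close>, it is at most a constant times \<open>(|h| |T|)^{-1} (|T| m)^q\<close>.

  The first conjunct is the case \<open>p = q = 1\<close> with kernel weights. What has to be supplied is that
  the maximum over the Fourier frequencies of the smoothed periodogram of the centred field \<open>V - \<mu>\<close> is bounded in
  probability, and this is where the two alternative sets of hypotheses enter.

  Under \<open>K3\<close> and \<open>P4\<close> the smoothed periodogram is a weighted sum of sample autocovariances over the
  lags. Replacing these by their means costs the uniform deviation in \<open>P4\<close> times the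
  sum over all lags of the moduli of the Fourier coefficients of the weights. That sum is \<open>O(|h|^{-1})\<close>:
  by Fourier inversion it is an integral of the transform \<open>k\<close> against Fejer kernels, and a
  radially decreasing majorant of \<open>k\<close> cannot see the oscillation of the Fejer kernels below the
  scale \<open>h\<close> (lemma \<open>kernel_lag_sum_bound\<close>). The means contribute at most the sum of \<open>|\<gamma>|\<close>.

  Under geometric-moment contraction \<open>V - \<mu>\<close> is approximated in \<open>L\<^sup>4\<close>, at a geometric rate in \<open>r\<close>,
  by functions of the innovations at distance less than \<open>r\<close> (lemma \<open>fourth_moment_approximants\<close>). The
  increments of this approximation are split into residue classes of sites so sparse that within each class the variables
  are independent. The smoothed periodogram of one class is a quadratic form
  whose off-diagonal part has fourth moment at most a constant times \<open>B\<^sup>2\<close>, where \<open>B = O((|h| |T|)^{-1})\<close> bounds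
  the folded weights; summing over the \<open>|T|\<close> frequencies gives \<open>O(|h|^{-2} |T|^{-1})\<close>, which is
  bounded because the bandwidth is at least a constant times a power of \<open>|T|\<close> whose exponent exceeds
  \<open>- (\<phi> - 4) / \<phi> \<ge> - 1/2\<close> (lemma \<open>smoothed_periodogram_bound\<close>). The geometric rate pays for the number of
  classes.
\<close>

section \<open>Fourth moments of quadratic forms in independent variables\<close>

lemma (in prob_space) indep_factor:
  fixes X :: "'i \<Rightarrow> 'a \<Rightarrow> real" and \<phi> :: "real \<Rightarrow> real"
  assumes ind: "indep_vars (\<lambda>_. borel) X (insert x F)" and x: "x \<notin> F"
    and \<phi>: "\<phi> \<in> borel_measurable borel" and \<psi>: "\<psi> \<in> borel_measurable (Pi\<^sub>M F (\<lambda>_. borel))"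
    and int: "integrable M (\<lambda>\<omega>. \<phi> (X x \<omega>))" "integrable M (\<lambda>\<omega>. \<psi> (restrict (\<lambda>i. X i \<omega>) F))"
  shows "integrable M (\<lambda>\<omega>. \<phi> (X x \<omega>) * \<psi> (restrict (\<lambda>i. X i \<omega>) F))"
    and "expectation (\<lambda>\<omega>. \<phi> (X x \<omega>) * \<psi> (restrict (\<lambda>i. X i \<omega>) F))
         = expectation (\<lambda>\<omega>. \<phi> (X x \<omega>)) * expectation (\<lambda>\<omega>. \<psi> (restrict (\<lambda>i. X i \<omega>) F))"
proof -
  have iv: "indep_var (PiM {x} (\<lambda>_. borel)) (\<lambda>\<omega>. restrict (\<lambda>i. X i \<omega>) {x})
      (PiM F (\<lambda>_. borel)) (\<lambda>\<omega>. restrict (\<lambda>i. X i \<omega>) F)"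
    by (rule indep_var_restrict[OF ind]) (use x in auto)
  have m: "(\<lambda>v. \<phi> (v x)) \<in> borel_measurable (PiM {x} (\<lambda>_. borel))"
    by (rule measurable_compose[OF _ \<phi>]) simp
  have "indep_var borel ((\<lambda>v. \<phi> (v x)) \<circ> (\<lambda>\<omega>. restrict (\<lambda>i. X i \<omega>) {x}))
      borel (\<psi> \<circ> (\<lambda>\<omega>. restrict (\<lambda>i. X i \<omega>) F))"
    by (rule indep_var_compose[OF iv m \<psi>])
  then have *: "indep_var borel (\<lambda>\<omega>. \<phi> (X x \<omega>)) borel (\<lambda>\<omega>. \<psi> (restrict (\<lambda>i. X i \<omega>) F))"
    by (simp add: comp_def)
  show "integrable M (\<lambda>\<omega>. \<phi> (X x \<omega>) * \<psi> (restrict (\<lambda>i. X i \<omega>) F))"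
    by (rule indep_var_integrable[OF * int])
  show "expectation (\<lambda>\<omega>. \<phi> (X x \<omega>) * \<psi> (restrict (\<lambda>i. X i \<omega>) F))
         = expectation (\<lambda>\<omega>. \<phi> (X x \<omega>)) * expectation (\<lambda>\<omega>. \<psi> (restrict (\<lambda>i. X i \<omega>) F))"
    by (rule indep_var_lebesgue_integral[OF * int])
qed

lemma abs_mult_le_half_sum_squares: "\<bar>a * b\<bar> \<le> (a\<^sup>2 + b\<^sup>2) / (2::real)"
  using sum_squares_bound[of "\<bar>a\<bar>" "\<bar>b\<bar>"] by (simp add: abs_mult)

lemma integral_mult_le_of_squares:
  fixes r g :: "'a \<Rightarrow> real"
  assumes i: "integrable M (\<lambda>\<omega>. (r \<omega>)\<^sup>2)" "integrable M (\<lambda>\<omega>. (g \<omega>)\<^sup>2)"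
    and m[measurable]: "r \<in> borel_measurable M" "g \<in> borel_measurable M"
    and R: "(LINT \<omega>|M. (r \<omega>)\<^sup>2) \<le> \<rho>\<^sup>2" and G: "(LINT \<omega>|M. (g \<omega>)\<^sup>2) \<le> \<gamma>\<^sup>2"
    and nn: "\<rho> \<ge> 0" "\<gamma> \<ge> 0"
  shows "integrable M (\<lambda>\<omega>. r \<omega> * g \<omega>)" "(LINT \<omega>|M. r \<omega> * g \<omega>) \<le> \<rho> * \<gamma>"
proof -
  show ii: "integrable M (\<lambda>\<omega>. r \<omega> * g \<omega>)"
    by (rule Bochner_Integration.integrable_bound[OF Bochner_Integration.integrable_add[OF i]])
      (auto intro!: order_trans[OF abs_mult_le_half_sum_squares])
  have key: "(LINT \<omega>|M. r \<omega> * g \<omega>) \<le> (\<rho> + \<epsilon>) * (\<gamma> + \<epsilon>)" if e: "\<epsilon> > 0" for \<epsilon>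
  proof -
    define s where "s = (\<gamma> + \<epsilon>) / (\<rho> + \<epsilon>)"
    have s: "s > 0" using nn e by (simp add: s_def)
    have "r \<omega> * g \<omega> \<le> s/2 * (r \<omega>)\<^sup>2 + 1/(2 * s) * (g \<omega>)\<^sup>2" for \<omega>
    proof -
      have "0 \<le> (s * r \<omega> - g \<omega>)\<^sup>2 / (2 * s)" using s by simp
      also have "\<dots> = s/2 * (r \<omega>)\<^sup>2 + 1/(2 * s) * (g \<omega>)\<^sup>2 - r \<omega> * g \<omega>"
        using s by (simp add: field_simps power2_eq_square)
      finally show ?thesis by simp
    qed
    then have "(LINT \<omega>|M. r \<omega> * g \<omega>) \<le> (LINT \<omega>|M. s/2 * (r \<omega>)\<^sup>2 + 1/(2 * s) * (g \<omega>)\<^sup>2)"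
      by (intro integral_mono ii Bochner_Integration.integrable_add) (use i in auto)
    also have "\<dots> = s/2 * (LINT \<omega>|M. (r \<omega>)\<^sup>2) + 1/(2 * s) * (LINT \<omega>|M. (g \<omega>)\<^sup>2)"
      using i by simp
    also have "\<dots> \<le> s/2 * (\<rho> + \<epsilon>)\<^sup>2 + 1/(2 * s) * (\<gamma> + \<epsilon>)\<^sup>2"
    proof -
      have "\<rho>\<^sup>2 \<le> (\<rho> + \<epsilon>)\<^sup>2" "\<gamma>\<^sup>2 \<le> (\<gamma> + \<epsilon>)\<^sup>2" using nn e by (auto intro!: power_mono)
      then show ?thesis using R G s by (intro add_mono mult_left_mono) auto
    qed
    also have "\<dots> = (\<rho> + \<epsilon>) * (\<gamma> + \<epsilon>)"
    proof -
      have "p / r / 2 * r\<^sup>2 + 1 / (2 * (p / r)) * p\<^sup>2 = r * p" if "r > 0" "p > 0" for r p :: real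
        using that by (simp add: field_simps power2_eq_square)
      from this[of "\<rho> + \<epsilon>" "\<gamma> + \<epsilon>"] show ?thesis unfolding s_def using nn e by linarith
    qed
    finally show ?thesis .
  qed
  have lim: "((\<lambda>\<epsilon>. (\<rho> + \<epsilon>) * (\<gamma> + \<epsilon>)) \<longlongrightarrow> (\<rho> + 0) * (\<gamma> + 0)) (at_right 0)"
    by (intro tendsto_intros)
  have "(LINT \<omega>|M. r \<omega> * g \<omega>) \<le> (\<rho> + 0) * (\<gamma> + 0)"
    by (rule tendsto_lowerbound[OF lim]) (auto intro!: key eventually_at_right_less[THEN eventually_mono])
  then show "(LINT \<omega>|M. r \<omega> * g \<omega>) \<le> \<rho> * \<gamma>" by simp
qed

lemma pow_le_1_pow4: "\<bar>x::real\<bar> \<le> 1 + x^4" "x\<^sup>2 \<le> (1 + x^4)/2" "\<bar>x^3\<bar> \<le> (x\<^sup>2 + x^4)/2"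
proof -
  show *: "x\<^sup>2 \<le> (1 + x^4)/2" using abs_mult_le_half_sum_squares[of 1 "x\<^sup>2"] by (simp add: power_mult[symmetric])
  have "\<bar>x\<bar> \<le> (1 + x\<^sup>2)/2" using abs_mult_le_half_sum_squares[of 1 x] by simp
  moreover have "0 \<le> x^4" by simp
  moreover have "a \<le> (1 + b)/2 \<Longrightarrow> 0 \<le> c \<Longrightarrow> b \<le> (1 + c)/2 \<Longrightarrow> a \<le> 1 + c" for a b c :: real
    by (simp add: field_simps)
  ultimately show "\<bar>x\<bar> \<le> 1 + x^4" using * by blast
  show "\<bar>x^3\<bar> \<le> (x\<^sup>2 + x^4)/2" using abs_mult_le_half_sum_squares[of x "x\<^sup>2"]
    by (simp add: power_mult[symmetric] power3_eq_cube power2_eq_square mult.assoc power4_eq_xxxx)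
qed

text \<open>
  One variable is added at a time: in the expansion of \<open>(r + X g)^4\<close> the term linear in \<open>X\<close> has mean zero
  by independence, and Cauchy-Schwarz controls the others. Bounding fourth moments by
  squares \<open>\<rho>\<^sup>2\<close> and \<open>\<gamma>\<^sup>2\<close> lets the two inductions below close by completing a square.
\<close>

lemma (in prob_space) fourth_moment_step:
  fixes X :: "'i \<Rightarrow> 'a \<Rightarrow> real" and \<psi>r \<psi>g :: "('i \<Rightarrow> real) \<Rightarrow> real"
  assumes ind: "indep_vars (\<lambda>_. borel) X (insert x F)" and x: "x \<notin> F"
    and \<psi>[measurable]: "\<psi>r \<in> borel_measurable (Pi\<^sub>M F (\<lambda>_. borel))" "\<psi>g \<in> borel_measurable (Pi\<^sub>M F (\<lambda>_. borel))"
    and X4: "integrable M (\<lambda>\<omega>. X x \<omega> ^ 4)" "expectation (\<lambda>\<omega>. X x \<omega> ^ 4) \<le> 1" "expectation (X x) = 0"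
    and r_def: "\<And>\<omega>. r \<omega> = \<psi>r (restrict (\<lambda>i. X i \<omega>) F)"
    and g_def: "\<And>\<omega>. g \<omega> = \<psi>g (restrict (\<lambda>i. X i \<omega>) F)"
    and r4: "integrable M (\<lambda>\<omega>. r \<omega> ^ 4)" "expectation (\<lambda>\<omega>. r \<omega> ^ 4) \<le> \<rho>\<^sup>2" "\<rho> \<ge> 0"
    and g4: "integrable M (\<lambda>\<omega>. g \<omega> ^ 4)" "expectation (\<lambda>\<omega>. g \<omega> ^ 4) \<le> \<gamma>\<^sup>2" "\<gamma> \<ge> 0"
  shows "integrable M (\<lambda>\<omega>. (r \<omega> + X x \<omega> * g \<omega>) ^ 4)"
    and "expectation (\<lambda>\<omega>. (r \<omega> + X x \<omega> * g \<omega>) ^ 4) \<le> \<rho>\<^sup>2 + 8 * \<rho> * \<gamma> + 3 * \<gamma>\<^sup>2"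
proof -
  have Xm[measurable]: "X i \<in> borel_measurable M" if "i \<in> insert x F" for i
    using ind that by (auto simp: indep_vars_def)
  have Rm[measurable]: "(\<lambda>\<omega>. restrict (\<lambda>i. X i \<omega>) F) \<in> M \<rightarrow>\<^sub>M Pi\<^sub>M F (\<lambda>_. borel)"
    by (rule measurable_restrict) (use Xm in auto)
  have Xx[measurable]: "X x \<in> borel_measurable M" using Xm by auto
  have rm[measurable]: "r \<in> borel_measurable M" and gm[measurable]: "g \<in> borel_measurable M"
    unfolding r_def[abs_def] g_def[abs_def] by measurable
  have X1: "integrable M (X x)"
    by (rule Bochner_Integration.integrable_bound[where f="\<lambda>\<omega>. 1 + X x \<omega> ^ 4"]) (use X4 pow_le_1_pow4(1) in auto)
  have X2: "integrable M (\<lambda>\<omega>. (X x \<omega>)\<^sup>2)"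
    by (rule Bochner_Integration.integrable_bound[where f="\<lambda>\<omega>. 1 + X x \<omega> ^ 4"]) (use X4 pow_le_1_pow4(2) in \<open>auto intro!: order_trans[OF pow_le_1_pow4(2)]\<close>)
  have X3: "integrable M (\<lambda>\<omega>. (X x \<omega>)^3)"
    by (rule Bochner_Integration.integrable_bound[where f="\<lambda>\<omega>. (X x \<omega>)\<^sup>2 + X x \<omega> ^ 4"]) (use X4 X2 in \<open>auto intro!: order_trans[OF pow_le_1_pow4(3)]\<close>)
  have EX2: "expectation (\<lambda>\<omega>. (X x \<omega>)\<^sup>2) \<le> 1"
  proof -
    have "expectation (\<lambda>\<omega>. (X x \<omega>)\<^sup>2) \<le> expectation (\<lambda>\<omega>. (1 + X x \<omega>^4)/2)"
      by (intro integral_mono X2) (use X4 pow_le_1_pow4(2) in auto)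
    then show ?thesis using X4 by (simp add: prob_space)
  qed
  have EX3: "\<bar>expectation (\<lambda>\<omega>. (X x \<omega>)^3)\<bar> \<le> 1"
  proof -
    have "\<bar>expectation (\<lambda>\<omega>. (X x \<omega>)^3)\<bar> \<le> expectation (\<lambda>\<omega>. ((X x \<omega>)\<^sup>2 + X x \<omega>^4)/2)"
      by (intro integral_abs_bound[THEN order_trans] integral_mono integrable_abs X3) (use X4 X2 pow_le_1_pow4(3) in auto)
    then show ?thesis using X4 X2 EX2 by simp
  qed
  have sq4: "((y::real)\<^sup>2)\<^sup>2 = y^4" for y by (simp add: power_mult[symmetric])
  have r2g2: "integrable M (\<lambda>\<omega>. (r \<omega>)\<^sup>2 * (g \<omega>)\<^sup>2)" "expectation (\<lambda>\<omega>. (r \<omega>)\<^sup>2 * (g \<omega>)\<^sup>2) \<le> \<rho> * \<gamma>"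
    using integral_mult_le_of_squares[of M "\<lambda>\<omega>. (r \<omega>)\<^sup>2" "\<lambda>\<omega>. (g \<omega>)\<^sup>2" \<rho> \<gamma>] r4 g4 by (auto simp: sq4)
  have b1: "\<bar>r \<omega> * g \<omega>^3\<bar> \<le> ((r \<omega>)\<^sup>2 * (g \<omega>)\<^sup>2 + g \<omega> ^ 4)/2" for \<omega>
    using abs_mult_le_half_sum_squares[of "r \<omega> * g \<omega>" "(g \<omega>)\<^sup>2"] by (simp add: power_mult_distrib sq4 power3_eq_cube power2_eq_square mult_ac power4_eq_xxxx)
  have b3: "\<bar>r \<omega>^3 * g \<omega>\<bar> \<le> ((r \<omega>)\<^sup>2 * (g \<omega>)\<^sup>2 + r \<omega> ^ 4)/2" for \<omega>
    using abs_mult_le_half_sum_squares[of "r \<omega> * g \<omega>" "(r \<omega>)\<^sup>2"] by (simp add: power_mult_distrib sq4 power3_eq_cube power2_eq_square mult_ac power4_eq_xxxx)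
  have rg3: "integrable M (\<lambda>\<omega>. r \<omega> * g \<omega>^3)"
    by (rule Bochner_Integration.integrable_bound[where f="\<lambda>\<omega>. ((r \<omega>)\<^sup>2 * (g \<omega>)\<^sup>2 + g \<omega> ^ 4)"])
      (use r2g2 g4 in \<open>auto intro!: order_trans[OF b1]\<close>)
  have r3g: "integrable M (\<lambda>\<omega>. r \<omega>^3 * g \<omega>)"
    by (rule Bochner_Integration.integrable_bound[where f="\<lambda>\<omega>. ((r \<omega>)\<^sup>2 * (g \<omega>)\<^sup>2 + r \<omega> ^ 4)"])
      (use r2g2 r4 in \<open>auto intro!: order_trans[OF b3]\<close>)
  have Erg3: "\<bar>expectation (\<lambda>\<omega>. r \<omega> * g \<omega>^3)\<bar> \<le> (\<rho> * \<gamma> + \<gamma>\<^sup>2)/2"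
  proof -
    have "\<bar>expectation (\<lambda>\<omega>. r \<omega> * g \<omega>^3)\<bar> \<le> expectation (\<lambda>\<omega>. ((r \<omega>)\<^sup>2 * (g \<omega>)\<^sup>2 + g \<omega> ^ 4)/2)"
      by (intro integral_abs_bound[THEN order_trans] integral_mono integrable_abs rg3) (use r2g2 g4 b1 in auto)
    also have "\<dots> \<le> (\<rho> * \<gamma> + \<gamma>\<^sup>2)/2" using r2g2 g4 by simp
    finally show ?thesis .
  qed
  note fac = indep_factor[OF ind x]
  have m1: "(\<lambda>v. \<psi>r v ^ 3 * \<psi>g v) \<in> borel_measurable (Pi\<^sub>M F (\<lambda>_. borel))"
    "(\<lambda>v. (\<psi>r v)\<^sup>2 * (\<psi>g v)\<^sup>2) \<in> borel_measurable (Pi\<^sub>M F (\<lambda>_. borel))"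
    "(\<lambda>v. \<psi>r v * \<psi>g v^3) \<in> borel_measurable (Pi\<^sub>M F (\<lambda>_. borel))"
    "(\<lambda>v. \<psi>g v^4) \<in> borel_measurable (Pi\<^sub>M F (\<lambda>_. borel))" by measurable
  have f1: "integrable M (\<lambda>\<omega>. X x \<omega> * (r \<omega>^3 * g \<omega>))"
      "expectation (\<lambda>\<omega>. X x \<omega> * (r \<omega>^3 * g \<omega>)) = 0"
    using fac[of "\<lambda>y. y", OF _ m1(1)] X1 r3g X4 by (auto simp: r_def[symmetric] g_def[symmetric])
  have f2: "integrable M (\<lambda>\<omega>. (X x \<omega>)\<^sup>2 * ((r \<omega>)\<^sup>2 * (g \<omega>)\<^sup>2))"
      "expectation (\<lambda>\<omega>. (X x \<omega>)\<^sup>2 * ((r \<omega>)\<^sup>2 * (g \<omega>)\<^sup>2)) = expectation (\<lambda>\<omega>. (X x \<omega>)\<^sup>2) * expectation (\<lambda>\<omega>. (r \<omega>)\<^sup>2 * (g \<omega>)\<^sup>2)"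
    using fac[of "\<lambda>y. y\<^sup>2", OF _ m1(2)] X2 r2g2 by (auto simp: r_def[symmetric] g_def[symmetric])
  have f3: "integrable M (\<lambda>\<omega>. (X x \<omega>)^3 * (r \<omega> * g \<omega>^3))"
      "expectation (\<lambda>\<omega>. (X x \<omega>)^3 * (r \<omega> * g \<omega>^3)) = expectation (\<lambda>\<omega>. (X x \<omega>)^3) * expectation (\<lambda>\<omega>. r \<omega> * g \<omega>^3)"
    using fac[of "\<lambda>y. y^3", OF _ m1(3)] X3 rg3 by (auto simp: r_def[symmetric] g_def[symmetric])
  have f4: "integrable M (\<lambda>\<omega>. (X x \<omega>)^4 * g \<omega>^4)"
      "expectation (\<lambda>\<omega>. (X x \<omega>)^4 * g \<omega>^4) = expectation (\<lambda>\<omega>. (X x \<omega>)^4) * expectation (\<lambda>\<omega>. g \<omega>^4)"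
    using fac[of "\<lambda>y. y^4", OF _ m1(4)] X4 g4 by (auto simp: g_def[symmetric])
  have eq: "(r \<omega> + X x \<omega> * g \<omega>) ^ 4 = r \<omega>^4 + 4 * (X x \<omega> * (r \<omega>^3 * g \<omega>))
      + 6 * ((X x \<omega>)\<^sup>2 * ((r \<omega>)\<^sup>2 * (g \<omega>)\<^sup>2)) + 4 * ((X x \<omega>)^3 * (r \<omega> * g \<omega>^3)) + (X x \<omega>)^4 * g \<omega>^4" for \<omega>
    by (simp add: power_numeral_reduce) algebra
  show "integrable M (\<lambda>\<omega>. (r \<omega> + X x \<omega> * g \<omega>) ^ 4)"
    unfolding eq using f1 f2 f3 f4 r4 by auto
  have "expectation (\<lambda>\<omega>. (r \<omega> + X x \<omega> * g \<omega>) ^ 4) = expectation (\<lambda>\<omega>. r \<omega>^4)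
      + 6 * (expectation (\<lambda>\<omega>. (X x \<omega>)\<^sup>2) * expectation (\<lambda>\<omega>. (r \<omega>)\<^sup>2 * (g \<omega>)\<^sup>2))
      + 4 * (expectation (\<lambda>\<omega>. (X x \<omega>)^3) * expectation (\<lambda>\<omega>. r \<omega> * g \<omega>^3))
      + expectation (\<lambda>\<omega>. (X x \<omega>)^4) * expectation (\<lambda>\<omega>. g \<omega>^4)"
    unfolding eq using f1 f2 f3 f4 r4 by simp
  also have "\<dots> \<le> \<rho>\<^sup>2 + 6 * (1 * (\<rho> * \<gamma>)) + 4 * (1 * ((\<rho> * \<gamma> + \<gamma>\<^sup>2)/2)) + 1 * \<gamma>\<^sup>2"
  proof (intro add_mono mult_left_mono)
    show "expectation (\<lambda>\<omega>. (X x \<omega>)\<^sup>2) * expectation (\<lambda>\<omega>. (r \<omega>)\<^sup>2 * (g \<omega>)\<^sup>2) \<le> 1 * (\<rho> * \<gamma>)"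
      by (intro mult_mono EX2 r2g2) (auto intro!: integral_nonneg)
    show "expectation (\<lambda>\<omega>. (X x \<omega>)^3) * expectation (\<lambda>\<omega>. r \<omega> * g \<omega>^3) \<le> 1 * ((\<rho> * \<gamma> + \<gamma>\<^sup>2)/2)"
    proof -
      have "expectation (\<lambda>\<omega>. (X x \<omega>)^3) * expectation (\<lambda>\<omega>. r \<omega> * g \<omega>^3)
         \<le> \<bar>expectation (\<lambda>\<omega>. (X x \<omega>)^3)\<bar> * \<bar>expectation (\<lambda>\<omega>. r \<omega> * g \<omega>^3)\<bar>"
        by (simp add: abs_mult[symmetric])
      also have "\<dots> \<le> 1 * ((\<rho> * \<gamma> + \<gamma>\<^sup>2)/2)" by (intro mult_mono EX3 Erg3) auto
      finally show ?thesis .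
    qed
    show "expectation (\<lambda>\<omega>. (X x \<omega>)^4) * expectation (\<lambda>\<omega>. g \<omega>^4) \<le> 1 * \<gamma>\<^sup>2"
      by (intro mult_mono X4 g4) (auto intro!: integral_nonneg)
  qed (use r4 in auto)
  finally show "expectation (\<lambda>\<omega>. (r \<omega> + X x \<omega> * g \<omega>) ^ 4) \<le> \<rho>\<^sup>2 + 8 * \<rho> * \<gamma> + 3 * \<gamma>\<^sup>2"
    by (simp add: field_simps)
qed

lemma (in prob_space) fourth_moment_linear_form:
  fixes X :: "'i \<Rightarrow> 'a \<Rightarrow> real"
  assumes "finite F" and ind: "indep_vars (\<lambda>_. borel) X F"
    and X4: "\<And>i. i \<in> F \<Longrightarrow> integrable M (\<lambda>\<omega>. X i \<omega> ^ 4)"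
      "\<And>i. i \<in> F \<Longrightarrow> expectation (\<lambda>\<omega>. X i \<omega> ^ 4) \<le> 1"
      "\<And>i. i \<in> F \<Longrightarrow> expectation (X i) = 0"
  shows "integrable M (\<lambda>\<omega>. (\<Sum>i\<in>F. b i * X i \<omega>) ^ 4) \<and>
    expectation (\<lambda>\<omega>. (\<Sum>i\<in>F. b i * X i \<omega>) ^ 4) \<le> (4 * (\<Sum>i\<in>F. (b i)\<^sup>2))\<^sup>2"
  using assms
proof (induction F)
  case empty
  then show ?case by simp
next
  case (insert x F)
  have IH: "integrable M (\<lambda>\<omega>. (\<Sum>i\<in>F. b i * X i \<omega>) ^ 4)"
    "expectation (\<lambda>\<omega>. (\<Sum>i\<in>F. b i * X i \<omega>) ^ 4) \<le> (4 * (\<Sum>i\<in>F. (b i)\<^sup>2))\<^sup>2"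
    using insert.IH[OF indep_vars_subset[OF insert.prems(1)]] insert.prems by auto
  have b4: "(b x)^4 \<le> ((b x)\<^sup>2)\<^sup>2" by (simp add: power_mult[symmetric])
  note * = fourth_moment_step[where X=X and x=x and F=F and r="\<lambda>\<omega>. \<Sum>i\<in>F. b i * X i \<omega>"
      and \<psi>r = "\<lambda>v. \<Sum>i\<in>F. b i * v i" and g="\<lambda>_. b x" and \<psi>g = "\<lambda>_. b x" and
      \<rho>="4 * (\<Sum>i\<in>F. (b i)\<^sup>2)" and \<gamma>="(b x)\<^sup>2", OF insert.prems(1) insert.hyps(2)]
  have ex: "(\<Sum>i\<in>insert x F. b i * X i \<omega>) = (\<Sum>i\<in>F. b i * X i \<omega>) + X x \<omega> * b x" for \<omega>
    using insert.hyps by (simp add: mult.commute)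
  have A: "integrable M (\<lambda>\<omega>. ((\<Sum>i\<in>F. b i * X i \<omega>) + X x \<omega> * b x) ^ 4)"
    "expectation (\<lambda>\<omega>. ((\<Sum>i\<in>F. b i * X i \<omega>) + X x \<omega> * b x) ^ 4)
      \<le> (4 * (\<Sum>i\<in>F. (b i)\<^sup>2))\<^sup>2 + 8 * (4 * (\<Sum>i\<in>F. (b i)\<^sup>2)) * (b x)\<^sup>2 + 3 * ((b x)\<^sup>2)\<^sup>2"
    by (rule *; use insert.prems IH b4 in \<open>auto simp: prob_space intro!: sum_nonneg\<close>)+
  have "(4 * s)\<^sup>2 + 8 * (4 * s) * t + 3 * t\<^sup>2 \<le> (4 * (s + t))\<^sup>2" for s t :: real
    by (simp add: power2_eq_square algebra_simps)
  from order_trans[OF A(2) this] A(1) show ?case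
    unfolding ex using insert.hyps by (simp add: add.commute)
qed

text \<open>
  Splitting off the variable \<open>X x\<close> leaves \<open>r + X x * g\<close>, where \<open>r\<close> is the form in the remaining variables and
  \<open>g\<close> is linear in them, so that the linear case bounds \<open>g\<close>. The exponent 4 matters later: the bound is
  quadratic in the sum of the squared coefficients, hence small enough to be summed over all frequencies.
\<close>

lemma (in prob_space) fourth_moment_offdiagonal_form:
  fixes X :: "'i \<Rightarrow> 'a \<Rightarrow> real" and a :: "'i \<Rightarrow> 'i \<Rightarrow> real"
  assumes "finite F" and ind: "indep_vars (\<lambda>_. borel) X F"
    and X4: "\<And>i. i \<in> F \<Longrightarrow> integrable M (\<lambda>\<omega>. X i \<omega> ^ 4)"
      "\<And>i. i \<in> F \<Longrightarrow> expectation (\<lambda>\<omega>. X i \<omega> ^ 4) \<le> 1"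
      "\<And>i. i \<in> F \<Longrightarrow> expectation (X i) = 0"
  shows "integrable M (\<lambda>\<omega>. (\<Sum>i\<in>F. \<Sum>j\<in>F - {i}. a i j * X i \<omega> * X j \<omega>) ^ 4) \<and>
    expectation (\<lambda>\<omega>. (\<Sum>i\<in>F. \<Sum>j\<in>F - {i}. a i j * X i \<omega> * X j \<omega>) ^ 4)
      \<le> (32 * (\<Sum>i\<in>F. \<Sum>j\<in>F - {i}. (a i j)\<^sup>2))\<^sup>2"
  using assms
proof (induction F)
  case empty
  then show ?case by simp
next
  case (insert x F)
  let ?r = "\<lambda>\<omega>. (\<Sum>i\<in>F. \<Sum>j\<in>F - {i}. a i j * X i \<omega> * X j \<omega>)"
  let ?b = "\<lambda>i. a x i + a i x"
  let ?A = "\<Sum>i\<in>F. \<Sum>j\<in>F - {i}. (a i j)\<^sup>2" and ?B = "\<Sum>i\<in>F. (a x i)\<^sup>2 + (a i x)\<^sup>2"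
  have IH: "integrable M (\<lambda>\<omega>. ?r \<omega> ^ 4)" "expectation (\<lambda>\<omega>. ?r \<omega> ^ 4) \<le> (32 * ?A)\<^sup>2"
    using insert.IH[OF indep_vars_subset[OF insert.prems(1)]] insert.prems by auto
  have L: "integrable M (\<lambda>\<omega>. (\<Sum>i\<in>F. ?b i * X i \<omega>) ^ 4)"
    "expectation (\<lambda>\<omega>. (\<Sum>i\<in>F. ?b i * X i \<omega>) ^ 4) \<le> (4 * (\<Sum>i\<in>F. (?b i)\<^sup>2))\<^sup>2"
    using fourth_moment_linear_form[OF insert.hyps(1) indep_vars_subset[OF insert.prems(1)], of ?b] insert.prems by auto
  have "(\<Sum>i\<in>F. (?b i)\<^sup>2) \<le> (\<Sum>i\<in>F. 2 * ((a x i)\<^sup>2 + (a i x)\<^sup>2))"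
    by (rule sum_mono) (use sum_squares_bound[of "a x _" "a _ x"] in \<open>simp add: power2_sum field_simps\<close>)
  then have "(\<Sum>i\<in>F. (?b i)\<^sup>2) \<le> 2 * ?B" by (simp only: sum_distrib_left)
  then have "(4 * (\<Sum>i\<in>F. (?b i)\<^sup>2))\<^sup>2 \<le> (8 * ?B)\<^sup>2"
    by (intro power_mono) (auto intro!: sum_nonneg)
  note L2 = order_trans[OF L(2) this]
  have split: "(\<Sum>i\<in>insert x F. \<Sum>j\<in>insert x F - {i}. c i j) = (\<Sum>i\<in>F. \<Sum>j\<in>F - {i}. c i j) + (\<Sum>i\<in>F. c x i + c i x)"
    for c :: "'i \<Rightarrow> 'i \<Rightarrow> real"
  proof -
    have "(\<Sum>j\<in>insert x F - {i}. c i j) = c i x + (\<Sum>j\<in>F - {i}. c i j)" if "i \<in> F" for i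
    proof -
      have "insert x F - {i} = insert x (F - {i})" using that insert.hyps by auto
      then show ?thesis using insert.hyps by simp
    qed
    moreover have "insert x F - {x} = F" using insert.hyps by auto
    ultimately show ?thesis using insert.hyps by (simp add: sum.distrib)
  qed
  have ex: "(\<Sum>i\<in>insert x F. \<Sum>j\<in>insert x F - {i}. a i j * X i \<omega> * X j \<omega>)
      = ?r \<omega> + X x \<omega> * (\<Sum>i\<in>F. ?b i * X i \<omega>)" for \<omega>
    unfolding split by (simp add: sum_distrib_left algebra_simps)
  note * = fourth_moment_step[where X=X and x=x and F=F and r="?r"
      and \<psi>r = "\<lambda>v. \<Sum>i\<in>F. \<Sum>j\<in>F - {i}. a i j * v i * v j"
      and g="\<lambda>\<omega>. \<Sum>i\<in>F. ?b i * X i \<omega>" and \<psi>g = "\<lambda>v. \<Sum>i\<in>F. ?b i * v i" and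
      \<rho>="32 * ?A" and \<gamma>="8 * ?B", OF insert.prems(1) insert.hyps(2)]
  have mr: "(\<lambda>v. \<Sum>i\<in>F. \<Sum>j\<in>F - {i}. a i j * v i * v j) \<in> borel_measurable (Pi\<^sub>M F (\<lambda>_. borel))"
    by measurable
  have A: "integrable M (\<lambda>\<omega>. (?r \<omega> + X x \<omega> * (\<Sum>i\<in>F. ?b i * X i \<omega>)) ^ 4)"
    "expectation (\<lambda>\<omega>. (?r \<omega> + X x \<omega> * (\<Sum>i\<in>F. ?b i * X i \<omega>)) ^ 4)
      \<le> (32 * ?A)\<^sup>2 + 8 * (32 * ?A) * (8 * ?B) + 3 * (8 * ?B)\<^sup>2"
    by (rule *; use insert.prems IH L L2 mr in \<open>auto intro!: sum_nonneg\<close>)+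
  \<comment> \<open>The constants 32 and 8 make the cross terms agree: \<open>8 * 32 * 8 = 2 * 32 * 32\<close>.\<close>
  have "(32 * s)\<^sup>2 + 8 * (32 * s) * (8 * t) + 3 * (8 * t)\<^sup>2 \<le> (32 * (s + t))\<^sup>2" for s t :: real
    by (simp add: power2_eq_square algebra_simps)
  from order_trans[OF A(2) this] A(1) show ?case
    unfolding ex split by simp
qed

section \<open>Fourier representation of a continuous kernel\<close>

text \<open>
  A Gaussian factor makes every Fourier integral absolutely convergent; its width is then sent to zero.
\<close>

definition gauss2 :: "real \<times> real \<Rightarrow> real" where
  "gauss2 z = std_normal_density (fst z) * std_normal_density (snd z)"

lemma lborel_prod_integral:
  fixes a b :: "real \<Rightarrow> complex"
  assumes a: "integrable lborel a" and b: "integrable lborel b"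
  shows "integrable lborel (\<lambda>z. a (fst z) * b (snd z))"
    and "(LINT z|lborel. a (fst z) * b (snd z)) = (LINT x|lborel. a x) * (LINT y|lborel. b y)"
proof -
  have [measurable]: "a \<in> borel_measurable borel" "b \<in> borel_measurable borel"
    using a b by (auto dest: borel_measurable_integrable)
  have i: "integrable (lborel \<Otimes>\<^sub>M lborel) (\<lambda>(x, y). a x * b y)"
  proof (rule lborel_pair.Fubini_integrable)
    show "integrable lborel (\<lambda>x. LINT y|lborel. norm (case (x, y) of (x, y) \<Rightarrow> a x * b y))"
      using a b by (simp add: norm_mult)
  qed (use b in auto)
  show "integrable lborel (\<lambda>z. a (fst z) * b (snd z))"
    using i by (simp add: lborel_prod case_prod_beta')
  have "(LINT z|lborel. a (fst z) * b (snd z)) = (LINT x|lborel. LINT y|lborel. a x * b y)"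
    using lborel_pair.integral_fst[OF i] by (simp add: lborel_prod case_prod_beta')
  then show "(LINT z|lborel. a (fst z) * b (snd z)) = (LINT x|lborel. a x) * (LINT y|lborel. b y)"
    by simp
qed

lemma gauss2_nonneg [simp]: "gauss2 z \<ge> 0"
  by (simp add: gauss2_def normal_density_nonneg)

lemma gauss2_measurable [measurable]: "gauss2 \<in> borel_measurable borel"
proof -
  have [measurable]: "fst \<in> borel_measurable (borel :: (real \<times> real) measure)" "snd \<in> borel_measurable (borel :: (real \<times> real) measure)"
    by (auto intro!: borel_measurable_continuous_onI continuous_intros)
  show ?thesis unfolding gauss2_def[abs_def] by measurable
qed

lemma gauss2_bound: "2 * pi * gauss2 z \<le> 1"
proof -
  have "std_normal_density x \<le> 1 / sqrt (2 * pi)" for x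
    unfolding std_normal_density_def by (simp add: divide_right_mono)
  then have "gauss2 z \<le> (1 / sqrt (2 * pi)) * (1 / sqrt (2 * pi))"
    unfolding gauss2_def by (intro mult_mono) (auto simp: normal_density_nonneg)
  also have "\<dots> = 1 / (2 * pi)" by simp
  finally show ?thesis by (simp add: field_simps)
qed

lemma gauss2_le_1: "gauss2 z \<le> 1"
proof -
  have "1 * gauss2 z \<le> 2 * pi * gauss2 z" using pi_gt3 by (intro mult_right_mono) auto
  then show ?thesis using gauss2_bound[of z] by simp
qed

lemma gauss2_integral: "integrable lborel gauss2" "(LINT z|lborel. gauss2 z) = 1"
proof -
  have i: "integrable lborel (\<lambda>x. complex_of_real (std_normal_density x))"
    using integrable_normal_density[of 1 0] by (intro integrable_of_real) simp
  have e: "(LINT x|lborel. complex_of_real (std_normal_density x)) = 1"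
    using integral_normal_density[of 1 0] by simp
  note p = lborel_prod_integral[OF i i]
  have "integrable lborel (\<lambda>z. complex_of_real (gauss2 z))" "(LINT z|lborel. complex_of_real (gauss2 z)) = 1"
    using p e by (simp_all add: gauss2_def)
  then show "integrable lborel gauss2" "(LINT z|lborel. gauss2 z) = 1"
    by (auto simp only: complex_of_real_integrable_eq integral_complex_of_real of_real_eq_1_iff)
qed

lemma std_normal_fourier:
  assumes s: "s > 0"
  shows "integrable lborel (\<lambda>x. complex_of_real (std_normal_density (s * x)) * iexp (x * w))"
    and "(LINT x|lborel. complex_of_real (std_normal_density (s * x)) * iexp (x * w))
      = complex_of_real (sqrt (2 * pi) / s * std_normal_density (w / s))"
proof -
  define f where "f x = complex_of_real (std_normal_density x) * iexp (x * (w / s))" for x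
  have i0: "integrable lborel (\<lambda>x. complex_of_real (std_normal_density x))"
    using integrable_normal_density[of 1 0] by (intro integrable_of_real) simp
  have [measurable]: "f \<in> borel_measurable borel" unfolding f_def[abs_def] by measurable
  have fi: "integrable lborel f"
    by (rule Bochner_Integration.integrable_bound[OF i0]) (auto simp: f_def norm_mult)
  have "(LINT x|lborel. f x) = char std_normal_distribution (w / s)"
    unfolding char_def
    by (subst integral_density) (auto simp: f_def[abs_def] normal_density_nonneg scaleR_conv_of_real mult.commute)
  also have "\<dots> = complex_of_real (exp (- (w/s)\<^sup>2 / 2))"
    by (simp add: char_std_normal_distribution)
  also have "exp (- (w/s)\<^sup>2 / 2) = sqrt (2 * pi) * std_normal_density (w / s)"
    by (simp add: std_normal_density_def)
  finally have fe: "(LINT x|lborel. f x) = complex_of_real (sqrt (2 * pi) * std_normal_density (w / s))" .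
  have eq: "(\<lambda>x. complex_of_real (std_normal_density (s * x)) * iexp (x * w)) = (\<lambda>x. f (0 + s * x))"
    using s by (simp add: f_def fun_eq_iff)
  show "integrable lborel (\<lambda>x. complex_of_real (std_normal_density (s * x)) * iexp (x * w))"
    unfolding eq by (rule lborel_integrable_real_affine[OF fi]) (use s in auto)
  have "(LINT x|lborel. f x) = s *\<^sub>R (LINT x|lborel. f (0 + s * x))"
    using lborel_integral_real_affine[of s f 0] s by simp
  then have "(LINT x|lborel. f (0 + s * x)) = (LINT x|lborel. f x) / s"
    using s by (simp add: scaleR_conv_of_real)
  then show "(LINT x|lborel. complex_of_real (std_normal_density (s * x)) * iexp (x * w))
      = complex_of_real (sqrt (2 * pi) / s * std_normal_density (w / s))"
    unfolding eq fe using s by simp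
qed

lemma gauss2_fourier:
  assumes s: "s > 0"
  shows "integrable lborel (\<lambda>x. complex_of_real (gauss2 (s *\<^sub>R x)) * iexp (x \<bullet> w))"
    and "(LINT x|lborel. complex_of_real (gauss2 (s *\<^sub>R x)) * iexp (x \<bullet> w))
      = complex_of_real (2 * pi / s\<^sup>2 * gauss2 ((1/s) *\<^sub>R w))"
proof -
  have eq: "complex_of_real (gauss2 (s *\<^sub>R x)) * iexp (x \<bullet> w)
     = complex_of_real (std_normal_density (s * fst x)) * iexp (fst x * fst w)
      * (complex_of_real (std_normal_density (s * snd x)) * iexp (snd x * snd w))" for x :: "real \<times> real"
    by (simp add: gauss2_def inner_prod_def distrib_left exp_add)
  show "integrable lborel (\<lambda>x. complex_of_real (gauss2 (s *\<^sub>R x)) * iexp (x \<bullet> w))"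
    unfolding eq using lborel_prod_integral(1)[OF std_normal_fourier(1)[OF s] std_normal_fourier(1)[OF s]] .
  have r: "sqrt (2 * pi) / s * a * (sqrt (2 * pi) / s * b) = 2 * pi / s\<^sup>2 * (a * b)" for a b
    using s by (simp add: field_simps power2_eq_square)
  show "(LINT x|lborel. complex_of_real (gauss2 (s *\<^sub>R x)) * iexp (x \<bullet> w))
      = complex_of_real (2 * pi / s\<^sup>2 * gauss2 ((1/s) *\<^sub>R w))"
    unfolding eq lborel_prod_integral(2)[OF std_normal_fourier(1)[OF s] std_normal_fourier(1)[OF s]]
      std_normal_fourier(2)[OF s] of_real_mult[symmetric] r
    by (simp add: gauss2_def)
qed

lemma gauss2_mollify_tendsto:
  fixes g :: "real \<times> real \<Rightarrow> real"
  assumes c: "continuous_on UNIV g" and b: "\<And>x. \<bar>g x\<bar> \<le> B"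
  shows "(\<lambda>n. LINT z|lborel. g (u + (1 / Suc n) *\<^sub>R z) * gauss2 z) \<longlonglongrightarrow> g u"
proof -
  have [measurable]: "g \<in> borel_measurable borel" by (rule borel_measurable_continuous_onI[OF c])
  have "(\<lambda>n. LINT z|lborel. g (u + (1 / Suc n) *\<^sub>R z) * gauss2 z) \<longlonglongrightarrow> (LINT z|lborel. g u * gauss2 z)"
  proof (rule integral_dominated_convergence[where w="\<lambda>z. B * gauss2 z"])
    show "integrable lborel (\<lambda>z. B * gauss2 z)" using gauss2_integral by simp
    show "AE z in lborel. (\<lambda>n. g (u + (1 / Suc n) *\<^sub>R z) * gauss2 z) \<longlonglongrightarrow> g u * gauss2 z"
    proof (intro AE_I2 tendsto_mult tendsto_const)
      fix z :: "real \<times> real"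
      have "(\<lambda>n. u + (1 / real (Suc n)) *\<^sub>R z) \<longlonglongrightarrow> u + 0 *\<^sub>R z"
        by (intro tendsto_intros LIMSEQ_Suc[OF lim_1_over_n])
      then have "(\<lambda>n. g (u + (1 / real (Suc n)) *\<^sub>R z)) \<longlonglongrightarrow> g (u + 0 *\<^sub>R z)"
        by (rule continuous_on_tendsto_compose[OF c]) auto
      then show "(\<lambda>n. g (u + (1 / real (Suc n)) *\<^sub>R z)) \<longlonglongrightarrow> g u" by simp
    qed
    show "AE z in lborel. norm (g (u + (1 / Suc n) *\<^sub>R z) * gauss2 z) \<le> B * gauss2 z" for n
      by (intro AE_I2) (simp add: abs_mult mult_right_mono b)
  qed (auto)
  then show ?thesis using gauss2_integral by simp
qed

lemma lborel2_affine:
  fixes f :: "real \<times> real \<Rightarrow> 'b::{banach, second_countable_topology}"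
  assumes s: "s > (0::real)" and f: "integrable lborel f"
  shows "integrable lborel (\<lambda>z. f (u + s *\<^sub>R z))"
    "(LINT z|lborel. f (u + s *\<^sub>R z)) = (1 / s\<^sup>2) *\<^sub>R (LINT z|lborel. f z)"
proof -
  have [measurable]: "f \<in> borel_measurable borel" using f by auto
  have l: "(lborel :: (real \<times> real) measure) = density (distr lborel borel (\<lambda>x. u + s *\<^sub>R x)) (\<lambda>_. ennreal (s\<^sup>2))"
    using lborel_affine[of s u] s by (simp add: power2_eq_square)
  have "integrable (density (distr lborel borel (\<lambda>x. u + s *\<^sub>R x)) (\<lambda>_. ennreal (s\<^sup>2))) f"
    unfolding l[symmetric] by (rule f)
  then have "integrable lborel (\<lambda>x. s\<^sup>2 *\<^sub>R f (u + s *\<^sub>R x))"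
    by (subst (asm) integrable_density) (auto simp: integrable_distr_eq)
  from integrable_scaleR_right[OF this, of "1 / s\<^sup>2"]
  show *: "integrable lborel (\<lambda>z. f (u + s *\<^sub>R z))" using s by simp
  have "(LINT z|lborel. f z) = (LINT z|density (distr lborel borel (\<lambda>x. u + s *\<^sub>R x)) (\<lambda>_. ennreal (s\<^sup>2)). f z)"
    unfolding l[symmetric] ..
  also have "\<dots> = (LINT x|lborel. s\<^sup>2 *\<^sub>R f (u + s *\<^sub>R x))"
    by (subst integral_density) (auto simp: integral_distr)
  finally show "(LINT z|lborel. f (u + s *\<^sub>R z)) = (1 / s\<^sup>2) *\<^sub>R (LINT z|lborel. f z)"
    using s by simp
qed

lemma kernel_ft_measurable [measurable]:
  assumes "K \<in> borel_measurable borel"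
  shows "kernel_ft K \<in> borel_measurable borel"
proof -
  have "(\<lambda>x. LINT l|lborel. complex_of_real (K l) * exp (\<i> * complex_of_real (x \<bullet> l))) \<in> borel_measurable borel"
    by (rule lborel.borel_measurable_lebesgue_integral) (use assms in measurable)
  then show ?thesis unfolding kernel_ft_def[abs_def] .
qed

text \<open>
  Fubini applied to the double integral of \<open>K v * iexp (x \<bullet> (v - u))\<close> against a Gaussian in \<open>x\<close>: integrating
  in \<open>v\<close> first gives the transform of \<open>K\<close>, integrating in \<open>x\<close> first gives the Gaussian average of \<open>K\<close>
  around \<open>u\<close>.
\<close>

lemma mollified_kernel_fourier:
  assumes K: "integrable lborel K" and s: "s > 0"
  shows "integrable lborel (\<lambda>x. kernel_ft K x * iexp (- (x \<bullet> u)) * complex_of_real (gauss2 (s *\<^sub>R x)))"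
    and "complex_of_real (LINT z|lborel. K (u + s *\<^sub>R z) * gauss2 z)
      = (1 / (4 * pi\<^sup>2)) * (LINT x|lborel. kernel_ft K x * iexp (- (x \<bullet> u)) * complex_of_real (2 * pi * gauss2 (s *\<^sub>R x)))"
proof -
  have [measurable]: "K \<in> borel_measurable borel" using K by auto
  define F where "F = (\<lambda>(x::real \<times> real) (v::real \<times> real). complex_of_real (K v) * iexp (x \<bullet> (v - u)) * complex_of_real (gauss2 (s *\<^sub>R x)))"
  have gi: "integrable lborel (\<lambda>x. gauss2 (s *\<^sub>R x))"
    using lborel2_affine(1)[OF s gauss2_integral(1), of 0] by simp
  have Fm[measurable]: "(\<lambda>(x, v). F x v) \<in> borel_measurable (lborel \<Otimes>\<^sub>M lborel)"
    unfolding F_def by measurable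
  have nF: "norm (F x v) = \<bar>K v\<bar> * gauss2 (s *\<^sub>R x)" for x v
    by (simp add: F_def norm_mult)
  have Fi: "integrable (lborel \<Otimes>\<^sub>M lborel) (\<lambda>(x, v). F x v)"
  proof (rule lborel_pair.Fubini_integrable[OF Fm])
    show "integrable lborel (\<lambda>x. LINT v|lborel. norm (case (x, v) of (x, v) \<Rightarrow> F x v))"
      using gi by (simp add: nF)
    show "AE x in lborel. integrable lborel (\<lambda>v. case (x, v) of (x, v) \<Rightarrow> F x v)"
    proof (rule AE_I2)
      fix x :: "real \<times> real"
      have m: "(\<lambda>v. F x v) \<in> borel_measurable lborel" unfolding F_def by measurable
      show "integrable lborel (\<lambda>v. case (x, v) of (x, v) \<Rightarrow> F x v)"
        by (rule Bochner_Integration.integrable_bound[of _ "\<lambda>v. \<bar>K v\<bar> * gauss2 (s *\<^sub>R x)"])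
          (use K m nF in auto)
    qed
  qed
  have in1: "(LINT v|lborel. F x v) = kernel_ft K x * iexp (- (x \<bullet> u)) * complex_of_real (gauss2 (s *\<^sub>R x))" for x
  proof -
    have "F x v = (complex_of_real (K v) * iexp (x \<bullet> v)) * (iexp (- (x \<bullet> u)) * complex_of_real (gauss2 (s *\<^sub>R x)))" for v
      by (simp add: F_def inner_diff_right right_diff_distrib exp_diff exp_minus field_simps)
    then have "(LINT v|lborel. F x v) = (LINT v|lborel. (complex_of_real (K v) * iexp (x \<bullet> v)) * (iexp (- (x \<bullet> u)) * complex_of_real (gauss2 (s *\<^sub>R x))))"
      by simp
    also have "\<dots> = kernel_ft K x * (iexp (- (x \<bullet> u)) * complex_of_real (gauss2 (s *\<^sub>R x)))"
      unfolding kernel_ft_def by (rule integral_mult_left_zero)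
    finally show ?thesis by (simp add: mult.assoc)
  qed
  show i1: "integrable lborel (\<lambda>x. kernel_ft K x * iexp (- (x \<bullet> u)) * complex_of_real (gauss2 (s *\<^sub>R x)))"
    using lborel_pair.integrable_fst[OF Fi] by (simp add: in1)
  have in2: "(LINT x|lborel. F x v) = complex_of_real (2 * pi / s\<^sup>2) * complex_of_real (K v * gauss2 ((1/s) *\<^sub>R (v - u)))" for v
  proof -
    have "(LINT x|lborel. F x v) = complex_of_real (K v) * (LINT x|lborel. complex_of_real (gauss2 (s *\<^sub>R x)) * iexp (x \<bullet> (v - u)))"
      by (simp add: F_def mult_ac)
    also have "\<dots> = complex_of_real (K v) * complex_of_real (2 * pi / s\<^sup>2 * gauss2 ((1/s) *\<^sub>R (v - u)))"
      by (simp only: gauss2_fourier(2)[OF s])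
    finally show ?thesis by (simp add: mult_ac)
  qed
  have Ki: "integrable lborel (\<lambda>v. K v * gauss2 ((1/s) *\<^sub>R (v - u)))"
    by (rule Bochner_Integration.integrable_bound[OF K])
      (auto simp: abs_mult intro!: mult_left_le gauss2_le_1)
  have aff: "(LINT z|lborel. K (u + s *\<^sub>R z) * gauss2 z) = (1 / s\<^sup>2) * (LINT v|lborel. K v * gauss2 ((1/s) *\<^sub>R (v - u)))"
    using lborel2_affine(2)[OF s Ki, of u] s by simp
  have "(LINT x|lborel. kernel_ft K x * iexp (- (x \<bullet> u)) * complex_of_real (gauss2 (s *\<^sub>R x)))
      = (LINT x|lborel. LINT v|lborel. F x v)" by (simp add: in1)
  also have "\<dots> = (LINT v|lborel. LINT x|lborel. F x v)"
    by (rule lborel_pair.Fubini_integral[symmetric]) (use Fi in simp)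
  also have "\<dots> = (LINT v|lborel. complex_of_real (2 * pi / s\<^sup>2) * complex_of_real (K v * gauss2 ((1/s) *\<^sub>R (v - u))))"
    by (simp only: in2)
  also have "\<dots> = complex_of_real (2 * pi / s\<^sup>2) * (LINT v|lborel. complex_of_real (K v * gauss2 ((1/s) *\<^sub>R (v - u))))"
    by (rule integral_mult_right_zero)
  also have "\<dots> = complex_of_real (2 * pi / s\<^sup>2 * (LINT v|lborel. K v * gauss2 ((1/s) *\<^sub>R (v - u))))"
    by (subst integral_complex_of_real) (simp only: of_real_mult)
  also have "\<dots> = complex_of_real (2 * pi * (LINT z|lborel. K (u + s *\<^sub>R z) * gauss2 z))"
    unfolding aff by simp
  finally have E: "(LINT x|lborel. kernel_ft K x * iexp (- (x \<bullet> u)) * complex_of_real (gauss2 (s *\<^sub>R x)))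
     = complex_of_real (2 * pi * (LINT z|lborel. K (u + s *\<^sub>R z) * gauss2 z))" .
  have "(LINT x|lborel. kernel_ft K x * iexp (- (x \<bullet> u)) * complex_of_real (2 * pi * gauss2 (s *\<^sub>R x)))
     = complex_of_real (2 * pi) * (LINT x|lborel. kernel_ft K x * iexp (- (x \<bullet> u)) * complex_of_real (gauss2 (s *\<^sub>R x)))"
    by (subst integral_mult_right_zero[symmetric]) (simp add: mult_ac)
  then show "complex_of_real (LINT z|lborel. K (u + s *\<^sub>R z) * gauss2 z)
      = (1 / (4 * pi\<^sup>2)) * (LINT x|lborel. kernel_ft K x * iexp (- (x \<bullet> u)) * complex_of_real (2 * pi * gauss2 (s *\<^sub>R x)))"
    unfolding E by (simp add: power2_eq_square)
qed

lemma mollified_combination_bound: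
  fixes \<beta> :: "'j \<Rightarrow> complex" and w :: "'j \<Rightarrow> real \<times> real"
  assumes K: "integrable lborel K" and k: "integrable lborel (kernel_ft K)" and I: "finite I"
  shows "cmod (\<Sum>i\<in>I. \<beta> i * complex_of_real (LINT z|lborel. K (w i + (1 / Suc n) *\<^sub>R z) * gauss2 z))
     \<le> (1 / (4 * pi\<^sup>2)) * (LINT x|lborel. cmod (kernel_ft K x) * cmod (\<Sum>i\<in>I. \<beta> i * iexp (- (x \<bullet> w i))))"
proof -
  have [measurable]: "K \<in> borel_measurable borel" using K by auto
  let ?m = "\<lambda>n u. LINT z|lborel. K (u + (1 / Suc n) *\<^sub>R z) * gauss2 z"
  show ?thesis
  proof -
    define s where "s = 1 / real (Suc n)"
    have s: "s > 0" by (simp add: s_def)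
    let ?f = "\<lambda>u x. kernel_ft K x * iexp (- (x \<bullet> u)) * complex_of_real (2 * pi * gauss2 (s *\<^sub>R x))"
    have fi: "integrable lborel (?f u)" for u
    proof -
      have "?f u = (\<lambda>x. complex_of_real (2 * pi) * (kernel_ft K x * iexp (- (x \<bullet> u)) * complex_of_real (gauss2 (s *\<^sub>R x))))"
        by (simp add: mult_ac fun_eq_iff)
      then show ?thesis using mollified_kernel_fourier(1)[OF K s, of u]
        by (simp only:) (intro integrable_mult_right)
    qed
    have "(\<Sum>i\<in>I. \<beta> i * complex_of_real (?m n (w i)))
       = (\<Sum>i\<in>I. \<beta> i * ((1 / (4 * pi\<^sup>2)) * (LINT x|lborel. ?f (w i) x)))"
      unfolding mollified_kernel_fourier(2)[OF K s, unfolded s_def] s_def by simp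
    also have "\<dots> = (1 / (4 * pi\<^sup>2)) * (\<Sum>i\<in>I. LINT x|lborel. \<beta> i * ?f (w i) x)"
      by (simp add: sum_distrib_left mult_ac)
    also have "(\<Sum>i\<in>I. LINT x|lborel. \<beta> i * ?f (w i) x) = (LINT x|lborel. (\<Sum>i\<in>I. \<beta> i * ?f (w i) x))"
      by (rule Bochner_Integration.integral_sum[symmetric]) (use fi in auto)
    finally have e: "(\<Sum>i\<in>I. \<beta> i * complex_of_real (?m n (w i)))
       = (1 / (4 * pi\<^sup>2)) * (LINT x|lborel. (\<Sum>i\<in>I. \<beta> i * ?f (w i) x))" .
    have "cmod (LINT x|lborel. (\<Sum>i\<in>I. \<beta> i * ?f (w i) x))
       \<le> (LINT x|lborel. cmod (\<Sum>i\<in>I. \<beta> i * ?f (w i) x))"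
      by (rule integral_norm_bound)
    also have "\<dots> \<le> (LINT x|lborel. cmod (kernel_ft K x) * cmod (\<Sum>i\<in>I. \<beta> i * iexp (- (x \<bullet> w i))))"
    proof (rule integral_mono)
      show "integrable lborel (\<lambda>x. cmod (\<Sum>i\<in>I. \<beta> i * ?f (w i) x))" using fi by (intro integrable_norm) auto
      have "integrable lborel (\<lambda>x. (\<Sum>i\<in>I. cmod (\<beta> i)) * cmod (kernel_ft K x))"
        using k by auto
      then show "integrable lborel (\<lambda>x. cmod (kernel_ft K x) * cmod (\<Sum>i\<in>I. \<beta> i * iexp (- (x \<bullet> w i))))"
      proof (rule Bochner_Integration.integrable_bound)
        show "AE x in lborel. norm (cmod (kernel_ft K x) * cmod (\<Sum>i\<in>I. \<beta> i * iexp (- (x \<bullet> w i))))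
            \<le> norm ((\<Sum>i\<in>I. cmod (\<beta> i)) * cmod (kernel_ft K x))"
        proof (rule AE_I2)
          fix x
          have "cmod (\<Sum>i\<in>I. \<beta> i * iexp (- (x \<bullet> w i))) \<le> (\<Sum>i\<in>I. cmod (\<beta> i))"
            by (rule order_trans[OF norm_sum]) (simp add: norm_mult)
          then show "norm (cmod (kernel_ft K x) * cmod (\<Sum>i\<in>I. \<beta> i * iexp (- (x \<bullet> w i))))
            \<le> norm ((\<Sum>i\<in>I. cmod (\<beta> i)) * cmod (kernel_ft K x))"
            by (simp add: abs_mult sum_nonneg mult.commute mult_left_mono)
        qed
      qed measurable
      fix x
      have "(\<Sum>i\<in>I. \<beta> i * ?f (w i) x) = kernel_ft K x * complex_of_real (2 * pi * gauss2 (s *\<^sub>R x)) * (\<Sum>i\<in>I. \<beta> i * iexp (- (x \<bullet> w i)))"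
        by (simp add: sum_distrib_left mult_ac)
      also have "cmod \<dots> = cmod (kernel_ft K x) * (2 * pi * gauss2 (s *\<^sub>R x)) * cmod (\<Sum>i\<in>I. \<beta> i * iexp (- (x \<bullet> w i)))"
        by (simp add: norm_mult abs_mult)
      also have "\<dots> \<le> cmod (kernel_ft K x) * 1 * cmod (\<Sum>i\<in>I. \<beta> i * iexp (- (x \<bullet> w i)))"
        by (intro mult_right_mono mult_left_mono gauss2_bound) auto
      finally show "cmod (\<Sum>i\<in>I. \<beta> i * ?f (w i) x) \<le> cmod (kernel_ft K x) * cmod (\<Sum>i\<in>I. \<beta> i * iexp (- (x \<bullet> w i)))"
        by simp
    qed
    finally show ?thesis unfolding e by (simp add: norm_mult norm_divide norm_power divide_right_mono)
  qed
qed

text \<open>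
  Fourier inversion at finitely many points, stated as the inequality that is used. Continuity makes
  the inversion hold at every point and not merely almost everywhere. The mollified
  kernel converges to \<open>K\<close> pointwise once \<open>K\<close> is known to be bounded, and boundedness comes from the same inequality
  for a single point applied to a truncation of \<open>K\<close>.
\<close>

lemma kernel_combination_bound:
  fixes b :: "'i \<Rightarrow> complex" and p :: "'i \<Rightarrow> real \<times> real"
  assumes c: "continuous_on UNIV K" and nn: "\<And>x. K x \<ge> 0" and K: "integrable lborel K"
    and k: "integrable lborel (kernel_ft K)" and A: "finite A"
  shows "cmod (\<Sum>i\<in>A. b i * complex_of_real (K (p i)))
     \<le> (1 / (4 * pi\<^sup>2)) * (LINT x|lborel. cmod (kernel_ft K x) * cmod (\<Sum>i\<in>A. b i * iexp (- (x \<bullet> p i))))"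
proof -
  have [measurable]: "K \<in> borel_measurable borel" using K by auto
  let ?m = "\<lambda>n u. LINT z|lborel. K (u + (1 / Suc n) *\<^sub>R z) * gauss2 z"
  let ?B = "1 / (4 * pi\<^sup>2) * (LINT x|lborel. cmod (kernel_ft K x))"
  note bd = mollified_combination_bound[OF K k]
  have Kb: "K u \<le> ?B" for u
  proof -
    \<comment> \<open>A bounded function that agrees with \<open>K\<close> at \<open>u\<close>, so that the mollification is known to converge there.\<close>
    define g where "g x = min (K x) (K u + 1)" for x
    have "(\<lambda>n. LINT z|lborel. g (u + (1 / Suc n) *\<^sub>R z) * gauss2 z) \<longlonglongrightarrow> g u"
    proof (rule gauss2_mollify_tendsto[where B="K u + 1"])
      show "continuous_on UNIV g" unfolding g_def[abs_def] by (intro continuous_intros c)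
      show "\<bar>g x\<bar> \<le> K u + 1" for x using nn[of x] nn[of u] by (simp add: g_def)
    qed
    moreover have "(LINT z|lborel. g (u + (1 / Suc n) *\<^sub>R z) * gauss2 z) \<le> ?B" for n
    proof -
      have ki: "integrable lborel (\<lambda>z. K (u + (1 / Suc n) *\<^sub>R z) * gauss2 z)"
        by (rule Bochner_Integration.integrable_bound[OF lborel2_affine(1)[OF _ K, of "1 / Suc n" u]])
         (auto simp: abs_mult intro!: mult_left_le gauss2_le_1)
      have "(LINT z|lborel. g (u + (1 / Suc n) *\<^sub>R z) * gauss2 z) \<le> ?m n u"
      proof (rule integral_mono[OF _ ki])
        show "integrable lborel (\<lambda>z. g (u + (1 / Suc n) *\<^sub>R z) * gauss2 z)"
          by (rule Bochner_Integration.integrable_bound[OF ki]) (use nn in \<open>auto simp: g_def abs_mult intro!: mult_right_mono\<close>)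
      qed (auto simp: g_def intro!: mult_right_mono)
      also have "?m n u \<le> cmod (\<Sum>i\<in>{()}. 1 * complex_of_real (?m n u))" by simp
      also have "\<dots> \<le> (1 / (4 * pi\<^sup>2)) * (LINT x|lborel. cmod (kernel_ft K x) * cmod (\<Sum>i\<in>{()}. 1 * iexp (- (x \<bullet> u))))"
        by (rule bd[where w="\<lambda>_. u" and I="{()}"]) simp
      finally show ?thesis by simp
    qed
    ultimately have "g u \<le> ?B" by (intro LIMSEQ_le_const2) auto
    then show ?thesis by (simp add: g_def)
  qed
  have "(\<lambda>n. \<Sum>i\<in>A. b i * complex_of_real (?m n (p i))) \<longlonglongrightarrow> (\<Sum>i\<in>A. b i * complex_of_real (K (p i)))"
    by (intro tendsto_sum tendsto_mult tendsto_const tendsto_of_real gauss2_mollify_tendsto[where B="?B"] c)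
      (use nn Kb in auto)
  then have "(\<lambda>n. cmod (\<Sum>i\<in>A. b i * complex_of_real (?m n (p i)))) \<longlonglongrightarrow> cmod (\<Sum>i\<in>A. b i * complex_of_real (K (p i)))"
    by (rule tendsto_norm)
  then show ?thesis
    by (rule LIMSEQ_le_const2) (use bd[OF A, of b] in auto)
qed

section \<open>Fejer kernels summed over lags\<close>

text \<open>
  The Fejer weights: they make exponential sums nonnegative, which removes the absolute value inside the
  Fourier integral.
\<close>

definition tri :: "nat \<Rightarrow> int \<Rightarrow> real" where
  "tri N s = max 0 (1 - \<bar>real_of_int s\<bar> / real N)"

definition fejer :: "nat \<Rightarrow> real \<Rightarrow> real" where
  "fejer N \<theta> = (\<Sum>s\<in>{- int N..int N}. tri N s * cos (real_of_int s * \<theta>))"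

text \<open>
  A difference \<open>s\<close> with \<open>\<bar>s\<bar> \<le> N\<close> is attained by \<open>N - \<bar>s\<bar>\<close> pairs.
\<close>

lemma double_sum_diff:
  fixes f :: "int \<Rightarrow> 'a::comm_ring_1"
  shows "(\<Sum>a<N. \<Sum>b<N. f (int a - int b)) = (\<Sum>s\<in>{- int N..int N}. of_int (int N - \<bar>s\<bar>) * f s)"
proof (induction N)
  case 0
  then show ?case by simp
next
  case (Suc N)
  have "(\<Sum>a<Suc N. \<Sum>b<Suc N. f (int a - int b))
     = (\<Sum>a<N. \<Sum>b<N. f (int a - int b)) + (\<Sum>a<N. f (int a - int N)) + (\<Sum>b<Suc N. f (int N - int b))"
    by (simp add: sum.distrib)
  also have "(\<Sum>a<N. f (int a - int N)) = (\<Sum>s\<in>{- int N..-1}. f s)"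
    by (rule sum.reindex_bij_witness[where i="\<lambda>s. nat (s + int N)" and j="\<lambda>a. int a - int N"]) auto
  also have "(\<Sum>b<Suc N. f (int N - int b)) = (\<Sum>s\<in>{0..int N}. f s)"
    by (rule sum.reindex_bij_witness[where i="\<lambda>s. nat (int N - s)" and j="\<lambda>b. int N - int b"]) auto
  also have "(\<Sum>a<N. \<Sum>b<N. f (int a - int b)) + (\<Sum>s\<in>{- int N..-1}. f s) + (\<Sum>s\<in>{0..int N}. f s)
     = (\<Sum>s\<in>{- int N..int N}. of_int (int N - \<bar>s\<bar>) * f s) + (\<Sum>s\<in>{- int N..int N}. f s)"
  proof -
    have "{- int N..int N} = {- int N..-1} \<union> {0..int N}" by auto
    then have "(\<Sum>s\<in>{- int N..int N}. f s) = (\<Sum>s\<in>{- int N..-1}. f s) + (\<Sum>s\<in>{0..int N}. f s)"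
      by (simp add: sum.union_disjoint)
    then show ?thesis using Suc.IH by simp
  qed
  also have "\<dots> = (\<Sum>s\<in>{- int N..int N}. of_int (int (Suc N) - \<bar>s\<bar>) * f s)"
    by (simp add: sum.distrib[symmetric] algebra_simps)
  also have "\<dots> = (\<Sum>s\<in>{- int (Suc N)..int (Suc N)}. of_int (int (Suc N) - \<bar>s\<bar>) * f s)"
  proof (rule sum.mono_neutral_left)
    show "\<forall>s\<in>{- int (Suc N)..int (Suc N)} - {- int N..int N}. of_int (int (Suc N) - \<bar>s\<bar>) * f s = 0"
    proof
      fix s assume "s \<in> {- int (Suc N)..int (Suc N)} - {- int N..int N}"
      then have "int (Suc N) - \<bar>s\<bar> = 0" by auto
      then show "of_int (int (Suc N) - \<bar>s\<bar>) * f s = 0" by (simp only: of_int_0 mult_zero_left)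
    qed
  qed auto
  finally show ?case .
qed

lemma tri_bounds: "0 \<le> tri N s" "tri N s \<le> 1" by (auto simp: tri_def)

lemma tri_on: "N > 0 \<Longrightarrow> s \<in> {- int N..int N} \<Longrightarrow> tri N s = real_of_int (int N - \<bar>s\<bar>) / real N"
  by (auto simp: tri_def field_simps max_def)

lemma tri_off: "N > 0 \<Longrightarrow> s \<notin> {- int N..int N} \<Longrightarrow> tri N s = 0"
  by (auto simp: tri_def field_simps max_def)

lemma tri_tendsto: "(\<lambda>N. tri N s) \<longlonglongrightarrow> 1"
proof -
  have "(\<lambda>N. max 0 (1 - \<bar>real_of_int s\<bar> / real N)) \<longlonglongrightarrow> max 0 (1 - 0)"
    by (intro tendsto_intros lim_const_over_n)
  then show ?thesis by (simp add: tri_def)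
qed

lemma fejer_iexp:
  assumes "N > 0"
  shows "(\<Sum>s\<in>{- int N..int N}. complex_of_real (tri N s) * iexp (real_of_int s * \<theta>)) = complex_of_real (fejer N \<theta>)"
    and "fejer N \<theta> \<ge> 0"
proof -
  let ?S = "\<Sum>s\<in>{- int N..int N}. complex_of_real (tri N s) * iexp (real_of_int s * \<theta>)"
  have "?S = (1 / of_nat N) * (\<Sum>s\<in>{- int N..int N}. of_int (int N - \<bar>s\<bar>) * iexp (real_of_int s * \<theta>))"
    unfolding sum_distrib_left by (rule sum.cong) (use assms in \<open>simp_all add: tri_on del: of_int_diff\<close>)
  also have "\<dots> = (1 / of_nat N) * (\<Sum>a<N. \<Sum>b<N. iexp (real_of_int (int a - int b) * \<theta>))"
    by (simp only: double_sum_diff[where f="\<lambda>s. iexp (real_of_int s * \<theta>)"])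
  also have "(\<Sum>a<N. \<Sum>b<N. iexp (real_of_int (int a - int b) * \<theta>))
      = (\<Sum>a<N. iexp (real a * \<theta>)) * cnj (\<Sum>a<N. iexp (real a * \<theta>))"
    unfolding sum_product cnj_sum
    by (intro sum.cong refl) (simp add: exp_cnj exp_add[symmetric] algebra_simps exp_diff exp_minus field_simps)
  also have "\<dots> = complex_of_real ((cmod (\<Sum>a<N. iexp (real a * \<theta>)))\<^sup>2)"
    by (simp only: complex_norm_square)
  finally have S: "?S = complex_of_real (1 / real N * (cmod (\<Sum>a<N. iexp (real a * \<theta>)))\<^sup>2)" by simp
  have "Re ?S = fejer N \<theta>" by (simp add: fejer_def Re_exp)
  with S have F: "fejer N \<theta> = 1 / real N * (cmod (\<Sum>a<N. iexp (real a * \<theta>)))\<^sup>2" by (metis Re_complex_of_real)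
  show "?S = complex_of_real (fejer N \<theta>)" unfolding F by (rule S)
  show "fejer N \<theta> \<ge> 0" unfolding F by simp
qed

text \<open>
  The \<open>2 d\<close> lags run through one full period of \<open>g\<close>.
\<close>

lemma sum_two_periods_shift:
  fixes g :: "real \<Rightarrow> real"
  assumes per: "\<And>y. g (y + 2 * real d) = g y"
  shows "(\<Sum>r\<in>{1 - int d..int d}. g (real_of_int r + c + real A)) = (\<Sum>r\<in>{1 - int d..int d}. g (real_of_int r + c))"
proof (induction A)
  case (Suc A)
  define G where "G r = g (real_of_int r + c + real A)" for r
  have "(\<Sum>r\<in>{1 - int d..int d}. g (real_of_int r + c + real (Suc A))) = (\<Sum>r\<in>{1 - int d..int d}. G (r + 1))"
    by (intro sum.cong refl) (simp add: G_def algebra_simps)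
  also have "\<dots> = (\<Sum>r\<in>{2 - int d..int d + 1}. G r)"
    by (rule sum.reindex_bij_witness[where i="\<lambda>r. r - 1" and j="\<lambda>r. r + 1"]) auto
  also have "\<dots> = (\<Sum>r\<in>{1 - int d..int d}. G r)"
  proof (cases "d = 0")
    case False
    have "{2 - int d..int d + 1} = insert (int d + 1) {2 - int d..int d}" "{1 - int d..int d} = insert (1 - int d) {2 - int d..int d}"
      using False by auto
    moreover have "G (int d + 1) = G (1 - int d)"
      using per[of "1 - real d + c + real A"] by (simp add: G_def algebra_simps)
    ultimately show ?thesis by simp
  qed auto
  finally show ?case using Suc.IH by (simp add: G_def)
qed simp

definition fejer_lag_sum :: "nat \<Rightarrow> nat \<Rightarrow> real \<Rightarrow> real \<Rightarrow> real" where
  "fejer_lag_sum N d h x = (\<Sum>r\<in>{1 - int d..int d}. fejer N (2 * pi * (real_of_int r - x / h) / real d))"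

lemma fejer_lag_sum_nonneg: "N > 0 \<Longrightarrow> fejer_lag_sum N d h x \<ge> 0"
  unfolding fejer_lag_sum_def by (intro sum_nonneg fejer_iexp)

lemma fejer_measurable [measurable]: "fejer N \<in> borel_measurable borel"
  unfolding fejer_def[abs_def] by measurable

lemma fejer_lag_sum_measurable [measurable]: "fejer_lag_sum N d h \<in> borel_measurable borel"
  unfolding fejer_lag_sum_def[abs_def] by measurable

text \<open>
  Only the constant term of the Fejer kernel survives integration over an interval whose length is \<open>2 A h\<close>
  for an integer \<open>A\<close>, because in the variable \<open>x / h\<close> the endpoints differ by an integer, and integer shifts do
  not change the sum over the lags. The mean is thus independent of \<open>N\<close> and of the centre \<open>x\<close>.
\<close>

lemma fejer_lag_sum_mean:
  assumes N: "N > 0" and d: "d > 0" and h: "h > 0"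
  shows "(\<integral>\<^sup>+y. ennreal (fejer_lag_sum N d h (x + y)) * indicator {- (real A * h)..real A * h} y \<partial>lborel)
    = ennreal (4 * real A * h * real d)"
proof -
  define \<theta> where "\<theta> s = 2 * pi * real_of_int s / real d" for s :: int
  define F where "F s r y = (if s = 0 then tri N 0 * y else - (tri N s * h / \<theta> s) * sin (\<theta> s * (real_of_int r - (x + y) / h)))" for s r y
  define \<Phi> where "\<Phi> y = (\<Sum>r\<in>{1 - int d..int d}. \<Sum>s\<in>{- int N..int N}. F s r y)" for y
  have F': "(F s r has_real_derivative tri N s * cos (real_of_int s * (2 * pi * (real_of_int r - (x + y) / h) / real d))) (at y)" for s r y
  proof (cases "s = 0")
    case True
    then show ?thesis by (auto simp: F_def[abs_def] intro!: derivative_eq_intros)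
  next
    case False
    have \<theta>: "\<theta> s \<noteq> 0" using False d by (simp add: \<theta>_def)
    have "(F s r has_real_derivative - (tri N s * h / \<theta> s) * (cos (\<theta> s * (real_of_int r - (x + y) / h)) * (\<theta> s * (- (1 / h))))) (at y)"
      unfolding F_def using False h by (auto intro!: derivative_eq_intros simp: field_simps)
    also have "- (tri N s * h / \<theta> s) * (cos (\<theta> s * (real_of_int r - (x + y) / h)) * (\<theta> s * (- (1 / h))))
        = tri N s * cos (\<theta> s * (real_of_int r - (x + y) / h))"
      using \<theta> h by (simp add: field_simps)
    also have "\<theta> s * (real_of_int r - (x + y) / h) = real_of_int s * (2 * pi * (real_of_int r - (x + y) / h) / real d)"
      by (simp add: \<theta>_def)
    finally show ?thesis .
  qed
  have \<Phi>': "(\<Phi> has_real_derivative fejer_lag_sum N d h (x + y)) (at y)" for y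
    unfolding \<Phi>_def[abs_def] fejer_lag_sum_def fejer_def by (intro DERIV_sum) (rule F')
  have "(\<integral>\<^sup>+y. ennreal (fejer_lag_sum N d h (x + y)) * indicator {- (real A * h)..real A * h} y \<partial>lborel)
     = ennreal (\<Phi> (real A * h) - \<Phi> (- (real A * h)))"
    by (rule nn_integral_FTC_Icc) (use \<Phi>' fejer_lag_sum_nonneg N h in \<open>auto intro: has_field_derivative_at_within\<close>)
  also have "\<Phi> (real A * h) - \<Phi> (- (real A * h)) = 4 * real A * h * real d"
  proof -
    have swap: "\<Phi> y = (\<Sum>s\<in>{- int N..int N}. \<Sum>r\<in>{1 - int d..int d}. F s r y)" for y
      unfolding \<Phi>_def by (rule sum.swap)
    have z: "(\<Sum>r\<in>{1 - int d..int d}. F s r (real A * h)) = (\<Sum>r\<in>{1 - int d..int d}. F s r (- (real A * h)))" if s: "s \<noteq> 0" for s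
    proof -
      define g where "g y = - (tri N s * h / \<theta> s) * sin (\<theta> s * y)" for y
      have per: "g (y + 2 * real d) = g y" for y
      proof -
        have "\<theta> s * (y + 2 * real d) = \<theta> s * y + 2 * pi * real_of_int (2 * s)"
          using d by (simp add: \<theta>_def field_simps)
        then have "sin (\<theta> s * (y + 2 * real d)) = sin (\<theta> s * y)"
          by (simp add: sin_add del: of_int_mult)
        then show ?thesis by (simp add: g_def)
      qed
      note sh = sum_two_periods_shift[of g d, OF per]
      have "F s r (real A * h) = g (real_of_int r + (- x / h - real A))" for r
        using s h by (simp add: F_def g_def field_simps)
      moreover have "F s r (- (real A * h)) = g (real_of_int r + (- x / h - real A) + real (2 * A))" for r
        using s h by (simp add: F_def g_def field_simps)
      ultimately show ?thesis using sh[of "- x / h - real A" "2 * A"] by simp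
    qed
    have "\<Phi> (real A * h) - \<Phi> (- (real A * h)) = (\<Sum>s\<in>{- int N..int N}. (\<Sum>r\<in>{1 - int d..int d}. F s r (real A * h)) - (\<Sum>r\<in>{1 - int d..int d}. F s r (- (real A * h))))"
      unfolding swap by (simp add: sum_subtractf)
    also have "\<dots> = (\<Sum>s\<in>{0}. (\<Sum>r\<in>{1 - int d..int d}. F s r (real A * h)) - (\<Sum>r\<in>{1 - int d..int d}. F s r (- (real A * h))))"
      by (rule sum.mono_neutral_right) (use z in auto)
    also have "\<dots> = 4 * real A * h * real d"
    proof -
      have "card {1 - int d..int d} = 2 * d" by simp
      then show ?thesis by (simp add: F_def tri_def algebra_simps)
    qed
    finally show ?thesis .
  qed
  finally show ?thesis .
qed

section \<open>Lag sums of kernel transforms under a radial majorant\<close>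

lemma infsum_count_integral:
  fixes f :: "'a \<Rightarrow> 'b::{banach, second_countable_topology}"
  assumes "(\<lambda>x. norm (f x)) summable_on A"
  shows "integrable (count_space A) f" "infsum f A = (LINT x|count_space A. f x)"
proof -
  have "Infinite_Set_Sum.abs_summable_on f A" using assms by (simp add: abs_summable_equivalent[symmetric])
  then show "integrable (count_space A) f" "infsum f A = (LINT x|count_space A. f x)"
    by (simp_all add: Infinite_Set_Sum.abs_summable_on_def infsetsum_infsum[symmetric] infsetsum_def)
qed

text \<open>
  Dominated convergence for the counting measure: Fejer summation recovers an absolutely convergent series.
\<close>

lemma tannery_infsum:
  fixes f :: "'a::countable \<Rightarrow> complex" and c :: "nat \<Rightarrow> 'a \<Rightarrow> real"
  assumes f: "(\<lambda>s. norm (f s)) summable_on UNIV"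
    and c: "\<And>N s. \<bar>c N s\<bar> \<le> 1" "\<And>s. (\<lambda>N. c N s) \<longlonglongrightarrow> 1"
    and I: "\<And>N. finite (I N)" "\<And>N s. N > 0 \<Longrightarrow> s \<notin> I N \<Longrightarrow> c N s = 0"
  shows "(\<lambda>N. \<Sum>s\<in>I N. complex_of_real (c N s) * f s) \<longlonglongrightarrow> infsum f UNIV"
proof -
  have eq: "(\<Sum>s\<in>I N. complex_of_real (c N s) * f s) = (LINT s|count_space UNIV. complex_of_real (c N s) * f s)" if "N > 0" for N
  proof -
    have *: "{s \<in> UNIV. complex_of_real (c N s) * f s \<noteq> 0} \<subseteq> I N" using I(2)[OF that] by auto
    have "(LINT s|count_space UNIV. complex_of_real (c N s) * f s) = (\<Sum>s | s \<in> UNIV \<and> complex_of_real (c N s) * f s \<noteq> 0. complex_of_real (c N s) * f s)"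
      by (rule lebesgue_integral_count_space_finite_support) (use finite_subset[OF * I(1)] in auto)
    also have "\<dots> = (\<Sum>s\<in>I N. complex_of_real (c N s) * f s)"
      by (rule sum.mono_neutral_left) (use * I(1) in auto)
    finally show ?thesis by simp
  qed
  have "(\<lambda>N. LINT s|count_space UNIV. complex_of_real (c N s) * f s) \<longlonglongrightarrow> (LINT s|count_space UNIV. f s)"
  proof (rule integral_dominated_convergence[where w="\<lambda>s. norm (f s)"])
    show "integrable (count_space UNIV) (\<lambda>s. norm (f s))"
      using infsum_count_integral(1)[OF f] by simp
    show "AE s in count_space UNIV. (\<lambda>N. complex_of_real (c N s) * f s) \<longlonglongrightarrow> f s"
    proof (rule AE_I2)
      fix s
      have "(\<lambda>N. complex_of_real (c N s) * f s) \<longlonglongrightarrow> complex_of_real 1 * f s"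
        by (intro tendsto_intros c)
      then show "(\<lambda>N. complex_of_real (c N s) * f s) \<longlonglongrightarrow> f s" by simp
    qed
    show "AE s in count_space UNIV. norm (complex_of_real (c N s) * f s) \<le> norm (f s)" for N
      using c(1)[of N] by (intro AE_I2) (simp add: norm_mult mult_left_le_one_le)
  qed auto
  then have "(\<lambda>N. LINT s|count_space UNIV. complex_of_real (c N s) * f s) \<longlonglongrightarrow> infsum f UNIV"
    using infsum_count_integral(2)[OF f] by simp
  then show ?thesis
    by (rule Lim_transform_eventually) (use eq in \<open>auto intro!: eventually_sequentiallyI[of 1]\<close>)
qed

lemma nn_integral_lborel_fst_snd:
  fixes f g :: "real \<Rightarrow> ennreal"
  assumes [measurable]: "f \<in> borel_measurable borel" "g \<in> borel_measurable borel"
  shows "(\<integral>\<^sup>+z. f (fst z) * g (snd z) \<partial>lborel) = (\<integral>\<^sup>+x. f x \<partial>lborel) * (\<integral>\<^sup>+y. g y \<partial>lborel)"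
proof -
  have "(\<integral>\<^sup>+z. f (fst z) * g (snd z) \<partial>lborel) = (\<integral>\<^sup>+z. f (fst z) * g (snd z) \<partial>(lborel \<Otimes>\<^sub>M lborel))"
    by (simp only: lborel_prod)
  also have "\<dots> = (\<integral>\<^sup>+x. \<integral>\<^sup>+y. f x * g y \<partial>lborel \<partial>lborel)"
    by (subst lborel.nn_integral_fst[symmetric]) auto
  also have "\<dots> = (\<integral>\<^sup>+x. f x \<partial>lborel) * (\<integral>\<^sup>+y. g y \<partial>lborel)"
    by (simp add: nn_integral_cmult nn_integral_multc)
  finally show ?thesis .
qed

text \<open>
  The reflection \<open>x \<mapsto> -x\<close> carries the negative half-line to the positive one.
\<close>

lemma nn_integral_abs_fold:
  fixes f :: "real \<Rightarrow> ennreal"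
  assumes [measurable]: "f \<in> borel_measurable borel"
  shows "(\<integral>\<^sup>+x. f \<bar>x\<bar> \<partial>lborel) \<le> 2 * (\<integral>\<^sup>+x. f x * indicator {0..} x \<partial>lborel)"
proof -
  let ?f = "\<lambda>x. f x * indicator {0..} x"
  have "(\<integral>\<^sup>+x. f \<bar>x\<bar> \<partial>lborel) \<le> (\<integral>\<^sup>+x. ?f x + ?f (0 + (-1) * x) \<partial>lborel)"
    by (rule nn_integral_mono) (auto simp: indicator_def)
  also have "\<dots> = (\<integral>\<^sup>+x. ?f x \<partial>lborel) + (\<integral>\<^sup>+x. ?f (0 + (-1) * x) \<partial>lborel)"
    by (rule nn_integral_add) measurable
  also have "(\<integral>\<^sup>+x. ?f (0 + (-1) * x) \<partial>lborel) = (\<integral>\<^sup>+x. ?f x \<partial>lborel)"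
    using nn_integral_real_affine[of ?f "-1" 0] by simp
  finally show ?thesis by (simp add: mult_2)
qed

lemma nn_integral_lborel_pair_shift:
  fixes f :: "real \<times> real \<Rightarrow> ennreal"
  assumes [measurable]: "f \<in> borel_measurable borel"
  shows "(\<integral>\<^sup>+x. f (u + x) \<partial>lborel) = (\<integral>\<^sup>+x. f x \<partial>lborel)"
proof -
  have "(\<integral>\<^sup>+x. f x \<partial>lborel) = (\<integral>\<^sup>+x. f x \<partial>distr lborel borel ((+) u))"
    by (simp only: lborel_distr_plus)
  then show ?thesis by (subst (asm) nn_integral_distr) auto
qed

text \<open>
  The majorant of the kernel transform in condition \<open>K3\<close>.
\<close>

locale radial_majorant =
  fixes kt :: "real \<times> real \<Rightarrow> real"
  assumes kt_nonneg: "\<And>x. kt x \<ge> 0"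
    and kt_even: "\<And>x1 x2. kt (- x1, x2) = kt (x1, x2) \<and> kt (x1, - x2) = kt (x1, x2)"
    and kt_quadrant: "\<And>x y. x \<in> {0..} \<times> {0..} \<Longrightarrow> y \<in> {0..} \<times> {0..} \<Longrightarrow> vmax x \<le> vmax y \<Longrightarrow> kt y \<le> kt x"
    and kt_set_integrable: "set_integrable lborel ({0..} \<times> {0..}) kt"
begin

lemma kt_abs: "kt (\<bar>a\<bar>, \<bar>b\<bar>) = kt (a, b)"
  using kt_even[of a b] kt_even[of a "-b"] kt_even[of "-a" b] by (cases "a \<ge> 0"; cases "b \<ge> 0") auto

lemma kt_mono: "vmax x \<le> vmax y \<Longrightarrow> kt y \<le> kt x"
  using kt_quadrant[of "(\<bar>fst x\<bar>, \<bar>snd x\<bar>)" "(\<bar>fst y\<bar>, \<bar>snd y\<bar>)"] by (simp add: vmax_def kt_abs)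

text \<open>
  Evenness carries \<open>kt\<close> back to the quadrant, where integrability includes measurability.
\<close>

lemma kt_measurable [measurable]: "kt \<in> borel_measurable borel"
proof -
  define q where "q z = indicator ({0..} \<times> {0..}) z *\<^sub>R kt z" for z :: "real \<times> real"
  have q[measurable]: "q \<in> borel_measurable borel"
    using kt_set_integrable unfolding set_integrable_def q_def[abs_def] by (auto dest: borel_measurable_integrable)
  have [measurable]: "(\<lambda>z::real \<times> real. (\<bar>fst z\<bar>, \<bar>snd z\<bar>)) \<in> borel_measurable borel"
    by (intro borel_measurable_continuous_onI continuous_intros)
  have "kt = (\<lambda>z. q (\<bar>fst z\<bar>, \<bar>snd z\<bar>))"
    by (auto simp: q_def kt_abs)
  also have "\<dots> \<in> borel_measurable borel" by measurable
  finally show ?thesis .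
qed

lemma kt_integrable: "integrable lborel kt"
proof (rule integrableI_bounded)
  show "kt \<in> borel_measurable lborel" by simp
  have [measurable]: "kt \<in> borel_measurable (borel \<Otimes>\<^sub>M borel)" by (simp add: borel_prod)
  have fin: "(\<integral>\<^sup>+z. ennreal (kt z) * indicator ({0..} \<times> {0..}) z \<partial>lborel) < \<infinity>"
  proof -
    have "(\<integral>\<^sup>+z. ennreal (norm (indicator ({0..} \<times> {0..}) z *\<^sub>R kt z)) \<partial>lborel) < \<infinity>"
      using kt_set_integrable unfolding set_integrable_def integrable_iff_bounded by simp
    then show ?thesis
      by (rule back_subst[where P="\<lambda>x. x < \<infinity>"]) (auto intro!: nn_integral_cong simp: kt_nonneg indicator_def)
  qed
  have "(\<integral>\<^sup>+z. ennreal (norm (kt z)) \<partial>lborel) = (\<integral>\<^sup>+z. ennreal (kt (\<bar>fst z\<bar>, \<bar>snd z\<bar>)) \<partial>(lborel \<Otimes>\<^sub>M lborel))"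
    unfolding lborel_prod by (intro nn_integral_cong) (simp add: kt_abs kt_nonneg)
  also have "\<dots> = (\<integral>\<^sup>+x. \<integral>\<^sup>+y. ennreal (kt (\<bar>x\<bar>, \<bar>y\<bar>)) \<partial>lborel \<partial>lborel)"
    by (subst lborel.nn_integral_fst[symmetric]) auto
  also have "\<dots> \<le> 2 * (\<integral>\<^sup>+x. (\<integral>\<^sup>+y. ennreal (kt (x, \<bar>y\<bar>)) \<partial>lborel) * indicator {0..} x \<partial>lborel)"
    by (rule nn_integral_abs_fold) simp
  also have "\<dots> \<le> 2 * (\<integral>\<^sup>+x. (2 * (\<integral>\<^sup>+y. ennreal (kt (x, y)) * indicator {0..} y \<partial>lborel)) * indicator {0..} x \<partial>lborel)"
    by (intro mult_left_mono nn_integral_mono mult_right_mono nn_integral_abs_fold) auto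
  also have "\<dots> = 2 * (2 * (\<integral>\<^sup>+x. (\<integral>\<^sup>+y. ennreal (kt (x, y)) * indicator {0..} y * indicator {0..} x \<partial>lborel) \<partial>lborel))"
  proof -
    have "(\<integral>\<^sup>+x. (2 * (\<integral>\<^sup>+y. ennreal (kt (x, y)) * indicator {0..} y \<partial>lborel)) * indicator {0..} x \<partial>lborel)
       = (\<integral>\<^sup>+x. 2 * (\<integral>\<^sup>+y. ennreal (kt (x, y)) * indicator {0..} y * indicator {0..} x \<partial>lborel) \<partial>lborel)"
      by (intro nn_integral_cong) (subst nn_integral_multc; simp add: mult.assoc)
    also have "\<dots> = 2 * (\<integral>\<^sup>+x. (\<integral>\<^sup>+y. ennreal (kt (x, y)) * indicator {0..} y * indicator {0..} x \<partial>lborel) \<partial>lborel)"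
      by (rule nn_integral_cmult) measurable
    finally show ?thesis by simp
  qed
  also have "(\<integral>\<^sup>+x. (\<integral>\<^sup>+y. ennreal (kt (x, y)) * indicator {0..} y * indicator {0..} x \<partial>lborel) \<partial>lborel)
     = (\<integral>\<^sup>+z. ennreal (kt z) * indicator {0..} (snd z) * indicator {0..} (fst z) \<partial>(lborel \<Otimes>\<^sub>M lborel))"
    by (subst lborel.nn_integral_fst[symmetric]) auto
  also have "\<dots> = (\<integral>\<^sup>+z. ennreal (kt z) * indicator ({0..} \<times> {0..}) z \<partial>lborel)"
    unfolding lborel_prod by (intro nn_integral_cong) (auto simp: indicator_def)
  finally have le: "(\<integral>\<^sup>+z. ennreal (norm (kt z)) \<partial>lborel) \<le> 2 * (2 * (\<integral>\<^sup>+z. ennreal (kt z) * indicator ({0..} \<times> {0..}) z \<partial>lborel))" .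
  then show "(\<integral>\<^sup>+z. ennreal (norm (kt z)) \<partial>lborel) < \<infinity>"
    using fin by (auto simp: ennreal_mult_less_top intro: le_less_trans)
qed

text \<open>
  Away from the origin a rectangle of size \<open>h1\<close> by \<open>h2\<close>, placed at \<open>x\<close> towards the origin, lies where
  \<open>kt\<close> is at least \<open>kt x\<close>, so \<open>kt x\<close> is at most a local average at scale \<open>h\<close>; near the
  origin \<open>kt x \<le> kt 0\<close>. The factor \<open>A\<close> compares the two bandwidths.
\<close>

lemma kt_local_average:
  assumes h: "h1 > 0" "h2 > 0" and A: "max h1 h2 \<le> real A * h1" "max h1 h2 \<le> real A * h2"
  shows "ennreal (kt x) \<le> ennreal (kt 0) * indicator ({- (real A * h1)..real A * h1} \<times> {- (real A * h2)..real A * h2}) x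
    + ennreal (1 / (h1 * h2)) * (\<integral>\<^sup>+u. ennreal (kt (x - u)) * indicator ({-h1..h1} \<times> {-h2..h2}) u \<partial>lborel)"
proof (cases "vmax x \<le> max h1 h2")
  case True
  then have "x \<in> {- (real A * h1)..real A * h1} \<times> {- (real A * h2)..real A * h2}"
    using A by (cases x) (auto simp: vmax_def)
  moreover have "kt x \<le> kt 0" by (rule kt_mono) (simp add: vmax_def)
  ultimately show ?thesis by (simp add: ennreal_leI add_increasing2)
next
  case False
  \<comment> \<open>The corner is chosen so that subtracting a point of the rectangle moves both coordinates towards the origin.\<close>
  define a where "a = (if fst x \<ge> 0 then 0 else - h1)"
  define b where "b = (if snd x \<ge> 0 then 0 else - h2)"
  let ?R = "cbox (a, b) (a + h1, b + h2)"
  have R: "?R \<subseteq> {-h1..h1} \<times> {-h2..h2}" using h by (auto simp: cbox_Pair_eq a_def b_def)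
  have ge: "kt x \<le> kt (x - u)" if "u \<in> ?R" for u
  proof (rule kt_mono)
    have "\<bar>fst x - fst u\<bar> \<le> max \<bar>fst x\<bar> h1" "\<bar>snd x - snd u\<bar> \<le> max \<bar>snd x\<bar> h2"
      using that h by (cases u; auto simp: cbox_Pair_eq a_def b_def split: if_splits)+
    moreover have "a \<le> max p h1 \<Longrightarrow> b \<le> max q h2 \<Longrightarrow> \<not> max p q \<le> max h1 h2 \<Longrightarrow> max a b \<le> max p q" for a b p q :: real
      by (simp add: max_def split: if_splits)
    ultimately show "vmax (x - u) \<le> vmax x" using False unfolding vmax_def fst_diff snd_diff by blast
  qed
  have "emeasure lborel ?R = ennreal (h1 * h2)"
  proof -
    have "emeasure (lborel \<Otimes>\<^sub>M lborel) ({a..a + h1} \<times> {b..b + h2}) = ennreal (h1 * h2)"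
      using h by (subst lborel.emeasure_pair_measure_Times) (auto simp: ennreal_mult)
    then show ?thesis by (simp add: lborel_prod cbox_Pair_eq)
  qed
  then have "ennreal (kt x) * ennreal (h1 * h2) = (\<integral>\<^sup>+u. ennreal (kt x) * indicator ?R u \<partial>lborel)"
    by (subst nn_integral_cmult_indicator) auto
  also have "\<dots> \<le> (\<integral>\<^sup>+u. ennreal (kt (x - u)) * indicator ({-h1..h1} \<times> {-h2..h2}) u \<partial>lborel)"
    using R ge by (intro nn_integral_mono) (auto simp: indicator_def intro!: ennreal_leI)
  finally have "ennreal (1 / (h1 * h2)) * (ennreal (kt x) * ennreal (h1 * h2))
     \<le> ennreal (1 / (h1 * h2)) * (\<integral>\<^sup>+u. ennreal (kt (x - u)) * indicator ({-h1..h1} \<times> {-h2..h2}) u \<partial>lborel)"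
    by (rule mult_left_mono) simp
  moreover have "ennreal (1 / (h1 * h2)) * (ennreal (kt x) * ennreal (h1 * h2)) = ennreal (kt x)"
    using h by (simp add: ennreal_mult[symmetric] kt_nonneg)
  ultimately show ?thesis by (simp add: add_increasing)
qed

text \<open>
  By \<open>kt_local_average\<close> the factor \<open>kt\<close> may be replaced by its average at scale \<open>h\<close>; Fubini moves
  the average to the Fejer sums, where it is given exactly by \<open>fejer_lag_sum_mean\<close>. The bound therefore does not depend
  on \<open>N\<close>.
\<close>

lemma nn_integral_kt_fejer_lag_sum:
  assumes h: "h1 > 0" "h2 > 0" and A: "max h1 h2 \<le> real A * h1" "max h1 h2 \<le> real A * h2"
    and N: "N > 0" and d: "d1 > 0" "d2 > 0"
  shows "(\<integral>\<^sup>+x. ennreal (kt x) * ennreal (fejer_lag_sum N d1 h1 (fst x) * fejer_lag_sum N d2 h2 (snd x)) \<partial>lborel)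
    \<le> ennreal (16 * real d1 * real d2 * ((real A)\<^sup>2 * kt 0 * (h1 * h2) + (LINT x|lborel. kt x)))"
proof -
  let ?p1 = "fejer_lag_sum N d1 h1" and ?p2 = "fejer_lag_sum N d2 h2"
  define \<Psi> where "\<Psi> x = ennreal (?p1 (fst x) * ?p2 (snd x))" for x
  have [measurable]: "fst \<in> borel_measurable (borel :: (real \<times> real) measure)" "snd \<in> borel_measurable (borel :: (real \<times> real) measure)"
    by (auto intro!: borel_measurable_continuous_onI continuous_intros)
  have \<Psi>m[measurable]: "\<Psi> \<in> borel_measurable borel" unfolding \<Psi>_def[abs_def] by measurable
  have p0: "?p1 y \<ge> 0" "?p2 y \<ge> 0" for y using fejer_lag_sum_nonneg[OF N] by auto
  have mean: "(\<integral>\<^sup>+u. \<Psi> (x + u) * indicator ({- (real B * h1)..real B * h1} \<times> {- (real B * h2)..real B * h2}) u \<partial>lborel)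
     = ennreal (16 * (real B)\<^sup>2 * (h1 * h2) * real d1 * real d2)" for x B
  proof -
    have "(\<integral>\<^sup>+u. \<Psi> (x + u) * indicator ({- (real B * h1)..real B * h1} \<times> {- (real B * h2)..real B * h2}) u \<partial>lborel)
       = (\<integral>\<^sup>+u. (ennreal (?p1 (fst x + fst u)) * indicator {- (real B * h1)..real B * h1} (fst u))
            * (ennreal (?p2 (snd x + snd u)) * indicator {- (real B * h2)..real B * h2} (snd u)) \<partial>lborel)"
      by (intro nn_integral_cong) (auto simp: \<Psi>_def ennreal_mult p0 indicator_def)
    also have "\<dots> = ennreal (4 * real B * h1 * real d1) * ennreal (4 * real B * h2 * real d2)"
      by (subst nn_integral_lborel_fst_snd) (auto simp: fejer_lag_sum_mean[OF N] d h)
    finally show ?thesis using h by (simp add: ennreal_mult[symmetric] power2_eq_square mult_ac)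
  qed
  define bA where "bA = {- (real A * h1)..real A * h1} \<times> {- (real A * h2)..real A * h2}"
  define b1 where "b1 = {-h1..h1} \<times> {-h2..h2}"
  have bm[measurable]: "bA \<in> sets borel" "b1 \<in> sets borel"
    unfolding bA_def b1_def by (auto intro!: borel_closed closed_Times)
  note kt_local_average = kt_local_average[OF h A, folded bA_def b1_def]
  define I where "I x = (\<integral>\<^sup>+u. ennreal (kt (x - u)) * indicator b1 u \<partial>lborel)" for x
  have km[measurable]: "(\<lambda>p::(real \<times> real) \<times> (real \<times> real). kt (fst p - snd p)) \<in> borel_measurable (borel \<Otimes>\<^sub>M borel)"
    by measurable
  have Im[measurable]: "I \<in> borel_measurable borel"
  proof -
    have "(\<lambda>x. \<integral>\<^sup>+u. ennreal (kt (fst (x, u) - snd (x, u))) * indicator b1 u \<partial>lborel) \<in> borel_measurable borel"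
      by (rule lborel.borel_measurable_nn_integral) measurable
    then show ?thesis by (simp add: I_def[abs_def])
  qed
  have pw: "(ennreal (kt 0) * indicator bA x + ennreal (1 / (h1 * h2)) * I x) * \<Psi> x
     = ennreal (kt 0) * (\<Psi> (0 + x) * indicator bA x) + ennreal (1 / (h1 * h2)) * (I x * \<Psi> x)" for x
    by (simp only: distrib_right add_0) (simp add: mult_ac)
  have "(\<integral>\<^sup>+x. ennreal (kt x) * \<Psi> x \<partial>lborel)
    \<le> (\<integral>\<^sup>+x. (ennreal (kt 0) * indicator bA x + ennreal (1 / (h1 * h2)) * I x) * \<Psi> x \<partial>lborel)"
    unfolding I_def by (rule nn_integral_mono) (rule mult_right_mono[OF kt_local_average], simp)
  also have "\<dots> = (\<integral>\<^sup>+x. ennreal (kt 0) * (\<Psi> (0 + x) * indicator bA x) \<partial>lborel)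
     + (\<integral>\<^sup>+x. ennreal (1 / (h1 * h2)) * (I x * \<Psi> x) \<partial>lborel)"
    unfolding pw by (rule nn_integral_add) measurable
  also have "(\<integral>\<^sup>+x. ennreal (kt 0) * (\<Psi> (0 + x) * indicator bA x) \<partial>lborel) = ennreal (kt 0) * (\<integral>\<^sup>+x. \<Psi> (0 + x) * indicator bA x \<partial>lborel)"
    by (rule nn_integral_cmult) measurable
  also have "(\<integral>\<^sup>+x. ennreal (1 / (h1 * h2)) * (I x * \<Psi> x) \<partial>lborel) = ennreal (1 / (h1 * h2)) * (\<integral>\<^sup>+x. I x * \<Psi> x \<partial>lborel)"
    by (rule nn_integral_cmult) measurable
  also have "(\<integral>\<^sup>+x. I x * \<Psi> x \<partial>lborel)
     = (\<integral>\<^sup>+x. \<integral>\<^sup>+u. ennreal (kt (x - u)) * indicator b1 u * \<Psi> x \<partial>lborel \<partial>lborel)"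
    unfolding I_def by (rule nn_integral_cong, rule nn_integral_multc[symmetric]) measurable
  also have "\<dots> = (\<integral>\<^sup>+u. \<integral>\<^sup>+x. ennreal (kt (x - u)) * indicator b1 u * \<Psi> x \<partial>lborel \<partial>lborel)"
    by (rule lborel_pair.Fubini') measurable
  also have "\<dots> = (\<integral>\<^sup>+u. \<integral>\<^sup>+x. ennreal (kt x) * indicator b1 u * \<Psi> (x + u) \<partial>lborel \<partial>lborel)"
  proof (rule nn_integral_cong)
    fix u :: "real \<times> real"
    show "(\<integral>\<^sup>+x. ennreal (kt (x - u)) * indicator b1 u * \<Psi> x \<partial>lborel) = (\<integral>\<^sup>+x. ennreal (kt x) * indicator b1 u * \<Psi> (x + u) \<partial>lborel)"
      using nn_integral_lborel_pair_shift[of "\<lambda>x. ennreal (kt (x - u)) * indicator b1 u * \<Psi> x" u, symmetric]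
      by (simp add: add.commute)
  qed
  also have "\<dots> = (\<integral>\<^sup>+x. \<integral>\<^sup>+u. ennreal (kt x) * indicator b1 u * \<Psi> (x + u) \<partial>lborel \<partial>lborel)"
    by (rule lborel_pair.Fubini') measurable
  also have "\<dots> = (\<integral>\<^sup>+x. ennreal (kt x) * ennreal (16 * (h1 * h2) * real d1 * real d2) \<partial>lborel)"
  proof (rule nn_integral_cong)
    fix x
    have "(\<integral>\<^sup>+u. ennreal (kt x) * indicator b1 u * \<Psi> (x + u) \<partial>lborel) = ennreal (kt x) * (\<integral>\<^sup>+u. \<Psi> (x + u) * indicator b1 u \<partial>lborel)"
      by (subst nn_integral_cmult[symmetric]) (auto simp: mult_ac)
    then show "(\<integral>\<^sup>+u. ennreal (kt x) * indicator b1 u * \<Psi> (x + u) \<partial>lborel) = ennreal (kt x) * ennreal (16 * (h1 * h2) * real d1 * real d2)"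
      using mean[of x 1] by (simp add: b1_def)
  qed
  also have "\<dots> = ennreal (LINT x|lborel. kt x) * ennreal (16 * (h1 * h2) * real d1 * real d2)"
    using nn_integral_eq_integral[OF kt_integrable] kt_nonneg by (simp add: nn_integral_multc)
  also have "ennreal (kt 0) * (\<integral>\<^sup>+x. \<Psi> (0 + x) * indicator bA x \<partial>lborel) + ennreal (1 / (h1 * h2)) * (ennreal (LINT x|lborel. kt x) * ennreal (16 * (h1 * h2) * real d1 * real d2))
     = ennreal (kt 0 * (16 * (real A)\<^sup>2 * (h1 * h2) * real d1 * real d2) + 1 / (h1 * h2) * ((LINT x|lborel. kt x) * (16 * (h1 * h2) * real d1 * real d2)))"
    unfolding bA_def mean using h kt_nonneg by (simp add: ennreal_mult[symmetric] ennreal_plus[symmetric] integral_nonneg del: ennreal_plus)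
  also have "kt 0 * (16 * (real A)\<^sup>2 * (h1 * h2) * real d1 * real d2) + 1 / (h1 * h2) * ((LINT x|lborel. kt x) * (16 * (h1 * h2) * real d1 * real d2))
     = 16 * real d1 * real d2 * ((real A)\<^sup>2 * kt 0 * (h1 * h2) + (LINT x|lborel. kt x))"
    using h by (simp add: field_simps)
  finally show ?thesis unfolding \<Psi>_def .
qed

text \<open>
  Fourier inversion turns the exponential sum at lag \<open>r\<close> into an integral of the transform against a product of two
  Fejer kernels; these are nonnegative, so the sum over \<open>r\<close> can be taken under the integral.
\<close>

lemma kernel_fejer_sum_bound:
  assumes c: "continuous_on UNIV K" and nn: "\<And>x. K x \<ge> 0" and K: "integrable lborel K"
    and k: "\<And>x. cmod (kernel_ft K x) \<le> kt x"
    and h: "h1 > 0" "h2 > 0" and A: "max h1 h2 \<le> real A * h1" "max h1 h2 \<le> real A * h2"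
    and N: "N > 0" and d: "d1 > 0" "d2 > 0"
  shows "(\<Sum>r\<in>{1 - int d1..int d1} \<times> {1 - int d2..int d2}.
      cmod (\<Sum>s\<in>{- int N..int N} \<times> {- int N..int N}. complex_of_real (tri N (fst s) * tri N (snd s)) *
        (iexp (freq (d1, d2) s \<bullet> rvec r) * complex_of_real (K (lattice_pt (h1, h2) (d1, d2) s)))))
    \<le> 4 / pi\<^sup>2 * (real d1 * real d2 * ((real A)\<^sup>2 * kt 0 * (h1 * h2) + (LINT x|lborel. kt x)))"
proof -
  have [measurable]: "K \<in> borel_measurable borel" using K by auto
  have [measurable]: "fst \<in> borel_measurable (borel :: (real \<times> real) measure)" "snd \<in> borel_measurable (borel :: (real \<times> real) measure)"
    by (auto intro!: borel_measurable_continuous_onI continuous_intros)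
  let ?I = "{- int N..int N} \<times> {- int N..int N}" and ?R = "{1 - int d1..int d1} \<times> {1 - int d2..int d2}"
  let ?F = "\<lambda>r x. fejer N (2 * pi * (real_of_int (fst r) - fst x / h1) / real d1) * fejer N (2 * pi * (real_of_int (snd r) - snd x / h2) / real d2)"
  have ki: "integrable lborel (kernel_ft K)"
    by (rule Bochner_Integration.integrable_bound[OF kt_integrable]) (use k in \<open>auto intro!: order_trans[OF k]\<close>)
  have Fnn: "?F r x \<ge> 0" for r x by (intro mult_nonneg_nonneg fejer_iexp N)
  have fb: "\<bar>fejer N \<theta>\<bar> \<le> real (2 * N + 1)" for \<theta>
  proof -
    have "\<bar>fejer N \<theta>\<bar> \<le> (\<Sum>s\<in>{- int N..int N}. \<bar>tri N s * cos (real_of_int s * \<theta>)\<bar>)" unfolding fejer_def by (rule sum_abs)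
    also have "\<dots> \<le> (\<Sum>s\<in>{- int N..int N}. 1 * 1)"
      unfolding abs_mult by (intro sum_mono mult_mono) (auto simp: tri_bounds)
    finally show ?thesis by simp
  qed
  have Fi: "integrable lborel (\<lambda>x. kt x * ?F r x)" for r
  proof (rule Bochner_Integration.integrable_bound)
    show "integrable lborel (\<lambda>x. (real (2 * N + 1) * real (2 * N + 1)) * kt x)" using kt_integrable by simp
    show "AE x in lborel. norm (kt x * ?F r x) \<le> norm (real (2 * N + 1) * real (2 * N + 1) * kt x)"
    proof (rule AE_I2)
      fix x
      have "\<bar>?F r x\<bar> \<le> real (2 * N + 1) * real (2 * N + 1)" unfolding abs_mult by (intro mult_mono fb) auto
      from mult_right_mono[OF this kt_nonneg[of x]]
      show "norm (kt x * ?F r x) \<le> norm (real (2 * N + 1) * real (2 * N + 1) * kt x)"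
        by (simp add: abs_mult kt_nonneg mult_ac)
    qed
  qed measurable
  have one: "cmod (\<Sum>s\<in>?I. complex_of_real (tri N (fst s) * tri N (snd s)) *
        (iexp (freq (d1, d2) s \<bullet> rvec r) * complex_of_real (K (lattice_pt (h1, h2) (d1, d2) s))))
      \<le> 1 / (4 * pi\<^sup>2) * (LINT x|lborel. kt x * ?F r x)" for r
  proof -
    let ?b = "\<lambda>s. complex_of_real (tri N (fst s) * tri N (snd s)) * iexp (freq (d1, d2) s \<bullet> rvec r)"
    have ex: "(\<Sum>s\<in>?I. ?b s * iexp (- (x \<bullet> lattice_pt (h1, h2) (d1, d2) s))) = complex_of_real (?F r x)" for x
    proof -
      let ?t1 = "2 * pi * (real_of_int (fst r) - fst x / h1) / real d1" and ?t2 = "2 * pi * (real_of_int (snd r) - snd x / h2) / real d2"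
      have "?b s * iexp (- (x \<bullet> lattice_pt (h1, h2) (d1, d2) s))
         = (complex_of_real (tri N (fst s)) * iexp (real_of_int (fst s) * ?t1)) * (complex_of_real (tri N (snd s)) * iexp (real_of_int (snd s) * ?t2))" for s
      proof -
        have "freq (d1, d2) s \<bullet> rvec r + - (x \<bullet> lattice_pt (h1, h2) (d1, d2) s) = real_of_int (fst s) * ?t1 + real_of_int (snd s) * ?t2"
          using h d by (simp add: freq_def rvec_def lattice_pt_def inner_prod_def field_simps)
        then have "iexp (freq (d1, d2) s \<bullet> rvec r) * iexp (- (x \<bullet> lattice_pt (h1, h2) (d1, d2) s))
           = iexp (real_of_int (fst s) * ?t1) * iexp (real_of_int (snd s) * ?t2)"
          unfolding exp_add[symmetric] distrib_left[symmetric] of_real_add[symmetric] by (simp only:)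
        then show ?thesis by (simp only: of_real_mult mult_ac)
      qed
      then show ?thesis
        by (simp only: of_real_mult fejer_iexp(1)[OF N, symmetric] sum_product sum.cartesian_product case_prod_beta')
    qed
    have "cmod (\<Sum>s\<in>?I. ?b s * complex_of_real (K (lattice_pt (h1, h2) (d1, d2) s)))
       \<le> 1 / (4 * pi\<^sup>2) * (LINT x|lborel. cmod (kernel_ft K x) * cmod (\<Sum>s\<in>?I. ?b s * iexp (- (x \<bullet> lattice_pt (h1, h2) (d1, d2) s))))"
      by (rule kernel_combination_bound[OF c nn K ki]) simp
    also have "\<dots> = 1 / (4 * pi\<^sup>2) * (LINT x|lborel. cmod (kernel_ft K x) * ?F r x)"
      unfolding ex norm_of_real using Fnn by simp
    also have "\<dots> \<le> 1 / (4 * pi\<^sup>2) * (LINT x|lborel. kt x * ?F r x)"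
    proof (intro mult_left_mono integral_mono)
      show "integrable lborel (\<lambda>x. cmod (kernel_ft K x) * ?F r x)"
        by (rule Bochner_Integration.integrable_bound[OF Fi[of r]])
          (use Fnn k kt_nonneg in \<open>auto simp: abs_mult intro!: mult_right_mono\<close>)
      show "integrable lborel (\<lambda>x. kt x * ?F r x)" by (rule Fi)
      show "cmod (kernel_ft K x) * ?F r x \<le> kt x * ?F r x" for x
        by (intro mult_right_mono k Fnn)
    qed simp
    finally show ?thesis by (simp only: mult.assoc)
  qed
  have "(\<Sum>r\<in>?R. cmod (\<Sum>s\<in>?I. complex_of_real (tri N (fst s) * tri N (snd s)) *
        (iexp (freq (d1, d2) s \<bullet> rvec r) * complex_of_real (K (lattice_pt (h1, h2) (d1, d2) s)))))
     \<le> (\<Sum>r\<in>?R. 1 / (4 * pi\<^sup>2) * (LINT x|lborel. kt x * ?F r x))"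
    by (rule sum_mono) (rule one)
  also have "\<dots> = 1 / (4 * pi\<^sup>2) * (LINT x|lborel. (\<Sum>r\<in>?R. kt x * ?F r x))"
    by (subst Bochner_Integration.integral_sum) (use Fi in \<open>auto simp only: sum_distrib_left\<close>)
  also have "(\<lambda>x. \<Sum>r\<in>?R. kt x * ?F r x) = (\<lambda>x. kt x * (fejer_lag_sum N d1 h1 (fst x) * fejer_lag_sum N d2 h2 (snd x)))"
    by (simp only: fejer_lag_sum_def sum_product sum.cartesian_product case_prod_beta') (simp only: sum_distrib_left)
  also have "1 / (4 * pi\<^sup>2) * (LINT x|lborel. kt x * (fejer_lag_sum N d1 h1 (fst x) * fejer_lag_sum N d2 h2 (snd x)))
    \<le> 1 / (4 * pi\<^sup>2) * (16 * real d1 * real d2 * ((real A)\<^sup>2 * kt 0 * (h1 * h2) + (LINT x|lborel. kt x)))"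
  proof (rule mult_left_mono)
    let ?g = "\<lambda>x. kt x * (fejer_lag_sum N d1 h1 (fst x) * fejer_lag_sum N d2 h2 (snd x))"
    have nnb: "0 \<le> 16 * real d1 * real d2 * ((real A)\<^sup>2 * kt 0 * (h1 * h2) + (LINT x|lborel. kt x))"
      using h by (intro mult_nonneg_nonneg add_nonneg_nonneg integral_nonneg) (auto simp: kt_nonneg)
    show "(LINT x|lborel. ?g x) \<le> 16 * real d1 * real d2 * ((real A)\<^sup>2 * kt 0 * (h1 * h2) + (LINT x|lborel. kt x))"
    proof (rule integral_real_bounded[OF nnb])
      have "(\<integral>\<^sup>+x. ennreal (?g x) \<partial>lborel) = (\<integral>\<^sup>+x. ennreal (kt x) * ennreal (fejer_lag_sum N d1 h1 (fst x) * fejer_lag_sum N d2 h2 (snd x)) \<partial>lborel)"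
        by (intro nn_integral_cong ennreal_mult kt_nonneg mult_nonneg_nonneg fejer_lag_sum_nonneg N)
      then show "(\<integral>\<^sup>+x. ennreal (?g x) \<partial>lborel) \<le> ennreal (16 * real d1 * real d2 * ((real A)\<^sup>2 * kt 0 * (h1 * h2) + (LINT x|lborel. kt x)))"
        using nn_integral_kt_fejer_lag_sum[OF h A N d] by simp
    qed
  qed simp
  also have "\<dots> = 4 / pi\<^sup>2 * (real d1 * real d2 * ((real A)\<^sup>2 * kt 0 * (h1 * h2) + (LINT x|lborel. kt x)))"
    by simp
  finally show ?thesis .
qed

text \<open>
  The limit \<open>N \<longlonglongrightarrow> \<infinity>\<close> of the previous bound.
\<close>

lemma kernel_lag_sum_bound:
  assumes c: "continuous_on UNIV K" and nn: "\<And>x. K x \<ge> 0" and K: "integrable lborel K"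
    and k: "\<And>x. cmod (kernel_ft K x) \<le> kt x"
    and h: "h1 > 0" "h2 > 0" and A: "max h1 h2 \<le> real A * h1" "max h1 h2 \<le> real A * h2"
    and d: "d1 > 0" "d2 > 0"
    and S: "(\<lambda>s. K (lattice_pt (h1, h2) (d1, d2) s)) summable_on UNIV"
  shows "(\<Sum>r\<in>{1 - int d1..int d1} \<times> {1 - int d2..int d2}.
      cmod (\<Sum>\<^sub>\<infinity>s. iexp (freq (d1, d2) s \<bullet> rvec r) * complex_of_real (K (lattice_pt (h1, h2) (d1, d2) s))))
    \<le> 4 / pi\<^sup>2 * (real d1 * real d2 * ((real A)\<^sup>2 * kt 0 * (h1 * h2) + (LINT x|lborel. kt x)))"
proof -
  let ?f = "\<lambda>r s. iexp (freq (d1, d2) s \<bullet> rvec r) * complex_of_real (K (lattice_pt (h1, h2) (d1, d2) s))"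
  let ?t = "\<lambda>N s. complex_of_real (tri N (fst s) * tri N (snd s))"
  have lim: "(\<lambda>N. \<Sum>s\<in>{- int N..int N} \<times> {- int N..int N}. ?t N s * ?f r s) \<longlonglongrightarrow> (\<Sum>\<^sub>\<infinity>s. ?f r s)" for r
  proof -
    have n1: "cmod (?f r s) = K (lattice_pt (h1, h2) (d1, d2) s)" for s
      by (simp add: norm_mult nn)
    have tb: "\<bar>tri N (fst s) * tri N (snd s)\<bar> \<le> 1" for N s
      using mult_mono[OF tri_bounds(2)[of N "fst s"] tri_bounds(2)[of N "snd s"]] by (simp add: tri_bounds abs_mult)
    show ?thesis
    proof (rule tannery_infsum)
      show "(\<lambda>s. cmod (?f r s)) summable_on UNIV" unfolding n1 by (rule S)
      show "(\<lambda>N. tri N (fst s) * tri N (snd s)) \<longlonglongrightarrow> 1" for s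
        using tendsto_mult[OF tri_tendsto[of "fst s"] tri_tendsto[of "snd s"]] by simp
      show "tri N (fst s) * tri N (snd s) = 0" if "N > 0" "s \<notin> {- int N..int N} \<times> {- int N..int N}" for N s
        using that tri_off[OF that(1), of "fst s"] tri_off[OF that(1), of "snd s"] by (cases s) auto
    qed (use tb in auto)
  qed
  show ?thesis
  proof (rule LIMSEQ_le_const2)
    show "(\<lambda>N. \<Sum>r\<in>{1 - int d1..int d1} \<times> {1 - int d2..int d2}. cmod (\<Sum>s\<in>{- int N..int N} \<times> {- int N..int N}. ?t N s * ?f r s))
       \<longlonglongrightarrow> (\<Sum>r\<in>{1 - int d1..int d1} \<times> {1 - int d2..int d2}. cmod (\<Sum>\<^sub>\<infinity>s. ?f r s))"
      by (intro tendsto_sum tendsto_norm lim)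
    show "\<exists>N. \<forall>n\<ge>N. (\<Sum>r\<in>{1 - int d1..int d1} \<times> {1 - int d2..int d2}. cmod (\<Sum>s\<in>{- int n..int n} \<times> {- int n..int n}. ?t n s * ?f r s))
       \<le> 4 / pi\<^sup>2 * (real d1 * real d2 * ((real A)\<^sup>2 * kt 0 * (h1 * h2) + (LINT x|lborel. kt x)))"
      by (rule exI[of _ 1]) (use kernel_fejer_sum_bound[OF c nn K k h A _ d] in auto)
  qed
qed

end

section \<open>Periodograms on a rectangular grid\<close>

text \<open>
  The periodogram with its value at multiples of the grid size retained: unlike \<open>pgram\<close> it is a quadratic form and
  satisfies Parseval's identity.
\<close>

definition pgram0 :: "nat \<times> nat \<Rightarrow> (int \<times> int \<Rightarrow> real) \<Rightarrow> int \<times> int \<Rightarrow> real" where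
  "pgram0 d W j = (xcoef d W j)\<^sup>2 + (ycoef d W j)\<^sup>2"

lemma iexp_2pi_int: "iexp (2 * pi * real_of_int n) = 1"
  by (simp only: complex_eq_iff) (simp add: Re_exp Im_exp cos_int_2pin sin_int_2pin)

lemma sum_iexp_full_period:
  fixes d :: nat and m :: int
  assumes d: "d > 0"
  shows "(\<Sum>t\<in>{1..int d}. iexp (2 * pi * real_of_int m / real d * real_of_int t)) = (if int d dvd m then of_nat d else 0)"
proof -
  define z where "z = iexp (2 * pi * real_of_int m / real d)"
  have zp: "iexp (2 * pi * real_of_int m / real d * real_of_int t) = z ^ nat t" if "t \<ge> 0" for t
  proof -
    have "z ^ nat t = exp (of_nat (nat t) * (\<i> * complex_of_real (2 * pi * real_of_int m / real d)))"
      unfolding z_def by (rule exp_of_nat_mult[symmetric])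
    also have "of_nat (nat t) * (\<i> * complex_of_real (2 * pi * real_of_int m / real d)) = \<i> * complex_of_real (2 * pi * real_of_int m / real d * real_of_int t)"
      using that by (simp add: mult_ac of_nat_nat)
    finally show ?thesis by simp
  qed
  have Suc: "Suc (nat (t - 1)) = nat t" if "1 \<le> t" for t :: int using that by simp
  have "(\<Sum>t\<in>{1..int d}. iexp (2 * pi * real_of_int m / real d * real_of_int t)) = (\<Sum>t\<in>{1..int d}. z ^ nat t)"
    by (rule sum.cong[OF refl], rule zp) simp
  also have "(\<Sum>t\<in>{1..int d}. z ^ nat t) = (\<Sum>k<d. z ^ Suc k)"
    by (rule sum.reindex_bij_witness[where i="\<lambda>k. int k + 1" and j="\<lambda>t. nat (t - 1)"]) (auto simp: Suc simp del: power_Suc)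
  also have "\<dots> = z * (\<Sum>k<d. z ^ k)" by (simp add: sum_distrib_left)
  finally have S: "(\<Sum>t\<in>{1..int d}. iexp (2 * pi * real_of_int m / real d * real_of_int t)) = z * (\<Sum>k<d. z ^ k)" .
  have zd: "z ^ d = 1"
  proof -
    have "z ^ d = iexp (2 * pi * real_of_int m)"
      using zp[of "int d"] d by (simp add: field_simps)
    also have "\<dots> = 1" by (rule iexp_2pi_int)
    finally show ?thesis .
  qed
  have z1: "z = 1 \<longleftrightarrow> int d dvd m"
  proof
    assume "z = 1"
    then obtain n :: int where n: "2 * pi * real_of_int m / real d = real_of_int (2 * n) * pi"
      unfolding z_def exp_eq_1 by auto
    then have "real_of_int m = real_of_int (n * int d)" using d by (simp add: field_simps)
    then show "int d dvd m" by (metis dvd_triv_right of_int_eq_iff)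
  next
    assume "int d dvd m"
    then obtain n where "m = int d * n" by (auto elim: dvdE)
    then have "2 * pi * real_of_int m / real d = 2 * pi * real_of_int n" using d by simp
    then show "z = 1" unfolding z_def by (simp only: iexp_2pi_int)
  qed
  show ?thesis
  proof (cases "z = 1")
    case True
    then show ?thesis unfolding S using z1 by simp
  next
    case False
    then have "(\<Sum>k<d. z ^ k) = 0" using sum_gp_strict[of z d] zd by simp
    then show ?thesis unfolding S using z1 False by simp
  qed
qed

lemma freq_inner: "freq d j \<bullet> rvec t = 2 * pi * real_of_int (fst j) / real (fst d) * real_of_int (fst t)
    + 2 * pi * real_of_int (snd j) / real (snd d) * real_of_int (snd t)"
  by (simp add: freq_def rvec_def inner_prod_def)

lemma freq_inner_commute: "freq d j \<bullet> rvec t = freq d t \<bullet> rvec j"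
  by (simp add: freq_inner mult_ac)

lemma freq_inner_diff: "freq d (i - j) \<bullet> rvec t = freq d i \<bullet> rvec t - freq d j \<bullet> rvec t"
  by (simp add: freq_inner diff_divide_distrib algebra_simps)

lemma freq_inner_add: "freq d (i + j) \<bullet> rvec t = freq d i \<bullet> rvec t + freq d j \<bullet> rvec t"
  by (simp add: freq_inner add_divide_distrib algebra_simps)

lemma grid_iexp_sum:
  assumes d: "fst d > 0" "snd d > 0"
  shows "(\<Sum>t\<in>grid d. iexp (freq d j \<bullet> rvec t))
    = (if int (fst d) dvd fst j \<and> int (snd d) dvd snd j then of_real (gsize d) else 0)"
proof -
  have "(\<Sum>t\<in>grid d. iexp (freq d j \<bullet> rvec t))
     = (\<Sum>t\<in>{1..int (fst d)}. iexp (2 * pi * real_of_int (fst j) / real (fst d) * real_of_int t))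
      * (\<Sum>t\<in>{1..int (snd d)}. iexp (2 * pi * real_of_int (snd j) / real (snd d) * real_of_int t))"
    unfolding grid_def sum_product sum.cartesian_product
    by (intro sum.cong refl) (auto simp: freq_inner exp_add distrib_left)
  then show ?thesis
    unfolding sum_iexp_full_period[OF d(1)] sum_iexp_full_period[OF d(2)] by (simp add: gsize_def)
qed

lemma finite_grid [simp]: "finite (grid d)" by (simp add: grid_def)

text \<open>
  Orthogonality of the exponentials \<open>grid_iexp_sum\<close>.
\<close>

lemma grid_parseval:
  fixes c :: "int \<times> int \<Rightarrow> complex"
  assumes d: "fst d > 0" "snd d > 0"
  shows "(\<Sum>t\<in>grid d. (cmod (\<Sum>r\<in>grid d. c r * iexp (freq d r \<bullet> rvec t)))\<^sup>2) = gsize d * (\<Sum>r\<in>grid d. (cmod (c r))\<^sup>2)"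
proof -
  have orth: "(\<Sum>t\<in>grid d. iexp (freq d (r - r') \<bullet> rvec t)) = (if r = r' then of_real (gsize d) else 0)"
    if "r \<in> grid d" "r' \<in> grid d" for r r'
  proof -
    have "int D dvd x - y \<longleftrightarrow> x = y" if "x \<in> {1..int D}" "y \<in> {1..int D}" for D and x y :: int
    proof
      assume "int D dvd x - y"
      moreover have "\<bar>x - y\<bar> < int D" using that by auto
      ultimately show "x = y" using zdvd_imp_le[of "int D" "\<bar>x - y\<bar>"] by fastforce
    qed simp
    with that have "int (fst d) dvd fst (r - r') \<and> int (snd d) dvd snd (r - r') \<longleftrightarrow> r = r'"
      by (auto simp: grid_def prod_eq_iff)
    then show ?thesis unfolding grid_iexp_sum[OF d] by simp
  qed
  have "complex_of_real (\<Sum>t\<in>grid d. (cmod (\<Sum>r\<in>grid d. c r * iexp (freq d r \<bullet> rvec t)))\<^sup>2)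
     = (\<Sum>t\<in>grid d. \<Sum>r\<in>grid d. \<Sum>r'\<in>grid d. c r * cnj (c r') * iexp (freq d (r - r') \<bullet> rvec t))"
    unfolding of_real_sum complex_norm_square cnj_sum sum_product
  proof (intro sum.cong refl)
    fix t r r'
    have "iexp (freq d (r - r') \<bullet> rvec t) = iexp (freq d r \<bullet> rvec t) * cnj (iexp (freq d r' \<bullet> rvec t))"
      unfolding freq_inner_diff by (simp add: exp_cnj right_diff_distrib exp_diff exp_minus field_simps)
    then show "c r * iexp (freq d r \<bullet> rvec t) * cnj (c r' * iexp (freq d r' \<bullet> rvec t)) = c r * cnj (c r') * iexp (freq d (r - r') \<bullet> rvec t)"
      by (simp add: mult_ac)
  qed
  also have "\<dots> = (\<Sum>r\<in>grid d. \<Sum>t\<in>grid d. \<Sum>r'\<in>grid d. c r * cnj (c r') * iexp (freq d (r - r') \<bullet> rvec t))"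
    by (rule sum.swap)
  also have "\<dots> = (\<Sum>r\<in>grid d. \<Sum>r'\<in>grid d. \<Sum>t\<in>grid d. c r * cnj (c r') * iexp (freq d (r - r') \<bullet> rvec t))"
    by (intro sum.cong refl sum.swap)
  also have "\<dots> = (\<Sum>r\<in>grid d. \<Sum>r'\<in>grid d. c r * cnj (c r') * (if r = r' then of_real (gsize d) else 0))"
    unfolding sum_distrib_left[symmetric] by (intro sum.cong refl arg_cong2[where f="(*)"] orth)
  also have "\<dots> = (\<Sum>r\<in>grid d. c r * cnj (c r) * of_real (gsize d))"
    by (intro sum.cong refl) (simp add: sum.delta' if_distrib cong: if_cong)
  also have "\<dots> = complex_of_real (gsize d * (\<Sum>r\<in>grid d. (cmod (c r))\<^sup>2))"
    by (simp only: sum_distrib_left of_real_sum of_real_mult complex_norm_square mult_ac)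
  finally show ?thesis by (simp only: of_real_eq_iff)
qed

lemma coef_dft: "complex_of_real (xcoef d W j) + \<i> * complex_of_real (ycoef d W j)
    = (1 / complex_of_real (sqrt (gsize d))) * (\<Sum>t\<in>grid d. complex_of_real (W t) * iexp (- (freq d j \<bullet> rvec t)))"
proof -
  have "complex_of_real (W t) * iexp (- (freq d j \<bullet> rvec t)) = complex_of_real (W t * cos (- (freq d j \<bullet> rvec t))) + \<i> * complex_of_real (W t * sin (- (freq d j \<bullet> rvec t)))" for t
    by (simp add: complex_eq_iff Re_exp Im_exp)
  note e = this
  define A where "A = (\<Sum>t\<in>grid d. W t * cos (- (freq d j \<bullet> rvec t)))"
  define B where "B = (\<Sum>t\<in>grid d. W t * sin (- (freq d j \<bullet> rvec t)))"
  have "(\<Sum>t\<in>grid d. complex_of_real (W t) * iexp (- (freq d j \<bullet> rvec t))) = complex_of_real A + \<i> * complex_of_real B"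
    unfolding e sum.distrib A_def B_def of_real_sum sum_distrib_left by (rule refl)
  moreover have "xcoef d W j = 1 / sqrt (gsize d) * A" "ycoef d W j = 1 / sqrt (gsize d) * B"
    by (simp_all only: xcoef_def ycoef_def A_def B_def)
  ultimately show ?thesis by (simp add: distrib_left)
qed

lemma pgram0_cmod:
  "pgram0 d W j = (1 / gsize d) * (cmod (\<Sum>t\<in>grid d. complex_of_real (W t) * iexp (- (freq d j \<bullet> rvec t))))\<^sup>2"
proof -
  have "pgram0 d W j = (cmod (complex_of_real (xcoef d W j) + \<i> * complex_of_real (ycoef d W j)))\<^sup>2"
    by (simp add: pgram0_def cmod_power2)
  also have "\<dots> = (1 / gsize d) * (cmod (\<Sum>t\<in>grid d. complex_of_real (W t) * iexp (- (freq d j \<bullet> rvec t))))\<^sup>2"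
    unfolding coef_dft by (simp add: norm_mult norm_divide power_mult_distrib power_divide gsize_def)
  finally show ?thesis .
qed

lemma pgram0_nonneg [simp]: "pgram0 d W j \<ge> 0" by (simp add: pgram0_def)

lemma pgram_nonneg [simp]: "pgram d W j \<ge> 0" by (simp add: pgram_def)

lemma pgram_le_pgram0: "pgram d W j \<le> pgram0 d W j" by (simp add: pgram_def pgram0_def)

lemma sum_pgram0:
  assumes d: "fst d > 0" "snd d > 0"
  shows "(\<Sum>j\<in>grid d. pgram0 d W j) = (\<Sum>t\<in>grid d. (W t)\<^sup>2)"
proof -
  have g: "gsize d > 0" using d by (simp add: gsize_def)
  have "cmod (\<Sum>t\<in>grid d. complex_of_real (W t) * iexp (- (freq d j \<bullet> rvec t)))
     = cmod (\<Sum>t\<in>grid d. complex_of_real (W t) * iexp (freq d t \<bullet> rvec j))" for j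
  proof -
    have "cnj (\<Sum>t\<in>grid d. complex_of_real (W t) * iexp (- (freq d j \<bullet> rvec t)))
       = (\<Sum>t\<in>grid d. complex_of_real (W t) * iexp (freq d t \<bullet> rvec j))"
      unfolding freq_inner_commute[of d _ j] by (simp add: cnj_sum exp_cnj)
    from arg_cong[OF this, of cmod] show ?thesis by (simp only: complex_mod_cnj)
  qed
  then have "(\<Sum>j\<in>grid d. pgram0 d W j) = 1 / gsize d * (\<Sum>j\<in>grid d. (cmod (\<Sum>t\<in>grid d. complex_of_real (W t) * iexp (freq d t \<bullet> rvec j)))\<^sup>2)"
    unfolding pgram0_cmod sum_distrib_left by simp
  then show ?thesis unfolding grid_parseval[OF d] using g by simp
qed

lemma coef_diff:
  "xcoef d (\<lambda>t. V t - W t) j = xcoef d V j - xcoef d W j" "ycoef d (\<lambda>t. V t - W t) j = ycoef d V j - ycoef d W j"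
  by (simp_all only: xcoef_def ycoef_def sum_subtractf left_diff_distrib right_diff_distrib)

text \<open>
  The reverse triangle inequality in the plane; at multiples of the grid size both ordinates on the left vanish.
\<close>

lemma sqrt_pgram_diff:
  "\<bar>sqrt (pgram d V j) - sqrt (pgram d W j)\<bar> \<le> sqrt (pgram0 d (\<lambda>t. V t - W t) j)"
proof -
  have "\<bar>sqrt (a\<^sup>2 + b\<^sup>2) - sqrt (a'\<^sup>2 + b'\<^sup>2)\<bar> \<le> sqrt ((a - a')\<^sup>2 + (b - b')\<^sup>2)" for a b a' b' :: real
    using norm_triangle_ineq3[of "Complex a b" "Complex a' b'"] by (simp add: complex_norm complex_diff)
  then show ?thesis by (simp add: pgram_def pgram0_def coef_diff)
qed

lemma coef_sum_le: "\<bar>xcoef d W j + ycoef d W j\<bar> \<le> 2 * sqrt (pgram0 d W j)"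
proof -
  have "\<bar>xcoef d W j\<bar> \<le> sqrt (pgram0 d W j)" "\<bar>ycoef d W j\<bar> \<le> sqrt (pgram0 d W j)"
    unfolding pgram0_def by (auto intro: real_le_rsqrt)
  then show ?thesis by linarith
qed

lemma iexp_freq_shift:
  assumes "fst d > 0" "snd d > 0"
  shows "iexp (- (freq d (j + (a * int (fst d), b * int (snd d))) \<bullet> rvec t)) = iexp (- (freq d j \<bullet> rvec t))"
proof -
  have "- (freq d (j + (a * int (fst d), b * int (snd d))) \<bullet> rvec t) = - (freq d j \<bullet> rvec t) + 2 * pi * real_of_int (- (a * fst t + b * snd t))"
    using assms by (simp add: freq_inner field_simps)
  then have "iexp (- (freq d (j + (a * int (fst d), b * int (snd d))) \<bullet> rvec t)) = iexp (- (freq d j \<bullet> rvec t)) * iexp (2 * pi * real_of_int (- (a * fst t + b * snd t)))"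
    by (simp only: of_real_add distrib_left exp_add)
  also have "iexp (2 * pi * real_of_int (- (a * fst t + b * snd t))) = 1"
    by (rule iexp_2pi_int)
  finally show ?thesis by simp
qed

definition grid_periodic :: "nat \<times> nat \<Rightarrow> (int \<times> int \<Rightarrow> 'b) \<Rightarrow> bool" where
  "grid_periodic d F \<longleftrightarrow> (\<forall>j a b. F (j + (a * int (fst d), b * int (snd d))) = F j)"

lemma coef_periodic:
  assumes "fst d > 0" "snd d > 0"
  shows "grid_periodic d (xcoef d W)" "grid_periodic d (ycoef d W)"
proof -
  have "cos (- (freq d (j + (a * int (fst d), b * int (snd d))) \<bullet> rvec t)) = cos (- (freq d j \<bullet> rvec t))"
    "sin (- (freq d (j + (a * int (fst d), b * int (snd d))) \<bullet> rvec t)) = sin (- (freq d j \<bullet> rvec t))" for j a b t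
    using arg_cong[OF iexp_freq_shift[OF assms, of j a b t], of Re] arg_cong[OF iexp_freq_shift[OF assms, of j a b t], of Im]
    by (simp_all add: Re_exp Im_exp)
  then show "grid_periodic d (xcoef d W)" "grid_periodic d (ycoef d W)"
    by (simp_all add: grid_periodic_def xcoef_def ycoef_def)
qed

lemma pgram_periodic:
  assumes "fst d > 0" "snd d > 0"
  shows "grid_periodic d (pgram0 d W)" "grid_periodic d (pgram d W)"
proof -
  note c = coef_periodic[OF assms, of W, unfolded grid_periodic_def, rule_format]
  show "grid_periodic d (pgram0 d W)" by (simp add: grid_periodic_def pgram0_def c)
  have "(\<exists>c1 c2. j + (a * int (fst d), b * int (snd d)) = (c1 * int (fst d), c2 * int (snd d))) \<longleftrightarrow> (\<exists>c1 c2. j = (c1 * int (fst d), c2 * int (snd d)))" for j a b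
  proof safe
    fix c1 c2 assume "j + (a * int (fst d), b * int (snd d)) = (c1 * int (fst d), c2 * int (snd d))"
    then have "j = ((c1 - a) * int (fst d), (c2 - b) * int (snd d))" by (cases j) (auto simp: algebra_simps)
    then show "\<exists>c1 c2. j = (c1 * int (fst d), c2 * int (snd d))" by blast
  next
    fix c1 c2
    show "\<exists>c1' c2'. (c1 * int (fst d), c2 * int (snd d)) + (a * int (fst d), b * int (snd d)) = (c1' * int (fst d), c2' * int (snd d))"
      by (rule exI[of _ "c1 + a"], rule exI[of _ "c2 + b"]) (simp add: algebra_simps)
  qed
  then show "grid_periodic d (pgram d W)" unfolding grid_periodic_def pgram_def c by (simp only:) simp
qed

text \<open>
  A constant contributes only at multiples of the grid size, where \<open>pgram\<close> is zero by definition.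
\<close>

lemma pgram_le_centered:
  assumes "fst d > 0" "snd d > 0"
  shows "pgram d W j \<le> pgram0 d (\<lambda>t. W t - \<mu>) j"
proof (cases "\<exists>c1 c2. j = (c1 * int (fst d), c2 * int (snd d))")
  case True
  then show ?thesis by (simp add: pgram_def)
next
  case False
  have "\<not> (int (fst d) dvd fst j \<and> int (snd d) dvd snd j)"
  proof
    assume "int (fst d) dvd fst j \<and> int (snd d) dvd snd j"
    then obtain a b where "fst j = int (fst d) * a" "snd j = int (snd d) * b" by (auto elim!: dvdE)
    then have "j = (a * int (fst d), b * int (snd d))" by (simp add: prod_eq_iff)
    with False show False by blast
  qed
  then have "(\<Sum>t\<in>grid d. iexp (freq d j \<bullet> rvec t)) = 0" unfolding grid_iexp_sum[OF assms] by auto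
  then have "cnj (\<Sum>t\<in>grid d. iexp (freq d j \<bullet> rvec t)) = 0" by simp
  then have z: "(\<Sum>t\<in>grid d. iexp (- (freq d j \<bullet> rvec t))) = 0" by (simp add: cnj_sum exp_cnj)
  have "(\<Sum>t\<in>grid d. complex_of_real (W t - \<mu>) * iexp (- (freq d j \<bullet> rvec t)))
      = (\<Sum>t\<in>grid d. complex_of_real (W t) * iexp (- (freq d j \<bullet> rvec t))) - complex_of_real \<mu> * (\<Sum>t\<in>grid d. iexp (- (freq d j \<bullet> rvec t)))"
    by (simp add: left_diff_distrib sum_subtractf sum_distrib_left)
  then have "pgram0 d (\<lambda>t. W t - \<mu>) j = pgram0 d W j" unfolding pgram0_cmod z by simp
  then show ?thesis using pgram_le_pgram0 by simp
qed

lemma pgram0_quadratic: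
  "pgram0 d W j = (\<Sum>t\<in>grid d. \<Sum>u\<in>grid d. (1 / gsize d) * cos (freq d j \<bullet> rvec (u - t)) * (W t * W u))"
proof -
  have rv: "rvec (u - t) = rvec u - rvec t" for u t by (simp add: rvec_def)
  have g: "(1 / sqrt (gsize d) * a)\<^sup>2 = (1 / gsize d) * (a * a)" for a
    by (simp add: power_mult_distrib power_divide gsize_def power2_eq_square)
  have "pgram0 d W j = (\<Sum>t\<in>grid d. \<Sum>u\<in>grid d. (1 / gsize d) * (W t * cos (- (freq d j \<bullet> rvec t)) * (W u * cos (- (freq d j \<bullet> rvec u)))
      + W t * sin (- (freq d j \<bullet> rvec t)) * (W u * sin (- (freq d j \<bullet> rvec u)))))"
    unfolding pgram0_def xcoef_def ycoef_def g sum_product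
    by (simp add: sum_distrib_left sum.distrib distrib_left)
  also have "\<dots> = (\<Sum>t\<in>grid d. \<Sum>u\<in>grid d. (1 / gsize d) * cos (freq d j \<bullet> rvec (u - t)) * (W t * W u))"
    by (intro sum.cong refl) (simp add: rv inner_diff_right cos_diff field_simps)
  finally show ?thesis .
qed

text \<open>
  The double sum over pairs of sites, collected by their difference.
\<close>

lemma pgram0_lag_sum:
  "pgram0 d W j = (\<Sum>r\<in>{1 - int (fst d)..int (fst d)} \<times> {1 - int (snd d)..int (snd d)}. sample_acov d 0 W r * cos (freq d j \<bullet> rvec r))"
proof -
  let ?L = "{1 - int (fst d)..int (fst d)} \<times> {1 - int (snd d)..int (snd d)}"
  let ?G = "\<lambda>r. {t. t \<in> grid d \<and> t + r \<in> grid d}"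
  have fin: "finite (?G r)" for r by (rule finite_subset[OF _ finite_grid[of d]]) auto
  have "pgram0 d W j = (\<Sum>(t, u)\<in>grid d \<times> grid d. (1 / gsize d) * cos (freq d j \<bullet> rvec (u - t)) * (W t * W u))"
    unfolding pgram0_quadratic by (rule sum.cartesian_product)
  also have "\<dots> = (\<Sum>(r, t)\<in>Sigma ?L ?G. (1 / gsize d) * cos (freq d j \<bullet> rvec r) * (W t * W (t + r)))"
    by (rule sum.reindex_bij_witness[where i="\<lambda>(r, t). (t, t + r)" and j="\<lambda>(t, u). (u - t, t)"]) (auto simp: grid_def)
  also have "\<dots> = (\<Sum>r\<in>?L. \<Sum>t\<in>?G r. (1 / gsize d) * cos (freq d j \<bullet> rvec r) * (W t * W (t + r)))"
    by (rule sum.Sigma[symmetric]) (use fin in auto)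
  also have "\<dots> = (\<Sum>r\<in>?L. sample_acov d 0 W r * cos (freq d j \<bullet> rvec r))"
    unfolding sample_acov_def by (simp add: sum_distrib_left sum_distrib_right mult_ac)
  finally show ?thesis .
qed

section \<open>Boundedness and convergence in probability, and perturbation of powers\<close>

definition with_high_prob :: "'w measure \<Rightarrow> (nat \<Rightarrow> 'w \<Rightarrow> bool) \<Rightarrow> bool" where
  "with_high_prob M P \<longleftrightarrow> (\<forall>\<epsilon>>0. \<forall>\<^sub>F n in sequentially.
     \<exists>B\<in>sets M. measure M B < \<epsilon> \<and> (\<forall>\<omega>\<in>space M - B. P n \<omega>))"

text \<open>
  Only upper bounds are recorded, through exceptional sets; this form does not ask the
  dominating variables to be measurable.
\<close>

definition prob_bounded :: "'w measure \<Rightarrow> (nat \<Rightarrow> 'w \<Rightarrow> real) \<Rightarrow> bool" where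
  "prob_bounded M A \<longleftrightarrow> (\<forall>\<epsilon>>0. \<exists>C. \<forall>\<^sub>F n in sequentially.
     \<exists>B\<in>sets M. measure M B < \<epsilon> \<and> (\<forall>\<omega>\<in>space M - B. A n \<omega> \<le> C))"

definition prob_vanishing :: "'w measure \<Rightarrow> (nat \<Rightarrow> 'w \<Rightarrow> real) \<Rightarrow> bool" where
  "prob_vanishing M X \<longleftrightarrow> (\<forall>\<delta>>0. with_high_prob M (\<lambda>n \<omega>. X n \<omega> \<le> \<delta>))"

text \<open>
  Multiplication by \<open>c\<close> undoes a rate \<open>a\<close>.
\<close>

lemma (in prob_space) small_op_imp_vanishing:
  assumes "small_op M a X" "\<And>n. c n \<ge> 0" "\<forall>\<^sub>F n in sequentially. c n * \<bar>a n\<bar> \<le> L"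
  shows "prob_vanishing M (\<lambda>n \<omega>. c n * \<bar>X n \<omega>\<bar>)"
  unfolding prob_vanishing_def with_high_prob_def
proof (intro allI impI)
  fix \<delta> \<epsilon> :: real assume e: "\<delta> > 0" "\<epsilon> > 0"
  define \<eta> where "\<eta> = \<delta> / (\<bar>L\<bar> + 1)"
  have \<eta>: "\<eta> > 0" using e by (simp add: \<eta>_def)
  have [measurable]: "X n \<in> borel_measurable M" for n using assms by (simp add: small_op_def)
  let ?B = "\<lambda>n. {\<omega> \<in> space M. \<bar>X n \<omega>\<bar> > \<eta> * \<bar>a n\<bar>}"
  have "(\<lambda>n. measure M (?B n)) \<longlonglongrightarrow> 0" using assms \<eta> by (auto simp: small_op_def)
  then have "\<forall>\<^sub>F n in sequentially. measure M (?B n) < \<epsilon>" using e by (auto intro: order_tendstoD(2))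
  with assms(3) show "\<forall>\<^sub>F n in sequentially. \<exists>B\<in>sets M. measure M B < \<epsilon> \<and> (\<forall>\<omega>\<in>space M - B. c n * \<bar>X n \<omega>\<bar> \<le> \<delta>)"
  proof eventually_elim
    case (elim n)
    have "c n * \<bar>X n \<omega>\<bar> \<le> \<delta>" if "\<omega> \<in> space M - ?B n" for \<omega>
    proof -
      have "c n * \<bar>X n \<omega>\<bar> \<le> c n * (\<eta> * \<bar>a n\<bar>)" using that assms(2) by (intro mult_left_mono) auto
      also have "\<dots> = \<eta> * (c n * \<bar>a n\<bar>)" by simp
      also have "\<dots> \<le> \<eta> * (\<bar>L\<bar> + 1)" using elim \<eta> by (intro mult_left_mono) auto
      also have "\<dots> = \<delta>" by (simp add: \<eta>_def)
      finally show ?thesis .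
    qed
    then show ?case using elim by (intro bexI[of _ "?B n"]) auto
  qed
qed

lemma (in prob_space) prob_vanishing_imp_small_op:
  assumes "\<And>n. X n \<in> borel_measurable M" "prob_vanishing M (\<lambda>n \<omega>. \<bar>X n \<omega>\<bar>)"
  shows "small_op M (\<lambda>_. 1) X"
  unfolding small_op_def
proof (intro conjI allI impI assms(1))
  fix \<epsilon> :: real assume e: "\<epsilon> > 0"
  have [measurable]: "X n \<in> borel_measurable M" for n by (rule assms)
  show "(\<lambda>n. measure M {\<omega> \<in> space M. \<bar>X n \<omega>\<bar> > \<epsilon> * \<bar>1\<bar>}) \<longlonglongrightarrow> 0"
  proof (rule order_tendstoI)
    fix \<delta> :: real assume "0 < \<delta>"
    with assms(2) e have "\<forall>\<^sub>F n in sequentially. \<exists>B\<in>sets M. measure M B < \<delta> \<and> (\<forall>\<omega>\<in>space M - B. \<bar>X n \<omega>\<bar> \<le> \<epsilon>)"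
      by (auto simp: prob_vanishing_def with_high_prob_def)
    then show "\<forall>\<^sub>F n in sequentially. measure M {\<omega> \<in> space M. \<bar>X n \<omega>\<bar> > \<epsilon> * \<bar>1\<bar>} < \<delta>"
    proof eventually_elim
      case (elim n)
      then obtain B where B: "B \<in> sets M" "measure M B < \<delta>" "\<forall>\<omega>\<in>space M - B. \<bar>X n \<omega>\<bar> \<le> \<epsilon>" by auto
      have "measure M {\<omega> \<in> space M. \<bar>X n \<omega>\<bar> > \<epsilon> * \<bar>1\<bar>} \<le> measure M B"
        using B by (intro finite_measure_mono) (auto simp: not_less[symmetric])
      then show ?case using B by simp
    qed
  qed (auto intro!: always_eventually less_le_trans[OF _ measure_nonneg])
qed

text \<open>
  First \<open>\<eta>\<close> is chosen small in terms of a bound for \<open>A\<close> valid with high probability, then \<open>n\<close> large in terms of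
  \<open>\<eta>\<close>.
\<close>

lemma (in prob_space) prob_vanishing_sandwich:
  assumes A: "prob_bounded M A" and B: "\<And>\<eta>. \<eta> > 0 \<Longrightarrow> prob_vanishing M (B \<eta>)"
    and le: "\<And>\<eta>. \<eta> > 0 \<Longrightarrow> \<forall>\<^sub>F n in sequentially. \<forall>\<omega>\<in>space M. X n \<omega> \<le> \<eta> * A n \<omega> + B \<eta> n \<omega>"
  shows "prob_vanishing M X"
  unfolding prob_vanishing_def with_high_prob_def
proof (intro allI impI)
  fix \<delta> \<epsilon> :: real assume e: "\<delta> > 0" "\<epsilon> > 0"
  obtain C where C: "\<forall>\<^sub>F n in sequentially. \<exists>S\<in>sets M. measure M S < \<epsilon>/2 \<and> (\<forall>\<omega>\<in>space M - S. A n \<omega> \<le> C)"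
    using A e unfolding prob_bounded_def by (meson half_gt_zero)
  define \<eta> where "\<eta> = \<delta> / (2 * (\<bar>C\<bar> + 1))"
  have \<eta>: "\<eta> > 0" using e by (simp add: \<eta>_def)
  have "\<forall>\<^sub>F n in sequentially. \<exists>S\<in>sets M. measure M S < \<epsilon>/2 \<and> (\<forall>\<omega>\<in>space M - S. B \<eta> n \<omega> \<le> \<delta>/2)"
    using B[OF \<eta>] e unfolding prob_vanishing_def with_high_prob_def by (meson half_gt_zero)
  with C le[OF \<eta>] show "\<forall>\<^sub>F n in sequentially. \<exists>S\<in>sets M. measure M S < \<epsilon> \<and> (\<forall>\<omega>\<in>space M - S. X n \<omega> \<le> \<delta>)"
  proof eventually_elim
    case (elim n)
    then obtain S S' where S: "S \<in> sets M" "measure M S < \<epsilon>/2" "\<forall>\<omega>\<in>space M - S. A n \<omega> \<le> C"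
      "S' \<in> sets M" "measure M S' < \<epsilon>/2" "\<forall>\<omega>\<in>space M - S'. B \<eta> n \<omega> \<le> \<delta>/2" by blast
    have "X n \<omega> \<le> \<delta>" if "\<omega> \<in> space M - (S \<union> S')" for \<omega>
    proof -
      have "X n \<omega> \<le> \<eta> * A n \<omega> + B \<eta> n \<omega>" using elim that by auto
      also have "\<dots> \<le> \<eta> * (\<bar>C\<bar> + 1) + \<delta>/2"
        using S that \<eta> by (intro add_mono mult_left_mono) force+
      also have "\<eta> * (\<bar>C\<bar> + 1) = \<delta>/2" by (simp add: \<eta>_def field_simps)
      finally show ?thesis by simp
    qed
    moreover have "measure M (S \<union> S') < \<epsilon>"
      using measure_subadditive[of S M S'] S by simp
    ultimately show ?case using S by (intro bexI[of _ "S \<union> S'"]) auto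
  qed
qed

lemma prob_vanishing_cmult_powr:
  assumes "prob_vanishing M X" "\<And>n \<omega>. X n \<omega> \<ge> 0" "c \<ge> 0" "q > 0"
  shows "prob_vanishing M (\<lambda>n \<omega>. c * X n \<omega> powr q)"
  unfolding prob_vanishing_def with_high_prob_def
proof (intro allI impI)
  fix \<delta> \<epsilon> :: real assume e: "\<delta> > 0" "\<epsilon> > 0"
  define \<eta> where "\<eta> = (\<delta> / (c + 1)) powr (1 / q)"
  have \<eta>: "\<eta> > 0" using e assms by (simp add: \<eta>_def)
  have "\<forall>\<^sub>F n in sequentially. \<exists>S\<in>sets M. measure M S < \<epsilon> \<and> (\<forall>\<omega>\<in>space M - S. X n \<omega> \<le> \<eta>)"
    using assms(1) \<eta> e by (auto simp: prob_vanishing_def with_high_prob_def)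
  then show "\<forall>\<^sub>F n in sequentially. \<exists>S\<in>sets M. measure M S < \<epsilon> \<and> (\<forall>\<omega>\<in>space M - S. c * X n \<omega> powr q \<le> \<delta>)"
  proof (rule eventually_mono)
    fix n assume "\<exists>S\<in>sets M. measure M S < \<epsilon> \<and> (\<forall>\<omega>\<in>space M - S. X n \<omega> \<le> \<eta>)"
    then obtain S where S: "S \<in> sets M" "measure M S < \<epsilon>" "\<forall>\<omega>\<in>space M - S. X n \<omega> \<le> \<eta>" by blast
    have "c * X n \<omega> powr q \<le> \<delta>" if "\<omega> \<in> space M - S" for \<omega>
    proof -
      have "X n \<omega> powr q \<le> \<eta> powr q" using S that assms by (intro powr_mono2) auto
      also have "\<dots> = \<delta> / (c + 1)" using e assms by (simp add: \<eta>_def powr_powr)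
      finally have "c * X n \<omega> powr q \<le> c * (\<delta> / (c + 1))" using assms by (intro mult_left_mono)
      also have "\<dots> \<le> \<delta>" using assms e by (simp add: field_simps)
      finally show ?thesis .
    qed
    then show "\<exists>S\<in>sets M. measure M S < \<epsilon> \<and> (\<forall>\<omega>\<in>space M - S. c * X n \<omega> powr q \<le> \<delta>)" using S by blast
  qed
qed

lemma (in prob_space) prob_bounded_markov:
  assumes "\<forall>\<^sub>F n in sequentially. integrable M (Y n) \<and> expectation (Y n) \<le> C \<and> (\<forall>\<omega>\<in>space M. 0 \<le> Y n \<omega>)"
  shows "prob_bounded M Y"
  unfolding prob_bounded_def
proof (intro allI impI)
  fix \<epsilon> :: real assume e: "\<epsilon> > 0"
  define D where "D = (\<bar>C\<bar> + 1) * 2 / \<epsilon>"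
  have D: "D > 0" using e by (simp add: D_def)
  from assms have "\<forall>\<^sub>F n in sequentially. \<exists>S\<in>sets M. measure M S < \<epsilon> \<and> (\<forall>\<omega>\<in>space M - S. Y n \<omega> \<le> D)"
  proof eventually_elim
    case (elim n)
    then have [measurable]: "Y n \<in> borel_measurable M" by auto
    have "measure M {\<omega> \<in> space M. D \<le> Y n \<omega>} \<le> expectation (Y n) / D"
      using integral_Markov_inequality_measure[of M "Y n" "{}" D] elim D by (auto intro!: AE_I2)
    also have "\<dots> \<le> (\<bar>C\<bar> + 1) / D" using elim D by (intro divide_right_mono) auto
    also have "(\<bar>C\<bar> + 1) / D = \<epsilon> / 2"
    proof -
      have "c / (c * 2 / \<epsilon>) = \<epsilon> / 2" if "c > 0" for c using that e by simp
      from this[of "\<bar>C\<bar> + 1"] show ?thesis by (simp add: D_def)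
    qed
    also have "\<epsilon> / 2 < \<epsilon>" using e by simp
    finally show ?case by (intro bexI[of _ "{\<omega> \<in> space M. D \<le> Y n \<omega>}"]) auto
  qed
  then show "\<exists>C. \<forall>\<^sub>F n in sequentially. \<exists>S\<in>sets M. measure M S < \<epsilon> \<and> (\<forall>\<omega>\<in>space M - S. Y n \<omega> \<le> C)" ..
qed

lemma (in prob_space) prob_bounded_const_add_vanishing:
  assumes "prob_vanishing M R"
  shows "prob_bounded M (\<lambda>n \<omega>. c + R n \<omega>)"
  unfolding prob_bounded_def
proof (intro allI impI exI[of _ "c + 1"])
  fix \<epsilon> :: real assume e: "\<epsilon> > 0"
  have "\<forall>\<^sub>F n in sequentially. \<exists>S\<in>sets M. measure M S < \<epsilon> \<and> (\<forall>\<omega>\<in>space M - S. R n \<omega> \<le> 1)"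
    using assms e by (auto simp: prob_vanishing_def with_high_prob_def)
  then show "\<forall>\<^sub>F n in sequentially. \<exists>S\<in>sets M. measure M S < \<epsilon> \<and> (\<forall>\<omega>\<in>space M - S. c + R n \<omega> \<le> c + 1)" by simp
qed

text \<open>
  If \<open>\<delta>\<close> is small relative to \<open>u\<close>, continuity of \<open>k \<mapsto> (1 + k) powr p\<close> at \<open>0\<close> gives the first term; otherwise
  \<open>u\<close> and \<open>v\<close> are both bounded by multiples of \<open>\<delta>\<close>.
\<close>

lemma powr_perturb_same:
  assumes p: "p > 0" and \<eta>: "\<eta> > 0"
  shows "\<exists>C\<ge>0. \<forall>u v \<delta>::real. 0 \<le> u \<longrightarrow> 0 \<le> v \<longrightarrow> 0 \<le> \<delta> \<longrightarrow> \<bar>u - v\<bar> \<le> \<delta> \<longrightarrow> \<bar>u powr p - v powr p\<bar> \<le> \<eta> * u powr p + C * \<delta> powr p"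
proof -
  have "((\<lambda>k. (1 + k) powr p) \<longlongrightarrow> (1 + 0) powr p) (at_right (0::real))" "((\<lambda>k. (1 - k) powr p) \<longlongrightarrow> (1 - 0) powr p) (at_right (0::real))"
    by (intro tendsto_intros; simp)+
  then have "\<forall>\<^sub>F k in at_right (0::real). (1 + k) powr p < 1 + \<eta>" "\<forall>\<^sub>F k in at_right (0::real). (1 - k) powr p > 1 - \<eta>"
    using \<eta> by (auto intro: order_tendstoD)
  moreover have "\<forall>\<^sub>F k in at_right (0::real). k > 0" by (simp add: eventually_at_right_less)
  moreover have "\<forall>\<^sub>F k in at_right (0::real). k < 1" by (intro eventually_at_right_real[of 0 1, THEN eventually_mono]) auto
  ultimately have "\<forall>\<^sub>F k in at_right (0::real). (1 + k) powr p < 1 + \<eta> \<and> (1 - k) powr p > 1 - \<eta> \<and> k > 0 \<and> k < 1"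
    by eventually_elim auto
  then obtain k :: real where k: "(1 + k) powr p < 1 + \<eta>" "(1 - k) powr p > 1 - \<eta>" "k > 0" "k < 1"
    using eventually_happens'[of "at_right (0::real)"] by (auto simp: trivial_limit_at_right_real)
  define C where "C = (1 + 1 / k) powr p"
  have "\<bar>u powr p - v powr p\<bar> \<le> \<eta> * u powr p + C * \<delta> powr p"
    if h: "0 \<le> u" "0 \<le> v" "0 \<le> \<delta>" "\<bar>u - v\<bar> \<le> \<delta>" for u v \<delta> :: real
  proof (cases "\<delta> \<le> k * u")
    case True
    have "v powr p \<le> ((1 + k) * u) powr p" using h True p by (intro powr_mono2) (auto simp: algebra_simps)
    also have "\<dots> = (1 + k) powr p * u powr p" using h k by (simp add: powr_mult)
    also have "\<dots> \<le> (1 + \<eta>) * u powr p" using k by (intro mult_right_mono) auto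
    finally have 1: "v powr p \<le> (1 + \<eta>) * u powr p" .
    have ku: "k * u \<le> u" using h k by (intro mult_left_le_one_le) auto
    have "(1 - \<eta>) * u powr p \<le> (1 - k) powr p * u powr p" using k by (intro mult_right_mono) auto
    also have "\<dots> = ((1 - k) * u) powr p" using h k by (simp add: powr_mult)
    also have "\<dots> \<le> v powr p" using h True p k ku by (intro powr_mono2) (auto simp: algebra_simps)
    finally have 2: "(1 - \<eta>) * u powr p \<le> v powr p" .
    have "\<bar>u powr p - v powr p\<bar> \<le> \<eta> * u powr p" using 1 2 by (simp add: algebra_simps abs_le_iff)
    then show ?thesis by (simp add: C_def add_increasing2)
  next
    case False
    then have u: "u \<le> 1 / k * \<delta>" using k by (simp add: field_simps)
    then have "u \<le> (1 + 1 / k) * \<delta>" "v \<le> (1 + 1 / k) * \<delta>" using h by (auto simp: algebra_simps)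
    then have "u powr p \<le> ((1 + 1 / k) * \<delta>) powr p" "v powr p \<le> ((1 + 1 / k) * \<delta>) powr p"
      using h p by (auto intro!: powr_mono2)
    moreover have "((1 + 1 / k) * \<delta>) powr p = C * \<delta> powr p" using h k by (simp add: powr_mult C_def)
    moreover have "0 \<le> u powr p" "0 \<le> v powr p" "0 \<le> \<eta> * u powr p" using \<eta> by auto
    ultimately show ?thesis by linarith
  qed
  moreover have "C \<ge> 0" by (simp add: C_def)
  ultimately show ?thesis by blast
qed

lemma powr_le_small_plus:
  assumes p: "0 < p" "p \<le> q" and \<eta>: "\<eta> > 0"
  shows "\<exists>C\<ge>0. \<forall>\<delta>\<ge>0. \<delta> powr p \<le> \<eta> + C * (\<delta>::real) powr q"
proof (intro exI conjI allI impI)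
  let ?k = "\<eta> powr (1 / p)"
  show "?k powr (p - q) \<ge> 0" by simp
  fix \<delta> :: real assume d: "\<delta> \<ge> 0"
  show "\<delta> powr p \<le> \<eta> + ?k powr (p - q) * \<delta> powr q"
  proof (cases "\<delta> \<le> ?k")
    case True
    then have "\<delta> powr p \<le> ?k powr p" using d p by (intro powr_mono2) auto
    also have "\<dots> = \<eta>" using p \<eta> by (simp add: powr_powr)
    finally show ?thesis by (simp add: add_increasing2)
  next
    case False
    have k0: "?k > 0" using \<eta> by simp
    with False have d0: "\<delta> > 0" "?k > 0" by linarith+
    have "\<delta> powr p = \<delta> powr (p - q) * \<delta> powr q" by (simp add: powr_add[symmetric])
    also have "\<dots> \<le> ?k powr (p - q) * \<delta> powr q"
      using False d0 p by (intro mult_right_mono powr_mono2') auto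
    finally show ?thesis using \<eta> by simp
  qed
qed

text \<open>
  The inequality behind all parts of the theorem. The exponent is doubled to pass to square roots, where
  the difference is controlled.
\<close>

lemma powr_perturb:
  assumes p: "0 < p" "p \<le> q" and \<eta>: "\<eta> > 0"
  shows "\<exists>C\<ge>0. \<forall>a b c::real. 0 \<le> a \<longrightarrow> 0 \<le> b \<longrightarrow> 0 \<le> c \<longrightarrow> \<bar>sqrt a - sqrt b\<bar> \<le> sqrt c \<longrightarrow> \<bar>a powr p - b powr p\<bar> \<le> \<eta> * (2 + a powr q) + C * c powr q"
proof -
  obtain C where C: "C \<ge> 0" "\<And>u v \<delta>::real. 0 \<le> u \<Longrightarrow> 0 \<le> v \<Longrightarrow> 0 \<le> \<delta> \<Longrightarrow> \<bar>u - v\<bar> \<le> \<delta> \<Longrightarrow> \<bar>u powr (2 * p) - v powr (2 * p)\<bar> \<le> \<eta> * u powr (2 * p) + C * \<delta> powr (2 * p)"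
    using powr_perturb_same[of "2 * p" \<eta>] p \<eta> by auto
  obtain D where D: "D \<ge> 0" "\<And>\<delta>::real. \<delta> \<ge> 0 \<Longrightarrow> \<delta> powr p \<le> \<eta> / (C + 1) + D * \<delta> powr q"
    using powr_le_small_plus[of p q "\<eta> / (C + 1)"] p \<eta> C(1) by auto
  have sq: "sqrt x powr (2 * p) = x powr p" if "x \<ge> 0" for x :: real
    using that by (simp add: powr_half_sqrt[symmetric] powr_powr)
  have "\<bar>a powr p - b powr p\<bar> \<le> \<eta> * (2 + a powr q) + (C * D) * c powr q"
    if h: "0 \<le> a" "0 \<le> b" "0 \<le> c" "\<bar>sqrt a - sqrt b\<bar> \<le> sqrt c" for a b c :: real
  proof -
    have "\<bar>a powr p - b powr p\<bar> \<le> \<eta> * a powr p + C * c powr p"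
      using C(2)[of "sqrt a" "sqrt b" "sqrt c"] h by (simp add: sq)
    also have "\<dots> \<le> \<eta> * (1 + a powr q) + C * (\<eta> / (C + 1) + D * c powr q)"
    proof (intro add_mono mult_left_mono)
      show "a powr p \<le> 1 + a powr q"
      proof (cases "a \<le> 1")
        case True
        then have "a powr p \<le> 1 powr p" using h p by (intro powr_mono2) auto
        then show ?thesis by (simp add: add_increasing2)
      next
        case False
        then have "a powr p \<le> a powr q" using p by (intro powr_mono) auto
        then show ?thesis by simp
      qed
    qed (use \<eta> C D h in auto)
    also have "C * (\<eta> / (C + 1)) \<le> \<eta>" using C(1) \<eta> by (simp add: field_simps)
    then have "\<eta> * (1 + a powr q) + C * (\<eta> / (C + 1) + D * c powr q) \<le> \<eta> * (2 + a powr q) + (C * D) * c powr q"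
      by (simp add: algebra_simps)
    finally show ?thesis .
  qed
  moreover have "C * D \<ge> 0" using C D by simp
  ultimately show ?thesis by blast
qed

lemma sum_powr_le_powr_sum:
  assumes "finite S" "\<And>i. i \<in> S \<Longrightarrow> x i \<ge> (0::real)" "q \<ge> 1"
  shows "(\<Sum>i\<in>S. x i powr q) \<le> (\<Sum>i\<in>S. x i) powr q"
proof (cases "(\<Sum>i\<in>S. x i) = 0")
  case True
  then have "\<forall>i\<in>S. x i = 0" using assms by (simp add: sum_nonneg_eq_0_iff)
  then show ?thesis using True by simp
next
  case False
  let ?X = "\<Sum>i\<in>S. x i"
  have X: "?X > 0" using False assms by (simp add: sum_nonneg less_le)
  have "(\<Sum>i\<in>S. x i powr q) \<le> (\<Sum>i\<in>S. x i * ?X powr (q - 1))"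
  proof (rule sum_mono)
    fix i assume i: "i \<in> S"
    have "x i powr q = x i * x i powr (q - 1)" using assms i by (cases "x i = 0") (auto simp: powr_diff less_le)
    also have "\<dots> \<le> x i * ?X powr (q - 1)"
      using assms i by (intro mult_left_mono powr_mono2 member_le_sum) auto
    finally show "x i powr q \<le> x i * ?X powr (q - 1)" .
  qed
  also have "\<dots> = ?X powr q" using X unfolding sum_distrib_right[symmetric] by (simp add: powr_diff)
  finally show ?thesis .
qed

section \<open>Local approximation of contracting fields\<close>

text \<open>
  Choosing each coordinate from one of two independent copies does not change the law of an i.i.d. family; finite-dimensional
  cylinders determine the law.
\<close>

lemma distr_merge_iid:
  fixes N :: "real measure" and A :: "'i set"
  assumes N: "prob_space N" "sets N = sets borel"
  defines "P \<equiv> \<Pi>\<^sub>M i\<in>(UNIV :: 'i set). N"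
  shows "distr (P \<Otimes>\<^sub>M P) P (\<lambda>z s. if s \<in> A then fst z s else snd z s) = P"
proof -
  interpret N: prob_space N by fact
  have PP: "prob_space P" unfolding P_def by (rule prob_space_PiM) (rule N(1))
  interpret P: prob_space P by fact
  interpret PP: pair_prob_space P P ..
  have spN: "space N = UNIV" using N(2) by (simp add: sets_eq_imp_space_eq)
  let ?m = "\<lambda>z s. if s \<in> A then fst z s else snd z s :: real"
  have mm: "?m \<in> (P \<Otimes>\<^sub>M P) \<rightarrow>\<^sub>M P"
  proof -
    have "(\<lambda>z. if s \<in> A then fst z s else snd z s) \<in> (P \<Otimes>\<^sub>M P) \<rightarrow>\<^sub>M N" for s
      unfolding P_def by (cases "s \<in> A") (auto intro!: measurable_compose[OF measurable_fst] measurable_compose[OF measurable_snd] measurable_component_singleton)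
    then show ?thesis unfolding P_def by (intro measurable_PiM_single') (auto simp: spN)
  qed
  show ?thesis
  proof (rule measure_eqI_PiM_infinite[symmetric, of P "UNIV" "\<lambda>_. N"])
    show "sets P = sets (Pi\<^sub>M UNIV (\<lambda>_. N))" "sets (distr (P \<Otimes>\<^sub>M P) P ?m) = sets (Pi\<^sub>M UNIV (\<lambda>_. N))" by (simp_all add: P_def)
    show "finite_measure P" by (rule P.finite_measure_axioms)
    fix J :: "'i set" and F assume J: "finite J" "J \<subseteq> UNIV" and F: "\<And>i. i \<in> J \<Longrightarrow> F i \<in> sets N"
    let ?E = "\<lambda>J. prod_emb UNIV (\<lambda>_. N) J (Pi\<^sub>E J F)"
    have E: "?E K = {x. \<forall>s\<in>K. x s \<in> F s} \<inter> space P" for K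
      by (auto simp: prod_emb_def P_def space_PiM PiE_iff extensional_def restrict_def)
    have em: "emeasure P (?E K) = (\<Prod>i\<in>K. emeasure N (F i))" if "K \<subseteq> J" for K
      unfolding P_def by (rule emeasure_PiM_emb) (use N that J F finite_subset in auto)
    have Es: "?E K \<in> sets P" if "K \<subseteq> J" for K
      unfolding P_def by (rule sets_PiM_I) (use that J F finite_subset in auto)
    have "emeasure (distr (P \<Otimes>\<^sub>M P) P ?m) (?E J) = emeasure (P \<Otimes>\<^sub>M P) (?m -` ?E J \<inter> space (P \<Otimes>\<^sub>M P))"
      by (rule emeasure_distr[OF mm]) (use Es in auto)
    also have "?m -` ?E J \<inter> space (P \<Otimes>\<^sub>M P) = ?E (J \<inter> A) \<times> ?E (J - A)"
      using measurable_space[OF mm] unfolding E by (auto simp: space_pair_measure split: if_splits)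
    also have "emeasure (P \<Otimes>\<^sub>M P) \<dots> = emeasure P (?E (J \<inter> A)) * emeasure P (?E (J - A))"
      by (rule P.emeasure_pair_measure_Times) (use Es in auto)
    also have "\<dots> = (\<Prod>i\<in>J. emeasure N (F i))"
      using J by (subst em, simp, subst em, auto simp: prod.Int_Diff[of J _ A])
    finally show "emeasure P (?E J) = emeasure (distr (P \<Otimes>\<^sub>M P) P ?m) (?E J)" using em by simp
  qed
qed

text \<open>
  Three ranges of \<open>D\<close>: below \<open>\<delta>\<close>, between \<open>\<delta>\<close> and \<open>1 / \<delta>\<close>, and above \<open>1 / \<delta>\<close>.
\<close>

lemma fourth_power_interpolation:
  fixes D \<delta> a \<phi> :: real
  assumes D: "D \<ge> 0" and d: "0 < \<delta>" "\<delta> \<le> 1" and a: "a > 0" and p: "\<phi> > 4"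
  shows "D ^ 4 \<le> \<delta> ^ 4 + \<delta> powr (- 4 - a) * D powr a + \<delta> powr (\<phi> - 4) * D powr \<phi>"
proof -
  have nn: "0 \<le> \<delta> ^ 4" "0 \<le> \<delta> powr (- 4 - a) * D powr a" "0 \<le> \<delta> powr (\<phi> - 4) * D powr \<phi>" using d by auto
  consider "D \<le> \<delta>" | "\<delta> < D" "D \<le> 1 / \<delta>" | "1 / \<delta> < D" by linarith
  then show ?thesis
  proof cases
    case 1
    then have "D ^ 4 \<le> \<delta> ^ 4" using D by (intro power_mono)
    then show ?thesis using nn by linarith
  next
    case 2
    have D0: "D > 0" using 2 d by linarith
    have "D ^ 4 \<le> (1 / \<delta>) ^ 4" using 2 D by (intro power_mono) auto
    also have "(1 / \<delta>) ^ 4 = \<delta> powr (- 4)" using d by (simp add: powr_minus powr_numeral power_inverse divide_inverse)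
    also have "\<dots> = \<delta> powr (- 4 - a) * \<delta> powr a" by (simp add: powr_add[symmetric])
    also have "\<dots> \<le> \<delta> powr (- 4 - a) * D powr a" using 2 d a by (intro mult_left_mono powr_mono2) auto
    finally show ?thesis using nn by linarith
  next
    case 3
    have D0: "D > 0" using 3 d by (meson divide_pos_pos less_trans zero_less_one)
    have "D ^ 4 = D powr (4 - \<phi>) * D powr \<phi>" using D0 by (simp add: powr_add[symmetric] powr_numeral)
    also have "\<dots> \<le> (1 / \<delta>) powr (4 - \<phi>) * D powr \<phi>" using 3 d p by (intro mult_right_mono powr_mono2') auto
    also have "(1 / \<delta>) powr (4 - \<phi>) = \<delta> powr (\<phi> - 4)"
    proof -
      have "(1 / \<delta>) powr (4 - \<phi>) = (\<delta> powr (- 1)) powr (4 - \<phi>)" using d by (simp add: powr_minus divide_inverse)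
      also have "\<dots> = \<delta> powr (- 1 * (4 - \<phi>))" by (rule powr_powr)
      finally show ?thesis by simp
    qed
    finally show ?thesis using nn by linarith
  qed
qed

text \<open>
  Taking \<open>\<delta>\<close> to be a small power of \<open>\<rho>^m\<close> makes all three terms geometrically small. This upgrades contraction of a
  moment of arbitrary order \<open>a\<close> to contraction of the fourth moment.
\<close>

lemma geometric_interpolation:
  fixes C M \<rho> a \<phi> :: real
  assumes "C \<ge> 0" "M \<ge> 0" and r: "0 < \<rho>" "\<rho> < 1" and a: "a > 0" and p: "\<phi> > 4"
  shows "\<exists>C' \<rho>'. 0 < C' \<and> 0 < \<rho>' \<and> \<rho>' < 1 \<and>
    (\<forall>m::nat. \<exists>\<delta>. 0 < \<delta> \<and> \<delta> \<le> 1 \<and> \<delta> ^ 4 + \<delta> powr (- 4 - a) * (C * \<rho> ^ m) + \<delta> powr (\<phi> - 4) * M \<le> (C' * \<rho>' ^ m) ^ 4)"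
proof -
  \<comment> \<open>With \<open>\<delta> = \<rho> powr (b * m)\<close> the factor \<open>\<delta> powr (- 4 - a)\<close> costs half of the decay of \<open>\<rho> ^ m\<close>.\<close>
  define b where "b = 1 / (2 * (4 + a))"
  have b: "b > 0" using a by (simp add: b_def)
  define c where "c = min (4 * b) (min (1/2) (b * (\<phi> - 4)))"
  have c: "c > 0" using b p by (simp add: c_def)
  define \<rho>' where "\<rho>' = \<rho> powr (c / 4)"
  define C' where "C' = (1 + C + M) powr (1 / 4)"
  have r': "0 < \<rho>'" "\<rho>' < 1" using r c using powr_less_mono2[of "c / 4" \<rho> 1] by (auto simp: \<rho>'_def)
  have C': "C' > 0" using assms by (simp add: C'_def)
  have "\<exists>\<delta>. 0 < \<delta> \<and> \<delta> \<le> 1 \<and> \<delta> ^ 4 + \<delta> powr (- 4 - a) * (C * \<rho> ^ m) + \<delta> powr (\<phi> - 4) * M \<le> (C' * \<rho>' ^ m) ^ 4" for m :: nat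
  proof (intro exI conjI)
    let ?d = "\<rho> powr (b * real m)"
    show "0 < ?d" using r by simp
    show "?d \<le> 1" using r b by (intro powr_le1) auto
    have mono: "\<rho> powr (x * real m) \<le> \<rho> powr (c * real m)" if "c \<le> x" for x
      using r that by (intro powr_mono') (auto intro: mult_right_mono)
    have 1: "?d ^ 4 \<le> \<rho> powr (c * real m)"
    proof -
      have "?d ^ 4 = \<rho> powr (4 * b * real m)" using r by (simp add: powr_numeral[symmetric] powr_powr mult_ac)
      then show ?thesis using mono[of "4 * b"] by (simp add: c_def)
    qed
    have 2: "?d powr (- 4 - a) * (C * \<rho> ^ m) \<le> C * \<rho> powr (c * real m)"
    proof -
      have "?d powr (- 4 - a) * \<rho> ^ m = \<rho> powr (b * real m * (- 4 - a) + real m)"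
        using r by (simp add: powr_powr powr_add powr_realpow)
      also have "b * real m * (- 4 - a) + real m = 1/2 * real m" using a by (simp add: b_def field_simps)
      also have "\<rho> powr (1/2 * real m) \<le> \<rho> powr (c * real m)" by (rule mono) (simp add: c_def)
      finally have "C * (?d powr (- 4 - a) * \<rho> ^ m) \<le> C * \<rho> powr (c * real m)" using assms by (intro mult_left_mono) auto
      then show ?thesis by (simp add: mult_ac)
    qed
    have 3: "?d powr (\<phi> - 4) * M \<le> M * \<rho> powr (c * real m)"
    proof -
      have "?d powr (\<phi> - 4) = \<rho> powr (b * (\<phi> - 4) * real m)" by (simp add: powr_powr mult_ac)
      also have "\<dots> \<le> \<rho> powr (c * real m)" by (rule mono) (simp add: c_def)
      finally show ?thesis using assms by (simp add: mult.commute mult_left_mono)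
    qed
    have "(C' * \<rho>' ^ m) ^ 4 = (1 + C + M) * \<rho> powr (c * real m)"
    proof -
      have "C' ^ 4 = 1 + C + M" using assms by (simp add: C'_def powr_numeral[symmetric] powr_powr)
      moreover have "(\<rho>' ^ m) ^ 4 = \<rho> powr (c * real m)"
        using r by (simp add: \<rho>'_def powr_realpow[symmetric] powr_numeral[symmetric] powr_powr)
      ultimately show ?thesis by (simp add: power_mult_distrib)
    qed
    then show "?d ^ 4 + ?d powr (- 4 - a) * (C * \<rho> ^ m) + ?d powr (\<phi> - 4) * M \<le> (C' * \<rho>' ^ m) ^ 4"
      using 1 2 3 by (simp add: algebra_simps)
  qed
  with C' r' show ?thesis by blast
qed

text \<open>
  The law \<open>P\<close> of the innovations lives on the sequence space \<open>S\<close>; transporting everything to \<open>P\<close> makes the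
  shift invariance of the field visible.
\<close>

locale innovation_field = prob_space M for M :: "'w measure" +
  fixes V :: "int \<times> int \<Rightarrow> 'w \<Rightarrow> real" and \<mu> :: real
    and G :: "(int \<times> int \<Rightarrow> real) \<Rightarrow> real" and e :: "int \<times> int \<Rightarrow> 'w \<Rightarrow> real"
  assumes rep: "innovation_rep M V \<mu> G e"
    and V_meas [measurable]: "\<And>t. V t \<in> borel_measurable M"
begin

abbreviation "S \<equiv> (\<Pi>\<^sub>M s\<in>(UNIV :: (int \<times> int) set). (borel :: real measure))"

definition "P = (\<Pi>\<^sub>M s\<in>(UNIV :: (int \<times> int) set). distr M borel (e 0))"

lemma sets_P [measurable_cong]: "sets P = sets S"
  unfolding P_def by (intro sets_PiM_cong) auto

lemma e_meas [measurable]: "e i \<in> borel_measurable M"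
  using rep unfolding innovation_rep_def iid_field_def indep_vars_def by blast

lemma G_meas [measurable]: "G \<in> borel_measurable S"
  using rep by (auto simp: innovation_rep_def)

lemma prob_distr_e: "prob_space (distr M borel (e 0))"
  by (rule prob_space_distr) simp

lemma prob_P: "prob_space P"
  unfolding P_def by (rule prob_space_PiM) (rule prob_distr_e)

lemma e_map_meas [measurable]: "(\<lambda>\<omega> s. e (t - s) \<omega>) \<in> M \<rightarrow>\<^sub>M S"
  by (rule measurable_PiM_single') (auto simp: space_PiM)

lemma distr_innovations: "distr M S (\<lambda>\<omega> s. e (t - s) \<omega>) = P"
proof -
  have ind: "indep_vars (\<lambda>_. borel) e UNIV" and id: "\<And>i. distr M borel (e i) = distr M borel (e 0)"
    using rep by (auto simp: innovation_rep_def iid_field_def)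
  have "distr M S (\<lambda>\<omega> s. e s \<omega>) = (\<Pi>\<^sub>M i\<in>UNIV. distr M borel (e i))"
    using indep_vars_iff_distr_eq_PiM[where I=UNIV and M'="\<lambda>_. borel" and X=e] ind by (simp add: restrict_UNIV)
  then have D: "distr M S (\<lambda>\<omega> s. e s \<omega>) = P" 
    unfolding P_def by (rule trans) (intro PiM_cong refl id)
  have r: "distr P P (\<lambda>x s. x (t - s)) = P"
    using distr_PiM_reindex[of UNIV "\<lambda>_. distr M borel (e 0)" "\<lambda>s. t - s" UNIV] prob_distr_e
    unfolding P_def by (simp add: restrict_UNIV inj_on_def)
  have m: "(\<lambda>x s. x (t - s)) \<in> S \<rightarrow>\<^sub>M S"
    by (rule measurable_PiM_single') (auto simp: space_PiM)
  have m0: "(\<lambda>\<omega> s. e s \<omega>) \<in> M \<rightarrow>\<^sub>M S"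
    by (rule measurable_PiM_single') (auto simp: space_PiM)
  have "distr M S (\<lambda>\<omega> s. e (t - s) \<omega>) = distr (distr M S (\<lambda>\<omega> s. e s \<omega>)) S (\<lambda>x s. x (t - s))"
    by (subst distr_distr[OF m m0]) (simp add: comp_def)
  also have "\<dots> = distr P P (\<lambda>x s. x (t - s))" unfolding D by (intro distr_cong) (auto simp: sets_P)
  finally show ?thesis using r by simp
qed

lemma distr_innovation_pair:
  "distr (M \<Otimes>\<^sub>M M) (S \<Otimes>\<^sub>M S) (\<lambda>(\<omega>, \<omega>'). (\<lambda>s. e (t - s) \<omega>, \<lambda>s. e (t - s) \<omega>')) = P \<Otimes>\<^sub>M P"
proof -
  interpret P: prob_space P by (rule prob_P)
  have "sigma_finite_measure (distr M S (\<lambda>\<omega> s. e (t - s) \<omega>))" unfolding distr_innovations ..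
  from pair_measure_distr[OF e_map_meas e_map_meas this]
  show ?thesis unfolding distr_innovations by simp
qed

definition "lag_ball m = {s :: int \<times> int. \<bar>fst s\<bar> < int m \<and> \<bar>snd s\<bar> < int m}"

definition "merge_ball m x y = (\<lambda>s. if s \<in> lag_ball m then x s else y s :: real)"

lemma merge_ball_meas [measurable]: "(\<lambda>z. merge_ball m (fst z) (snd z)) \<in> (S \<Otimes>\<^sub>M S) \<rightarrow>\<^sub>M S"
proof -
  have "(\<lambda>z. if s \<in> lag_ball m then fst z s else snd z s) \<in> borel_measurable (S \<Otimes>\<^sub>M S)" for s
    by (cases "s \<in> lag_ball m") (auto intro!: measurable_compose[OF measurable_fst] measurable_compose[OF measurable_snd])
  then show ?thesis unfolding merge_ball_def by (intro measurable_PiM_single') (auto simp: space_PiM)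
qed

lemma merge_ball_meas1 [measurable]: "(\<lambda>x. merge_ball m x y) \<in> S \<rightarrow>\<^sub>M S"
proof -
  have "(\<lambda>x. if s \<in> lag_ball m then x s else y s) \<in> borel_measurable S" for s
    by (cases "s \<in> lag_ball m") auto
  then show ?thesis unfolding merge_ball_def by (intro measurable_PiM_single') (auto simp: space_PiM)
qed

lemma distr_merge_ball: "distr (P \<Otimes>\<^sub>M P) P (\<lambda>z. merge_ball m (fst z) (snd z)) = P"
  unfolding merge_ball_def P_def by (rule distr_merge_iid) (auto intro: prob_distr_e)

lemma nn_integral_merge_ball:
  assumes [measurable]: "f \<in> borel_measurable S"
  shows "(\<integral>\<^sup>+z. f (merge_ball m (fst z) (snd z)) \<partial>(P \<Otimes>\<^sub>M P)) = (\<integral>\<^sup>+x. f x \<partial>P)"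
proof -
  have "(\<integral>\<^sup>+x. f x \<partial>P) = (\<integral>\<^sup>+x. f x \<partial>distr (P \<Otimes>\<^sub>M P) P (\<lambda>z. merge_ball m (fst z) (snd z)))"
    by (simp only: distr_merge_ball)
  also have "\<dots> = (\<integral>\<^sup>+z. f (merge_ball m (fst z) (snd z)) \<partial>(P \<Otimes>\<^sub>M P))"
    by (rule nn_integral_distr) measurable
  finally show ?thesis by simp
qed

lemma nn_integral_innovations:
  assumes [measurable]: "f \<in> borel_measurable S"
  shows "(\<integral>\<^sup>+\<omega>. f (\<lambda>s. e (t - s) \<omega>) \<partial>M) = (\<integral>\<^sup>+x. f x \<partial>P)"
  using nn_integral_distr[OF e_map_meas, of f t] unfolding distr_innovations by simp

lemma nn_integral_innovation_pair:
  assumes [measurable]: "f \<in> borel_measurable (S \<Otimes>\<^sub>M S)"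
  shows "(\<integral>\<^sup>+z. f (\<lambda>s. e (t - s) (fst z), \<lambda>s. e (t - s) (snd z)) \<partial>(M \<Otimes>\<^sub>M M)) = (\<integral>\<^sup>+z. f z \<partial>(P \<Otimes>\<^sub>M P))"
proof -
  have "(\<integral>\<^sup>+z. f z \<partial>(P \<Otimes>\<^sub>M P)) = (\<integral>\<^sup>+z. f (case z of (\<omega>, \<omega>') \<Rightarrow> (\<lambda>s. e (t - s) \<omega>, \<lambda>s. e (t - s) \<omega>')) \<partial>(M \<Otimes>\<^sub>M M))"
    unfolding distr_innovation_pair[of t, symmetric] by (rule nn_integral_distr) measurable
  then show ?thesis by (simp add: case_prod_beta')
qed

lemma V_rep: "AE \<omega> in M. V j \<omega> - \<mu> = G (\<lambda>s. e (j - s) \<omega>)"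
  using rep unfolding innovation_rep_def by blast

lemma V_rep_fst: "AE z in M \<Otimes>\<^sub>M M. V j (fst z) - \<mu> = G (\<lambda>s. e (j - s) (fst z))"
proof (rule AE_distrD[of fst "M \<Otimes>\<^sub>M M" M])
  show "AE x in distr (M \<Otimes>\<^sub>M M) M fst. V j x - \<mu> = G (\<lambda>s. e (j - s) x)"
    unfolding distr_pair_fst by (rule V_rep)
qed simp

text \<open>
  The contraction condition at the site \<open>(m, 0)\<close>, where the innovations kept by the coupling are exactly those
  with lag in \<open>lag_ball m\<close>.
\<close>

lemma coupling_moment:
  assumes g: "\<And>j. integrable (M \<Otimes>\<^sub>M M) (\<lambda>\<omega>. \<bar>V j (fst \<omega>) - coupled_dagger \<mu> G e j \<omega>\<bar> powr a)"
      "\<And>j. (LINT \<omega>|(M \<Otimes>\<^sub>M M). \<bar>V j (fst \<omega>) - coupled_dagger \<mu> G e j \<omega>\<bar> powr a) \<le> C * \<rho> powr vmax (rvec j)"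
    and r: "\<rho> > 0" "C \<ge> 0"
  shows "(\<integral>\<^sup>+z. ennreal (\<bar>G (fst z) - G (merge_ball m (fst z) (snd z))\<bar> powr a) \<partial>(P \<Otimes>\<^sub>M P)) \<le> ennreal (C * \<rho> ^ m)"
proof -
  let ?j = "(int m, 0 :: int)"
  let ?D = "\<lambda>z. \<bar>G (fst z) - G (merge_ball m (fst z) (snd z))\<bar> powr a"
  have vm: "vmax (rvec ?j) = real m" by (simp add: vmax_def rvec_def)
  have cond: "vmax (rvec s) < vmax (rvec ?j) \<longleftrightarrow> s \<in> lag_ball m" for s
    unfolding vm by (auto simp: vmax_def rvec_def lag_ball_def)
  have [measurable]: "(\<lambda>z. ennreal (?D z)) \<in> borel_measurable (S \<Otimes>\<^sub>M S)" by measurable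
  have "(\<integral>\<^sup>+z. ennreal (?D z) \<partial>(P \<Otimes>\<^sub>M P))
     = (\<integral>\<^sup>+z. ennreal (?D (\<lambda>s. e (?j - s) (fst z), \<lambda>s. e (?j - s) (snd z))) \<partial>(M \<Otimes>\<^sub>M M))"
    by (rule nn_integral_innovation_pair[symmetric]) measurable
  also have "\<dots> = (\<integral>\<^sup>+z. ennreal (\<bar>V ?j (fst z) - coupled_dagger \<mu> G e ?j z\<bar> powr a) \<partial>(M \<Otimes>\<^sub>M M))"
  proof (rule nn_integral_cong_AE, use V_rep_fst[of ?j] in eventually_elim)
    fix z :: "'w \<times> 'w" assume *: "V ?j (fst z) - \<mu> = G (\<lambda>s. e (?j - s) (fst z))"
    have "coupled_dagger \<mu> G e ?j z = \<mu> + G (merge_ball m (\<lambda>s. e (?j - s) (fst z)) (\<lambda>s. e (?j - s) (snd z)))"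
      unfolding coupled_dagger_def merge_ball_def cond by simp
    then show "ennreal (?D (\<lambda>s. e (?j - s) (fst z), \<lambda>s. e (?j - s) (snd z))) = ennreal (\<bar>V ?j (fst z) - coupled_dagger \<mu> G e ?j z\<bar> powr a)"
      using * by (simp add: algebra_simps)
  qed
  also have "\<dots> = ennreal (LINT z|(M \<Otimes>\<^sub>M M). \<bar>V ?j (fst z) - coupled_dagger \<mu> G e ?j z\<bar> powr a)"
    by (rule nn_integral_eq_integral[OF g(1)]) simp
  also have "\<dots> \<le> ennreal (C * \<rho> ^ m)"
    using g(2)[of ?j] r unfolding vm by (intro ennreal_leI) (simp add: powr_realpow)
  finally show ?thesis .
qed

lemma powr_add_le: "(x + y) powr p \<le> 2 powr p * (x powr p + y powr p)" if "x \<ge> 0" "y \<ge> 0" "p \<ge> 0" for x y p :: real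
proof -
  have "(x + y) powr p \<le> (2 * max x y) powr p" using that by (intro powr_mono2) auto
  also have "\<dots> = 2 powr p * max x y powr p" using that by (simp add: powr_mult)
  also have "\<dots> \<le> 2 powr p * (x powr p + y powr p)" by (intro mult_left_mono) (auto simp: max_def)
  finally show ?thesis .
qed

text \<open>
  In the coupled field the innovations outside the ball are an independent copy; averaging over that copy
  shows that some frozen configuration \<open>y\<close> of it does at least as well as twice the mean, and freezing it yields a function of the
  innovations inside the ball alone.
\<close>

lemma fourth_moment_approximants:
  assumes g: "gmc M V \<mu> G e" and V: "integrable M (\<lambda>\<omega>. \<bar>V 0 \<omega>\<bar> powr \<phi>)" and p: "\<phi> > 4"
  shows "\<exists>H C \<rho>. 0 < C \<and> 0 < \<rho> \<and> \<rho> < (1::real) \<and> (\<forall>m. H m \<in> borel_measurable S \<and>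
      (\<forall>x x'. (\<forall>s\<in>lag_ball m. x s = x' s) \<longrightarrow> H m x = H m x') \<and>
      (\<forall>t. integrable M (\<lambda>\<omega>. (V t \<omega> - \<mu> - H m (\<lambda>s. e (t - s) \<omega>)) ^ 4) \<and>
        expectation (\<lambda>\<omega>. (V t \<omega> - \<mu> - H m (\<lambda>s. e (t - s) \<omega>)) ^ 4) \<le> (C * \<rho> ^ m) ^ 4))"
proof -
  interpret P: prob_space P by (rule prob_P)
  interpret PP: pair_prob_space P P ..
  obtain a C0 \<rho>0 where a: "a > 0" and C0: "C0 > 0" and \<rho>0: "0 < \<rho>0" "\<rho>0 < 1"
    and g: "\<And>j. integrable (M \<Otimes>\<^sub>M M) (\<lambda>\<omega>. \<bar>V j (fst \<omega>) - coupled_dagger \<mu> G e j \<omega>\<bar> powr a)"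
      "\<And>j. (LINT \<omega>|(M \<Otimes>\<^sub>M M). \<bar>V j (fst \<omega>) - coupled_dagger \<mu> G e j \<omega>\<bar> powr a) \<le> C0 * \<rho>0 powr vmax (rvec j)"
    using g unfolding gmc_def by blast
  have spP: "space P = UNIV" unfolding sets_eq_imp_space_eq[OF sets_P] by (simp add: space_PiM)
  define J where "J = (\<integral>\<^sup>+x. ennreal (\<bar>G x\<bar> powr \<phi>) \<partial>P)"
  have Jfin: "J < \<infinity>"
  proof -
    have "J = (\<integral>\<^sup>+\<omega>. ennreal (\<bar>G (\<lambda>s. e (0 - s) \<omega>)\<bar> powr \<phi>) \<partial>M)"
      unfolding J_def by (rule nn_integral_innovations[symmetric]) measurable
    also have "\<dots> = (\<integral>\<^sup>+\<omega>. ennreal (\<bar>V 0 \<omega> - \<mu>\<bar> powr \<phi>) \<partial>M)"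
      by (rule nn_integral_cong_AE, use V_rep[of 0] in eventually_elim) simp
    also have "\<dots> \<le> (\<integral>\<^sup>+\<omega>. ennreal (2 powr \<phi> * (\<bar>V 0 \<omega>\<bar> powr \<phi> + \<bar>\<mu>\<bar> powr \<phi>)) \<partial>M)"
    proof (rule nn_integral_mono, rule ennreal_leI)
      fix \<omega>
      have "\<bar>V 0 \<omega> - \<mu>\<bar> powr \<phi> \<le> (\<bar>V 0 \<omega>\<bar> + \<bar>\<mu>\<bar>) powr \<phi>" using p by (intro powr_mono2) auto
      also have "\<dots> \<le> 2 powr \<phi> * (\<bar>V 0 \<omega>\<bar> powr \<phi> + \<bar>\<mu>\<bar> powr \<phi>)" by (rule powr_add_le) (use p in auto)
      finally show "\<bar>V 0 \<omega> - \<mu>\<bar> powr \<phi> \<le> 2 powr \<phi> * (\<bar>V 0 \<omega>\<bar> powr \<phi> + \<bar>\<mu>\<bar> powr \<phi>)" .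
    qed
    also have "\<dots> = ennreal (LINT \<omega>|M. 2 powr \<phi> * (\<bar>V 0 \<omega>\<bar> powr \<phi> + \<bar>\<mu>\<bar> powr \<phi>))"
      by (rule nn_integral_eq_integral) (use V in auto)
    also have "\<dots> < \<infinity>" by simp
    finally show ?thesis .
  qed
  define MM where "MM = 2 powr \<phi> * (2 * enn2real J)"
  have MM: "MM \<ge> 0" by (simp add: MM_def)
  define D where "D m z = \<bar>G (fst z) - G (merge_ball m (fst z) (snd z))\<bar>" for m z
  have Dm[measurable]: "D m \<in> borel_measurable (S \<Otimes>\<^sub>M S)" for m
    unfolding D_def[abs_def] by measurable
  have D0: "D m z \<ge> 0" for m z by (simp add: D_def)
  have Da: "(\<integral>\<^sup>+z. ennreal (D m z powr a) \<partial>(P \<Otimes>\<^sub>M P)) \<le> ennreal (C0 * \<rho>0 ^ m)" for m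
    unfolding D_def by (rule coupling_moment[OF g]) (use C0 \<rho>0 in auto)
  have Dp: "(\<integral>\<^sup>+z. ennreal (D m z powr \<phi>) \<partial>(P \<Otimes>\<^sub>M P)) \<le> ennreal MM" for m
  proof -
    have "(\<integral>\<^sup>+z. ennreal (D m z powr \<phi>) \<partial>(P \<Otimes>\<^sub>M P))
       \<le> (\<integral>\<^sup>+z. ennreal (2 powr \<phi>) * (ennreal (\<bar>G (fst z)\<bar> powr \<phi>) + ennreal (\<bar>G (merge_ball m (fst z) (snd z))\<bar> powr \<phi>)) \<partial>(P \<Otimes>\<^sub>M P))"
    proof (rule nn_integral_mono)
      fix z :: "(int \<times> int \<Rightarrow> real) \<times> (int \<times> int \<Rightarrow> real)"
      have "D m z powr \<phi> \<le> (\<bar>G (fst z)\<bar> + \<bar>G (merge_ball m (fst z) (snd z))\<bar>) powr \<phi>"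
        unfolding D_def using p by (intro powr_mono2) auto
      also have "\<dots> \<le> 2 powr \<phi> * (\<bar>G (fst z)\<bar> powr \<phi> + \<bar>G (merge_ball m (fst z) (snd z))\<bar> powr \<phi>)"
        by (rule powr_add_le) (use p in auto)
      finally show "ennreal (D m z powr \<phi>) \<le> ennreal (2 powr \<phi>) * (ennreal (\<bar>G (fst z)\<bar> powr \<phi>) + ennreal (\<bar>G (merge_ball m (fst z) (snd z))\<bar> powr \<phi>))"
        by (simp add: ennreal_mult[symmetric] ennreal_plus[symmetric] ennreal_leI del: ennreal_plus)
    qed
    also have "\<dots> = ennreal (2 powr \<phi>) * ((\<integral>\<^sup>+z. ennreal (\<bar>G (fst z)\<bar> powr \<phi>) \<partial>(P \<Otimes>\<^sub>M P)) + (\<integral>\<^sup>+z. ennreal (\<bar>G (merge_ball m (fst z) (snd z))\<bar> powr \<phi>) \<partial>(P \<Otimes>\<^sub>M P)))"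
      by (subst nn_integral_cmult, measurable) (subst nn_integral_add, auto)
    also have "(\<integral>\<^sup>+z. ennreal (\<bar>G (merge_ball m (fst z) (snd z))\<bar> powr \<phi>) \<partial>(P \<Otimes>\<^sub>M P)) = J"
      unfolding J_def by (rule nn_integral_merge_ball) measurable
    also have "(\<integral>\<^sup>+z. ennreal (\<bar>G (fst z)\<bar> powr \<phi>) \<partial>(P \<Otimes>\<^sub>M P)) = J"
    proof -
      have "J = (\<integral>\<^sup>+x. ennreal (\<bar>G x\<bar> powr \<phi>) \<partial>distr (P \<Otimes>\<^sub>M P) P fst)"
        unfolding J_def by (simp only: P.distr_pair_fst)
      also have "\<dots> = (\<integral>\<^sup>+z. ennreal (\<bar>G (fst z)\<bar> powr \<phi>) \<partial>(P \<Otimes>\<^sub>M P))"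
        by (rule nn_integral_distr) measurable
      finally show ?thesis by simp
    qed
    also have "ennreal (2 powr \<phi>) * (J + J) = ennreal MM"
    proof -
      have "ennreal (enn2real J) = J" using Jfin by simp
      moreover have "ennreal (2 powr \<phi>) * (ennreal j + ennreal j) = ennreal (2 powr \<phi> * (2 * j))" if "j \<ge> 0" for j :: real
        using that by (simp add: ennreal_mult[symmetric] ennreal_plus[symmetric] del: ennreal_plus)
      from this[of "enn2real J"] have "ennreal (2 powr \<phi>) * (ennreal (enn2real J) + ennreal (enn2real J)) = ennreal MM"
        by (simp only: MM_def enn2real_nonneg)
      ultimately show ?thesis by (simp only:)
    qed
    finally show ?thesis .
  qed
  obtain C' \<rho>' where C': "0 < C'" "0 < \<rho>'" "\<rho>' < 1"
    and gi: "\<And>m::nat. \<exists>\<delta>. 0 < \<delta> \<and> \<delta> \<le> 1 \<and> \<delta> ^ 4 + \<delta> powr (- 4 - a) * (C0 * \<rho>0 ^ m) + \<delta> powr (\<phi> - 4) * MM \<le> (C' * \<rho>' ^ m) ^ 4"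
    using geometric_interpolation[of C0 MM \<rho>0 a \<phi>] C0 MM \<rho>0 a p by auto
  have D4: "(\<integral>\<^sup>+z. ennreal (D m z ^ 4) \<partial>(P \<Otimes>\<^sub>M P)) \<le> ennreal ((C' * \<rho>' ^ m) ^ 4)" for m
  proof -
    obtain \<delta> where d: "0 < \<delta>" "\<delta> \<le> 1" and le: "\<delta> ^ 4 + \<delta> powr (- 4 - a) * (C0 * \<rho>0 ^ m) + \<delta> powr (\<phi> - 4) * MM \<le> (C' * \<rho>' ^ m) ^ 4"
      using gi by blast
    have "(\<integral>\<^sup>+z. ennreal (D m z ^ 4) \<partial>(P \<Otimes>\<^sub>M P))
       \<le> (\<integral>\<^sup>+z. ennreal (\<delta> ^ 4) + (ennreal (\<delta> powr (- 4 - a)) * ennreal (D m z powr a) + ennreal (\<delta> powr (\<phi> - 4)) * ennreal (D m z powr \<phi>)) \<partial>(P \<Otimes>\<^sub>M P))"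
    proof (rule nn_integral_mono)
      fix z
      show "ennreal (D m z ^ 4) \<le> ennreal (\<delta> ^ 4) + (ennreal (\<delta> powr (- 4 - a)) * ennreal (D m z powr a) + ennreal (\<delta> powr (\<phi> - 4)) * ennreal (D m z powr \<phi>))"
        using fourth_power_interpolation[OF D0[of m z] d a p] d
        by (simp add: ennreal_mult[symmetric] ennreal_plus[symmetric] ennreal_leI del: ennreal_plus)
    qed
    also have "\<dots> = ennreal (\<delta> ^ 4) + (ennreal (\<delta> powr (- 4 - a)) * (\<integral>\<^sup>+z. ennreal (D m z powr a) \<partial>(P \<Otimes>\<^sub>M P))
        + ennreal (\<delta> powr (\<phi> - 4)) * (\<integral>\<^sup>+z. ennreal (D m z powr \<phi>) \<partial>(P \<Otimes>\<^sub>M P)))"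
      by (simp add: nn_integral_add nn_integral_cmult PP.emeasure_space_1)
    also have "\<dots> \<le> ennreal (\<delta> ^ 4) + (ennreal (\<delta> powr (- 4 - a)) * ennreal (C0 * \<rho>0 ^ m) + ennreal (\<delta> powr (\<phi> - 4)) * ennreal MM)"
      by (intro add_mono mult_left_mono Da Dp) auto
    also have "\<dots> = ennreal (\<delta> ^ 4 + \<delta> powr (- 4 - a) * (C0 * \<rho>0 ^ m) + \<delta> powr (\<phi> - 4) * MM)"
      using d C0 \<rho>0 MM by (simp add: ennreal_mult[symmetric] ennreal_plus[symmetric] add.assoc del: ennreal_plus)
    also have "\<dots> \<le> ennreal ((C' * \<rho>' ^ m) ^ 4)" by (rule ennreal_leI[OF le])
    finally show ?thesis .
  qed
  \<comment> \<open>Some section of \<open>D m\<close> is at most twice the mean over all sections.\<close>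
  have "\<exists>y. (\<integral>\<^sup>+x. ennreal (D m (x, y) ^ 4) \<partial>P) \<le> ennreal (2 * (C' * \<rho>' ^ m) ^ 4)" for m
  proof (rule ccontr)
    assume "\<not> ?thesis"
    then have gt: "ennreal (2 * (C' * \<rho>' ^ m) ^ 4) \<le> (\<integral>\<^sup>+x. ennreal (D m (x, y) ^ 4) \<partial>P)" for y
      by (meson le_cases)
    have "ennreal (2 * (C' * \<rho>' ^ m) ^ 4) = (\<integral>\<^sup>+y. ennreal (2 * (C' * \<rho>' ^ m) ^ 4) \<partial>P)"
      by (simp add: P.emeasure_space_1)
    also have "\<dots> \<le> (\<integral>\<^sup>+y. (\<integral>\<^sup>+x. ennreal (D m (x, y) ^ 4) \<partial>P) \<partial>P)"
      by (rule nn_integral_mono) (rule gt)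
    also have "\<dots> = (\<integral>\<^sup>+z. ennreal (D m z ^ 4) \<partial>(P \<Otimes>\<^sub>M P))"
      by (rule PP.nn_integral_snd) measurable
    also have "\<dots> \<le> ennreal ((C' * \<rho>' ^ m) ^ 4)" by (rule D4)
    finally have "2 * (C' * \<rho>' ^ m) ^ 4 \<le> (C' * \<rho>' ^ m) ^ 4" using C' by (subst (asm) ennreal_le_iff) auto
    moreover have "0 < (C' * \<rho>' ^ m) ^ 4" using C' by simp
    ultimately show False by linarith
  qed
  then obtain y where y: "\<And>m. (\<integral>\<^sup>+x. ennreal (D m (x, y m) ^ 4) \<partial>P) \<le> ennreal (2 * (C' * \<rho>' ^ m) ^ 4)" by metis
  define H where "H m x = G (merge_ball m x (y m))" for m x
  have Hm[measurable]: "H m \<in> borel_measurable S" for m unfolding H_def[abs_def] by measurable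
  have Hloc: "H m x = H m x'" if "\<forall>s\<in>lag_ball m. x s = x' s" for m x x'
  proof -
    have "merge_ball m x (y m) = merge_ball m x' (y m)" using that by (auto simp: merge_ball_def fun_eq_iff)
    then show ?thesis by (simp add: H_def)
  qed
  have main: "integrable M (\<lambda>\<omega>. (V t \<omega> - \<mu> - H m (\<lambda>s. e (t - s) \<omega>)) ^ 4) \<and>
        expectation (\<lambda>\<omega>. (V t \<omega> - \<mu> - H m (\<lambda>s. e (t - s) \<omega>)) ^ 4) \<le> (2 * C' * \<rho>' ^ m) ^ 4" for m t
  proof -
    let ?Z = "\<lambda>\<omega>. (V t \<omega> - \<mu> - H m (\<lambda>s. e (t - s) \<omega>)) ^ 4"
    have Zm[measurable]: "?Z \<in> borel_measurable M" by measurable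
    have "(\<integral>\<^sup>+\<omega>. ennreal (?Z \<omega>) \<partial>M) = (\<integral>\<^sup>+\<omega>. ennreal ((G (\<lambda>s. e (t - s) \<omega>) - H m (\<lambda>s. e (t - s) \<omega>)) ^ 4) \<partial>M)"
      by (rule nn_integral_cong_AE, use V_rep[of t] in eventually_elim) simp
    also have "\<dots> = (\<integral>\<^sup>+x. ennreal ((G x - H m x) ^ 4) \<partial>P)"
      by (rule nn_integral_innovations) measurable
    also have "\<dots> = (\<integral>\<^sup>+x. ennreal (D m (x, y m) ^ 4) \<partial>P)"
      by (simp add: D_def H_def)
    also have "\<dots> \<le> ennreal (2 * (C' * \<rho>' ^ m) ^ 4)" by (rule y)
    also have "\<dots> \<le> ennreal ((2 * C' * \<rho>' ^ m) ^ 4)"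
      using C' by (intro ennreal_leI) (simp add: power_mult_distrib)
    finally have le: "(\<integral>\<^sup>+\<omega>. ennreal (?Z \<omega>) \<partial>M) \<le> ennreal ((2 * C' * \<rho>' ^ m) ^ 4)" .
    have i: "integrable M ?Z"
      by (rule integrableI_bounded) (use le in \<open>auto intro: le_less_trans\<close>)
    have "expectation ?Z \<le> (2 * C' * \<rho>' ^ m) ^ 4"
      by (rule integral_real_bounded) (use C' le in auto)
    with i show ?thesis by blast
  qed
  show ?thesis
  proof (rule exI[of _ H], rule exI[of _ "2 * C'"], rule exI[of _ \<rho>'], intro conjI allI impI)
    show "0 < 2 * C'" "0 < \<rho>'" "\<rho>' < 1" using C' by auto
    show "H m \<in> borel_measurable S" for m by (rule Hm)
    show "H m x = H m x'" if "\<forall>s\<in>lag_ball m. x s = x' s" for m x x' using that by (rule Hloc)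
    show "integrable M (\<lambda>\<omega>. (V t \<omega> - \<mu> - H m (\<lambda>s. e (t - s) \<omega>)) ^ 4)" for m t using main by blast
    show "expectation (\<lambda>\<omega>. (V t \<omega> - \<mu> - H m (\<lambda>s. e (t - s) \<omega>)) ^ 4) \<le> (2 * C' * \<rho>' ^ m) ^ 4" for m t using main by blast
  qed
qed

end

section \<open>Smoothing weights folded onto the grid\<close>

definition grid_shift :: "nat \<times> nat \<Rightarrow> int \<times> int \<Rightarrow> int \<times> int" where
  "grid_shift d m = (fst m * int (fst d), snd m * int (snd d))"

text \<open>
  The representative of a site in the grid, modulo the side lengths; residues are taken in \<open>1..d\<close>.
\<close>

definition grid_rep :: "nat \<times> nat \<Rightarrow> int \<times> int \<Rightarrow> int \<times> int" where
  "grid_rep d j = ((fst j - 1) mod int (fst d) + 1, (snd j - 1) mod int (snd d) + 1)"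

lemma grid_periodic_shift: "grid_periodic d F \<Longrightarrow> F (j + grid_shift d m) = F j"
  by (simp only: grid_periodic_def grid_shift_def)

lemma grid_rep_in: "fst d > 0 \<Longrightarrow> snd d > 0 \<Longrightarrow> grid_rep d j \<in> grid d"
proof -
  have "1 \<le> x mod int D + 1 \<and> x mod int D + 1 \<le> int D" if "D > 0" for x :: int and D :: nat
    using that pos_mod_sign[of "int D" x] pos_mod_bound[of "int D" x] by linarith
  then show "fst d > 0 \<Longrightarrow> snd d > 0 \<Longrightarrow> grid_rep d j \<in> grid d"
    by (simp add: grid_rep_def grid_def)
qed

lemma grid_rep_shift: "j = grid_rep d j + grid_shift d ((fst j - 1) div int (fst d), (snd j - 1) div int (snd d))"
proof -
  have "x = (x - 1) mod D + 1 + (x - 1) div D * D" for x D :: int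
    using div_mult_mod_eq[of "x - 1" D] by linarith
  then show ?thesis by (simp only: grid_rep_def grid_shift_def prod_eq_iff fst_add snd_add fst_conv snd_conv)
qed

lemma grid_periodic_rep: "grid_periodic d F \<Longrightarrow> F (grid_rep d j) = F j"
  by (subst (2) grid_rep_shift[of j d]) (simp only: grid_periodic_shift)

lemma grid_rep_id: "r \<in> grid d \<Longrightarrow> grid_rep d r = r"
  by (auto simp: grid_def grid_rep_def prod_eq_iff)

lemma grid_rep_add_shift: "grid_rep d (j + grid_shift d m) = grid_rep d j"
proof -
  have "(a + b * D - 1) mod D = (a - 1) mod D" for a b D :: int
    using mod_mult_self1[of "a - 1" b D] by (simp add: algebra_simps)
  then show ?thesis by (simp add: grid_rep_def grid_shift_def)
qed

lemma sum_grid_shift: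
  assumes d: "fst d > 0" "snd d > 0" and F: "grid_periodic d F"
  shows "(\<Sum>r\<in>grid d. F (k + r)) = (\<Sum>r\<in>grid d. F r)"
proof (rule sum.reindex_bij_witness[where i="\<lambda>r. grid_rep d (r - k)" and j="\<lambda>r. grid_rep d (k + r)"])
  have e: "((a + b - 1) mod D - a) mod D = (b - 1) mod D" for a b D :: int
    by (simp add: mod_simps)
  have e': "(a + (b - a - 1) mod D) mod D = (b - 1) mod D" for a b D :: int
    by (simp add: mod_simps)
  fix r assume r: "r \<in> grid d"
  show "grid_rep d (grid_rep d (k + r) - k) = r"
    using grid_rep_id[OF r] by (simp add: grid_rep_def e)
  show "grid_rep d (k + grid_rep d (r - k)) = r"
    using grid_rep_id[OF r] by (simp add: grid_rep_def e')
  show "grid_rep d (k + r) \<in> grid d" "grid_rep d (r - k) \<in> grid d" using d by (auto intro: grid_rep_in)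
  show "F (grid_rep d (k + r)) = F (k + r)" by (rule grid_periodic_rep[OF F])
qed

lemma grid_periodic_comp: "grid_periodic d F \<Longrightarrow> grid_periodic d (\<lambda>j. f (F j))"
  by (simp add: grid_periodic_def)

lemma grid_periodic_comp2: "grid_periodic d F \<Longrightarrow> grid_periodic d G \<Longrightarrow> grid_periodic d (\<lambda>j. f (F j) (G j))"
  by (simp add: grid_periodic_def)

text \<open>
  A probability on \<open>\<int>\<^sup>2\<close> acts on grid-periodic functions only through the probability it induces on the grid, which
  is bounded by \<open>B\<close>.
\<close>

locale smoothing_weights =
  fixes d :: "nat \<times> nat" and p :: "int \<times> int \<Rightarrow> real" and B :: real
  assumes d_pos: "fst d > 0" "snd d > 0"
    and p_nonneg: "\<And>s. p s \<ge> 0" and p_summable: "p summable_on UNIV" and p_total: "(\<Sum>\<^sub>\<infinity>s. p s) = 1"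
    and p_folded_le: "\<And>r. r \<in> grid d \<Longrightarrow> (\<Sum>\<^sub>\<infinity>m. p (r + grid_shift d m)) \<le> B"
begin

definition "pbar r = (\<Sum>\<^sub>\<infinity>m. p (r + grid_shift d m))"

lemma pbar_nonneg: "pbar r \<ge> 0" unfolding pbar_def by (rule infsum_nonneg) (rule p_nonneg)

lemma pbar_le: "r \<in> grid d \<Longrightarrow> pbar r \<le> B" unfolding pbar_def by (rule p_folded_le)

lemma grid_nonempty: "(1, 1) \<in> grid d" using d_pos by (auto simp: grid_def)

lemma B_nonneg: "B \<ge> 0" using pbar_nonneg pbar_le[OF grid_nonempty] by (rule order_trans)

lemma gsize_pos: "gsize d > 0" using d_pos by (simp add: gsize_def)

lemma card_grid: "real (card (grid d)) = gsize d" by (simp add: grid_def gsize_def)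

text \<open>
  The plane is the disjoint union of the classes of grid points, and a grid-periodic function is constant on each
  class.
\<close>

lemma smooth_has_sum:
  fixes F :: "int \<times> int \<Rightarrow> real"
  assumes F: "grid_periodic d F"
  shows "((\<lambda>s. p s * F (k + s)) has_sum (\<Sum>r\<in>grid d. pbar r * F (k + r))) UNIV"
proof -
  let ?C = "\<lambda>r. range (\<lambda>m. r + grid_shift d m)"
  have inj: "inj (\<lambda>m. r + grid_shift d m)" for r
    using d_pos by (auto simp: inj_on_def grid_shift_def prod_eq_iff)
  have hs: "((\<lambda>s. p s * F (k + s)) has_sum (pbar r * F (k + r))) (?C r)" for r
  proof -
    have "p summable_on ?C r" using p_summable by (rule summable_on_subset_banach) simp
    then have "(\<lambda>m. p (r + grid_shift d m)) summable_on UNIV"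
      by (subst (asm) summable_on_reindex[OF inj]) (simp add: comp_def)
    then have "((\<lambda>m. p (r + grid_shift d m)) has_sum pbar r) UNIV" unfolding pbar_def by simp
    then have "((\<lambda>m. p (r + grid_shift d m) * F (k + r)) has_sum (pbar r * F (k + r))) UNIV"
      by (rule has_sum_cmult_left)
    moreover have "F (k + (r + grid_shift d m)) = F (k + r)" for m
      using grid_periodic_shift[OF F, of "k + r" m] by (simp add: add.assoc)
    ultimately show ?thesis by (subst has_sum_reindex[OF inj]) (simp add: comp_def)
  qed
  have U: "(\<Union>r\<in>grid d. ?C r) = UNIV"
  proof -
    have "s \<in> (\<Union>r\<in>grid d. ?C r)" for s
      by (rule UN_I[of "grid_rep d s"], rule grid_rep_in) (use d_pos grid_rep_shift[of s d] in auto)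
    then show ?thesis by blast
  qed
  have dis: "?C r \<inter> ?C r' = {}" if "r \<in> grid d" "r' \<in> grid d" "r \<noteq> r'" for r r'
  proof (rule ccontr)
    assume "?C r \<inter> ?C r' \<noteq> {}"
    then obtain x where "x \<in> ?C r" "x \<in> ?C r'" by blast
    then obtain m m' where x: "x = r + grid_shift d m" and x': "x = r' + grid_shift d m'" by blast
    have "grid_rep d x = grid_rep d r" unfolding x by (rule grid_rep_add_shift)
    moreover have "grid_rep d x = grid_rep d r'" unfolding x' by (rule grid_rep_add_shift)
    ultimately have "grid_rep d r = grid_rep d r'" by simp
    then show False using that grid_rep_id by auto
  qed
  have "((\<lambda>s. p s * F (k + s)) has_sum (\<Sum>r\<in>grid d. pbar r * F (k + r))) (\<Union>r\<in>grid d. ?C r)"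
    by (rule sum_has_sum) (use hs dis in auto)
  then show ?thesis unfolding U .
qed

lemma smooth_eq:
  fixes F :: "int \<times> int \<Rightarrow> real"
  assumes F: "grid_periodic d F"
  shows "(\<Sum>\<^sub>\<infinity>s. p s * F (k + s)) = (\<Sum>r\<in>grid d. pbar r * F (k + r))"
  using smooth_has_sum[OF F] by (rule infsumI)

lemma sum_pbar: "(\<Sum>r\<in>grid d. pbar r) = 1"
  using smooth_eq[of "\<lambda>_. 1" 0] p_total by (simp add: grid_periodic_def)

lemma smooth_le_sum:
  fixes F :: "int \<times> int \<Rightarrow> real"
  assumes F: "grid_periodic d F" and nn: "\<And>j. F j \<ge> 0"
  shows "(\<Sum>r\<in>grid d. pbar r * F (k + r)) \<le> B * (\<Sum>r\<in>grid d. F r)"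
proof -
  have "(\<Sum>r\<in>grid d. pbar r * F (k + r)) \<le> (\<Sum>r\<in>grid d. B * F (k + r))"
    by (intro sum_mono mult_right_mono pbar_le nn)
  also have "\<dots> = B * (\<Sum>r\<in>grid d. F r)"
    using sum_grid_shift[OF d_pos F, of k] by (simp add: sum_distrib_left[symmetric])
  finally show ?thesis .
qed

text \<open>
  The smoothed periodogram at frequency index \<open>k\<close>.
\<close>

definition "Q k W = (\<Sum>r\<in>grid d. pbar r * pgram0 d W (k + r))"

text \<open>
  The matrix of the quadratic form \<open>Q k\<close>.
\<close>

definition "a k t u = (1 / gsize d) * (\<Sum>r\<in>grid d. pbar r * cos (freq d (k + r) \<bullet> rvec (u - t)))"

lemma Q_quadratic: "Q k W = (\<Sum>t\<in>grid d. \<Sum>u\<in>grid d. a k t u * W t * W u)"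
proof -
  have "Q k W = (\<Sum>r\<in>grid d. \<Sum>t\<in>grid d. \<Sum>u\<in>grid d. pbar r * ((1 / gsize d) * cos (freq d (k + r) \<bullet> rvec (u - t)) * (W t * W u)))"
    unfolding Q_def pgram0_quadratic sum_distrib_left ..
  also have "\<dots> = (\<Sum>t\<in>grid d. \<Sum>r\<in>grid d. \<Sum>u\<in>grid d. pbar r * ((1 / gsize d) * cos (freq d (k + r) \<bullet> rvec (u - t)) * (W t * W u)))"
    by (rule sum.swap)
  also have "\<dots> = (\<Sum>t\<in>grid d. \<Sum>u\<in>grid d. \<Sum>r\<in>grid d. pbar r * ((1 / gsize d) * cos (freq d (k + r) \<bullet> rvec (u - t)) * (W t * W u)))"
    by (intro sum.cong refl sum.swap)
  also have "\<dots> = (\<Sum>t\<in>grid d. \<Sum>u\<in>grid d. a k t u * W t * W u)"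
    unfolding a_def by (intro sum.cong refl) (simp add: sum_distrib_left sum_distrib_right mult_ac)
  finally show ?thesis .
qed

lemma a_diag: "a k t t = 1 / gsize d"
proof -
  have "rvec (t - t) = 0" by (simp add: rvec_def zero_prod_def)
  then show ?thesis by (simp add: a_def sum_pbar)
qed

text \<open>
  Each row of the matrix is a discrete Fourier transform of the folded weights, so Parseval gives the sum of
  their squares, and this is at most their maximum times their sum.
\<close>

lemma sum_a_squared: "(\<Sum>t\<in>grid d. \<Sum>u\<in>grid d. (a k t u)\<^sup>2) \<le> B"
proof -
  let ?g = "gsize d"
  have one: "(\<Sum>u\<in>grid d. (a k t u)\<^sup>2) \<le> (1 / ?g) * (\<Sum>r\<in>grid d. (pbar r)\<^sup>2)" for t
  proof -
    define c where "c r = complex_of_real (pbar r) * iexp (- (freq d r \<bullet> rvec t))" for r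
    have ab: "\<bar>a k t u\<bar> \<le> (1 / ?g) * cmod (\<Sum>r\<in>grid d. c r * iexp (freq d r \<bullet> rvec u))" for u
    proof -
      have rv: "rvec (u - t) = rvec u - rvec t" by (simp add: rvec_def)
      have "complex_of_real (pbar r) * iexp (freq d (k + r) \<bullet> rvec (u - t)) = iexp (freq d k \<bullet> rvec (u - t)) * (c r * iexp (freq d r \<bullet> rvec u))" for r
        unfolding c_def freq_inner_add by (simp add: rv inner_diff_right exp_add distrib_left right_diff_distrib exp_diff exp_minus field_simps)
      then have "(\<Sum>r\<in>grid d. complex_of_real (pbar r) * iexp (freq d (k + r) \<bullet> rvec (u - t))) = iexp (freq d k \<bullet> rvec (u - t)) * (\<Sum>r\<in>grid d. c r * iexp (freq d r \<bullet> rvec u))"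
        by (simp add: sum_distrib_left)
      then have n: "cmod (\<Sum>r\<in>grid d. complex_of_real (pbar r) * iexp (freq d (k + r) \<bullet> rvec (u - t))) = cmod (\<Sum>r\<in>grid d. c r * iexp (freq d r \<bullet> rvec u))"
        by (simp add: norm_mult)
      have "(\<Sum>r\<in>grid d. pbar r * cos (freq d (k + r) \<bullet> rvec (u - t))) = Re (\<Sum>r\<in>grid d. complex_of_real (pbar r) * iexp (freq d (k + r) \<bullet> rvec (u - t)))"
        by (simp add: Re_exp)
      then have "\<bar>\<Sum>r\<in>grid d. pbar r * cos (freq d (k + r) \<bullet> rvec (u - t))\<bar> \<le> cmod (\<Sum>r\<in>grid d. c r * iexp (freq d r \<bullet> rvec u))"
        using abs_Re_le_cmod[of "\<Sum>r\<in>grid d. complex_of_real (pbar r) * iexp (freq d (k + r) \<bullet> rvec (u - t))"] unfolding n by (simp only:)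
      then show ?thesis unfolding a_def abs_mult using gsize_pos by (simp add: divide_right_mono)
    qed
    have "(\<Sum>u\<in>grid d. (a k t u)\<^sup>2) \<le> (\<Sum>u\<in>grid d. ((1 / ?g) * cmod (\<Sum>r\<in>grid d. c r * iexp (freq d r \<bullet> rvec u)))\<^sup>2)"
      by (rule sum_mono, rule abs_le_square_iff[THEN iffD1], rule order_trans[OF ab abs_ge_self])
    also have "\<dots> = (1 / ?g)\<^sup>2 * (\<Sum>u\<in>grid d. (cmod (\<Sum>r\<in>grid d. c r * iexp (freq d r \<bullet> rvec u)))\<^sup>2)"
      unfolding power_mult_distrib by (rule sum_distrib_left[symmetric])
    also have "\<dots> = (1 / ?g)\<^sup>2 * (?g * (\<Sum>r\<in>grid d. (cmod (c r))\<^sup>2))"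
      by (simp only: grid_parseval[OF d_pos])
    also have "\<dots> = (1 / ?g) * (\<Sum>r\<in>grid d. (pbar r)\<^sup>2)"
      using gsize_pos by (simp add: c_def norm_mult power2_eq_square)
    finally show ?thesis .
  qed
  have "(\<Sum>t\<in>grid d. \<Sum>u\<in>grid d. (a k t u)\<^sup>2) \<le> (\<Sum>t\<in>grid d. (1 / ?g) * (\<Sum>r\<in>grid d. (pbar r)\<^sup>2))"
    by (rule sum_mono) (rule one)
  also have "\<dots> = (\<Sum>r\<in>grid d. (pbar r)\<^sup>2)" using gsize_pos card_grid by simp
  also have "\<dots> \<le> (\<Sum>r\<in>grid d. B * pbar r)"
    unfolding power2_eq_square by (intro sum_mono mult_right_mono pbar_le pbar_nonneg)
  also have "\<dots> = B" by (simp add: sum_distrib_left[symmetric] sum_pbar)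
  finally show ?thesis .
qed

lemma Q_le_energy: "Q k W \<le> B * (\<Sum>t\<in>grid d. (W t)\<^sup>2)"
  unfolding Q_def using smooth_le_sum[OF pgram_periodic(1)[OF d_pos], of W k] by (simp add: sum_pgram0[OF d_pos])

text \<open>
  The diagonal is a mean of squares, and the off-diagonal part is replaced by its fourth power plus one, in
  order to be summable over \<open>k\<close>.
\<close>

lemma Q_restricted:
  assumes F: "F \<subseteq> grid d"
  shows "Q k (\<lambda>t. if t \<in> F then W t else 0)
    \<le> (1 / gsize d) * (\<Sum>t\<in>F. (W t)\<^sup>2) + 1 + (\<Sum>t\<in>F. \<Sum>u\<in>F - {t}. a k t u * W t * W u) ^ 4"
proof -
  have fin: "finite F" using F finite_grid by (rule finite_subset)
  have r: "(\<Sum>t\<in>grid d. if t \<in> F then f t else 0) = (\<Sum>t\<in>F. f t)" for f :: "_ \<Rightarrow> real"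
    using F by (simp add: sum.If_cases Int_absorb1)
  have "Q k (\<lambda>t. if t \<in> F then W t else 0) = (\<Sum>t\<in>grid d. if t \<in> F then (\<Sum>u\<in>grid d. if u \<in> F then a k t u * W t * W u else 0) else 0)"
    unfolding Q_quadratic by (intro sum.cong refl) (auto intro!: sum.cong)
  also have "\<dots> = (\<Sum>t\<in>F. \<Sum>u\<in>F. a k t u * W t * W u)" unfolding r ..
  also have "\<dots> = (\<Sum>t\<in>F. (1 / gsize d) * (W t)\<^sup>2 + (\<Sum>u\<in>F - {t}. a k t u * W t * W u))"
    by (intro sum.cong refl) (simp add: sum.remove[OF fin] a_diag power2_eq_square)
  also have "\<dots> = (1 / gsize d) * (\<Sum>t\<in>F. (W t)\<^sup>2) + (\<Sum>t\<in>F. \<Sum>u\<in>F - {t}. a k t u * W t * W u)"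
    by (simp add: sum.distrib sum_distrib_left)
  finally show ?thesis using pow_le_1_pow4(1)[of "\<Sum>t\<in>F. \<Sum>u\<in>F - {t}. a k t u * W t * W u"] by linarith
qed

lemma Q_add: "Q k (\<lambda>t. W t + Z t) \<le> 2 * Q k W + 2 * Q k Z"
proof -
  have "pgram0 d (\<lambda>t. W t + Z t) j \<le> 2 * pgram0 d W j + 2 * pgram0 d Z j" for j
  proof -
    have c: "xcoef d (\<lambda>t. W t + Z t) j = xcoef d W j + xcoef d Z j" "ycoef d (\<lambda>t. W t + Z t) j = ycoef d W j + ycoef d Z j"
      by (simp_all only: xcoef_def ycoef_def distrib_right sum.distrib distrib_left)
    have sq: "(x + y)\<^sup>2 \<le> 2 * x\<^sup>2 + 2 * y\<^sup>2" for x y :: real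
      using sum_squares_bound[of x y] by (simp add: power2_sum)
    show ?thesis unfolding pgram0_def c
      using add_mono[OF sq[of "xcoef d W j" "xcoef d Z j"] sq[of "ycoef d W j" "ycoef d Z j"]]
      by (simp only: distrib_left add_ac)
  qed
  then have "Q k (\<lambda>t. W t + Z t) \<le> (\<Sum>r\<in>grid d. pbar r * (2 * pgram0 d W (k + r) + 2 * pgram0 d Z (k + r)))"
    unfolding Q_def by (intro sum_mono mult_left_mono pbar_nonneg)
  also have "\<dots> = 2 * Q k W + 2 * Q k Z"
    unfolding Q_def by (simp add: distrib_left sum.distrib sum_distrib_left mult_ac)
  finally show ?thesis .
qed

text \<open>
  The Cauchy-Schwarz inequality with weights \<open>\<theta>\<close>.
\<close>

lemma Q_weighted_sum:
  assumes I: "finite I" and th: "\<And>i. i \<in> I \<Longrightarrow> \<theta> i \<ge> 0"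
  shows "Q k (\<lambda>t. \<Sum>i\<in>I. \<theta> i * Z i t) \<le> (\<Sum>i\<in>I. \<theta> i) * (\<Sum>i\<in>I. \<theta> i * Q k (Z i))"
proof -
  have cs: "(\<Sum>i\<in>I. \<theta> i * x i)\<^sup>2 \<le> (\<Sum>i\<in>I. \<theta> i) * (\<Sum>i\<in>I. \<theta> i * (x i)\<^sup>2)" for x
  proof -
    have "(\<Sum>i\<in>I. sqrt (\<theta> i) * (sqrt (\<theta> i) * x i))\<^sup>2 \<le> (\<Sum>i\<in>I. (sqrt (\<theta> i))\<^sup>2) * (\<Sum>i\<in>I. (sqrt (\<theta> i) * x i)\<^sup>2)"
      by (rule Cauchy_Schwarz_ineq_sum)
    moreover have "(\<Sum>i\<in>I. sqrt (\<theta> i) * (sqrt (\<theta> i) * x i)) = (\<Sum>i\<in>I. \<theta> i * x i)"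
      by (intro sum.cong refl) (use th in \<open>simp add: mult.assoc[symmetric]\<close>)
    moreover have "(\<Sum>i\<in>I. (sqrt (\<theta> i))\<^sup>2) = (\<Sum>i\<in>I. \<theta> i)" "(\<Sum>i\<in>I. (sqrt (\<theta> i) * x i)\<^sup>2) = (\<Sum>i\<in>I. \<theta> i * (x i)\<^sup>2)"
      by (intro sum.cong refl; use th in \<open>simp add: power_mult_distrib\<close>)+
    ultimately show ?thesis by simp
  qed
  have "pgram0 d (\<lambda>t. \<Sum>i\<in>I. \<theta> i * Z i t) j \<le> (\<Sum>i\<in>I. \<theta> i) * (\<Sum>i\<in>I. \<theta> i * pgram0 d (Z i) j)" for j
  proof -
    have lin: "c * (\<Sum>t\<in>grid d. (\<Sum>i\<in>I. \<theta> i * Z i t) * f t) = (\<Sum>i\<in>I. \<theta> i * (c * (\<Sum>t\<in>grid d. Z i t * f t)))" for c and f :: "_ \<Rightarrow> real"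
      unfolding sum_distrib_left sum_distrib_right by (subst sum.swap) (simp add: mult_ac)
    have "pgram0 d (\<lambda>t. \<Sum>i\<in>I. \<theta> i * Z i t) j = (\<Sum>i\<in>I. \<theta> i * xcoef d (Z i) j)\<^sup>2 + (\<Sum>i\<in>I. \<theta> i * ycoef d (Z i) j)\<^sup>2"
      unfolding pgram0_def xcoef_def ycoef_def lin ..
    also have "\<dots> \<le> (\<Sum>i\<in>I. \<theta> i) * (\<Sum>i\<in>I. \<theta> i * (xcoef d (Z i) j)\<^sup>2) + (\<Sum>i\<in>I. \<theta> i) * (\<Sum>i\<in>I. \<theta> i * (ycoef d (Z i) j)\<^sup>2)"
      by (intro add_mono cs)
    also have "\<dots> = (\<Sum>i\<in>I. \<theta> i) * (\<Sum>i\<in>I. \<theta> i * pgram0 d (Z i) j)"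
      by (simp add: pgram0_def distrib_left sum.distrib)
    finally show ?thesis .
  qed
  then have "Q k (\<lambda>t. \<Sum>i\<in>I. \<theta> i * Z i t) \<le> (\<Sum>r\<in>grid d. pbar r * ((\<Sum>i\<in>I. \<theta> i) * (\<Sum>i\<in>I. \<theta> i * pgram0 d (Z i) (k + r))))"
    unfolding Q_def by (intro sum_mono mult_left_mono pbar_nonneg)
  also have "\<dots> = (\<Sum>i\<in>I. \<theta> i) * (\<Sum>r\<in>grid d. \<Sum>i\<in>I. pbar r * (\<theta> i * pgram0 d (Z i) (k + r)))"
    by (simp add: sum_distrib_left mult_ac)
  also have "(\<Sum>r\<in>grid d. \<Sum>i\<in>I. pbar r * (\<theta> i * pgram0 d (Z i) (k + r))) = (\<Sum>i\<in>I. \<theta> i * Q k (Z i))"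
    unfolding Q_def by (subst sum.swap) (simp add: sum_distrib_left mult_ac)
  finally show ?thesis .
qed

end

section \<open>Smoothed periodograms of contracting fields\<close>

lemma (in prob_space) pow4_expectation_le:
  fixes U :: "'a \<Rightarrow> real"
  assumes U: "integrable M U" "integrable M (\<lambda>\<omega>. U \<omega> ^ 4)"
  shows "(expectation U) ^ 4 \<le> expectation (\<lambda>\<omega>. U \<omega> ^ 4)"
proof -
  let ?m = "expectation U"
  have tangent: "?m ^ 4 + 4 * ?m ^ 3 * (x - ?m) \<le> x ^ 4" for x :: real
  proof -
    have "x ^ 4 - (?m ^ 4 + 4 * ?m ^ 3 * (x - ?m)) = (x - ?m)\<^sup>2 * ((x + ?m)\<^sup>2 + 2 * ?m\<^sup>2)"
      by (simp add: power_numeral_reduce) algebra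
    also have "\<dots> \<ge> 0" by simp
    finally show ?thesis by simp
  qed
  have "expectation (\<lambda>\<omega>. ?m ^ 4 + 4 * ?m ^ 3 * (U \<omega> - ?m)) \<le> expectation (\<lambda>\<omega>. U \<omega> ^ 4)"
    by (intro integral_mono U(2) tangent) (use U in auto)
  then show ?thesis using U by (simp add: prob_space)
qed

lemma pow4_add_le: "(x + y) ^ 4 \<le> 8 * (x ^ 4 + y ^ 4)" for x y :: real
proof -
  have sq: "(a + b)\<^sup>2 \<le> 2 * (a\<^sup>2 + b\<^sup>2)" for a b :: real
    using sum_squares_bound[of a b] by (simp add: power2_sum)
  have "(x + y) ^ 4 = ((x + y)\<^sup>2)\<^sup>2" by (simp add: power_mult[symmetric])
  also have "\<dots> \<le> (2 * (x\<^sup>2 + y\<^sup>2))\<^sup>2" by (intro power_mono sq) simp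
  also have "\<dots> = 4 * (x\<^sup>2 + y\<^sup>2)\<^sup>2" by (subst power_mult_distrib) simp
  also have "\<dots> \<le> 4 * (2 * ((x\<^sup>2)\<^sup>2 + (y\<^sup>2)\<^sup>2))" by (intro mult_left_mono sq) simp
  finally show ?thesis by (simp add: power_mult[symmetric])
qed

lemma (in prob_space) integrable_of_pow4:
  fixes U :: "'a \<Rightarrow> real"
  assumes [measurable]: "U \<in> borel_measurable M" and U: "integrable M (\<lambda>\<omega>. U \<omega> ^ 4)"
  shows "integrable M U" "integrable M (\<lambda>\<omega>. (U \<omega>)\<^sup>2)"
proof -
  show "integrable M U"
    by (rule Bochner_Integration.integrable_bound[where f="\<lambda>\<omega>. 1 + U \<omega> ^ 4"]) (use U pow_le_1_pow4(1) in auto)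
  show "integrable M (\<lambda>\<omega>. (U \<omega>)\<^sup>2)"
    by (rule Bochner_Integration.integrable_bound[where f="\<lambda>\<omega>. 1 + U \<omega> ^ 4"])
      (use U in \<open>auto intro!: order_trans[OF pow_le_1_pow4(2)]\<close>)
qed

lemma (in prob_space) square_expectation_le:
  fixes U :: "'a \<Rightarrow> real"
  assumes [measurable]: "U \<in> borel_measurable M" and U: "integrable M (\<lambda>\<omega>. U \<omega> ^ 4)"
    and le: "expectation (\<lambda>\<omega>. U \<omega> ^ 4) \<le> \<tau> ^ 4"
  shows "expectation (\<lambda>\<omega>. (U \<omega>)\<^sup>2) \<le> \<tau>\<^sup>2"
  using integral_mult_le_of_squares(2)[of M "\<lambda>\<omega>. (U \<omega>)\<^sup>2" "\<lambda>_. 1" "\<tau>\<^sup>2" 1] U le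
  by (simp add: power_mult[symmetric] prob_space)

text \<open>
  The mean is at most the \<open>L\<^sup>4\<close> norm, so centring at most doubles that norm.
\<close>

lemma (in prob_space) centered_pow4:
  fixes U :: "'a \<Rightarrow> real"
  assumes U: "integrable M U" "integrable M (\<lambda>\<omega>. U \<omega> ^ 4)" and le: "expectation (\<lambda>\<omega>. U \<omega> ^ 4) \<le> \<tau> ^ 4"
  shows "integrable M (\<lambda>\<omega>. (U \<omega> - expectation U) ^ 4)"
    and "expectation (\<lambda>\<omega>. (U \<omega> - expectation U) ^ 4) \<le> (2 * \<tau>) ^ 4"
proof -
  have [measurable]: "U \<in> borel_measurable M" using U by auto
  have b: "(U \<omega> - expectation U) ^ 4 \<le> 8 * (U \<omega> ^ 4 + expectation U ^ 4)" for \<omega>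
    using pow4_add_le[of "U \<omega>" "- expectation U"] by simp
  show i: "integrable M (\<lambda>\<omega>. (U \<omega> - expectation U) ^ 4)"
    by (rule Bochner_Integration.integrable_bound[where f="\<lambda>\<omega>. 8 * (U \<omega> ^ 4 + expectation U ^ 4)"])
      (use U b in auto)
  have "expectation (\<lambda>\<omega>. (U \<omega> - expectation U) ^ 4) \<le> expectation (\<lambda>\<omega>. 8 * (U \<omega> ^ 4 + expectation U ^ 4))"
    by (intro integral_mono i b) (use U in auto)
  also have "\<dots> = 8 * (expectation (\<lambda>\<omega>. U \<omega> ^ 4) + expectation U ^ 4)"
    using U by (simp add: prob_space)
  also have "\<dots> \<le> 8 * (\<tau> ^ 4 + \<tau> ^ 4)"
    using pow4_expectation_le[OF U] le by (intro mult_left_mono add_mono) auto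
  finally show "expectation (\<lambda>\<omega>. (U \<omega> - expectation U) ^ 4) \<le> (2 * \<tau>) ^ 4" by (simp add: power_mult_distrib)
qed

context innovation_field
begin

text \<open>
  The variables depend on disjoint sets of innovations.
\<close>

lemma local_indep_vars:
  assumes \<psi>: "\<psi> \<in> borel_measurable S" and loc: "\<And>x x'. (\<forall>s\<in>lag_ball m. x s = x' s) \<Longrightarrow> \<psi> x = (\<psi> x' :: real)"
    and sep: "\<And>t u. t \<in> F \<Longrightarrow> u \<in> F \<Longrightarrow> t \<noteq> u \<Longrightarrow> 2 * int m - 1 \<le> \<bar>fst t - fst u\<bar> \<or> 2 * int m - 1 \<le> \<bar>snd t - snd u\<bar>"
  shows "indep_vars (\<lambda>_. borel) (\<lambda>t \<omega>. \<psi> (\<lambda>s. e (t - s) \<omega>)) F"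
proof -
  define Kt where "Kt t = (\<lambda>s. t - s) ` lag_ball m" for t
  have ind: "indep_vars (\<lambda>_. borel) e UNIV"
    using rep by (auto simp: innovation_rep_def iid_field_def)
  have dis: "disjoint_family_on Kt F"
    unfolding disjoint_family_on_def
  proof (intro ballI impI)
    fix t u assume tu: "t \<in> F" "u \<in> F" "t \<noteq> u"
    show "Kt t \<inter> Kt u = {}"
    proof (rule ccontr)
      assume "Kt t \<inter> Kt u \<noteq> {}"
      then obtain z where "z \<in> Kt t" "z \<in> Kt u" by blast
      then obtain s s' where s: "s \<in> lag_ball m" "s' \<in> lag_ball m" "z = t - s" "z = u - s'" unfolding Kt_def by blast
      then have "fst t - fst u = fst s - fst s'" "snd t - snd u = snd s - snd s'"
        by (auto simp: prod_eq_iff algebra_simps)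
      moreover have "\<bar>fst s - fst s'\<bar> \<le> 2 * int m - 2" "\<bar>snd s - snd s'\<bar> \<le> 2 * int m - 2"
        using s by (auto simp: lag_ball_def)
      ultimately show False using sep[OF tu] by auto
    qed
  qed
  have r: "indep_vars (\<lambda>t. PiM (Kt t) (\<lambda>_. borel)) (\<lambda>t \<omega>. restrict (\<lambda>i. e i \<omega>) (Kt t)) F"
    by (rule indep_vars_restrict[OF ind _ dis]) simp
  \<comment> \<open>Outside the ball, where \<open>\<psi>\<close> is constant, the value \<open>0\<close> is a placeholder.\<close>
  define f where "f t z = \<psi> (\<lambda>s. if s \<in> lag_ball m then z (t - s) else 0)" for t z
  have fm: "f t \<in> borel_measurable (PiM (Kt t) (\<lambda>_. borel))" for t
  proof -
    have "(\<lambda>z s. if s \<in> lag_ball m then z (t - s) else (0::real)) \<in> PiM (Kt t) (\<lambda>_. borel) \<rightarrow>\<^sub>M S"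
    proof (rule measurable_PiM_single')
      show "(\<lambda>z. if s \<in> lag_ball m then z (t - s) else (0::real)) \<in> borel_measurable (PiM (Kt t) (\<lambda>_. borel))" for s
        by (cases "s \<in> lag_ball m") (auto simp: Kt_def intro!: measurable_component_singleton)
    qed (auto simp: space_PiM)
    from measurable_compose[OF this \<psi>] show ?thesis by (simp add: f_def[abs_def])
  qed
  have "indep_vars (\<lambda>_. borel) (\<lambda>t \<omega>. f t (restrict (\<lambda>i. e i \<omega>) (Kt t))) F"
    by (rule indep_vars_compose2[OF r]) (rule fm)
  moreover have "f t (restrict (\<lambda>i. e i \<omega>) (Kt t)) = \<psi> (\<lambda>s. e (t - s) \<omega>)" for t \<omega>
    unfolding f_def by (rule loc) (auto simp: Kt_def)
  ultimately show ?thesis by simp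
qed

lemma expectation_shift_invariant:
  assumes [measurable]: "\<psi> \<in> borel_measurable S"
  shows "expectation (\<lambda>\<omega>. \<psi> (\<lambda>s. e (t - s) \<omega>)) = (LINT x|P. \<psi> x :: real)"
  using integral_distr[OF e_map_meas, of \<psi> t] unfolding distr_innovations by simp

definition residue_class :: "nat \<Rightarrow> int \<times> int \<Rightarrow> (int \<times> int) set" where
  "residue_class L c = {t. fst t mod int L = fst c \<and> snd t mod int L = snd c}"

lemma residue_class_sep:
  assumes "L > 0" "t \<in> residue_class L c" "u \<in> residue_class L c" "t \<noteq> u"
  shows "int L \<le> \<bar>fst t - fst u\<bar> \<or> int L \<le> \<bar>snd t - snd u\<bar>"
proof -
  have key: "int L \<le> \<bar>x - y\<bar>" if "x mod int L = y mod int L" "x \<noteq> y" for x y :: int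
  proof -
    have "int L dvd x - y" using that by (simp add: mod_eq_dvd_iff)
    then show ?thesis using zdvd_imp_le[of "int L" "\<bar>x - y\<bar>"] that by simp
  qed
  show ?thesis using assms key[of "fst t" "fst u"] key[of "snd t" "snd u"] by (auto simp: residue_class_def prod_eq_iff)
qed

text \<open>
  The maximum over \<open>k\<close> of nonnegative fourth powers is bounded by their sum. Within a residue class the variables are
  independent, so each of the \<open>gsize d\<close> terms has mean at most \<open>(32 B)\<^sup>2\<close>.
\<close>

lemma residue_class_sup_bound:
  assumes sw: "smoothing_weights d p B" and \<psi>: "\<psi> \<in> borel_measurable S"
    and loc: "\<And>x x'. (\<forall>s\<in>lag_ball m. x s = x' s) \<Longrightarrow> \<psi> x = \<psi> x'"
    and L: "int L \<ge> 2 * int m - 1" "L > 0"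
    and mom: "\<And>t. integrable M (\<lambda>\<omega>. \<psi> (\<lambda>s. e (t - s) \<omega>) ^ 4)" "\<And>t. expectation (\<lambda>\<omega>. \<psi> (\<lambda>s. e (t - s) \<omega>) ^ 4) \<le> 1"
      "\<And>t. expectation (\<lambda>\<omega>. \<psi> (\<lambda>s. e (t - s) \<omega>)) = 0"
  shows "\<exists>Y. integrable M Y \<and> (\<forall>\<omega>. 0 \<le> Y \<omega>) \<and> expectation Y \<le> 2 + 1024 * B\<^sup>2 * gsize d \<and>
    (\<forall>k\<in>grid d. \<forall>\<omega>. smoothing_weights.Q d p k (\<lambda>t. if t \<in> residue_class L c then \<psi> (\<lambda>s. e (t - s) \<omega>) else 0) \<le> Y \<omega>)"
proof -
  interpret sw: smoothing_weights d p B by (rule sw)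
  define F where "F = grid d \<inter> residue_class L c"
  have F: "F \<subseteq> grid d" "finite F" by (auto simp: F_def)
  let ?X = "\<lambda>t \<omega>. \<psi> (\<lambda>s. e (t - s) \<omega>)"
  have ind: "indep_vars (\<lambda>_. borel) ?X F"
    by (rule local_indep_vars[OF \<psi> loc]) (use residue_class_sep[OF L(2)] L in \<open>fastforce simp: F_def\<close>)+
  have Xm[measurable]: "?X t \<in> borel_measurable M" for t
    by (rule measurable_compose[OF e_map_meas \<psi>])
  let ?O = "\<lambda>k \<omega>. (\<Sum>t\<in>F. \<Sum>u\<in>F - {t}. sw.a k t u * ?X t \<omega> * ?X u \<omega>) ^ 4"
  have off: "integrable M (?O k)" "expectation (?O k) \<le> 1024 * B\<^sup>2" for k
  proof -
    have o: "integrable M (?O k) \<and> expectation (?O k) \<le> (32 * (\<Sum>t\<in>F. \<Sum>u\<in>F - {t}. (sw.a k t u)\<^sup>2))\<^sup>2"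
      by (rule fourth_moment_offdiagonal_form[OF F(2) ind]) (use mom in auto)
    then show "integrable M (?O k)" by blast
    have "(\<Sum>t\<in>F. \<Sum>u\<in>F - {t}. (sw.a k t u)\<^sup>2) \<le> (\<Sum>t\<in>F. \<Sum>u\<in>grid d. (sw.a k t u)\<^sup>2)"
      by (intro sum_mono sum_mono2) (use F in auto)
    also have "\<dots> \<le> (\<Sum>t\<in>grid d. \<Sum>u\<in>grid d. (sw.a k t u)\<^sup>2)"
      by (intro sum_mono2) (use F in \<open>auto intro!: sum_nonneg\<close>)
    also have "\<dots> \<le> B" by (rule sw.sum_a_squared)
    finally have "(32 * (\<Sum>t\<in>F. \<Sum>u\<in>F - {t}. (sw.a k t u)\<^sup>2))\<^sup>2 \<le> (32 * B)\<^sup>2"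
      by (intro power_mono mult_left_mono) (auto intro!: mult_nonneg_nonneg sum_nonneg)
    with o show "expectation (?O k) \<le> 1024 * B\<^sup>2" by (simp add: power_mult_distrib)
  qed
  have sq: "integrable M (\<lambda>\<omega>. (?X t \<omega>)\<^sup>2)" "expectation (\<lambda>\<omega>. (?X t \<omega>)\<^sup>2) \<le> 1" for t
    using integrable_of_pow4(2)[OF Xm mom(1)] square_expectation_le[OF Xm mom(1), where \<tau>=1] mom(2) by auto
  define Y where "Y \<omega> = (1 / gsize d) * (\<Sum>t\<in>F. (?X t \<omega>)\<^sup>2) + 1 + (\<Sum>k\<in>grid d. ?O k \<omega>)" for \<omega>
  have Yi: "integrable M Y" unfolding Y_def[abs_def]
    by (intro Bochner_Integration.integrable_add Bochner_Integration.integrable_sum integrable_mult_right sq off) auto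
  have "expectation Y = (1 / gsize d) * (\<Sum>t\<in>F. expectation (\<lambda>\<omega>. (?X t \<omega>)\<^sup>2)) + 1 + (\<Sum>k\<in>grid d. expectation (?O k))"
    unfolding Y_def[abs_def] using sq off by (simp add: prob_space)
  also have "\<dots> \<le> (1 / gsize d) * (\<Sum>t\<in>grid d. 1) + 1 + (\<Sum>k\<in>grid d. 1024 * B\<^sup>2)"
  proof (intro add_mono mult_left_mono sum_mono off order_refl)
    have "(\<Sum>t\<in>F. expectation (\<lambda>\<omega>. (?X t \<omega>)\<^sup>2)) \<le> (\<Sum>t\<in>F. 1)" by (intro sum_mono sq)
    also have "\<dots> \<le> (\<Sum>t\<in>grid d. 1)" by (intro sum_mono2) (use F in auto)
    finally show "(\<Sum>t\<in>F. expectation (\<lambda>\<omega>. (?X t \<omega>)\<^sup>2)) \<le> (\<Sum>t\<in>grid d. 1)" .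
  qed (use sw.gsize_pos in auto)
  also have "\<dots> = 2 + 1024 * B\<^sup>2 * gsize d" using sw.gsize_pos sw.card_grid by simp
  finally have Ye: "expectation Y \<le> 2 + 1024 * B\<^sup>2 * gsize d" .
  have Onn: "?O k \<omega> \<ge> 0" for k \<omega> by simp
  have Y0: "0 \<le> Y \<omega>" for \<omega>
    unfolding Y_def using sw.gsize_pos by (intro add_nonneg_nonneg mult_nonneg_nonneg sum_nonneg Onn) auto
  have QY: "sw.Q k (\<lambda>t. if t \<in> residue_class L c then ?X t \<omega> else 0) \<le> Y \<omega>" if k: "k \<in> grid d" for k \<omega>
  proof -
    have "sw.Q k (\<lambda>t. if t \<in> residue_class L c then ?X t \<omega> else 0) = sw.Q k (\<lambda>t. if t \<in> F then ?X t \<omega> else 0)"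
      unfolding sw.Q_quadratic by (intro sum.cong refl) (auto simp: F_def)
    also have "\<dots> \<le> (1 / gsize d) * (\<Sum>t\<in>F. (?X t \<omega>)\<^sup>2) + 1 + ?O k \<omega>"
      by (rule sw.Q_restricted[OF F(1)])
    also have "?O k \<omega> \<le> (\<Sum>k\<in>grid d. ?O k \<omega>)" by (rule member_le_sum[OF k]) (auto simp: Onn)
    finally show ?thesis by (simp add: Y_def)
  qed
  show ?thesis using Yi Y0 Ye QY by blast
qed

lemma summable_square_geometric:
  assumes r: "0 < \<rho>" "\<rho> < (1::real)"
  shows "summable (\<lambda>m. (2 * real m + 1)\<^sup>2 * \<rho> ^ m)"
proof -
  define q where "q = sqrt (sqrt \<rho>)"
  have q4: "q ^ 4 = (q\<^sup>2)\<^sup>2" by (simp add: power_mult[symmetric])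
  have q: "0 < q" "q < 1" "q ^ 4 = \<rho>"
    unfolding q4 using r by (auto simp: q_def)
  define \<delta> where "\<delta> = 1 / q - 1"
  have \<delta>: "\<delta> > 0" using q by (simp add: \<delta>_def)
  have b: "(2 * real m + 1) * q ^ m \<le> 2 / \<delta> + 1" for m
  proof -
    have "1 + real m * \<delta> \<le> (1 + \<delta>) ^ m" using \<delta> by (intro Bernoulli_inequality) auto
    also have "(1 + \<delta>) ^ m = 1 / q ^ m" by (simp add: \<delta>_def power_one_over)
    finally have "(1 + real m * \<delta>) * q ^ m \<le> 1" using q by (simp add: field_simps)
    moreover have "0 \<le> q ^ m" using q by simp
    ultimately have "\<delta> * (real m * q ^ m) \<le> 1" by (simp add: algebra_simps)
    then have 1: "real m * q ^ m \<le> 1 / \<delta>" using \<delta> by (simp add: field_simps)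
    have 2: "q ^ m \<le> 1" using q by (intro power_le_one) auto
    show ?thesis using 1 2 by (simp add: algebra_simps)
  qed
  show ?thesis
  proof (rule summable_comparison_test')
    show "summable (\<lambda>m. (2 / \<delta> + 1)\<^sup>2 * (q\<^sup>2) ^ m)"
      using q by (intro summable_mult summable_geometric) (auto simp: power_less_one_iff abs_square_less_1)
    fix m
    have "(2 * real m + 1)\<^sup>2 * \<rho> ^ m = ((2 * real m + 1) * q ^ m)\<^sup>2 * (q\<^sup>2) ^ m"
      unfolding q(3)[symmetric] by (simp add: power_mult_distrib power_mult[symmetric] mult.commute power_add[symmetric])
    also have "\<dots> \<le> (2 / \<delta> + 1)\<^sup>2 * (q\<^sup>2) ^ m"
      using q by (intro mult_right_mono power_mono b) auto
    finally show "norm ((2 * real m + 1)\<^sup>2 * \<rho> ^ m) \<le> (2 / \<delta> + 1)\<^sup>2 * (q\<^sup>2) ^ m"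
      using r by simp
  qed
qed

text \<open>
  The approximants \<open>H m\<close> telescope into increments whose \<open>L\<^sup>4\<close> norm decays geometrically, and the \<open>m\<close>-th increment
  is split into \<open>(2 m + 1)\<^sup>2\<close> residue classes; the weighted Cauchy-Schwarz inequality recombines them
  with a finite total weight. The telescope stops at an \<open>N\<close> depending on the grid, beyond which even
  the crude energy bound on the remainder is at most one.
\<close>

lemma smoothed_periodogram_bound:
  fixes H :: "nat \<Rightarrow> (int \<times> int \<Rightarrow> real) \<Rightarrow> real"
  assumes C: "0 < C" and \<rho>: "0 < \<rho>" "\<rho> < (1::real)"
    and Hm: "\<And>m. H m \<in> borel_measurable S"
    and Hloc: "\<And>m x x'. (\<forall>s\<in>lag_ball m. x s = x' s) \<Longrightarrow> H m x = H m x'"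
    and Hi: "\<And>m t. integrable M (\<lambda>\<omega>. (V t \<omega> - \<mu> - H m (\<lambda>s. e (t - s) \<omega>)) ^ 4)"
    and He: "\<And>m t. expectation (\<lambda>\<omega>. (V t \<omega> - \<mu> - H m (\<lambda>s. e (t - s) \<omega>)) ^ 4) \<le> (C * \<rho> ^ m) ^ 4"
    and mean: "\<And>t. integrable M (V t)" "\<And>t. expectation (V t) = \<mu>"
  shows "\<exists>\<Theta>. \<forall>d p B. smoothing_weights d p B \<longrightarrow>
    (\<exists>Y. integrable M Y \<and> (\<forall>\<omega>. 0 \<le> Y \<omega>) \<and> expectation Y \<le> \<Theta> * (2 + 1024 * B\<^sup>2 * gsize d) + 2 \<and>
      (\<forall>k\<in>grid d. \<forall>\<omega>. smoothing_weights.Q d p k (\<lambda>t. V t \<omega> - \<mu>) \<le> Y \<omega>))"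
proof -
  define h where "h m t \<omega> = H m (\<lambda>s. e (t - s) \<omega>)" for m t \<omega>
  have hm[measurable]: "h m t \<in> borel_measurable M" for m t
    unfolding h_def[abs_def] by (rule measurable_compose[OF e_map_meas Hm])
  define E where "E m t \<omega> = V t \<omega> - \<mu> - h m t \<omega>" for m t \<omega>
  have Em[measurable]: "E m t \<in> borel_measurable M" for m t unfolding E_def[abs_def] by measurable
  have E4: "integrable M (\<lambda>\<omega>. E m t \<omega> ^ 4)" "expectation (\<lambda>\<omega>. E m t \<omega> ^ 4) \<le> (C * \<rho> ^ m) ^ 4" for m t
    using Hi He by (simp_all add: E_def h_def)
  have E1: "integrable M (E m t)" "integrable M (\<lambda>\<omega>. (E m t \<omega>)\<^sup>2)" for m t
    by (rule integrable_of_pow4[OF Em E4(1)])+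
  have h1: "integrable M (h m t)" for m t
  proof -
    have "h m t = (\<lambda>\<omega>. V t \<omega> - \<mu> - E m t \<omega>)" by (simp add: E_def fun_eq_iff)
    then show ?thesis using mean E1 by simp
  qed
  define U where "U m x = H (Suc m) x - H m x" for m x
  have Um[measurable]: "U m \<in> borel_measurable S" for m unfolding U_def[abs_def] using Hm by measurable
  define u where "u m = (LINT x|P. U m x)" for m
  \<comment> \<open>One factor 2 is for the difference of two errors, the other for centring.\<close>
  define \<tau> where "\<tau> m = 4 * C * \<rho> ^ m" for m
  have \<tau>: "\<tau> m > 0" for m using C \<rho> by (simp add: \<tau>_def)
  define \<psi> where "\<psi> m x = (U m x - u m) / \<tau> m" for m x
  have \<psi>m: "\<psi> m \<in> borel_measurable S" for m unfolding \<psi>_def[abs_def] by measurable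
  have \<psi>loc: "\<psi> m x = \<psi> m x'" if "\<forall>s\<in>lag_ball (Suc m). x s = x' s" for m x x'
  proof -
    have "lag_ball m \<subseteq> lag_ball (Suc m)" by (auto simp: lag_ball_def)
    then have "H m x = H m x'" "H (Suc m) x = H (Suc m) x'" using that by (auto intro!: Hloc)
    then show ?thesis by (simp add: \<psi>_def U_def)
  qed
  have Uh: "U m (\<lambda>s. e (t - s) \<omega>) = h (Suc m) t \<omega> - h m t \<omega>" for m t \<omega> by (simp add: U_def h_def)
  have Ui: "integrable M (\<lambda>\<omega>. U m (\<lambda>s. e (t - s) \<omega>))" for m t unfolding Uh using h1 by simp
  have u: "expectation (\<lambda>\<omega>. U m (\<lambda>s. e (t - s) \<omega>)) = u m" for m t
    unfolding u_def by (rule expectation_shift_invariant) (rule Um)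
  have U4: "integrable M (\<lambda>\<omega>. U m (\<lambda>s. e (t - s) \<omega>) ^ 4)" "expectation (\<lambda>\<omega>. U m (\<lambda>s. e (t - s) \<omega>) ^ 4) \<le> (2 * (C * \<rho> ^ m)) ^ 4" for m t
  proof -
    have b: "U m (\<lambda>s. e (t - s) \<omega>) ^ 4 \<le> 8 * (E m t \<omega> ^ 4 + E (Suc m) t \<omega> ^ 4)" for \<omega>
    proof -
      have e: "U m (\<lambda>s. e (t - s) \<omega>) = E m t \<omega> + - E (Suc m) t \<omega>" by (simp add: Uh E_def)
      show ?thesis using pow4_add_le[of "E m t \<omega>" "- E (Suc m) t \<omega>"] unfolding e by simp
    qed
    have m[measurable]: "(\<lambda>\<omega>. U m (\<lambda>s. e (t - s) \<omega>)) \<in> borel_measurable M" using Ui by auto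
    show i: "integrable M (\<lambda>\<omega>. U m (\<lambda>s. e (t - s) \<omega>) ^ 4)"
      by (rule Bochner_Integration.integrable_bound[where f="\<lambda>\<omega>. 8 * (E m t \<omega> ^ 4 + E (Suc m) t \<omega> ^ 4)"])
        (use E4 b in auto)
    have "expectation (\<lambda>\<omega>. U m (\<lambda>s. e (t - s) \<omega>) ^ 4) \<le> expectation (\<lambda>\<omega>. 8 * (E m t \<omega> ^ 4 + E (Suc m) t \<omega> ^ 4))"
      by (intro integral_mono i b) (use E4 in auto)
    also have "\<dots> = 8 * (expectation (\<lambda>\<omega>. E m t \<omega> ^ 4) + expectation (\<lambda>\<omega>. E (Suc m) t \<omega> ^ 4))"
      using E4 by simp
    also have "\<dots> \<le> 8 * ((C * \<rho> ^ m) ^ 4 + (C * \<rho> ^ m) ^ 4)"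
    proof (intro mult_left_mono add_mono E4)
      have "(C * \<rho> ^ Suc m) ^ 4 \<le> (C * \<rho> ^ m) ^ 4"
        using C \<rho> by (intro power_mono mult_left_mono) (auto intro: mult_left_le_one_le)
      then show "expectation (\<lambda>\<omega>. E (Suc m) t \<omega> ^ 4) \<le> (C * \<rho> ^ m) ^ 4" using E4(2)[of "Suc m" t] by linarith
    qed simp
    finally show "expectation (\<lambda>\<omega>. U m (\<lambda>s. e (t - s) \<omega>) ^ 4) \<le> (2 * (C * \<rho> ^ m)) ^ 4"
      by (subst power_mult_distrib) simp
  qed
  have \<psi>mom: "integrable M (\<lambda>\<omega>. \<psi> m (\<lambda>s. e (t - s) \<omega>) ^ 4)" "expectation (\<lambda>\<omega>. \<psi> m (\<lambda>s. e (t - s) \<omega>) ^ 4) \<le> 1"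
    "expectation (\<lambda>\<omega>. \<psi> m (\<lambda>s. e (t - s) \<omega>)) = 0" for m t
  proof -
    note c = centered_pow4[OF Ui U4, of m t, unfolded u]
    have p: "\<psi> m (\<lambda>s. e (t - s) \<omega>) ^ 4 = (U m (\<lambda>s. e (t - s) \<omega>) - u m) ^ 4 / \<tau> m ^ 4" for \<omega>
      by (simp add: \<psi>_def power_divide)
    show "integrable M (\<lambda>\<omega>. \<psi> m (\<lambda>s. e (t - s) \<omega>) ^ 4)" unfolding p using c(1) by simp
    have "expectation (\<lambda>\<omega>. \<psi> m (\<lambda>s. e (t - s) \<omega>) ^ 4) = expectation (\<lambda>\<omega>. (U m (\<lambda>s. e (t - s) \<omega>) - u m) ^ 4) / \<tau> m ^ 4"
      unfolding p by simp
    also have "\<dots> \<le> \<tau> m ^ 4 / \<tau> m ^ 4"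
      using c(2) \<tau>[of m] by (intro divide_right_mono) (simp_all add: \<tau>_def mult.assoc)
    also have "\<dots> = 1" using \<tau>[of m] by simp
    finally show "expectation (\<lambda>\<omega>. \<psi> m (\<lambda>s. e (t - s) \<omega>) ^ 4) \<le> 1" .
    show "expectation (\<lambda>\<omega>. \<psi> m (\<lambda>s. e (t - s) \<omega>)) = 0"
      unfolding \<psi>_def using Ui u by (simp add: prob_space)
  qed
  have sum1: "summable (\<lambda>m. (2 * real m + 1)\<^sup>2 * \<tau> m)"
  proof -
    have "(\<lambda>m. (2 * real m + 1)\<^sup>2 * \<tau> m) = (\<lambda>m. 4 * C * ((2 * real m + 1)\<^sup>2 * \<rho> ^ m))" by (simp add: \<tau>_def fun_eq_iff)
    then show ?thesis using summable_square_geometric[OF \<rho>] by (simp only: summable_mult)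
  qed
  define T where "T = (\<Sum>m. (2 * real m + 1)\<^sup>2 * \<tau> m)"
  have T: "(\<Sum>m<N. (2 * real m + 1)\<^sup>2 * \<tau> m) \<le> T" for N
    unfolding T_def by (rule sum_le_suminf[OF sum1]) (use \<tau> in \<open>auto intro!: mult_nonneg_nonneg less_imp_le\<close>)
  have "\<exists>Y. integrable M Y \<and> (\<forall>\<omega>. 0 \<le> Y \<omega>) \<and> expectation Y \<le> 2 * T\<^sup>2 * (2 + 1024 * B\<^sup>2 * gsize d) + 2 \<and>
      (\<forall>k\<in>grid d. \<forall>\<omega>. smoothing_weights.Q d p k (\<lambda>t. V t \<omega> - \<mu>) \<le> Y \<omega>)"
    if sw: "smoothing_weights d p B" for d p B
  proof -
    interpret sw: smoothing_weights d p B by (rule sw)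
    let ?A = "2 + 1024 * B\<^sup>2 * gsize d"
    have A0: "?A \<ge> 0" using sw.gsize_pos by (intro add_nonneg_nonneg mult_nonneg_nonneg) auto
    \<comment> \<open>The telescope is cut where the energy bound on the remainder becomes harmless.\<close>
    have "\<exists>N. B * gsize d * (C * \<rho> ^ N)\<^sup>2 \<le> 1"
    proof -
      have "(\<lambda>N. B * gsize d * (C * \<rho> ^ N)\<^sup>2) \<longlonglongrightarrow> B * gsize d * (C * 0)\<^sup>2"
        using \<rho> by (intro tendsto_intros LIMSEQ_power_zero) auto
      then have "\<forall>\<^sub>F N in sequentially. B * gsize d * (C * \<rho> ^ N)\<^sup>2 < 1" by (rule order_tendstoD(2)) simp
      then show ?thesis by (auto simp: eventually_sequentially intro: less_imp_le)
    qed
    then obtain N where N: "B * gsize d * (C * \<rho> ^ N)\<^sup>2 \<le> 1" by blast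
    let ?L = "\<lambda>m. 2 * m + 1 :: nat"
    define good where "good m c Y \<longleftrightarrow> integrable M Y \<and> (\<forall>\<omega>. 0 \<le> Y \<omega>) \<and> expectation Y \<le> ?A \<and>
      (\<forall>k\<in>grid d. \<forall>\<omega>. sw.Q k (\<lambda>t. if t \<in> residue_class (?L m) c then \<psi> m (\<lambda>s. e (t - s) \<omega>) else 0) \<le> Y \<omega>)" for m c Y
    have "\<exists>Y. good m c Y" for m c
      unfolding good_def
    proof (rule residue_class_sup_bound[OF sw \<psi>m, where m="Suc m"])
      show "\<psi> m x = \<psi> m x'" if "\<forall>s\<in>lag_ball (Suc m). x s = x' s" for x x' using that by (rule \<psi>loc)
      show "2 * int (Suc m) - 1 \<le> int (?L m)" "0 < ?L m" by simp_all
    qed (rule \<psi>mom)+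
    then have some: "good m c (SOME Y. good m c Y)" for m c by (rule someI_ex)
    obtain Y where "\<And>m c. good m c (Y m c)"
      by (rule that[of "\<lambda>m c. SOME Y. good m c Y"]) (rule some)
    then have Y: "\<And>m c. integrable M (Y m c)" "\<And>m c \<omega>. 0 \<le> Y m c \<omega>" "\<And>m c. expectation (Y m c) \<le> ?A"
      "\<And>m c k \<omega>. k \<in> grid d \<Longrightarrow> sw.Q k (\<lambda>t. if t \<in> residue_class (?L m) c then \<psi> m (\<lambda>s. e (t - s) \<omega>) else 0) \<le> Y m c \<omega>"
      unfolding good_def by blast+
    have EY0: "0 \<le> expectation (Y m c)" for m c
      by (rule Bochner_Integration.integral_nonneg) (rule Y(2))
    define CC where "CC m = {0..<int (?L m)} \<times> {0..<int (?L m)}" for m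
    define I where "I = Sigma {..<N} CC"
    have fI: "finite I" unfolding I_def CC_def by auto
    define \<theta> where "\<theta> i = \<tau> (fst i)" for i :: "nat \<times> int \<times> int"
    have \<theta>: "\<theta> i \<ge> 0" for i using \<tau>[of "fst i"] by (simp add: \<theta>_def)
    have s\<theta>: "(\<Sum>i\<in>I. \<theta> i) \<le> T" "0 \<le> (\<Sum>i\<in>I. \<theta> i)"
    proof -
      have "(\<Sum>i\<in>I. \<theta> i) = (\<Sum>m<N. \<Sum>c\<in>CC m. \<tau> m)"
        unfolding I_def \<theta>_def by (subst sum.Sigma) (auto simp: CC_def case_prod_beta')
      also have "\<dots> = (\<Sum>m<N. (2 * real m + 1)\<^sup>2 * \<tau> m)"
        by (intro sum.cong refl) (simp add: CC_def card_cartesian_product power2_eq_square add.commute)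
      also have "\<dots> \<le> T" by (rule T)
      finally show "(\<Sum>i\<in>I. \<theta> i) \<le> T" .
      show "0 \<le> (\<Sum>i\<in>I. \<theta> i)" using \<theta> by (rule sum_nonneg)
    qed
    define Z where "Z i \<omega> t = (if t \<in> residue_class (?L (fst i)) (snd i) then \<psi> (fst i) (\<lambda>s. e (t - s) \<omega>) else 0)" for i \<omega> t
    define R where "R t \<omega> = E N t \<omega> - expectation (E N t)" for t \<omega>
    have Zsum: "(\<Sum>i\<in>I. \<theta> i * Z i \<omega> t) = (h N t \<omega> - expectation (h N t))" for t \<omega>
    proof -
      have "(\<Sum>i\<in>I. \<theta> i * Z i \<omega> t) = (\<Sum>m<N. \<Sum>c\<in>CC m. \<tau> m * (if t \<in> residue_class (?L m) c then \<psi> m (\<lambda>s. e (t - s) \<omega>) else 0))"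
        unfolding I_def \<theta>_def Z_def by (subst sum.Sigma) (auto simp: CC_def case_prod_beta')
      also have "\<dots> = (\<Sum>m<N. U m (\<lambda>s. e (t - s) \<omega>) - u m)"
      proof (rule sum.cong[OF refl])
        fix m
        let ?c = "(fst t mod int (?L m), snd t mod int (?L m))"
        have Lp: "int (?L m) > 0" by simp
        have "t \<in> residue_class (?L m) c \<longleftrightarrow> c = ?c" if "c \<in> CC m" for c
          using that by (auto simp: residue_class_def CC_def prod_eq_iff)
        then have "(\<Sum>c\<in>CC m. \<tau> m * (if t \<in> residue_class (?L m) c then \<psi> m (\<lambda>s. e (t - s) \<omega>) else 0))
           = (\<Sum>c\<in>CC m. if c = ?c then \<tau> m * \<psi> m (\<lambda>s. e (t - s) \<omega>) else 0)"
          by (intro sum.cong refl) simp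
        also have "\<dots> = \<tau> m * \<psi> m (\<lambda>s. e (t - s) \<omega>)"
        proof -
          have "?c \<in> CC m" unfolding CC_def using pos_mod_sign[OF Lp] pos_mod_bound[OF Lp] by simp
          moreover have "finite (CC m)" by (simp add: CC_def)
          ultimately show ?thesis by simp
        qed
        also have "\<dots> = U m (\<lambda>s. e (t - s) \<omega>) - u m" using \<tau>[of m] by (simp add: \<psi>_def)
        finally show "(\<Sum>c\<in>CC m. \<tau> m * (if t \<in> residue_class (?L m) c then \<psi> m (\<lambda>s. e (t - s) \<omega>) else 0)) = U m (\<lambda>s. e (t - s) \<omega>) - u m" .
      qed
      also have "\<dots> = (\<Sum>m<N. (h (Suc m) t \<omega> - expectation (h (Suc m) t)) - (h m t \<omega> - expectation (h m t)))"
      proof (rule sum.cong[OF refl])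
        fix m
        have "u m = expectation (h (Suc m) t) - expectation (h m t)"
          unfolding u[symmetric, of m t] Uh using h1 by simp
        then show "U m (\<lambda>s. e (t - s) \<omega>) - u m = (h (Suc m) t \<omega> - expectation (h (Suc m) t)) - (h m t \<omega> - expectation (h m t))"
          by (simp add: Uh)
      qed
      also have "\<dots> = (h N t \<omega> - expectation (h N t)) - (h 0 t \<omega> - expectation (h 0 t))"
        by (rule sum_lessThan_telescope)
      also have "h 0 t \<omega> - expectation (h 0 t) = 0"
      proof -
        \<comment> \<open>The ball of radius \<open>0\<close> is empty, so the first approximant is constant.\<close>
        have "h 0 t = (\<lambda>_. H 0 (\<lambda>_. 0))" by (auto simp: h_def fun_eq_iff lag_ball_def intro!: Hloc)
        then show ?thesis by (simp add: prob_space)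
      qed
      finally show ?thesis by simp
    qed
    have split: "V t \<omega> - \<mu> = (\<Sum>i\<in>I. \<theta> i * Z i \<omega> t) + R t \<omega>" for t \<omega>
    proof -
      have "expectation (E N t) = - expectation (h N t)"
        unfolding E_def using mean h1 by (simp add: prob_space)
      then show ?thesis unfolding Zsum R_def by (simp add: E_def)
    qed
    have R2: "integrable M (\<lambda>\<omega>. (R t \<omega>)\<^sup>2)" "expectation (\<lambda>\<omega>. (R t \<omega>)\<^sup>2) \<le> (C * \<rho> ^ N)\<^sup>2" for t
    proof -
      let ?m = "expectation (E N t)"
      have ex: "(R t \<omega>)\<^sup>2 = (E N t \<omega>)\<^sup>2 - 2 * ?m * E N t \<omega> + ?m\<^sup>2" for \<omega>
        by (simp add: R_def power2_diff)
      show "integrable M (\<lambda>\<omega>. (R t \<omega>)\<^sup>2)" unfolding ex using E1 by simp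
      have "expectation (\<lambda>\<omega>. (R t \<omega>)\<^sup>2) = expectation (\<lambda>\<omega>. (E N t \<omega>)\<^sup>2) - ?m\<^sup>2"
        unfolding ex using E1 by (simp add: prob_space power2_eq_square)
      also have "\<dots> \<le> expectation (\<lambda>\<omega>. (E N t \<omega>)\<^sup>2)" by simp
      also have "\<dots> \<le> (C * \<rho> ^ N)\<^sup>2" by (rule square_expectation_le[OF Em E4])
      finally show "expectation (\<lambda>\<omega>. (R t \<omega>)\<^sup>2) \<le> (C * \<rho> ^ N)\<^sup>2" .
    qed
    define YY where "YY \<omega> = 2 * ((\<Sum>i\<in>I. \<theta> i) * (\<Sum>i\<in>I. \<theta> i * Y (fst i) (snd i) \<omega>)) + 2 * (B * (\<Sum>t\<in>grid d. (R t \<omega>)\<^sup>2))" for \<omega>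
    have "integrable M YY" unfolding YY_def[abs_def]
      by (intro Bochner_Integration.integrable_add Bochner_Integration.integrable_sum integrable_mult_right Y R2)
    moreover have "0 \<le> YY \<omega>" for \<omega>
      unfolding YY_def by (intro add_nonneg_nonneg mult_nonneg_nonneg sum_nonneg s\<theta> \<theta> Y sw.B_nonneg) auto
    moreover have "expectation YY \<le> 2 * T\<^sup>2 * ?A + 2"
    proof -
      have "expectation YY = 2 * ((\<Sum>i\<in>I. \<theta> i) * (\<Sum>i\<in>I. \<theta> i * expectation (Y (fst i) (snd i)))) + 2 * (B * (\<Sum>t\<in>grid d. expectation (\<lambda>\<omega>. (R t \<omega>)\<^sup>2)))"
        unfolding YY_def[abs_def] using Y(1) R2(1) by simp
      also have "\<dots> \<le> 2 * (T * (T * ?A)) + 2 * (B * (\<Sum>t\<in>grid d. (C * \<rho> ^ N)\<^sup>2))"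
      proof (intro add_mono mult_left_mono sum_mono R2 sw.B_nonneg)
        have "(\<Sum>i\<in>I. \<theta> i * expectation (Y (fst i) (snd i))) \<le> (\<Sum>i\<in>I. \<theta> i * ?A)"
          by (intro sum_mono mult_left_mono Y \<theta>)
        also have "\<dots> = (\<Sum>i\<in>I. \<theta> i) * ?A" by (rule sum_distrib_right[symmetric])
        also have "\<dots> \<le> T * ?A" by (intro mult_right_mono s\<theta> A0)
        finally have "(\<Sum>i\<in>I. \<theta> i * expectation (Y (fst i) (snd i))) \<le> T * ?A" .
        then show "(\<Sum>i\<in>I. \<theta> i) * (\<Sum>i\<in>I. \<theta> i * expectation (Y (fst i) (snd i))) \<le> T * (T * ?A)"
          using s\<theta> A0 by (intro mult_mono) (auto intro!: sum_nonneg mult_nonneg_nonneg \<theta> EY0)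
      qed auto
      also have "B * (\<Sum>t\<in>grid d. (C * \<rho> ^ N)\<^sup>2) \<le> 1" using N by (simp add: sw.card_grid mult.assoc)
      finally show ?thesis by (simp add: power2_eq_square mult.assoc)
    qed
    moreover have "sw.Q k (\<lambda>t. V t \<omega> - \<mu>) \<le> YY \<omega>" if k: "k \<in> grid d" for k \<omega>
    proof -
      have "sw.Q k (\<lambda>t. V t \<omega> - \<mu>) \<le> 2 * sw.Q k (\<lambda>t. \<Sum>i\<in>I. \<theta> i * Z i \<omega> t) + 2 * sw.Q k (\<lambda>t. R t \<omega>)"
        unfolding split by (rule sw.Q_add)
      also have "\<dots> \<le> 2 * ((\<Sum>i\<in>I. \<theta> i) * (\<Sum>i\<in>I. \<theta> i * sw.Q k (Z i \<omega>))) + 2 * (B * (\<Sum>t\<in>grid d. (R t \<omega>)\<^sup>2))"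
        by (intro add_mono mult_left_mono sw.Q_weighted_sum fI \<theta> sw.Q_le_energy) auto
      also have "\<dots> \<le> YY \<omega>"
        unfolding YY_def Z_def by (intro add_mono mult_left_mono sum_mono order_refl Y k \<theta> s\<theta>) auto
      finally show ?thesis .
    qed
    ultimately show ?thesis by blast
  qed
  then show ?thesis by blast
qed

end

section \<open>Smoothed periodograms in terms of sample autocovariances\<close>

context smoothing_weights
begin

text \<open>
  The modulus of the Fourier coefficient of the weights at lag \<open>r\<close>.
\<close>

definition "kappa r = cmod (\<Sum>\<^sub>\<infinity>s. iexp (freq d s \<bullet> rvec r) * complex_of_real (p s))"

lemma smooth_cos_le:
  "\<bar>\<Sum>s\<in>grid d. pbar s * cos (freq d (k + s) \<bullet> rvec r)\<bar> \<le> kappa r"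
  "\<bar>\<Sum>s\<in>grid d. pbar s * cos (freq d (k + s) \<bullet> rvec r)\<bar> \<le> 1"
proof -
  have per: "grid_periodic d (\<lambda>j. cos (freq d j \<bullet> rvec r))"
    unfolding grid_periodic_def
  proof (intro allI)
    fix j a b
    show "cos (freq d (j + (a * int (fst d), b * int (snd d))) \<bullet> rvec r) = cos (freq d j \<bullet> rvec r)"
      using arg_cong[OF iexp_freq_shift[OF d_pos, of j a b r], of Re] by (simp add: Re_exp)
  qed
  have "(\<lambda>s. norm (iexp (freq d s \<bullet> rvec r) * complex_of_real (p s))) summable_on UNIV"
    using p_summable by (simp add: norm_mult p_nonneg)
  then have sm: "(\<lambda>s. iexp (freq d s \<bullet> rvec r) * complex_of_real (p s)) summable_on UNIV"
    by (rule abs_summable_summable)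
  have "(\<Sum>s\<in>grid d. pbar s * cos (freq d (k + s) \<bullet> rvec r)) = (\<Sum>\<^sub>\<infinity>s. p s * cos (freq d (k + s) \<bullet> rvec r))"
    by (rule smooth_eq[OF per, symmetric])
  also have "\<dots> = (\<Sum>\<^sub>\<infinity>s. Re (iexp (freq d k \<bullet> rvec r) * (iexp (freq d s \<bullet> rvec r) * complex_of_real (p s))))"
  proof (rule infsum_cong)
    fix s
    show "p s * cos (freq d (k + s) \<bullet> rvec r) = Re (iexp (freq d k \<bullet> rvec r) * (iexp (freq d s \<bullet> rvec r) * complex_of_real (p s)))"
      by (simp add: freq_inner_add Re_exp Im_exp cos_add algebra_simps)
  qed
  also have "\<dots> = Re (\<Sum>\<^sub>\<infinity>s. iexp (freq d k \<bullet> rvec r) * (iexp (freq d s \<bullet> rvec r) * complex_of_real (p s)))"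
    by (rule infsum_Re[OF summable_on_cmult_right[OF sm]])
  also have "\<dots> = Re (iexp (freq d k \<bullet> rvec r) * (\<Sum>\<^sub>\<infinity>s. iexp (freq d s \<bullet> rvec r) * complex_of_real (p s)))"
    by (simp only: infsum_cmult_right[OF sm])
  finally have e: "(\<Sum>s\<in>grid d. pbar s * cos (freq d (k + s) \<bullet> rvec r)) = Re (iexp (freq d k \<bullet> rvec r) * (\<Sum>\<^sub>\<infinity>s. iexp (freq d s \<bullet> rvec r) * complex_of_real (p s)))" .
  show "\<bar>\<Sum>s\<in>grid d. pbar s * cos (freq d (k + s) \<bullet> rvec r)\<bar> \<le> kappa r"
    unfolding e kappa_def by (rule order_trans[OF abs_Re_le_cmod]) (simp add: norm_mult)
  have "\<bar>\<Sum>s\<in>grid d. pbar s * cos (freq d (k + s) \<bullet> rvec r)\<bar> \<le> (\<Sum>s\<in>grid d. \<bar>pbar s * cos (freq d (k + s) \<bullet> rvec r)\<bar>)"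
    by (rule sum_abs)
  also have "\<dots> \<le> (\<Sum>s\<in>grid d. pbar s * 1)"
    unfolding abs_mult by (intro sum_mono mult_mono) (auto simp: pbar_nonneg)
  finally show "\<bar>\<Sum>s\<in>grid d. pbar s * cos (freq d (k + s) \<bullet> rvec r)\<bar> \<le> 1" by (simp add: sum_pbar)
qed

text \<open>
  The centres \<open>\<gamma>\<close> are weighted by cosine averages of modulus at most one, the deviations by the Fourier coefficients
  of the weights.
\<close>

lemma Q_le_lag_sums:
  fixes \<gamma> :: "int \<times> int \<Rightarrow> real"
  defines "Lag \<equiv> {1 - int (fst d)..int (fst d)} \<times> {1 - int (snd d)..int (snd d)}"
  assumes D: "\<And>r. \<bar>sample_acov d 0 W r - \<gamma> r\<bar> \<le> D"
  shows "Q k W \<le> (\<Sum>r\<in>Lag. \<bar>\<gamma> r\<bar>) + D * (\<Sum>r\<in>Lag. kappa r)"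
proof -
  let ?c = "\<lambda>r. \<Sum>s\<in>grid d. pbar s * cos (freq d (k + s) \<bullet> rvec r)"
  have "Q k W = (\<Sum>s\<in>grid d. \<Sum>r\<in>Lag. pbar s * (sample_acov d 0 W r * cos (freq d (k + s) \<bullet> rvec r)))"
    unfolding Q_def pgram0_lag_sum Lag_def sum_distrib_left ..
  also have "\<dots> = (\<Sum>r\<in>Lag. \<Sum>s\<in>grid d. pbar s * (sample_acov d 0 W r * cos (freq d (k + s) \<bullet> rvec r)))"
    by (rule sum.swap)
  also have "\<dots> = (\<Sum>r\<in>Lag. sample_acov d 0 W r * ?c r)"
    by (intro sum.cong refl) (simp add: sum_distrib_left mult_ac)
  also have "\<dots> \<le> (\<Sum>r\<in>Lag. \<bar>\<gamma> r\<bar> + D * kappa r)"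
  proof (rule sum_mono)
    fix r
    have "sample_acov d 0 W r * ?c r = \<gamma> r * ?c r + (sample_acov d 0 W r - \<gamma> r) * ?c r" by (simp add: algebra_simps)
    also have "\<dots> \<le> \<bar>\<gamma> r\<bar> * \<bar>?c r\<bar> + \<bar>sample_acov d 0 W r - \<gamma> r\<bar> * \<bar>?c r\<bar>"
      unfolding abs_mult[symmetric] by (intro add_mono abs_ge_self)
    also have "\<dots> \<le> \<bar>\<gamma> r\<bar> * 1 + D * kappa r"
      by (intro add_mono mult_mono smooth_cos_le D order_refl order_trans[OF abs_ge_zero D]) auto
    finally show "sample_acov d 0 W r * ?c r \<le> \<bar>\<gamma> r\<bar> + D * kappa r" by simp
  qed
  also have "\<dots> = (\<Sum>r\<in>Lag. \<bar>\<gamma> r\<bar>) + D * (\<Sum>r\<in>Lag. kappa r)" by (simp add: sum.distrib sum_distrib_left)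
  finally show ?thesis .
qed

end

lemma sample_acov_shift: "sample_acov d 0 (\<lambda>t. W t - \<mu>) r = sample_acov d \<mu> W r"
  by (simp add: sample_acov_def)

lemma sample_acov_support:
  assumes "r \<notin> {1 - int (fst d)..int (fst d)} \<times> {1 - int (snd d)..int (snd d)}"
  shows "sample_acov d \<mu> W r = 0"
proof -
  have "{j. j \<in> grid d \<and> j + r \<in> grid d} = {}" using assms by (cases r) (auto simp: grid_def)
  then show ?thesis by (simp only: sample_acov_def sum.empty mult_zero_right)
qed

lemma bdd_above_sample_acov_deviation:
  "bdd_above (range (\<lambda>r. \<bar>sample_acov d \<mu> W r - (LINT \<omega>|M. sample_acov d \<mu> (X \<omega>) r)\<bar>))"
proof -
  let ?L = "{1 - int (fst d)..int (fst d)} \<times> {1 - int (snd d)..int (snd d)}"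
  let ?f = "\<lambda>r. \<bar>sample_acov d \<mu> W r - (LINT \<omega>|M. sample_acov d \<mu> (X \<omega>) r)\<bar>"
  have "range ?f \<subseteq> insert 0 (?f ` ?L)"
  proof
    fix y assume "y \<in> range ?f"
    then obtain r where "y = ?f r" by blast
    then show "y \<in> insert 0 (?f ` ?L)" using sample_acov_support[of r d] by (cases "r \<in> ?L") auto
  qed
  then show ?thesis by (rule bdd_above_mono[rotated]) simp
qed

lemma stationary_cross_moment:
  assumes "prob_space M" "stationary_field M V \<mu>"
  shows "integrable M (\<lambda>\<omega>. (V s \<omega> - \<mu>) * (V t \<omega> - \<mu>))"
    and "(LINT \<omega>|M. (V s \<omega> - \<mu>) * (V (s + r) \<omega> - \<mu>)) = autocov M V r"
    and "integrable M (V t)" "(LINT \<omega>|M. V t \<omega>) = \<mu>"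
proof -
  interpret prob_space M by fact
  have m[measurable]: "V t \<in> borel_measurable M" and i2: "integrable M (\<lambda>\<omega>. (V t \<omega>)\<^sup>2)" and mu: "(LINT \<omega>|M. V t \<omega>) = \<mu>"
    and cv: "covar M (V s) (V (s + t)) = covar M (V 0) (V t)" for s t
    using assms(2) unfolding stationary_field_def by blast+
  have i1: "integrable M (V t)" for t
    by (rule square_integrable_imp_integrable[OF m i2])
  show "integrable M (V t)" "(LINT \<omega>|M. V t \<omega>) = \<mu>" by (rule i1, rule mu)
  have ic: "integrable M (\<lambda>\<omega>. (V t \<omega> - \<mu>)\<^sup>2)" for t
    unfolding power2_diff using i1 i2 by simp
  show "integrable M (\<lambda>\<omega>. (V s \<omega> - \<mu>) * (V t \<omega> - \<mu>))"
    by (rule Bochner_Integration.integrable_bound[OF Bochner_Integration.integrable_add[OF ic[of s] ic[of t]]])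
      (auto intro!: order_trans[OF abs_mult_le_half_sum_squares])
  show "(LINT \<omega>|M. (V s \<omega> - \<mu>) * (V (s + r) \<omega> - \<mu>)) = autocov M V r"
    using cv[of s r] unfolding autocov_def covar_def mu by simp
qed

text \<open>
  At most all grid points contribute to a lag, so the expectation is \<open>autocov M V r\<close> times a proportion.
\<close>

lemma expected_sample_acov_le:
  assumes "prob_space M" "stationary_field M V \<mu>" "fst d > 0" "snd d > 0"
  shows "\<bar>LINT \<omega>|M. sample_acov d \<mu> (\<lambda>t. V t \<omega>) r\<bar> \<le> \<bar>autocov M V r\<bar>"
proof -
  let ?G = "{j. j \<in> grid d \<and> j + r \<in> grid d}"
  have g: "gsize d > 0" using assms by (simp add: gsize_def)
  have "(LINT \<omega>|M. sample_acov d \<mu> (\<lambda>t. V t \<omega>) r) = (1 / gsize d) * (\<Sum>j\<in>?G. LINT \<omega>|M. (V j \<omega> - \<mu>) * (V (j + r) \<omega> - \<mu>))"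
    unfolding sample_acov_def using stationary_cross_moment(1)[OF assms(1,2)] by simp
  also have "\<dots> = (real (card ?G) / gsize d) * autocov M V r"
    by (simp add: stationary_cross_moment(2)[OF assms(1,2)])
  finally have e: "(LINT \<omega>|M. sample_acov d \<mu> (\<lambda>t. V t \<omega>) r) = (real (card ?G) / gsize d) * autocov M V r" .
  have "real (card ?G) \<le> real (card (grid d))" by (intro of_nat_mono card_mono) auto
  also have "\<dots> = gsize d" by (simp add: grid_def gsize_def)
  finally have "real (card ?G) \<le> gsize d" .
  then have "real (card ?G) / gsize d \<le> 1" using g by simp
  then show ?thesis unfolding e abs_mult using g by (intro mult_left_le_one_le) auto
qed

lemma (in prob_space) prob_bounded_of_big_op:
  assumes X: "big_op M a X" and c: "\<forall>\<^sub>F n in sequentially. 0 \<le> c n \<and> c n * \<bar>a n\<bar> \<le> L"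
  shows "prob_bounded M (\<lambda>n \<omega>. c n * \<bar>X n \<omega>\<bar>)"
  unfolding prob_bounded_def
proof (intro allI impI)
  fix \<epsilon> :: real assume e: "\<epsilon> > 0"
  have [measurable]: "X n \<in> borel_measurable M" for n using X by (simp add: big_op_def)
  obtain C where C: "\<forall>\<^sub>F n in sequentially. measure M {\<omega> \<in> space M. \<bar>X n \<omega>\<bar> > C * \<bar>a n\<bar>} < \<epsilon>"
    using X e by (auto simp: big_op_def)
  from C c have "\<forall>\<^sub>F n in sequentially. \<exists>S\<in>sets M. measure M S < \<epsilon> \<and> (\<forall>\<omega>\<in>space M - S. c n * \<bar>X n \<omega>\<bar> \<le> \<bar>C\<bar> * \<bar>L\<bar>)"
  proof eventually_elim
    case (elim n)
    have "c n * \<bar>X n \<omega>\<bar> \<le> \<bar>C\<bar> * \<bar>L\<bar>" if "\<omega> \<in> space M - {\<omega> \<in> space M. \<bar>X n \<omega>\<bar> > C * \<bar>a n\<bar>}" for \<omega>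
    proof -
      have "\<bar>X n \<omega>\<bar> \<le> C * \<bar>a n\<bar>" using that by auto
      also have "\<dots> \<le> \<bar>C\<bar> * \<bar>a n\<bar>" by (intro mult_right_mono) auto
      finally have "c n * \<bar>X n \<omega>\<bar> \<le> c n * (\<bar>C\<bar> * \<bar>a n\<bar>)" using elim by (intro mult_left_mono) auto
      also have "\<dots> = \<bar>C\<bar> * (c n * \<bar>a n\<bar>)" by simp
      also have "\<dots> \<le> \<bar>C\<bar> * \<bar>L\<bar>" using elim by (intro mult_left_mono) auto
      finally show ?thesis .
    qed
    then show ?case using elim by (intro bexI[of _ "{\<omega> \<in> space M. \<bar>X n \<omega>\<bar> > C * \<bar>a n\<bar>}"]) auto
  qed
  then show "\<exists>C. \<forall>\<^sub>F n in sequentially. \<exists>S\<in>sets M. measure M S < \<epsilon> \<and> (\<forall>\<omega>\<in>space M - S. c n * \<bar>X n \<omega>\<bar> \<le> C)" ..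
qed

lemma (in prob_space) prob_bounded_const_add:
  assumes "prob_bounded M R"
  shows "prob_bounded M (\<lambda>n \<omega>. c + R n \<omega>)"
  unfolding prob_bounded_def
proof (intro allI impI)
  fix \<epsilon> :: real assume "\<epsilon> > 0"
  then obtain C where "\<forall>\<^sub>F n in sequentially. \<exists>S\<in>sets M. measure M S < \<epsilon> \<and> (\<forall>\<omega>\<in>space M - S. R n \<omega> \<le> C)"
    using assms by (auto simp: prob_bounded_def)
  then have "\<forall>\<^sub>F n in sequentially. \<exists>S\<in>sets M. measure M S < \<epsilon> \<and> (\<forall>\<omega>\<in>space M - S. c + R n \<omega> \<le> c + C)" by simp
  then show "\<exists>C. \<forall>\<^sub>F n in sequentially. \<exists>S\<in>sets M. measure M S < \<epsilon> \<and> (\<forall>\<omega>\<in>space M - S. c + R n \<omega> \<le> C)" ..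
qed

text \<open>
  The convention of value \<open>0\<close> for a divergent series agrees with that for a non-integrable function, so a
  series of measurable functions is measurable whether or not it converges.
\<close>

lemma infsum_eq_count_integral:
  fixes f :: "'a \<Rightarrow> real"
  shows "infsum f A = (LINT x|count_space A. f x)"
proof (cases "(\<lambda>x. norm (f x)) summable_on A")
  case True
  then show ?thesis by (rule infsum_count_integral)
next
  case False
  then have "\<not> f summable_on A" using summable_on_iff_abs_summable_on_real[THEN iffD1, of f A] by blast
  moreover have "\<not> integrable (count_space A) f"
    using False abs_summable_equivalent[THEN iffD2, of f A] unfolding Infinite_Set_Sum.abs_summable_on_def by blast
  ultimately show ?thesis by (simp add: infsum_not_exists not_integrable_integral_eq)
qed

lemma borel_measurable_infsum:
  fixes f :: "'a::countable \<Rightarrow> 'w \<Rightarrow> real"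
  assumes [measurable]: "\<And>j. f j \<in> borel_measurable M"
  shows "(\<lambda>\<omega>. \<Sum>\<^sub>\<infinity>j. f j \<omega>) \<in> borel_measurable M"
proof -
  interpret sigma_finite_measure "count_space (UNIV :: 'a set)"
    by (rule sigma_finite_measure_count_space_countable) simp
  have "(\<lambda>p. f (snd p) (fst p)) \<in> borel_measurable (M \<Otimes>\<^sub>M count_space UNIV)"
    by (rule measurable_compose_countable[where f="\<lambda>j p. f j (fst p)" and g=snd]) auto
  then have "(\<lambda>(\<omega>, j). f j \<omega>) \<in> borel_measurable (M \<Otimes>\<^sub>M count_space UNIV)"
    by (simp add: case_prod_beta')
  then have "(\<lambda>\<omega>. LINT j|count_space UNIV. f j \<omega>) \<in> borel_measurable M"
    by (rule borel_measurable_lebesgue_integral)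
  then show ?thesis by (simp add: infsum_eq_count_integral)
qed

lemma borel_measurable_finite_SUP:
  fixes f :: "'i \<Rightarrow> 'w \<Rightarrow> real"
  assumes "finite I" "\<And>j. j \<in> I \<Longrightarrow> f j \<in> borel_measurable M"
  shows "(\<lambda>\<omega>. SUP j\<in>I. f j \<omega>) \<in> borel_measurable M"
proof (cases "I = {}")
  case False
  have "bdd_above ((\<lambda>j. f j \<omega>) ` I)" for \<omega> using assms(1) by simp
  moreover have "countable I" using assms(1) by (rule countable_finite)
  ultimately show ?thesis using assms(2) by (intro borel_measurable_cSUP)
qed simp

lemma abs_SUP_le:
  fixes f :: "'i \<Rightarrow> real"
  assumes I: "finite I" "I \<noteq> {}" and b: "\<And>i. i \<in> I \<Longrightarrow> \<bar>f i\<bar> \<le> B"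
  shows "\<bar>SUP i\<in>I. f i\<bar> \<le> B"
proof -
  have le: "f i \<le> B" "- B \<le> f i" if "i \<in> I" for i using b[OF that] by (auto simp: abs_le_iff)
  have bd: "bdd_above (f ` I)" using I(1) by simp
  have 1: "(SUP i\<in>I. f i) \<le> B" using I(2) le(1) by (rule cSUP_least)
  obtain i where i: "i \<in> I" using I(2) by blast
  have "- B \<le> f i" by (rule le(2)[OF i])
  also have "f i \<le> (SUP i\<in>I. f i)" using i bd by (rule cSUP_upper)
  finally show ?thesis using 1 by (simp add: abs_le_iff)
qed

section \<open>Kernel weights under the bandwidth conditions\<close>

lemma freq_in_box:
  assumes "r \<in> grid d"
  shows "freq d r \<in> {0..2 * pi} \<times> {0..2 * pi}"
proof -
  have "2 * pi * real_of_int x / real D \<le> 2 * pi" if "1 \<le> x" "x \<le> int D" for x :: int and D :: nat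
  proof -
    have "real D > 0" using that by linarith
    moreover have "real_of_int x \<le> real D" using that by linarith
    ultimately show ?thesis by (simp add: field_simps)
  qed
  then show ?thesis using assms by (auto simp: freq_def grid_def)
qed

text \<open>
  Condition \<open>K1\<close> makes the normalising sum of order \<open>|h| |T|\<close>, and folding the lattice points modulo the grid produces
  exactly the periodised kernel that \<open>K2\<close> bounds. The sum over the lattice converges for large \<open>n\<close>, since its limit
  in \<open>K1\<close> is not zero.
\<close>

lemma kernel_smoothing:
  assumes K1: "K1 d h K" and K2: "K2 h K" and bw: "bandwidth_cond d h"
    and d1: "filterlim (\<lambda>n. fst (d n)) at_top sequentially" and d2: "filterlim (\<lambda>n. snd (d n)) at_top sequentially"
  shows "\<exists>C0>0. \<forall>\<^sub>F n in sequentially. fst (h n) > 0 \<and> snd (h n) > 0 \<and>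
     (\<lambda>s. K (lattice_pt (h n) (d n) s)) summable_on UNIV \<and>
     vabs (h n) * gsize (d n) / (8 * pi\<^sup>2) \<le> (\<Sum>\<^sub>\<infinity>s. K (lattice_pt (h n) (d n) s)) \<and>
     smoothing_weights (d n) (weight K (h n) (d n)) (C0 / (vabs (h n) * gsize (d n)))"
proof -
  obtain C where C: "\<forall>\<^sub>F n in sequentially. \<forall>l \<in> {0..2 * pi} \<times> {0..2 * pi}.
     (\<lambda>j. K (shifted_pt (h n) l j)) summable_on UNIV \<and> \<bar>K_per K (h n) l\<bar> \<le> C * (1 / vabs (h n))"
    using K2 by (auto simp: K2_def)
  have K0: "\<And>x. K x \<ge> 0" and lim: "(\<lambda>n. 4 * pi\<^sup>2 / (vabs (h n) * gsize (d n)) * (\<Sum>\<^sub>\<infinity>j. K (lattice_pt (h n) (d n) j))) \<longlonglongrightarrow> 1"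
    using K1 by (auto simp: K1_def)
  have hd: "\<forall>\<^sub>F n in sequentially. fst (h n) * real (fst (d n)) > 0" "\<forall>\<^sub>F n in sequentially. snd (h n) * real (snd (d n)) > 0"
    using bw unfolding bandwidth_cond_def filterlim_at_top_dense by auto
  \<comment> \<open>The limit is \<open>1\<close>; the margin \<open>1/2\<close> is the source of the constant \<open>8 * pi\<^sup>2\<close>.\<close>
  have half: "\<forall>\<^sub>F n in sequentially. 4 * pi\<^sup>2 / (vabs (h n) * gsize (d n)) * (\<Sum>\<^sub>\<infinity>j. K (lattice_pt (h n) (d n) j)) > 1/2"
    using lim by (rule order_tendstoD) simp
  define C0 where "C0 = 8 * pi\<^sup>2 * (\<bar>C\<bar> + 1)"
  have C0: "C0 > 0" unfolding C0_def by (intro mult_pos_pos) auto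
  from C hd half have "\<forall>\<^sub>F n in sequentially. fst (h n) > 0 \<and> snd (h n) > 0 \<and>
     (\<lambda>s. K (lattice_pt (h n) (d n) s)) summable_on UNIV \<and>
     vabs (h n) * gsize (d n) / (8 * pi\<^sup>2) \<le> (\<Sum>\<^sub>\<infinity>s. K (lattice_pt (h n) (d n) s)) \<and>
     smoothing_weights (d n) (weight K (h n) (d n)) (C0 / (vabs (h n) * gsize (d n)))"
  proof eventually_elim
    case (elim n)
    have h: "fst (h n) > 0" "snd (h n) > 0" and d: "fst (d n) > 0" "snd (d n) > 0"
      using elim by (auto simp: zero_less_mult_iff)
    define S where "S = (\<Sum>\<^sub>\<infinity>s. K (lattice_pt (h n) (d n) s))"
    have vg: "vabs (h n) * gsize (d n) > 0" using h d by (simp add: vabs_def gsize_def)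
    have vp: "vabs (h n) > 0" using h by (simp add: vabs_def)
    have S: "vabs (h n) * gsize (d n) / (8 * pi\<^sup>2) < S"
    proof -
      have "1/2 < 4 * pi\<^sup>2 / (vabs (h n) * gsize (d n)) * S" using elim by (simp add: S_def)
      then have "vabs (h n) * gsize (d n) < 8 * pi\<^sup>2 * S" using vg by (simp add: field_simps)
      then show ?thesis by (simp add: field_simps)
    qed
    have S0: "S > 0" by (rule le_less_trans[OF _ S]) (use vg in simp)
    have sm: "(\<lambda>s. K (lattice_pt (h n) (d n) s)) summable_on UNIV"
      using S0 infsum_not_exists[of "\<lambda>s. K (lattice_pt (h n) (d n) s)" UNIV] by (auto simp: S_def)
    have w: "weight K (h n) (d n) s = K (lattice_pt (h n) (d n) s) * inverse S" for s
      by (simp add: weight_def S_def divide_inverse)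
    have "smoothing_weights (d n) (weight K (h n) (d n)) (C0 / (vabs (h n) * gsize (d n)))"
    proof
      show "fst (d n) > 0" "snd (d n) > 0" by (rule d)+
      show "weight K (h n) (d n) s \<ge> 0" for s unfolding w using K0 S0 by simp
      show "weight K (h n) (d n) summable_on UNIV" unfolding w using sm by (rule summable_on_cmult_left)
      show "(\<Sum>\<^sub>\<infinity>s. weight K (h n) (d n) s) = 1"
        unfolding w infsum_cmult_left' S_def[symmetric] using S0 by simp
      fix r assume r: "r \<in> grid (d n)"
      have pt: "lattice_pt (h n) (d n) (r + grid_shift (d n) m) = shifted_pt (h n) (freq (d n) r) m" for m
        using d h by (simp add: lattice_pt_def shifted_pt_def grid_shift_def vdiv_def freq_def rvec_def field_simps)
      have "(\<Sum>\<^sub>\<infinity>m. weight K (h n) (d n) (r + grid_shift (d n) m)) = (\<Sum>\<^sub>\<infinity>m. K (shifted_pt (h n) (freq (d n) r) m)) * inverse S"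
        unfolding w pt by (rule infsum_cmult_left')
      also have "\<dots> \<le> (\<bar>C\<bar> + 1) * inverse S"
      proof (rule mult_right_mono)
        have "\<bar>K_per K (h n) (freq (d n) r)\<bar> \<le> C * (1 / vabs (h n))" 
          using elim(1)[rule_format, OF freq_in_box[OF r]] by (rule conjunct2)
        then have "1 / vabs (h n) * (\<Sum>\<^sub>\<infinity>m. K (shifted_pt (h n) (freq (d n) r) m)) \<le> C * (1 / vabs (h n))"
          unfolding K_per_def by linarith
        then show "(\<Sum>\<^sub>\<infinity>m. K (shifted_pt (h n) (freq (d n) r) m)) \<le> \<bar>C\<bar> + 1" using vp by (simp add: field_simps)
      qed (use S0 in simp)
      also have "\<dots> \<le> (\<bar>C\<bar> + 1) * (8 * pi\<^sup>2 / (vabs (h n) * gsize (d n)))"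
      proof (rule mult_left_mono)
        have "inverse S \<le> inverse (vabs (h n) * gsize (d n) / (8 * pi\<^sup>2))"
          using S vg by (intro le_imp_inverse_le) auto
        then show "inverse S \<le> 8 * pi\<^sup>2 / (vabs (h n) * gsize (d n))" by simp
      qed simp
      also have "\<dots> = C0 / (vabs (h n) * gsize (d n))" by (simp add: C0_def)
      finally show "(\<Sum>\<^sub>\<infinity>m. weight K (h n) (d n) (r + grid_shift (d n) m)) \<le> C0 / (vabs (h n) * gsize (d n))" .
    qed
    then show ?case using h sm S by (auto simp: S_def)
  qed
  with C0 show ?thesis by blast
qed

text \<open>
  By evenness the summation may be recentred at the frequency of interest.
\<close>

lemma fhat_eq_smooth:
  assumes h: "fst h > 0" "snd h > 0" and d: "fst d > 0" "snd d > 0" and even: "\<And>x. K (- x) = K x"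
  shows "fhat K h d W (freq d j) = 1 / (4 * pi\<^sup>2) * (\<Sum>\<^sub>\<infinity>s. weight K h d s * pgram d W (j + s))"
proof -
  have l: "vdiv (freq d k) h = lattice_pt h d k" for k
    by (simp add: vdiv_def freq_def lattice_pt_def mult.commute)
  have m: "vdiv (freq d j - freq d (j + s)) h = - lattice_pt h d s" for s
  proof -
    have "freq d j - freq d (j + s) = - freq d s"
      by (simp add: freq_def add_divide_distrib distrib_left)
    then have "vdiv (freq d j - freq d (j + s)) h = - vdiv (freq d s) h" by (simp add: vdiv_def)
    then show ?thesis unfolding l .
  qed
  let ?f = "\<lambda>s. K (vdiv (freq d j - freq d s) h) / (\<Sum>\<^sub>\<infinity>k. K (vdiv (freq d k) h)) * pgram d W s"
  have bij: "bij_betw (\<lambda>s. j + s) UNIV UNIV"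
    by (rule bij_betwI[where g="\<lambda>s. s - j"]) auto
  have "(\<Sum>\<^sub>\<infinity>s. ?f s) = (\<Sum>\<^sub>\<infinity>s. ?f (j + s))"
    by (rule infsum_reindex_bij_betw[OF bij, symmetric])
  also have "\<dots> = (\<Sum>\<^sub>\<infinity>s. weight K h d s * pgram d W (j + s))"
    unfolding m even l weight_def ..
  finally show ?thesis unfolding fhat_def by simp
qed

text \<open>
  Half of the grid, up to a boundary layer; the constant is chosen generously so that it covers all parities.
\<close>

lemma half_grid_size:
  assumes d: "fst d \<ge> 3" "snd d \<ge> 3"
  shows "half_grid d \<subseteq> grid d" "gsize d / 8 \<le> real (card (half_grid d))"
proof -
  obtain d1 d2 where dd: "d = (d1, d2)" by (cases d)
  show sub: "half_grid d \<subseteq> grid d"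
    using d unfolding dd half_grid_def grid_def Let_def by (auto split: if_splits)
  have fin: "finite (half_grid d)" using sub finite_grid by (rule finite_subset)
  have half: "real D / 8 \<le> real_of_int m" if "D \<ge> 3" "2 * m \<ge> int D - 2" for D :: nat and m :: int
    using that by linarith
  consider m where "{1..int d1} \<times> {1..m} \<subseteq> half_grid d" "2 * m \<ge> int d2 - 2"
    | m where "{1..m} \<times> {1..int d2} \<subseteq> half_grid d" "2 * m \<ge> int d1 - 2"
  proof -
    consider "odd (int d1) \<and> odd (int d2)" | "odd (int d1)" "even (int d2)" | "even (int d1)" "odd (int d2)" | "even (int d1)" "even (int d2)" by blast
    then show ?thesis
    proof cases
      case 1
      then have "{1..int d1} \<times> {1..(int d2 - 1) div 2} \<subseteq> half_grid d" unfolding dd half_grid_def Let_def fst_conv snd_conv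
        by (simp only: if_True if_False simp_thms) (rule Un_upper1)
      moreover have "2 * ((int d2 - 1) div 2) \<ge> int d2 - 2" using 1 by presburger
      ultimately show ?thesis by (rule that(1))
    next
      case 2
      then have "{1..int d1} \<times> {1..int d2 div 2 - 1} \<subseteq> half_grid d" unfolding dd half_grid_def Let_def fst_conv snd_conv
        by (simp only: if_True if_False simp_thms) (rule Un_upper1)
      moreover have "2 * (int d2 div 2 - 1) \<ge> int d2 - 2" using 2 by presburger
      ultimately show ?thesis by (rule that(1))
    next
      case 3
      then have "{1..int d1 div 2 - 1} \<times> {1..int d2} \<subseteq> half_grid d" unfolding dd half_grid_def Let_def fst_conv snd_conv
        by (simp only: if_True if_False simp_thms) (rule Un_upper1)
      moreover have "2 * (int d1 div 2 - 1) \<ge> int d1 - 2" using 3 by presburger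
      ultimately show ?thesis by (rule that(2))
    next
      case 4
      then have "{1..int d1} \<times> {1..int d2 div 2 - 1} \<subseteq> half_grid d" unfolding dd half_grid_def Let_def fst_conv snd_conv
        by (simp only: if_True if_False simp_thms) (rule Un_upper1)
      moreover have "2 * (int d2 div 2 - 1) \<ge> int d2 - 2" using 4 by presburger
      ultimately show ?thesis by (rule that(1))
    qed
  qed
  then show "gsize d / 8 \<le> real (card (half_grid d))"
  proof cases
    case 1
    have m: "real d2 / 8 \<le> real_of_int m" using half[of d2 m] 1 d by (simp add: dd)
    then have "0 \<le> m" by linarith
    then have "real (card ({1..int d1} \<times> {1..m})) = real d1 * real_of_int m" by (simp add: card_cartesian_product)
    moreover have "real (card ({1..int d1} \<times> {1..m})) \<le> real (card (half_grid d))"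
      by (intro of_nat_mono card_mono fin 1)
    moreover have "real d1 * (real d2 / 8) \<le> real d1 * real_of_int m" using m by (rule mult_left_mono) simp
    ultimately show ?thesis by (simp only: dd gsize_def fst_conv snd_conv)
  next
    case 2
    have m: "real d1 / 8 \<le> real_of_int m" using half[of d1 m] 2 d by (simp add: dd)
    then have "0 \<le> m" by linarith
    then have "real (card ({1..m} \<times> {1..int d2})) = real_of_int m * real d2" by (simp add: card_cartesian_product)
    moreover have "real (card ({1..m} \<times> {1..int d2})) \<le> real (card (half_grid d))"
      by (intro of_nat_mono card_mono fin 2)
    moreover have "(real d1 / 8) * real d2 \<le> real_of_int m * real d2" using m by (rule mult_right_mono) simp
    ultimately show ?thesis by (simp only: dd gsize_def fst_conv snd_conv)
  qed
qed

lemma coef_measurable: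
  assumes "\<And>t. t \<in> grid d \<Longrightarrow> W t \<in> borel_measurable M"
  shows "(\<lambda>\<omega>. xcoef d (\<lambda>t. W t \<omega>) j) \<in> borel_measurable M" "(\<lambda>\<omega>. ycoef d (\<lambda>t. W t \<omega>) j) \<in> borel_measurable M"
  unfolding xcoef_def ycoef_def
  by (intro borel_measurable_times borel_measurable_const borel_measurable_sum assms; assumption)+

lemma pgram_measurable:
  assumes "\<And>t. t \<in> grid d \<Longrightarrow> W t \<in> borel_measurable M"
  shows "(\<lambda>\<omega>. pgram d (\<lambda>t. W t \<omega>) j) \<in> borel_measurable M"
  unfolding pgram_def using coef_measurable[OF assms, where j=j]
  by (cases "\<exists>c1 c2. j = (c1 * int (fst d), c2 * int (snd d))") auto

lemma fhat_measurable:
  assumes "\<And>t. t \<in> grid d \<Longrightarrow> W t \<in> borel_measurable M"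
  shows "(\<lambda>\<omega>. fhat K h d (\<lambda>t. W t \<omega>) l) \<in> borel_measurable M"
  unfolding fhat_def
  by (intro borel_measurable_times borel_measurable_const borel_measurable_infsum pgram_measurable assms)

section \<open>Tightness of the maximal smoothed periodogram\<close>

lemma eventually_gsize_ge:
  assumes d1: "filterlim (\<lambda>n. fst (d n)) at_top sequentially" and d2: "filterlim (\<lambda>n. snd (d n)) at_top sequentially"
  shows "\<forall>\<^sub>F n in sequentially. fst (d n) \<ge> (3::nat) \<and> snd (d n) \<ge> (3::nat) \<and> gsize (d n) \<ge> 1"
proof -
  have "\<forall>\<^sub>F n in sequentially. fst (d n) \<ge> 3" "\<forall>\<^sub>F n in sequentially. snd (d n) \<ge> 3"
    using d1 d2 by (auto simp: filterlim_at_top)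
  then show ?thesis
  proof eventually_elim
    case (elim n)
    have "1 * 1 \<le> real (fst (d n)) * real (snd (d n))" using elim by (intro mult_mono) auto
    then show ?case using elim by (simp add: gsize_def)
  qed
qed

text \<open>
  The normalisation of the weights turns the bound on lag sums into one of order \<open>1 / |h|\<close>.
\<close>

lemma (in radial_majorant) sum_kappa_le:
  assumes sw: "smoothing_weights d (weight K h d) B"
    and c: "continuous_on UNIV K" and nn: "\<And>x. K x \<ge> 0" and K: "integrable lborel K"
    and k: "\<And>x. cmod (kernel_ft K x) \<le> kt x"
    and h: "fst h > 0" "snd h > 0" and A: "max (fst h) (snd h) \<le> real A * fst h" "max (fst h) (snd h) \<le> real A * snd h"
    and S: "(\<lambda>s. K (lattice_pt h d s)) summable_on UNIV" "vabs h * gsize d / (8 * pi\<^sup>2) \<le> (\<Sum>\<^sub>\<infinity>s. K (lattice_pt h d s))"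
  shows "(\<Sum>r\<in>{1 - int (fst d)..int (fst d)} \<times> {1 - int (snd d)..int (snd d)}. smoothing_weights.kappa d (weight K h d) r)
    \<le> 32 * ((real A)\<^sup>2 * kt 0 + (LINT x|lborel. kt x) / vabs h)"
proof -
  interpret smoothing_weights d "weight K h d" B by (rule sw)
  obtain h1 h2 where hh: "h = (h1, h2)" by (cases h)
  obtain e1 e2 where dd: "d = (e1, e2)" by (cases d)
  define T where "T = (\<Sum>\<^sub>\<infinity>s. K (lattice_pt h d s))"
  define I where "I = (LINT x|lborel. kt x)"
  let ?L = "{1 - int (fst d)..int (fst d)} \<times> {1 - int (snd d)..int (snd d)}"
  let ?z = "\<lambda>r. \<Sum>\<^sub>\<infinity>s. iexp (freq d s \<bullet> rvec r) * complex_of_real (K (lattice_pt h d s))"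
  have v: "vabs h > 0" using h by (simp add: vabs_def)
  have vh: "vabs h = h1 * h2" using h by (simp add: vabs_def hh)
  have T: "T > 0" by (rule less_le_trans[OF _ S(2)[folded T_def]]) (use v gsize_pos in simp)
  have kap: "kappa r = (1 / T) * cmod (?z r)" for r
  proof -
    have "iexp (freq d s \<bullet> rvec r) * complex_of_real (weight K h d s) = (iexp (freq d s \<bullet> rvec r) * complex_of_real (K (lattice_pt h d s))) * complex_of_real (1 / T)" for s
      by (simp add: weight_def T_def)
    then have "(\<Sum>\<^sub>\<infinity>s. iexp (freq d s \<bullet> rvec r) * complex_of_real (weight K h d s)) = ?z r * complex_of_real (1 / T)"
      by (simp only: infsum_cmult_left')
    then show ?thesis unfolding kappa_def using T by (simp add: norm_mult norm_divide)
  qed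
  have "(\<Sum>r\<in>?L. kappa r) = (1 / T) * (\<Sum>r\<in>?L. cmod (?z r))"
    unfolding kap by (rule sum_distrib_left[symmetric])
  also have "\<dots> \<le> (1 / T) * (4 / pi\<^sup>2 * (gsize d * ((real A)\<^sup>2 * kt 0 * vabs h + I)))"
  proof (rule mult_left_mono)
    have "(\<Sum>r\<in>{1 - int e1..int e1} \<times> {1 - int e2..int e2}.
      cmod (\<Sum>\<^sub>\<infinity>s. iexp (freq (e1, e2) s \<bullet> rvec r) * complex_of_real (K (lattice_pt (h1, h2) (e1, e2) s))))
      \<le> 4 / pi\<^sup>2 * (real e1 * real e2 * ((real A)\<^sup>2 * kt 0 * (h1 * h2) + (LINT x|lborel. kt x)))"
      by (rule kernel_lag_sum_bound[OF c nn K k]) (use h A S(1) d_pos in \<open>auto simp: hh dd\<close>)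
    then show "(\<Sum>r\<in>?L. cmod (?z r)) \<le> 4 / pi\<^sup>2 * (gsize d * ((real A)\<^sup>2 * kt 0 * vabs h + I))"
      unfolding vh by (simp add: hh dd gsize_def I_def)
  qed (use T in simp)
  also have "\<dots> \<le> (8 * pi\<^sup>2 / (vabs h * gsize d)) * (4 / pi\<^sup>2 * (gsize d * ((real A)\<^sup>2 * kt 0 * vabs h + I)))"
  proof (rule mult_right_mono)
    have "1 / T \<le> 1 / (vabs h * gsize d / (8 * pi\<^sup>2))"
      using S(2)[folded T_def] v gsize_pos by (intro divide_left_mono mult_pos_pos divide_pos_pos T) auto
    then show "1 / T \<le> 8 * pi\<^sup>2 / (vabs h * gsize d)" by simp
    show "0 \<le> 4 / pi\<^sup>2 * (gsize d * ((real A)\<^sup>2 * kt 0 * vabs h + I))"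
      using gsize_pos v unfolding I_def
      by (intro mult_nonneg_nonneg add_nonneg_nonneg Bochner_Integration.integral_nonneg) (auto simp: kt_nonneg)
  qed
  also have "\<dots> = 32 * ((real A)\<^sup>2 * kt 0 + I / vabs h)"
  proof -
    have "8 * P / (v * g) * (4 / P * (g * (a * v + I))) = 32 * (a + I / v)" if "P > 0" "v > 0" "g > 0" for P v g a :: real
      using that by (simp add: field_simps)
    from this[of "pi\<^sup>2" "vabs h" "gsize d" "(real A)\<^sup>2 * kt 0"] show ?thesis using v gsize_pos by simp
  qed
  finally show ?thesis unfolding I_def .
qed

text \<open>
  The lag sum of order \<open>1 / |h|\<close> multiplies a deviation of order \<open>|T|^{-v}\<close>, and the product stays bounded.
\<close>

lemma smoothed_periodogram_tight_lag_window:
  assumes prob: "prob_space M" and stat: "stationary_field M V \<mu>" and acov: "(\<lambda>j. \<bar>autocov M V j\<bar>) summable_on UNIV"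
    and P4: "P4 M V \<mu> d v" and v: "v > 0" and K1: "K1 d h K" and K2: "K2 h K" and K3: "K3 K" and bw: "bandwidth_cond d h"
    and d1: "filterlim (\<lambda>n. fst (d n)) at_top sequentially" and d2: "filterlim (\<lambda>n. snd (d n)) at_top sequentially"
    and lim: "(\<lambda>n. vabs (h n) + inverse (vabs (h n)) * gsize (d n) powr (- v)) \<longlonglongrightarrow> 0"
  shows "\<exists>Y. prob_bounded M Y \<and> (\<forall>\<^sub>F n in sequentially. \<forall>k\<in>grid (d n). \<forall>\<omega>\<in>space M.
     smoothing_weights.Q (d n) (weight K (h n) (d n)) k (\<lambda>t. V t \<omega> - \<mu>) \<le> Y n \<omega>)"
proof -
  interpret prob_space M by (rule prob)
  obtain kt where kt: "\<And>x. cmod (kernel_ft K x) \<le> kt x"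
    "\<And>x1 x2. kt (- x1, x2) = kt (x1, x2) \<and> kt (x1, - x2) = kt (x1, x2)"
    "\<forall>x \<in> {0..} \<times> {0..}. \<forall>y \<in> {0..} \<times> {0..}. vmax x \<le> vmax y \<longrightarrow> kt y \<le> kt x"
    "set_integrable lborel ({0..} \<times> {0..}) kt" and Kc: "continuous_on UNIV K"
    using K3 unfolding K3_def by blast
  interpret radial_majorant kt
    by standard (use kt in \<open>auto intro: order_trans[OF norm_ge_zero kt(1)]\<close>)
  have K0: "\<And>x. K x \<ge> 0" and Ki: "integrable lborel K" using K1 by (auto simp: K1_def has_bochner_integral_iff)
  obtain C0 where ev: "\<forall>\<^sub>F n in sequentially. fst (h n) > 0 \<and> snd (h n) > 0 \<and>
     (\<lambda>s. K (lattice_pt (h n) (d n) s)) summable_on UNIV \<and>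
     vabs (h n) * gsize (d n) / (8 * pi\<^sup>2) \<le> (\<Sum>\<^sub>\<infinity>s. K (lattice_pt (h n) (d n) s)) \<and>
     smoothing_weights (d n) (weight K (h n) (d n)) (C0 / (vabs (h n) * gsize (d n)))"
    using kernel_smoothing[OF K1 K2 bw d1 d2] by blast
  have "\<exists>A::nat. \<forall>\<^sub>F n in sequentially. \<bar>fst (h n)\<bar> \<le> real A * \<bar>snd (h n)\<bar> \<and> \<bar>snd (h n)\<bar> \<le> real A * \<bar>fst (h n)\<bar>"
  proof -
    have th: "(\<lambda>n. fst (h n)) \<in> O(\<lambda>n. snd (h n))" "(\<lambda>n. snd (h n)) \<in> O(\<lambda>n. fst (h n))"
      using bw unfolding bandwidth_cond_def by (auto simp: bigtheta_def bigomega_iff_bigo)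
    obtain c c' where c: "\<forall>\<^sub>F n in sequentially. norm (fst (h n)) \<le> c * norm (snd (h n))" "\<forall>\<^sub>F n in sequentially. norm (snd (h n)) \<le> c' * norm (fst (h n))"
      using th by (auto elim!: landau_o.bigE)
    obtain A :: nat where A: "max c c' \<le> real A" using real_arch_simple by blast
    from c have "\<forall>\<^sub>F n in sequentially. \<bar>fst (h n)\<bar> \<le> real A * \<bar>snd (h n)\<bar> \<and> \<bar>snd (h n)\<bar> \<le> real A * \<bar>fst (h n)\<bar>"
    proof eventually_elim
      case (elim n)
      have "c * norm (snd (h n)) \<le> real A * norm (snd (h n))" "c' * norm (fst (h n)) \<le> real A * norm (fst (h n))"
        using A by (auto intro!: mult_right_mono)
      then show ?case using elim by simp
    qed
    then show ?thesis by blast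
  qed
  then obtain A0 :: nat where A0: "\<forall>\<^sub>F n in sequentially. \<bar>fst (h n)\<bar> \<le> real A0 * \<bar>snd (h n)\<bar> \<and> \<bar>snd (h n)\<bar> \<le> real A0 * \<bar>fst (h n)\<bar>" by blast
  define A where "A = A0 + 1"
  define I where "I = (LINT x|lborel. kt x)"
  have I: "I \<ge> 0" unfolding I_def by (rule Bochner_Integration.integral_nonneg) (rule kt_nonneg)
  define X where "X n \<omega> = (SUP r. \<bar>sample_acov (d n) \<mu> (\<lambda>t. V t \<omega>) r - (LINT \<omega>'|M. sample_acov (d n) \<mu> (\<lambda>t. V t \<omega>') r)\<bar>)" for n \<omega>
  define c where "c n = 32 * ((real A)\<^sup>2 * kt 0 + I / vabs (h n))" for n
  define \<Gamma> where "\<Gamma> = (\<Sum>\<^sub>\<infinity>j. \<bar>autocov M V j\<bar>)"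
  have X: "big_op M (\<lambda>n. gsize (d n) powr (- v)) X" using P4 unfolding P4_def X_def[abs_def] .
  have lim1: "\<forall>\<^sub>F n in sequentially. vabs (h n) + inverse (vabs (h n)) * gsize (d n) powr (- v) < 1"
    using lim by (rule order_tendstoD) simp
  have "prob_bounded M (\<lambda>n \<omega>. c n * \<bar>X n \<omega>\<bar>)"
  proof (rule prob_bounded_of_big_op[OF X, where L="32 * ((real A)\<^sup>2 * kt 0 + I)"])
    from ev lim1 eventually_gsize_ge[OF d1 d2]
    show "\<forall>\<^sub>F n in sequentially. 0 \<le> c n \<and> c n * \<bar>gsize (d n) powr (- v)\<bar> \<le> 32 * ((real A)\<^sup>2 * kt 0 + I)"
    proof eventually_elim
      case (elim n)
      have hp: "fst (h n) > 0" "snd (h n) > 0" using elim(1) by blast+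
      then have vp: "vabs (h n) > 0" by (simp add: vabs_def)
      define g where "g = gsize (d n) powr (- v)"
      have "gsize (d n) powr (- v) \<le> gsize (d n) powr 0" using elim(3) v by (intro powr_mono) auto
      moreover have "gsize (d n) \<noteq> 0" using elim(3) by linarith
      ultimately have g: "0 \<le> g" "g \<le> 1" by (simp_all add: g_def)
      have "vabs (h n) + inverse (vabs (h n)) * g < 1" using elim(2) unfolding g_def .
      then have ig: "g / vabs (h n) \<le> 1" using vp by (simp add: divide_inverse mult.commute)
      have "c n * \<bar>gsize (d n) powr (- v)\<bar> = 32 * ((real A)\<^sup>2 * kt 0 * g + I * (g / vabs (h n)))"
        using g by (simp add: c_def g_def[symmetric] algebra_simps)
      also have "\<dots> \<le> 32 * ((real A)\<^sup>2 * kt 0 * 1 + I * 1)"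
        by (intro mult_left_mono add_mono g ig) (auto simp: kt_nonneg I)
      finally have "c n * \<bar>gsize (d n) powr (- v)\<bar> \<le> 32 * ((real A)\<^sup>2 * kt 0 + I)" by simp
      moreover have "0 \<le> c n" using vp I by (auto simp: c_def kt_nonneg intro!: add_nonneg_nonneg)
      ultimately show ?case by blast
    qed
  qed
  then have tight: "prob_bounded M (\<lambda>n \<omega>. \<Gamma> + c n * \<bar>X n \<omega>\<bar>)" by (rule prob_bounded_const_add)
  have "\<forall>\<^sub>F n in sequentially. \<forall>k\<in>grid (d n). \<forall>\<omega>\<in>space M.
     smoothing_weights.Q (d n) (weight K (h n) (d n)) k (\<lambda>t. V t \<omega> - \<mu>) \<le> \<Gamma> + c n * \<bar>X n \<omega>\<bar>"
    using ev A0
  proof eventually_elim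
    case (elim n)
    have h: "fst (h n) > 0" "snd (h n) > 0" and sw: "smoothing_weights (d n) (weight K (h n) (d n)) (C0 / (vabs (h n) * gsize (d n)))"
      and S: "(\<lambda>s. K (lattice_pt (h n) (d n) s)) summable_on UNIV" "vabs (h n) * gsize (d n) / (8 * pi\<^sup>2) \<le> (\<Sum>\<^sub>\<infinity>s. K (lattice_pt (h n) (d n) s))"
      using elim(1) by blast+
    interpret sw: smoothing_weights "d n" "weight K (h n) (d n)" "C0 / (vabs (h n) * gsize (d n))" by (rule sw)
    have Ab: "max (fst (h n)) (snd (h n)) \<le> real A * fst (h n)" "max (fst (h n)) (snd (h n)) \<le> real A * snd (h n)"
      using elim(2) h by (auto simp: A_def algebra_simps add_increasing add_increasing2)
    let ?L = "{1 - int (fst (d n))..int (fst (d n))} \<times> {1 - int (snd (d n))..int (snd (d n))}"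
    have kap: "(\<Sum>r\<in>?L. sw.kappa r) \<le> c n"
      unfolding c_def I_def by (rule sum_kappa_le[OF sw Kc K0 Ki kt(1) h Ab S])
    show ?case
    proof (intro ballI)
      fix k \<omega>
      let ?\<gamma> = "\<lambda>r. LINT \<omega>'|M. sample_acov (d n) \<mu> (\<lambda>t. V t \<omega>') r"
      have dev: "\<bar>sample_acov (d n) 0 (\<lambda>t. V t \<omega> - \<mu>) r - ?\<gamma> r\<bar> \<le> \<bar>X n \<omega>\<bar>" for r
      proof -
        have "\<bar>sample_acov (d n) \<mu> (\<lambda>t. V t \<omega>) r - ?\<gamma> r\<bar> \<le> X n \<omega>"
          unfolding X_def by (rule cSUP_upper[OF UNIV_I bdd_above_sample_acov_deviation])
        then show ?thesis unfolding sample_acov_shift by linarith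
      qed
      have "sw.Q k (\<lambda>t. V t \<omega> - \<mu>) \<le> (\<Sum>r\<in>?L. \<bar>?\<gamma> r\<bar>) + \<bar>X n \<omega>\<bar> * (\<Sum>r\<in>?L. sw.kappa r)"
        by (rule sw.Q_le_lag_sums) (rule dev)
      also have "\<dots> \<le> \<Gamma> + \<bar>X n \<omega>\<bar> * c n"
      proof (intro add_mono mult_left_mono kap)
        have "(\<Sum>r\<in>?L. \<bar>?\<gamma> r\<bar>) \<le> (\<Sum>r\<in>?L. \<bar>autocov M V r\<bar>)"
          by (rule sum_mono) (rule expected_sample_acov_le[OF prob stat sw.d_pos])
        also have "\<dots> \<le> \<Gamma>" unfolding \<Gamma>_def by (rule finite_sum_le_infsum[OF acov]) auto
        finally show "(\<Sum>r\<in>?L. \<bar>?\<gamma> r\<bar>) \<le> \<Gamma>" .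
      qed simp
      finally show "sw.Q k (\<lambda>t. V t \<omega> - \<mu>) \<le> \<Gamma> + c n * \<bar>X n \<omega>\<bar>" by (simp add: mult.commute)
    qed
  qed
  with tight show ?thesis by blast
qed

text \<open>
  Here \<open>B\<^sup>2 |T|\<close> is of order \<open>|h|^{-2} |T|^{-1}\<close>, at most \<open>|T|^{2 \<eta> - 1}\<close>, which is bounded since \<open>\<eta> < 1/2\<close>. Markov's
  inequality then gives tightness.
\<close>

lemma smoothed_periodogram_tight_gmc:
  assumes prob: "prob_space M" and stat: "stationary_field M V \<mu>"
    and rep: "innovation_rep M V \<mu> G e" and g: "gmc M V \<mu> G e"
    and mom: "integrable M (\<lambda>\<omega>. \<bar>V 0 \<omega>\<bar> powr \<phi>)" and \<phi>: "4 < \<phi>" "\<phi> \<le> 8"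
    and \<eta>: "0 < \<eta>" "\<eta> < (\<phi> - 4) / \<phi>" and O: "(\<lambda>n. inverse (vabs (h n) * gsize (d n) powr \<eta>)) \<in> O(\<lambda>_. 1)"
    and K1: "K1 d h K" and K2: "K2 h K" and bw: "bandwidth_cond d h"
    and d1: "filterlim (\<lambda>n. fst (d n)) at_top sequentially" and d2: "filterlim (\<lambda>n. snd (d n)) at_top sequentially"
  shows "\<exists>Y. prob_bounded M Y \<and> (\<forall>\<^sub>F n in sequentially. \<forall>k\<in>grid (d n). \<forall>\<omega>\<in>space M.
     smoothing_weights.Q (d n) (weight K (h n) (d n)) k (\<lambda>t. V t \<omega> - \<mu>) \<le> Y n \<omega>)"
proof -
  interpret prob_space M by (rule prob)
  interpret innovation_field M V \<mu> G e
    by (intro innovation_field.intro innovation_field_axioms.intro prob rep) (use stat in \<open>simp only: stationary_field_def\<close>)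
  obtain H C \<rho> where C: "0 < C" "0 < \<rho>" "\<rho> < 1" and H: "\<And>m. H m \<in> borel_measurable S \<and>
      (\<forall>x x'. (\<forall>s\<in>lag_ball m. x s = x' s) \<longrightarrow> H m x = H m x') \<and>
      (\<forall>t. integrable M (\<lambda>\<omega>. (V t \<omega> - \<mu> - H m (\<lambda>s. e (t - s) \<omega>)) ^ 4) \<and>
        expectation (\<lambda>\<omega>. (V t \<omega> - \<mu> - H m (\<lambda>s. e (t - s) \<omega>)) ^ 4) \<le> (C * \<rho> ^ m) ^ 4)"
    using fourth_moment_approximants[OF g mom \<phi>(1)] by blast
  have "\<exists>\<Theta>. \<forall>d p B. smoothing_weights d p B \<longrightarrow>
    (\<exists>Y. integrable M Y \<and> (\<forall>\<omega>. 0 \<le> Y \<omega>) \<and> expectation Y \<le> \<Theta> * (2 + 1024 * B\<^sup>2 * gsize d) + 2 \<and>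
      (\<forall>k\<in>grid d. \<forall>\<omega>. smoothing_weights.Q d p k (\<lambda>t. V t \<omega> - \<mu>) \<le> Y \<omega>))"
    by (rule smoothed_periodogram_bound[OF C, of H])
      (use H stationary_cross_moment(3,4)[OF prob stat] in blast)+
  then obtain \<Theta> where \<Theta>: "\<And>d p B. smoothing_weights d p B \<Longrightarrow>
    (\<exists>Y. integrable M Y \<and> (\<forall>\<omega>. 0 \<le> Y \<omega>) \<and> expectation Y \<le> \<Theta> * (2 + 1024 * B\<^sup>2 * gsize d) + 2 \<and>
      (\<forall>k\<in>grid d. \<forall>\<omega>. smoothing_weights.Q d p k (\<lambda>t. V t \<omega> - \<mu>) \<le> Y \<omega>))" by blast
  obtain C0 where C0: "C0 > 0" and ev: "\<forall>\<^sub>F n in sequentially. fst (h n) > 0 \<and> snd (h n) > 0 \<and>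
     (\<lambda>s. K (lattice_pt (h n) (d n) s)) summable_on UNIV \<and>
     vabs (h n) * gsize (d n) / (8 * pi\<^sup>2) \<le> (\<Sum>\<^sub>\<infinity>s. K (lattice_pt (h n) (d n) s)) \<and>
     smoothing_weights (d n) (weight K (h n) (d n)) (C0 / (vabs (h n) * gsize (d n)))"
    using kernel_smoothing[OF K1 K2 bw d1 d2] by blast
  obtain L where L: "\<forall>\<^sub>F n in sequentially. norm (inverse (vabs (h n) * gsize (d n) powr \<eta>)) \<le> L * norm (1::real)"
    using O by (auto elim!: landau_o.bigE)
  let ?B = "\<lambda>n. C0 / (vabs (h n) * gsize (d n))"
  define good where "good n Y \<longleftrightarrow> integrable M Y \<and> (\<forall>\<omega>. 0 \<le> Y \<omega>) \<and> expectation Y \<le> \<Theta> * (2 + 1024 * (?B n)\<^sup>2 * gsize (d n)) + 2 \<and>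
      (\<forall>k\<in>grid (d n). \<forall>\<omega>. smoothing_weights.Q (d n) (weight K (h n) (d n)) k (\<lambda>t. V t \<omega> - \<mu>) \<le> Y \<omega>)" for n Y
  define Y where "Y n = (SOME Y. good n Y)" for n
  have gd: "\<forall>\<^sub>F n in sequentially. good n (Y n)"
    using ev
  proof (rule eventually_mono)
    fix n assume "fst (h n) > 0 \<and> snd (h n) > 0 \<and>
     (\<lambda>s. K (lattice_pt (h n) (d n) s)) summable_on UNIV \<and>
     vabs (h n) * gsize (d n) / (8 * pi\<^sup>2) \<le> (\<Sum>\<^sub>\<infinity>s. K (lattice_pt (h n) (d n) s)) \<and>
     smoothing_weights (d n) (weight K (h n) (d n)) (?B n)"
    then have "\<exists>Y. good n Y" unfolding good_def by (intro \<Theta>) blast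
    then show "good n (Y n)" unfolding Y_def by (rule someI_ex)
  qed
  have \<eta>2: "\<eta> < 1/2"
  proof -
    have "(\<phi> - 4) / \<phi> \<le> 1/2" using \<phi> by (simp add: field_simps)
    then show ?thesis using \<eta> by linarith
  qed
  have "\<forall>\<^sub>F n in sequentially. integrable M (Y n) \<and> expectation (Y n) \<le> \<bar>\<Theta>\<bar> * (2 + 1024 * (C0\<^sup>2 * L\<^sup>2)) + 2 \<and> (\<forall>\<omega>\<in>space M. 0 \<le> Y n \<omega>)"
    using gd ev L eventually_gsize_ge[OF d1 d2]
  proof eventually_elim
    case (elim n)
    define g where "g = gsize (d n)"
    define w where "w = vabs (h n)"
    have w: "w > 0" using elim(2) by (auto simp: w_def vabs_def)
    have g1: "g \<ge> 1" using elim(4) by (simp add: g_def)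
    have Lw: "1 / (w * g powr \<eta>) \<le> L" using elim(3) w g1 by (simp add: w_def g_def divide_inverse)
    have "(?B n)\<^sup>2 * gsize (d n) = C0\<^sup>2 * ((1 / (w * g powr \<eta>))\<^sup>2 * g powr (2 * \<eta> - 1))"
    proof -
      have "g powr (2 * \<eta> - 1) = (g powr \<eta>)\<^sup>2 / g" using g1 by (simp add: powr_diff powr_numeral[symmetric] powr_powr mult.commute)
      then show ?thesis using w g1 by (simp add: w_def[symmetric] g_def[symmetric] power_divide power_mult_distrib field_simps power2_eq_square)
    qed
    also have "\<dots> \<le> C0\<^sup>2 * (L\<^sup>2 * 1)"
    proof (intro mult_left_mono mult_mono power_mono Lw)
      show "g powr (2 * \<eta> - 1) \<le> 1" using powr_mono[of "2 * \<eta> - 1" 0 g] \<eta>2 g1 by simp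
    qed (use w g1 in auto)
    finally have b: "(?B n)\<^sup>2 * gsize (d n) \<le> C0\<^sup>2 * L\<^sup>2" by simp
    have "\<Theta> * (2 + 1024 * (?B n)\<^sup>2 * gsize (d n)) \<le> \<bar>\<Theta>\<bar> * (2 + 1024 * (?B n)\<^sup>2 * gsize (d n))"
      using g1 by (intro mult_right_mono) (auto simp: g_def)
    also have "\<dots> \<le> \<bar>\<Theta>\<bar> * (2 + 1024 * (C0\<^sup>2 * L\<^sup>2))"
      using b by (intro mult_left_mono) (simp_all add: mult.assoc)
    finally have "expectation (Y n) \<le> \<bar>\<Theta>\<bar> * (2 + 1024 * (C0\<^sup>2 * L\<^sup>2)) + 2"
      using elim(1) unfolding good_def by linarith
    then show ?case using elim(1) unfolding good_def by blast
  qed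
  then have "prob_bounded M Y" by (rule prob_bounded_markov)
  moreover have "\<forall>\<^sub>F n in sequentially. \<forall>k\<in>grid (d n). \<forall>\<omega>\<in>space M.
     smoothing_weights.Q (d n) (weight K (h n) (d n)) k (\<lambda>t. V t \<omega> - \<mu>) \<le> Y n \<omega>"
    using gd by (rule eventually_mono) (auto simp: good_def)
  ultimately show ?thesis by blast
qed

section \<open>Weighted averages of perturbed quantities\<close>

lemma (in prob_space) prob_vanishing_cmult:
  assumes X: "prob_vanishing M X" and c: "c \<ge> 0"
  shows "prob_vanishing M (\<lambda>n \<omega>. c * X n \<omega>)"
  unfolding prob_vanishing_def with_high_prob_def
proof (intro allI impI)
  fix \<delta> \<epsilon> :: real assume e: "\<delta> > 0" "\<epsilon> > 0"
  have "\<delta> / (c + 1) > 0" using e c by simp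
  then have "\<forall>\<^sub>F n in sequentially. \<exists>S\<in>sets M. measure M S < \<epsilon> \<and> (\<forall>\<omega>\<in>space M - S. X n \<omega> \<le> \<delta> / (c + 1))"
    using X e(2) unfolding prob_vanishing_def with_high_prob_def by blast
  then show "\<forall>\<^sub>F n in sequentially. \<exists>S\<in>sets M. measure M S < \<epsilon> \<and> (\<forall>\<omega>\<in>space M - S. c * X n \<omega> \<le> \<delta>)"
  proof (rule eventually_mono)
    fix n assume "\<exists>S\<in>sets M. measure M S < \<epsilon> \<and> (\<forall>\<omega>\<in>space M - S. X n \<omega> \<le> \<delta> / (c + 1))"
    then obtain S where S: "S \<in> sets M" "measure M S < \<epsilon>" "\<forall>\<omega>\<in>space M - S. X n \<omega> \<le> \<delta> / (c + 1)" by blast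
    have "c * (\<delta> / (c + 1)) \<le> \<delta>" using c e by (simp add: field_simps)
    then have "c * X n \<omega> \<le> \<delta>" if "\<omega> \<in> space M - S" for \<omega>
      using mult_left_mono[OF S(3)[rule_format, OF that] c] by linarith
    then show "\<exists>S\<in>sets M. measure M S < \<epsilon> \<and> (\<forall>\<omega>\<in>space M - S. c * X n \<omega> \<le> \<delta>)" using S(1,2) by blast
  qed
qed

lemma (in prob_space) prob_vanishing_abs_of_small_op:
  assumes "small_op M a X" "c \<in> O(\<lambda>n. inverse (a n))" "\<forall>\<^sub>F n in sequentially. a n > 0" "\<And>n. c n \<ge> 0"
  shows "prob_vanishing M (\<lambda>n \<omega>. c n * \<bar>X n \<omega>\<bar>)"
proof -
  obtain L where L: "\<forall>\<^sub>F n in sequentially. norm (c n) \<le> L * norm (inverse (a n))"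
    using assms(2) by (auto elim!: landau_o.bigE)
  with assms(3) have "\<forall>\<^sub>F n in sequentially. c n * \<bar>a n\<bar> \<le> L"
  proof eventually_elim
    case (elim n)
    have "c n \<le> L * inverse (a n)" using elim assms(4)[of n] by simp
    then have "c n * a n \<le> L * inverse (a n) * a n" using elim(1) by (intro mult_right_mono) auto
    also have "L * inverse (a n) * a n = L" using elim(1) by simp
    finally show ?case using elim(1) by simp
  qed
  then show ?thesis using assms(1,4) by (intro small_op_imp_vanishing)
qed

lemma half_grid_nonempty:
  assumes "fst d \<ge> 3" "snd d \<ge> 3"
  shows "half_grid d \<noteq> {}"
proof -
  have "gsize d > 0" unfolding gsize_def using assms by (intro mult_pos_pos) auto
  then have "real (card (half_grid d)) > 0" using half_grid_size(2)[OF assms] by linarith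
  then show ?thesis by auto
qed

lemma finite_half_grid: "finite (half_grid d)"
  unfolding half_grid_def Let_def by simp

text \<open>
  Several families of averages, indexed by \<open>k \<in> J n\<close>, are controlled at once, because some conclusions concern a
  supremum over \<open>k\<close>. The bounds \<open>A\<close> and \<open>E\<close> are uniform in \<open>k\<close>.
\<close>

locale perturbed_averages = prob_space M for M :: "'w measure" +
  fixes J :: "nat \<Rightarrow> 'k set" and I :: "nat \<Rightarrow> 'i set" and w :: "nat \<Rightarrow> 'k \<Rightarrow> 'i \<Rightarrow> real"
    and u v e :: "nat \<Rightarrow> 'k \<Rightarrow> 'i \<Rightarrow> 'w \<Rightarrow> real" and A E :: "nat \<Rightarrow> 'w \<Rightarrow> real" and q :: real
  assumes q: "q \<ge> 1" and A: "prob_bounded M A" and E: "prob_vanishing M E"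
    and weights: "\<forall>\<^sub>F n in sequentially. \<forall>k\<in>J n. (\<forall>i\<in>I n. 0 \<le> w n k i) \<and> (\<Sum>i\<in>I n. w n k i) = 1"
    and close: "\<forall>\<^sub>F n in sequentially. \<forall>k\<in>J n. \<forall>i\<in>I n. \<forall>\<omega>\<in>space M. 0 \<le> u n k i \<omega> \<and> 0 \<le> v n k i \<omega> \<and> 0 \<le> e n k i \<omega> \<and>
      \<bar>sqrt (u n k i \<omega>) - sqrt (v n k i \<omega>)\<bar> \<le> sqrt (e n k i \<omega>)"
    and u_moment: "\<forall>\<^sub>F n in sequentially. \<forall>k\<in>J n. \<forall>\<omega>\<in>space M. (\<Sum>i\<in>I n. w n k i * u n k i \<omega> powr q) \<le> A n \<omega>"
    and e_moment: "\<forall>\<^sub>F n in sequentially. \<forall>k\<in>J n. \<forall>\<omega>\<in>space M. (\<Sum>i\<in>I n. w n k i * e n k i \<omega> powr q) \<le> E n \<omega>"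
begin

text \<open>
  The premise on \<open>X\<close> says that \<open>X n\<close> is bounded by any common bound of the averages; this covers a single average as
  well as a supremum of averages or of their moduli.
\<close>

lemma powr_differences_vanish:
  assumes p: "0 < p" "p \<le> q"
    and X: "\<forall>\<^sub>F n in sequentially. \<forall>\<omega>\<in>space M. \<forall>c. (\<forall>k\<in>J n. \<bar>\<Sum>i\<in>I n. w n k i * (u n k i \<omega> powr p - v n k i \<omega> powr p)\<bar> \<le> c) \<longrightarrow> \<bar>X n \<omega>\<bar> \<le> c"
  shows "prob_vanishing M (\<lambda>n \<omega>. \<bar>X n \<omega>\<bar>)"
proof -
  define D where "D \<eta> = (SOME C. C \<ge> 0 \<and> (\<forall>a b c::real. 0 \<le> a \<longrightarrow> 0 \<le> b \<longrightarrow> 0 \<le> c \<longrightarrow> \<bar>sqrt a - sqrt b\<bar> \<le> sqrt c \<longrightarrow> \<bar>a powr p - b powr p\<bar> \<le> \<eta> * (2 + a powr q) + C * c powr q))" for \<eta> :: real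
  have D: "D \<eta> \<ge> 0 \<and> (\<forall>a b c::real. 0 \<le> a \<longrightarrow> 0 \<le> b \<longrightarrow> 0 \<le> c \<longrightarrow> \<bar>sqrt a - sqrt b\<bar> \<le> sqrt c \<longrightarrow> \<bar>a powr p - b powr p\<bar> \<le> \<eta> * (2 + a powr q) + D \<eta> * c powr q)"
    if "\<eta> > 0" for \<eta> unfolding D_def by (rule someI_ex) (use powr_perturb[OF p that] in blast)
  show ?thesis
  proof (rule prob_vanishing_sandwich)
    show "prob_bounded M (\<lambda>n \<omega>. 2 + A n \<omega>)" by (rule prob_bounded_const_add[OF A])
    show "prob_vanishing M (\<lambda>n \<omega>. D \<eta> * E n \<omega>)" if "\<eta> > 0" for \<eta>
      using E D[OF that] by (intro prob_vanishing_cmult) auto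
    fix \<eta> :: real assume \<eta>: "\<eta> > 0"
    note D = D[OF \<eta>]
    from X weights close u_moment e_moment
    show "\<forall>\<^sub>F n in sequentially. \<forall>\<omega>\<in>space M. \<bar>X n \<omega>\<bar> \<le> \<eta> * (2 + A n \<omega>) + D \<eta> * E n \<omega>"
    proof eventually_elim
      case (elim n)
      have "\<bar>\<Sum>i\<in>I n. w n k i * (u n k i \<omega> powr p - v n k i \<omega> powr p)\<bar> \<le> \<eta> * (2 + A n \<omega>) + D \<eta> * E n \<omega>"
        if k: "k \<in> J n" and \<omega>: "\<omega> \<in> space M" for k \<omega>
      proof -
        have w: "\<And>i. i \<in> I n \<Longrightarrow> 0 \<le> w n k i" and w1: "(\<Sum>i\<in>I n. w n k i) = 1" using elim(2) k by blast+
        have "\<bar>\<Sum>i\<in>I n. w n k i * (u n k i \<omega> powr p - v n k i \<omega> powr p)\<bar> \<le> (\<Sum>i\<in>I n. \<bar>w n k i * (u n k i \<omega> powr p - v n k i \<omega> powr p)\<bar>)"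
          by (rule sum_abs)
        also have "\<dots> \<le> (\<Sum>i\<in>I n. w n k i * (\<eta> * (2 + u n k i \<omega> powr q) + D \<eta> * e n k i \<omega> powr q))"
        proof (rule sum_mono)
          fix i assume i: "i \<in> I n"
          have "\<bar>u n k i \<omega> powr p - v n k i \<omega> powr p\<bar> \<le> \<eta> * (2 + u n k i \<omega> powr q) + D \<eta> * e n k i \<omega> powr q"
            using elim(3) k i \<omega> D by blast
          then have "w n k i * \<bar>u n k i \<omega> powr p - v n k i \<omega> powr p\<bar> \<le> w n k i * (\<eta> * (2 + u n k i \<omega> powr q) + D \<eta> * e n k i \<omega> powr q)"
            using w[OF i] by (rule mult_left_mono)
          then show "\<bar>w n k i * (u n k i \<omega> powr p - v n k i \<omega> powr p)\<bar> \<le> w n k i * (\<eta> * (2 + u n k i \<omega> powr q) + D \<eta> * e n k i \<omega> powr q)"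
            using w[OF i] by (simp only: abs_mult abs_of_nonneg)
        qed
        also have "\<dots> = \<eta> * (2 * (\<Sum>i\<in>I n. w n k i) + (\<Sum>i\<in>I n. w n k i * u n k i \<omega> powr q)) + D \<eta> * (\<Sum>i\<in>I n. w n k i * e n k i \<omega> powr q)"
          by (simp add: sum_distrib_left sum.distrib algebra_simps)
        also have "\<dots> \<le> \<eta> * (2 * 1 + A n \<omega>) + D \<eta> * E n \<omega>"
          unfolding w1 using elim(4,5) k \<omega> \<eta> D by (intro add_mono mult_left_mono) auto
        finally show ?thesis by simp
      qed
      then show ?case using elim(1) by blast
    qed
  qed
qed

text \<open>
  Square roots of \<open>e\<close> are at most \<open>\<eta>\<close> plus a multiple of \<open>e powr q\<close>: the first term is as small as desired and the
  second vanishes with \<open>E\<close>.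
\<close>

lemma root_averages_vanish:
  assumes g: "\<forall>\<^sub>F n in sequentially. \<forall>k\<in>J n. \<forall>i\<in>I n. \<forall>\<omega>\<in>space M. \<bar>g n k i \<omega>\<bar> \<le> 2 * sqrt (e n k i \<omega>)"
    and X: "\<forall>\<^sub>F n in sequentially. \<forall>\<omega>\<in>space M. \<forall>c. (\<forall>k\<in>J n. \<bar>\<Sum>i\<in>I n. w n k i * g n k i \<omega>\<bar> \<le> c) \<longrightarrow> \<bar>X n \<omega>\<bar> \<le> c"
  shows "prob_vanishing M (\<lambda>n \<omega>. \<bar>X n \<omega>\<bar>)"
proof -
  define D where "D \<eta> = (SOME C. C \<ge> 0 \<and> (\<forall>\<delta>\<ge>0. \<delta> powr (1/2) \<le> \<eta> + C * (\<delta>::real) powr q))" for \<eta> :: real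
  have D: "D \<eta> \<ge> 0 \<and> (\<forall>\<delta>\<ge>0. \<delta> powr (1/2) \<le> \<eta> + D \<eta> * \<delta> powr q)" if "\<eta> > 0" for \<eta>
    unfolding D_def by (rule someI_ex) (use powr_le_small_plus[of "1/2" q \<eta>] that q in auto)
  show ?thesis
  proof (rule prob_vanishing_sandwich)
    show "prob_bounded M (\<lambda>_ _. 2)" unfolding prob_bounded_def
      by (auto intro!: exI[of _ 2] always_eventually bexI[of _ "{}"])
    show "prob_vanishing M (\<lambda>n \<omega>. (2 * D \<eta>) * E n \<omega>)" if "\<eta> > 0" for \<eta>
      using E D[OF that] by (intro prob_vanishing_cmult) auto
    fix \<eta> :: real assume \<eta>: "\<eta> > 0"
    note D = D[OF \<eta>]
    from X weights close g e_moment
    show "\<forall>\<^sub>F n in sequentially. \<forall>\<omega>\<in>space M. \<bar>X n \<omega>\<bar> \<le> \<eta> * 2 + (2 * D \<eta>) * E n \<omega>"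
    proof eventually_elim
      case (elim n)
      have "\<bar>\<Sum>i\<in>I n. w n k i * g n k i \<omega>\<bar> \<le> \<eta> * 2 + (2 * D \<eta>) * E n \<omega>"
        if k: "k \<in> J n" and \<omega>: "\<omega> \<in> space M" for k \<omega>
      proof -
        have w: "\<And>i. i \<in> I n \<Longrightarrow> 0 \<le> w n k i" and w1: "(\<Sum>i\<in>I n. w n k i) = 1" using elim(2) k by blast+
        have "\<bar>\<Sum>i\<in>I n. w n k i * g n k i \<omega>\<bar> \<le> (\<Sum>i\<in>I n. \<bar>w n k i * g n k i \<omega>\<bar>)"
          by (rule sum_abs)
        also have "\<dots> \<le> (\<Sum>i\<in>I n. w n k i * (2 * (\<eta> + D \<eta> * e n k i \<omega> powr q)))"
        proof (rule sum_mono)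
          fix i assume i: "i \<in> I n"
          have e0: "0 \<le> e n k i \<omega>" using elim(3) k i \<omega> by blast
          have "\<bar>g n k i \<omega>\<bar> \<le> 2 * sqrt (e n k i \<omega>)" using elim(4) k i \<omega> by blast
          also have "sqrt (e n k i \<omega>) \<le> \<eta> + D \<eta> * e n k i \<omega> powr q"
            using D e0 by (simp add: powr_half_sqrt)
          finally have "\<bar>g n k i \<omega>\<bar> \<le> 2 * (\<eta> + D \<eta> * e n k i \<omega> powr q)" by simp
          then have "w n k i * \<bar>g n k i \<omega>\<bar> \<le> w n k i * (2 * (\<eta> + D \<eta> * e n k i \<omega> powr q))"
            using w[OF i] by (rule mult_left_mono)
          then show "\<bar>w n k i * g n k i \<omega>\<bar> \<le> w n k i * (2 * (\<eta> + D \<eta> * e n k i \<omega> powr q))"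
            using w[OF i] by (simp only: abs_mult abs_of_nonneg)
        qed
        also have "\<dots> = \<eta> * (2 * (\<Sum>i\<in>I n. w n k i)) + (2 * D \<eta>) * (\<Sum>i\<in>I n. w n k i * e n k i \<omega> powr q)"
          by (simp add: sum_distrib_left sum.distrib algebra_simps)
        also have "\<dots> \<le> \<eta> * (2 * 1) + (2 * D \<eta>) * E n \<omega>"
          unfolding w1 using elim(5) k \<omega> \<eta> D by (intro add_mono mult_left_mono) auto
        finally show ?thesis by simp
      qed
      then show ?case using elim(1) by blast
    qed
  qed
qed

end

section \<open>Smoothed differences of periodograms\<close>

text \<open>
  The setting shared by all parts of the theorem; \<open>err\<close> is the mean squared estimation error.
\<close>

locale estimated_field = prob_space M for M :: "'w measure" +
  fixes V :: "int \<times> int \<Rightarrow> 'w \<Rightarrow> real" and \<mu> :: real and d :: "nat \<Rightarrow> nat \<times> nat"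
    and Vhat :: "nat \<Rightarrow> int \<times> int \<Rightarrow> 'w \<Rightarrow> real" and \<alpha> :: "nat \<Rightarrow> real"
  assumes stationary: "stationary_field M V \<mu>"
    and d1: "filterlim (\<lambda>n. fst (d n)) at_top sequentially" and d2: "filterlim (\<lambda>n. snd (d n)) at_top sequentially"
    and Vhat_meas: "\<And>n t. t \<in> grid (d n) \<Longrightarrow> Vhat n t \<in> borel_measurable M"
    and rate: "filterlim \<alpha> at_top sequentially"
    and mse: "small_op M (\<lambda>n. inverse (\<alpha> n))
          (\<lambda>n \<omega>. 1 / gsize (d n) * (\<Sum>t\<in>grid (d n). (V t \<omega> - Vhat n t \<omega>)\<^sup>2))"
begin

definition "err n \<omega> = 1 / gsize (d n) * (\<Sum>t\<in>grid (d n). (V t \<omega> - Vhat n t \<omega>)\<^sup>2)"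

abbreviation "I\<^sub>V n \<omega> \<equiv> pgram (d n) (\<lambda>t. V t \<omega>)"
abbreviation "I\<^sub>H n \<omega> \<equiv> pgram (d n) (\<lambda>t. Vhat n t \<omega>)"
abbreviation "I\<^sub>D n \<omega> \<equiv> pgram0 (d n) (\<lambda>t. V t \<omega> - Vhat n t \<omega>)"

lemma V_meas: "V t \<in> borel_measurable M" using stationary unfolding stationary_field_def by blast

lemma err_nonneg: "err n \<omega> \<ge> 0"
  unfolding err_def by (intro mult_nonneg_nonneg sum_nonneg) (auto simp: gsize_def)

text \<open>
  Parseval's identity for the estimation error.
\<close>

lemma sum_difference_pgram:
  assumes "fst (d n) > 0" "snd (d n) > 0"
  shows "(\<Sum>j\<in>grid (d n). I\<^sub>D n \<omega> j) = gsize (d n) * err n \<omega>"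
  unfolding err_def sum_pgram0[OF assms] using assms by (simp add: gsize_def)

lemma err_rate:
  assumes "c \<in> O(\<alpha>)" "\<And>n. c n \<ge> 0"
  shows "prob_vanishing M (\<lambda>n \<omega>. c n * err n \<omega>)"
proof -
  have pos: "\<forall>\<^sub>F n in sequentially. inverse (\<alpha> n) > 0"
    using rate[unfolded filterlim_at_top_dense, rule_format, of 0] by (rule eventually_mono) simp
  have "prob_vanishing M (\<lambda>n \<omega>. c n * \<bar>err n \<omega>\<bar>)"
    using mse assms pos unfolding err_def by (intro prob_vanishing_abs_of_small_op[where a="\<lambda>n. inverse (\<alpha> n)"]) (simp_all only: inverse_inverse_eq eta_contract_eq)
  then show ?thesis by (simp only: abs_of_nonneg[OF err_nonneg])
qed

text \<open>
  Each folded weight is at most \<open>C0 / (|h| |T|)\<close>, and a sum of \<open>q\<close>-th powers is at most the \<open>q\<close>-th power of the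
  sum, which Parseval identifies. The rate assumed for \<open>\<alpha>\<close> is the one at which the product vanishes.
\<close>

lemma smoothed_perturbed_averages:
  assumes K1: "K1 d h K" and K2: "K2 h K" and bw: "bandwidth_cond d h" and q: "q \<ge> 1"
    and O: "(\<lambda>n. (gsize (d n) powr (q - 1) / vabs (h n)) powr (1 / q)) \<in> O(\<alpha>)"
    and A: "prob_bounded M A"
    and mom: "\<forall>\<^sub>F n in sequentially. \<forall>k\<in>J n. \<forall>\<omega>\<in>space M.
       (\<Sum>\<^sub>\<infinity>s. weight K (h n) (d n) s * I\<^sub>V n \<omega> (k + s) powr q) \<le> A n \<omega>"
  shows "\<exists>E. perturbed_averages M J (\<lambda>n. grid (d n)) (\<lambda>n k. smoothing_weights.pbar (d n) (weight K (h n) (d n)))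
     (\<lambda>n k r \<omega>. I\<^sub>V n \<omega> (k + r)) (\<lambda>n k r \<omega>. I\<^sub>H n \<omega> (k + r)) (\<lambda>n k r \<omega>. I\<^sub>D n \<omega> (k + r)) A E q"
proof -
  obtain C0 where C0: "C0 > 0" and ev: "\<forall>\<^sub>F n in sequentially. fst (h n) > 0 \<and> snd (h n) > 0 \<and>
     (\<lambda>s. K (lattice_pt (h n) (d n) s)) summable_on UNIV \<and>
     vabs (h n) * gsize (d n) / (8 * pi\<^sup>2) \<le> (\<Sum>\<^sub>\<infinity>s. K (lattice_pt (h n) (d n) s)) \<and>
     smoothing_weights (d n) (weight K (h n) (d n)) (C0 / (vabs (h n) * gsize (d n)))"
    using kernel_smoothing[OF K1 K2 bw d1 d2] by blast
  have hp: "\<forall>\<^sub>F n in sequentially. vabs (h n) > 0"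
    using ev by (rule eventually_mono) (auto simp: vabs_def)
  have sw: "\<forall>\<^sub>F n in sequentially. smoothing_weights (d n) (weight K (h n) (d n)) (C0 / (vabs (h n) * gsize (d n)))"
    using ev by (rule eventually_mono) blast
  let ?c = "\<lambda>n. (gsize (d n) powr (q - 1) / vabs (h n)) powr (1 / q)"
  let ?E = "\<lambda>n \<omega>. C0 * (?c n * err n \<omega>) powr q"
  have "perturbed_averages M J (\<lambda>n. grid (d n)) (\<lambda>n k. smoothing_weights.pbar (d n) (weight K (h n) (d n)))
     (\<lambda>n k r \<omega>. I\<^sub>V n \<omega> (k + r)) (\<lambda>n k r \<omega>. I\<^sub>H n \<omega> (k + r)) (\<lambda>n k r \<omega>. I\<^sub>D n \<omega> (k + r)) A ?E q"
  proof (intro perturbed_averages.intro perturbed_averages_axioms.intro q A prob_space_axioms)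
    show "prob_vanishing M ?E"
      using C0 q err_nonneg by (intro prob_vanishing_cmult_powr err_rate O) auto
    show "\<forall>\<^sub>F n in sequentially. \<forall>k\<in>J n. (\<forall>r\<in>grid (d n). 0 \<le> smoothing_weights.pbar (d n) (weight K (h n) (d n)) r) \<and>
        (\<Sum>r\<in>grid (d n). smoothing_weights.pbar (d n) (weight K (h n) (d n)) r) = 1"
      using sw by (rule eventually_mono) (blast intro: smoothing_weights.pbar_nonneg smoothing_weights.sum_pbar)
    show "\<forall>\<^sub>F n in sequentially. \<forall>k\<in>J n. \<forall>r\<in>grid (d n). \<forall>\<omega>\<in>space M. 0 \<le> I\<^sub>V n \<omega> (k + r) \<and> 0 \<le> I\<^sub>H n \<omega> (k + r) \<and> 0 \<le> I\<^sub>D n \<omega> (k + r) \<and>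
        \<bar>sqrt (I\<^sub>V n \<omega> (k + r)) - sqrt (I\<^sub>H n \<omega> (k + r))\<bar> \<le> sqrt (I\<^sub>D n \<omega> (k + r))"
      by (intro always_eventually allI ballI conjI pgram_nonneg pgram0_nonneg sqrt_pgram_diff)
    show "\<forall>\<^sub>F n in sequentially. \<forall>k\<in>J n. \<forall>\<omega>\<in>space M.
       (\<Sum>r\<in>grid (d n). smoothing_weights.pbar (d n) (weight K (h n) (d n)) r * I\<^sub>V n \<omega> (k + r) powr q) \<le> A n \<omega>"
      using mom sw
    proof eventually_elim
      case (elim n)
      interpret smoothing_weights "d n" "weight K (h n) (d n)" "C0 / (vabs (h n) * gsize (d n))" by (rule elim(2))
      have "(\<Sum>\<^sub>\<infinity>s. weight K (h n) (d n) s * I\<^sub>V n \<omega> (k + s) powr q) = (\<Sum>r\<in>grid (d n). pbar r * I\<^sub>V n \<omega> (k + r) powr q)" for k \<omega>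
        by (rule smooth_eq) (rule grid_periodic_comp[OF pgram_periodic(2)[OF d_pos]])
      with elim(1) show ?case by simp
    qed
    show "\<forall>\<^sub>F n in sequentially. \<forall>k\<in>J n. \<forall>\<omega>\<in>space M.
       (\<Sum>r\<in>grid (d n). smoothing_weights.pbar (d n) (weight K (h n) (d n)) r * I\<^sub>D n \<omega> (k + r) powr q) \<le> ?E n \<omega>"
      using hp sw
    proof eventually_elim
      case (elim n)
      interpret smoothing_weights "d n" "weight K (h n) (d n)" "C0 / (vabs (h n) * gsize (d n))" by (rule elim(2))
      show ?case
      proof (intro ballI)
        fix k \<omega>
        let ?g = "gsize (d n)" and ?v = "vabs (h n)" and ?m = "err n \<omega>"
        have "(\<Sum>r\<in>grid (d n). pbar r * I\<^sub>D n \<omega> (k + r) powr q) \<le> C0 / (?v * ?g) * (\<Sum>r\<in>grid (d n). I\<^sub>D n \<omega> r powr q)"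
          by (rule smooth_le_sum) (rule grid_periodic_comp[OF pgram_periodic(1)[OF d_pos]], rule powr_ge_zero)
        also have "\<dots> \<le> C0 / (?v * ?g) * (?g * ?m) powr q"
          unfolding sum_difference_pgram[OF d_pos, symmetric]
          using B_nonneg q by (intro mult_left_mono sum_powr_le_powr_sum) auto
        also have "\<dots> = ?E n \<omega>"
        proof -
          have "?c n powr q = ?g powr (q - 1) / ?v" using q elim(1) by (simp add: powr_powr)
          then have "(?c n * ?m) powr q = ?g powr (q - 1) / ?v * ?m powr q"
            using err_nonneg by (simp add: powr_mult)
          moreover have "(?g * ?m) powr q = ?g * ?g powr (q - 1) * ?m powr q"
            using gsize_pos err_nonneg by (simp add: powr_mult powr_diff)
          ultimately show ?thesis using gsize_pos elim(1) by (simp add: field_simps)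
        qed
        finally show "(\<Sum>r\<in>grid (d n). pbar r * I\<^sub>D n \<omega> (k + r) powr q) \<le> ?E n \<omega>" .
      qed
    qed
  qed
  then show ?thesis by blast
qed

lemma smoothed_powr_differences_vanish:
  assumes K1: "K1 d h K" and K2: "K2 h K" and bw: "bandwidth_cond d h" and q: "q \<ge> 1"
    and O: "(\<lambda>n. (gsize (d n) powr (q - 1) / vabs (h n)) powr (1 / q)) \<in> O(\<alpha>)"
    and A: "prob_bounded M A"
    and mom: "\<forall>\<^sub>F n in sequentially. \<forall>k\<in>J n. \<forall>\<omega>\<in>space M.
       (\<Sum>\<^sub>\<infinity>s. weight K (h n) (d n) s * I\<^sub>V n \<omega> (k + s) powr q) \<le> A n \<omega>"
    and p: "0 < p" "p \<le> q"
    and X: "\<forall>\<^sub>F n in sequentially. \<forall>\<omega>\<in>space M. \<forall>c. (\<forall>k\<in>J n. \<bar>\<Sum>\<^sub>\<infinity>s. weight K (h n) (d n) s * (I\<^sub>V n \<omega> (k + s) powr p - I\<^sub>H n \<omega> (k + s) powr p)\<bar> \<le> c) \<longrightarrow> \<bar>X n \<omega>\<bar> \<le> c"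
  shows "prob_vanishing M (\<lambda>n \<omega>. \<bar>X n \<omega>\<bar>)"
proof -
  obtain E where "perturbed_averages M J (\<lambda>n. grid (d n)) (\<lambda>n k. smoothing_weights.pbar (d n) (weight K (h n) (d n)))
     (\<lambda>n k r \<omega>. I\<^sub>V n \<omega> (k + r)) (\<lambda>n k r \<omega>. I\<^sub>H n \<omega> (k + r)) (\<lambda>n k r \<omega>. I\<^sub>D n \<omega> (k + r)) A E q"
    using smoothed_perturbed_averages[OF K1 K2 bw q O A mom] by blast
  then interpret pa: perturbed_averages M J "\<lambda>n. grid (d n)" "\<lambda>n k. smoothing_weights.pbar (d n) (weight K (h n) (d n))"
     "\<lambda>n k r \<omega>. I\<^sub>V n \<omega> (k + r)" "\<lambda>n k r \<omega>. I\<^sub>H n \<omega> (k + r)" "\<lambda>n k r \<omega>. I\<^sub>D n \<omega> (k + r)" A E q .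
  obtain C0 where ev: "\<forall>\<^sub>F n in sequentially. fst (h n) > 0 \<and> snd (h n) > 0 \<and>
     (\<lambda>s. K (lattice_pt (h n) (d n) s)) summable_on UNIV \<and>
     vabs (h n) * gsize (d n) / (8 * pi\<^sup>2) \<le> (\<Sum>\<^sub>\<infinity>s. K (lattice_pt (h n) (d n) s)) \<and>
     smoothing_weights (d n) (weight K (h n) (d n)) (C0 / (vabs (h n) * gsize (d n)))"
    using kernel_smoothing[OF K1 K2 bw d1 d2] by blast
  show ?thesis
  proof (rule pa.powr_differences_vanish[OF p])
    show "\<forall>\<^sub>F n in sequentially. \<forall>\<omega>\<in>space M. \<forall>c. (\<forall>k\<in>J n. \<bar>\<Sum>r\<in>grid (d n). smoothing_weights.pbar (d n) (weight K (h n) (d n)) r *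
        (I\<^sub>V n \<omega> (k + r) powr p - I\<^sub>H n \<omega> (k + r) powr p)\<bar> \<le> c) \<longrightarrow> \<bar>X n \<omega>\<bar> \<le> c"
      using X ev
    proof eventually_elim
      case (elim n)
      interpret smoothing_weights "d n" "weight K (h n) (d n)" "C0 / (vabs (h n) * gsize (d n))" using elim(2) by blast
      have "(\<Sum>\<^sub>\<infinity>s. weight K (h n) (d n) s * (I\<^sub>V n \<omega> (k + s) powr p - I\<^sub>H n \<omega> (k + s) powr p)) = (\<Sum>r\<in>grid (d n). pbar r * (I\<^sub>V n \<omega> (k + r) powr p - I\<^sub>H n \<omega> (k + r) powr p))" for k \<omega>
        by (rule smooth_eq[where F="\<lambda>j. I\<^sub>V n \<omega> j powr p - I\<^sub>H n \<omega> j powr p"])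
          (rule grid_periodic_comp2[OF pgram_periodic(2)[OF d_pos] pgram_periodic(2)[OF d_pos]])
      with elim(1) show ?case by simp
    qed
  qed
qed

lemma smoothed_coef_differences_vanish:
  assumes K1: "K1 d h K" and K2: "K2 h K" and bw: "bandwidth_cond d h" and q: "q \<ge> 1"
    and O: "(\<lambda>n. (gsize (d n) powr (q - 1) / vabs (h n)) powr (1 / q)) \<in> O(\<alpha>)"
    and A: "prob_bounded M A"
    and mom: "\<forall>\<^sub>F n in sequentially. \<forall>k\<in>J n. \<forall>\<omega>\<in>space M.
       (\<Sum>\<^sub>\<infinity>s. weight K (h n) (d n) s * I\<^sub>V n \<omega> (k + s) powr q) \<le> A n \<omega>"
    and X: "\<forall>\<^sub>F n in sequentially. \<forall>\<omega>\<in>space M. \<forall>c. (\<forall>k\<in>J n. \<bar>\<Sum>\<^sub>\<infinity>s. weight K (h n) (d n) s *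
       (xcoef (d n) (\<lambda>t. V t \<omega>) (k + s) - xcoef (d n) (\<lambda>t. Vhat n t \<omega>) (k + s)
           + ycoef (d n) (\<lambda>t. V t \<omega>) (k + s) - ycoef (d n) (\<lambda>t. Vhat n t \<omega>) (k + s))\<bar> \<le> c) \<longrightarrow> \<bar>X n \<omega>\<bar> \<le> c"
  shows "prob_vanishing M (\<lambda>n \<omega>. \<bar>X n \<omega>\<bar>)"
proof -
  obtain E where "perturbed_averages M J (\<lambda>n. grid (d n)) (\<lambda>n k. smoothing_weights.pbar (d n) (weight K (h n) (d n)))
     (\<lambda>n k r \<omega>. I\<^sub>V n \<omega> (k + r)) (\<lambda>n k r \<omega>. I\<^sub>H n \<omega> (k + r)) (\<lambda>n k r \<omega>. I\<^sub>D n \<omega> (k + r)) A E q"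
    using smoothed_perturbed_averages[OF K1 K2 bw q O A mom] by blast
  then interpret pa: perturbed_averages M J "\<lambda>n. grid (d n)" "\<lambda>n k. smoothing_weights.pbar (d n) (weight K (h n) (d n))"
     "\<lambda>n k r \<omega>. I\<^sub>V n \<omega> (k + r)" "\<lambda>n k r \<omega>. I\<^sub>H n \<omega> (k + r)" "\<lambda>n k r \<omega>. I\<^sub>D n \<omega> (k + r)" A E q .
  obtain C0 where ev: "\<forall>\<^sub>F n in sequentially. fst (h n) > 0 \<and> snd (h n) > 0 \<and>
     (\<lambda>s. K (lattice_pt (h n) (d n) s)) summable_on UNIV \<and>
     vabs (h n) * gsize (d n) / (8 * pi\<^sup>2) \<le> (\<Sum>\<^sub>\<infinity>s. K (lattice_pt (h n) (d n) s)) \<and>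
     smoothing_weights (d n) (weight K (h n) (d n)) (C0 / (vabs (h n) * gsize (d n)))"
    using kernel_smoothing[OF K1 K2 bw d1 d2] by blast
  let ?\<Delta> = "\<lambda>n \<omega> t. V t \<omega> - Vhat n t \<omega>"
  let ?g = "\<lambda>n \<omega> j. xcoef (d n) (?\<Delta> n \<omega>) j + ycoef (d n) (?\<Delta> n \<omega>) j"
  have split: "xcoef (d n) (\<lambda>t. V t \<omega>) j - xcoef (d n) (\<lambda>t. Vhat n t \<omega>) j
           + ycoef (d n) (\<lambda>t. V t \<omega>) j - ycoef (d n) (\<lambda>t. Vhat n t \<omega>) j = ?g n \<omega> j" for n \<omega> j
    unfolding coef_diff by simp
  show ?thesis
  proof (rule pa.root_averages_vanish[where g="\<lambda>n k r \<omega>. ?g n \<omega> (k + r)"])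
    show "\<forall>\<^sub>F n in sequentially. \<forall>k\<in>J n. \<forall>r\<in>grid (d n). \<forall>\<omega>\<in>space M. \<bar>?g n \<omega> (k + r)\<bar> \<le> 2 * sqrt (I\<^sub>D n \<omega> (k + r))"
      by (intro always_eventually allI ballI coef_sum_le)
    show "\<forall>\<^sub>F n in sequentially. \<forall>\<omega>\<in>space M. \<forall>c. (\<forall>k\<in>J n. \<bar>\<Sum>r\<in>grid (d n). smoothing_weights.pbar (d n) (weight K (h n) (d n)) r *
        ?g n \<omega> (k + r)\<bar> \<le> c) \<longrightarrow> \<bar>X n \<omega>\<bar> \<le> c"
      using X[unfolded split] ev
    proof eventually_elim
      case (elim n)
      interpret smoothing_weights "d n" "weight K (h n) (d n)" "C0 / (vabs (h n) * gsize (d n))" using elim(2) by blast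
      have "(\<Sum>\<^sub>\<infinity>s. weight K (h n) (d n) s * ?g n \<omega> (k + s)) = (\<Sum>r\<in>grid (d n). pbar r * ?g n \<omega> (k + r))" for k \<omega>
        by (rule smooth_eq[where F="?g n \<omega>"])
          (rule grid_periodic_comp2[OF coef_periodic(1)[OF d_pos] coef_periodic(2)[OF d_pos]])
      with elim(1) show ?case by simp
    qed
  qed
qed

text \<open>
  The case \<open>p = q = 1\<close> of the smoothed comparison: up to the factor \<open>1 / (4 \<pi>\<^sup>2)\<close> the estimator is a smoothed
  periodogram.
\<close>

lemma fhat_difference_vanishes:
  assumes K1: "K1 d h K" and K2: "K2 h K" and bw: "bandwidth_cond d h"
    and O: "(\<lambda>n. inverse (vabs (h n))) \<in> O(\<alpha>)"
    and Y: "prob_bounded M Y"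
    and Q: "\<forall>\<^sub>F n in sequentially. \<forall>k\<in>grid (d n). \<forall>\<omega>\<in>space M.
     smoothing_weights.Q (d n) (weight K (h n) (d n)) k (\<lambda>t. V t \<omega> - \<mu>) \<le> Y n \<omega>"
  shows "small_op M (\<lambda>_. 1) (\<lambda>n \<omega>. SUP j\<in>grid (d n).
        \<bar>fhat K (h n) (d n) (\<lambda>t. V t \<omega>) (freq (d n) j) - fhat K (h n) (d n) (\<lambda>t. Vhat n t \<omega>) (freq (d n) j)\<bar>)"
proof -
  obtain C0 where ev: "\<forall>\<^sub>F n in sequentially. fst (h n) > 0 \<and> snd (h n) > 0 \<and>
     (\<lambda>s. K (lattice_pt (h n) (d n) s)) summable_on UNIV \<and>
     vabs (h n) * gsize (d n) / (8 * pi\<^sup>2) \<le> (\<Sum>\<^sub>\<infinity>s. K (lattice_pt (h n) (d n) s)) \<and>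
     smoothing_weights (d n) (weight K (h n) (d n)) (C0 / (vabs (h n) * gsize (d n)))"
    using kernel_smoothing[OF K1 K2 bw d1 d2] by blast
  have even: "\<And>x. K (- x) = K x" using K1 unfolding K1_def by blast
  show ?thesis
  proof (rule prob_vanishing_imp_small_op)
    show "(\<lambda>\<omega>. SUP j\<in>grid (d n). \<bar>fhat K (h n) (d n) (\<lambda>t. V t \<omega>) (freq (d n) j) - fhat K (h n) (d n) (\<lambda>t. Vhat n t \<omega>) (freq (d n) j)\<bar>) \<in> borel_measurable M" for n
      by (intro borel_measurable_finite_SUP finite_grid borel_measurable_abs borel_measurable_diff fhat_measurable V_meas Vhat_meas)
    show "prob_vanishing M (\<lambda>n \<omega>. \<bar>SUP j\<in>grid (d n). \<bar>fhat K (h n) (d n) (\<lambda>t. V t \<omega>) (freq (d n) j) - fhat K (h n) (d n) (\<lambda>t. Vhat n t \<omega>) (freq (d n) j)\<bar>\<bar>)"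
    proof (rule smoothed_powr_differences_vanish[OF K1 K2 bw _ _ Y, where q=1 and p=1 and J="\<lambda>n. grid (d n)"])
      have "\<forall>\<^sub>F n in sequentially. inverse (vabs (h n)) = (gsize (d n) powr (1 - 1) / vabs (h n)) powr (1 / 1)"
        using ev
      proof eventually_elim
        case (elim n)
        then interpret smoothing_weights "d n" "weight K (h n) (d n)" "C0 / (vabs (h n) * gsize (d n))" by blast
        have "vabs (h n) > 0" using elim by (simp add: vabs_def)
        then show ?case using gsize_pos by (simp add: divide_inverse)
      qed
      then show "(\<lambda>n. (gsize (d n) powr (1 - 1) / vabs (h n)) powr (1 / 1)) \<in> O(\<alpha>)"
        using O by (simp only: landau_o.big.in_cong)
      show "\<forall>\<^sub>F n in sequentially. \<forall>k\<in>grid (d n). \<forall>\<omega>\<in>space M. (\<Sum>\<^sub>\<infinity>s. weight K (h n) (d n) s * I\<^sub>V n \<omega> (k + s) powr 1) \<le> Y n \<omega>"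
        using Q ev
      proof eventually_elim
        case (elim n)
        then interpret smoothing_weights "d n" "weight K (h n) (d n)" "C0 / (vabs (h n) * gsize (d n))" by blast
        show ?case
        proof (intro ballI)
          fix k \<omega> assume k: "k \<in> grid (d n)" "\<omega> \<in> space M"
          have "(\<Sum>\<^sub>\<infinity>s. weight K (h n) (d n) s * I\<^sub>V n \<omega> (k + s) powr 1) = (\<Sum>r\<in>grid (d n). pbar r * I\<^sub>V n \<omega> (k + r) powr 1)"
            by (rule smooth_eq) (rule grid_periodic_comp[OF pgram_periodic(2)[OF d_pos]])
          also have "\<dots> \<le> Q k (\<lambda>t. V t \<omega> - \<mu>)"
            unfolding Q_def by (intro sum_mono mult_left_mono pbar_nonneg) (simp add: pgram_le_centered d_pos)
          also have "\<dots> \<le> Y n \<omega>" using elim(1) k by blast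
          finally show "(\<Sum>\<^sub>\<infinity>s. weight K (h n) (d n) s * I\<^sub>V n \<omega> (k + s) powr 1) \<le> Y n \<omega>" .
        qed
      qed
      show "\<forall>\<^sub>F n in sequentially. \<forall>\<omega>\<in>space M. \<forall>c. (\<forall>k\<in>grid (d n). \<bar>\<Sum>\<^sub>\<infinity>s. weight K (h n) (d n) s * (I\<^sub>V n \<omega> (k + s) powr 1 - I\<^sub>H n \<omega> (k + s) powr 1)\<bar> \<le> c)
         \<longrightarrow> \<bar>SUP j\<in>grid (d n). \<bar>fhat K (h n) (d n) (\<lambda>t. V t \<omega>) (freq (d n) j) - fhat K (h n) (d n) (\<lambda>t. Vhat n t \<omega>) (freq (d n) j)\<bar>\<bar> \<le> c"
        using ev
      proof eventually_elim
        case (elim n)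
        then interpret smoothing_weights "d n" "weight K (h n) (d n)" "C0 / (vabs (h n) * gsize (d n))" by blast
        have h: "fst (h n) > 0" "snd (h n) > 0" using elim by blast+
        show ?case
        proof (intro ballI allI impI abs_SUP_le finite_grid)
          show "grid (d n) \<noteq> {}" using grid_nonempty by blast
          fix \<omega> c j assume b: "\<forall>k\<in>grid (d n). \<bar>\<Sum>\<^sub>\<infinity>s. weight K (h n) (d n) s * (I\<^sub>V n \<omega> (k + s) powr 1 - I\<^sub>H n \<omega> (k + s) powr 1)\<bar> \<le> c"
            and j: "j \<in> grid (d n)"
          let ?S = "\<Sum>\<^sub>\<infinity>s. weight K (h n) (d n) s * (I\<^sub>V n \<omega> (j + s) powr 1 - I\<^sub>H n \<omega> (j + s) powr 1)"
          have sm: "(\<Sum>\<^sub>\<infinity>s. weight K (h n) (d n) s * pgram (d n) W (j + s)) = (\<Sum>r\<in>grid (d n). pbar r * pgram (d n) W (j + r))" for W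
            by (rule smooth_eq) (rule pgram_periodic(2)[OF d_pos])
          have "?S = (\<Sum>r\<in>grid (d n). pbar r * (I\<^sub>V n \<omega> (j + r) powr 1 - I\<^sub>H n \<omega> (j + r) powr 1))"
            by (rule smooth_eq[where F="\<lambda>j. I\<^sub>V n \<omega> j powr 1 - I\<^sub>H n \<omega> j powr 1"])
              (rule grid_periodic_comp2[OF pgram_periodic(2)[OF d_pos] pgram_periodic(2)[OF d_pos]])
          then have "fhat K (h n) (d n) (\<lambda>t. V t \<omega>) (freq (d n) j) - fhat K (h n) (d n) (\<lambda>t. Vhat n t \<omega>) (freq (d n) j) = 1 / (4 * pi\<^sup>2) * ?S"
            unfolding fhat_eq_smooth[where K=K and h="h n", OF h d_pos even] sm by (simp add: right_diff_distrib sum_subtractf)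
          then have eq: "\<bar>fhat K (h n) (d n) (\<lambda>t. V t \<omega>) (freq (d n) j) - fhat K (h n) (d n) (\<lambda>t. Vhat n t \<omega>) (freq (d n) j)\<bar> = 1 / (4 * pi\<^sup>2) * \<bar>?S\<bar>"
            by (simp only: abs_mult) simp
          have "1 \<le> pi\<^sup>2" by (rule one_le_power) (use pi_gt3 in simp)
          then have "1 \<le> 4 * pi\<^sup>2" by linarith
          then have "1 / (4 * pi\<^sup>2) * \<bar>?S\<bar> \<le> 1 * \<bar>?S\<bar>" by (intro mult_right_mono) auto
          also have "\<dots> \<le> c" using b j by simp
          finally show "\<bar>\<bar>fhat K (h n) (d n) (\<lambda>t. V t \<omega>) (freq (d n) j) - fhat K (h n) (d n) (\<lambda>t. Vhat n t \<omega>) (freq (d n) j)\<bar>\<bar> \<le> c"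
            unfolding eq[symmetric] by simp
        qed
      qed
    qed simp_all
  qed
qed

end

section \<open>Averages over half the frequencies\<close>

context estimated_field
begin

abbreviation "f\<^sub>V n j \<equiv> spec_dens M V (freq (d n) j)"

text \<open>
  The spectral density is bounded below on the box of Fourier frequencies, so dividing by it costs a constant, and the
  uniform weights are at most \<open>8 / |T|\<close>.
\<close>

lemma half_grid_perturbed_averages:
  assumes P3: "P3 M V" and q: "q \<ge> 1" and O: "(\<lambda>n. gsize (d n) powr ((q - 1) / q)) \<in> O(\<alpha>)"
    and A: "prob_bounded M A"
    and mom: "\<And>n \<omega>. \<omega> \<in> space M \<Longrightarrow>
      1 / real (card (half_grid (d n))) * (\<Sum>j\<in>half_grid (d n). I\<^sub>V n \<omega> j powr q / f\<^sub>V n j powr q) \<le> A n \<omega>"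
  shows "\<exists>E :: nat \<Rightarrow> 'w \<Rightarrow> real. perturbed_averages M (\<lambda>_. {()}) (\<lambda>n. half_grid (d n)) (\<lambda>n _ _. 1 / real (card (half_grid (d n))))
     (\<lambda>n _ j \<omega>. I\<^sub>V n \<omega> j / f\<^sub>V n j) (\<lambda>n _ j \<omega>. I\<^sub>H n \<omega> j / f\<^sub>V n j) (\<lambda>n _ j \<omega>. I\<^sub>D n \<omega> j / f\<^sub>V n j) A E q \<and>
     (\<forall>\<^sub>F n in sequentially. \<forall>j\<in>half_grid (d n). f\<^sub>V n j > 0)"
proof -
  obtain c where c: "c > 0" "\<And>l. l \<in> {0..2 * pi} \<times> {0..2 * pi} \<Longrightarrow> c \<le> spec_dens M V l"
    using P3 unfolding P3_def by blast
  have big: "\<forall>\<^sub>F n in sequentially. fst (d n) \<ge> 3 \<and> snd (d n) \<ge> 3 \<and> gsize (d n) \<ge> 1"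
    by (rule eventually_gsize_ge[OF d1 d2])
  have fc: "c \<le> f\<^sub>V n j" if "fst (d n) \<ge> 3" "snd (d n) \<ge> 3" "j \<in> half_grid (d n)" for n j
    using half_grid_size(1)[OF that(1,2)] that(3) by (intro c(2) freq_in_box) blast
  have f0: "\<forall>\<^sub>F n in sequentially. \<forall>j\<in>half_grid (d n). f\<^sub>V n j > 0"
    using big
  proof (rule eventually_mono)
    fix n assume n: "fst (d n) \<ge> 3 \<and> snd (d n) \<ge> 3 \<and> gsize (d n) \<ge> 1"
    show "\<forall>j\<in>half_grid (d n). f\<^sub>V n j > 0"
      using fc[of n] n c(1) less_le_trans by blast
  qed
  let ?N = "\<lambda>n. real (card (half_grid (d n)))"
  let ?c = "\<lambda>n. gsize (d n) powr ((q - 1) / q)"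
  let ?E = "\<lambda>n \<omega>. (8 / c powr q) * (?c n * err n \<omega>) powr q"
  have "perturbed_averages M (\<lambda>_. {()}) (\<lambda>n. half_grid (d n)) (\<lambda>n _ _. 1 / ?N n)
     (\<lambda>n _ j \<omega>. I\<^sub>V n \<omega> j / f\<^sub>V n j) (\<lambda>n _ j \<omega>. I\<^sub>H n \<omega> j / f\<^sub>V n j) (\<lambda>n _ j \<omega>. I\<^sub>D n \<omega> j / f\<^sub>V n j) A ?E q"
  proof (intro perturbed_averages.intro perturbed_averages_axioms.intro q A prob_space_axioms)
    show "prob_vanishing M ?E"
      using q err_nonneg by (intro prob_vanishing_cmult_powr err_rate O) auto
    show "\<forall>\<^sub>F n in sequentially. \<forall>k\<in>{()}. (\<forall>j\<in>half_grid (d n). 0 \<le> 1 / ?N n) \<and> (\<Sum>j\<in>half_grid (d n). 1 / ?N n) = 1"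
      using big
    proof (rule eventually_mono)
      fix n assume "fst (d n) \<ge> 3 \<and> snd (d n) \<ge> 3 \<and> gsize (d n) \<ge> 1"
      then have "card (half_grid (d n)) \<noteq> 0" using half_grid_nonempty[of "d n"] finite_half_grid by simp
      then show "\<forall>k\<in>{()}. (\<forall>j\<in>half_grid (d n). 0 \<le> 1 / ?N n) \<and> (\<Sum>j\<in>half_grid (d n). 1 / ?N n) = 1" by simp
    qed
    show "\<forall>\<^sub>F n in sequentially. \<forall>k\<in>{()}. \<forall>j\<in>half_grid (d n). \<forall>\<omega>\<in>space M. 0 \<le> I\<^sub>V n \<omega> j / f\<^sub>V n j \<and> 0 \<le> I\<^sub>H n \<omega> j / f\<^sub>V n j \<and> 0 \<le> I\<^sub>D n \<omega> j / f\<^sub>V n j \<and>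
        \<bar>sqrt (I\<^sub>V n \<omega> j / f\<^sub>V n j) - sqrt (I\<^sub>H n \<omega> j / f\<^sub>V n j)\<bar> \<le> sqrt (I\<^sub>D n \<omega> j / f\<^sub>V n j)"
      using f0
    proof (rule eventually_mono)
      fix n assume f: "\<forall>j\<in>half_grid (d n). f\<^sub>V n j > 0"
      have "\<bar>sqrt (I\<^sub>V n \<omega> j / f\<^sub>V n j) - sqrt (I\<^sub>H n \<omega> j / f\<^sub>V n j)\<bar> \<le> sqrt (I\<^sub>D n \<omega> j / f\<^sub>V n j)" if "f\<^sub>V n j > 0" for j \<omega>
      proof -
        have "\<bar>sqrt (I\<^sub>V n \<omega> j / f\<^sub>V n j) - sqrt (I\<^sub>H n \<omega> j / f\<^sub>V n j)\<bar> = \<bar>sqrt (I\<^sub>V n \<omega> j) - sqrt (I\<^sub>H n \<omega> j)\<bar> / sqrt (f\<^sub>V n j)"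
          using that by (simp add: real_sqrt_divide diff_divide_distrib[symmetric])
        also have "\<dots> \<le> sqrt (I\<^sub>D n \<omega> j) / sqrt (f\<^sub>V n j)"
          using that by (intro divide_right_mono sqrt_pgram_diff) auto
        finally show ?thesis by (simp add: real_sqrt_divide)
      qed
      with f show "\<forall>k\<in>{()}. \<forall>j\<in>half_grid (d n). \<forall>\<omega>\<in>space M. 0 \<le> I\<^sub>V n \<omega> j / f\<^sub>V n j \<and> 0 \<le> I\<^sub>H n \<omega> j / f\<^sub>V n j \<and> 0 \<le> I\<^sub>D n \<omega> j / f\<^sub>V n j \<and>
        \<bar>sqrt (I\<^sub>V n \<omega> j / f\<^sub>V n j) - sqrt (I\<^sub>H n \<omega> j / f\<^sub>V n j)\<bar> \<le> sqrt (I\<^sub>D n \<omega> j / f\<^sub>V n j)"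
        by (auto intro!: divide_nonneg_pos)
    qed
    show "\<forall>\<^sub>F n in sequentially. \<forall>k\<in>{()}. \<forall>\<omega>\<in>space M.
       (\<Sum>j\<in>half_grid (d n). 1 / ?N n * (I\<^sub>V n \<omega> j / f\<^sub>V n j) powr q) \<le> A n \<omega>"
      using f0
    proof (rule eventually_mono)
      fix n assume f: "\<forall>j\<in>half_grid (d n). f\<^sub>V n j > 0"
      have "(\<Sum>j\<in>half_grid (d n). 1 / ?N n * (I\<^sub>V n \<omega> j / f\<^sub>V n j) powr q)
          = 1 / ?N n * (\<Sum>j\<in>half_grid (d n). I\<^sub>V n \<omega> j powr q / f\<^sub>V n j powr q)" for \<omega>
        unfolding sum_distrib_left using f by (intro sum.cong refl) (simp add: powr_divide less_imp_le)
      then show "\<forall>k\<in>{()}. \<forall>\<omega>\<in>space M. (\<Sum>j\<in>half_grid (d n). 1 / ?N n * (I\<^sub>V n \<omega> j / f\<^sub>V n j) powr q) \<le> A n \<omega>"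
        using mom by simp
    qed
    show "\<forall>\<^sub>F n in sequentially. \<forall>k\<in>{()}. \<forall>\<omega>\<in>space M.
       (\<Sum>j\<in>half_grid (d n). 1 / ?N n * (I\<^sub>D n \<omega> j / f\<^sub>V n j) powr q) \<le> ?E n \<omega>"
      using big
    proof (rule eventually_mono)
      fix n assume n: "fst (d n) \<ge> 3 \<and> snd (d n) \<ge> 3 \<and> gsize (d n) \<ge> 1"
      then have d3: "fst (d n) \<ge> 3" "snd (d n) \<ge> 3" and g: "gsize (d n) > 0" and dp: "fst (d n) > 0" "snd (d n) > 0" by auto
      note N = half_grid_size[OF d3]
      have "(\<Sum>j\<in>half_grid (d n). 1 / ?N n * (I\<^sub>D n \<omega> j / f\<^sub>V n j) powr q) \<le> ?E n \<omega>" for \<omega>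
      proof -
        have "(\<Sum>j\<in>half_grid (d n). 1 / ?N n * (I\<^sub>D n \<omega> j / f\<^sub>V n j) powr q)
            \<le> (\<Sum>j\<in>half_grid (d n). 8 / gsize (d n) * (I\<^sub>D n \<omega> j powr q / c powr q))"
        proof (rule sum_mono)
          fix j assume j: "j \<in> half_grid (d n)"
          have "1 / ?N n \<le> 1 / (gsize (d n) / 8)" using N(2) g by (intro divide_left_mono) auto
          moreover have "(I\<^sub>D n \<omega> j / f\<^sub>V n j) powr q \<le> (I\<^sub>D n \<omega> j / c) powr q"
            using fc[OF d3 j] c(1) q by (intro powr_mono2 divide_left_mono mult_pos_pos) (auto intro!: divide_nonneg_pos)
          then have "(I\<^sub>D n \<omega> j / f\<^sub>V n j) powr q \<le> I\<^sub>D n \<omega> j powr q / c powr q"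
            using c(1) by (simp add: powr_divide)
          ultimately show "1 / ?N n * (I\<^sub>D n \<omega> j / f\<^sub>V n j) powr q \<le> 8 / gsize (d n) * (I\<^sub>D n \<omega> j powr q / c powr q)"
            using g by (intro mult_mono) auto
        qed
        also have "\<dots> = 8 / c powr q / gsize (d n) * (\<Sum>j\<in>half_grid (d n). I\<^sub>D n \<omega> j powr q)"
          by (simp add: sum_distrib_left mult_ac)
        also have "\<dots> \<le> 8 / c powr q / gsize (d n) * (gsize (d n) * err n \<omega>) powr q"
        proof (rule mult_left_mono)
          have "(\<Sum>j\<in>half_grid (d n). I\<^sub>D n \<omega> j powr q) \<le> (\<Sum>j\<in>grid (d n). I\<^sub>D n \<omega> j powr q)"
            by (rule sum_mono2[OF finite_grid N(1)]) simp
          also have "\<dots> \<le> (gsize (d n) * err n \<omega>) powr q"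
            unfolding sum_difference_pgram[OF dp, symmetric] using q by (intro sum_powr_le_powr_sum) auto
          finally show "(\<Sum>j\<in>half_grid (d n). I\<^sub>D n \<omega> j powr q) \<le> (gsize (d n) * err n \<omega>) powr q" .
        qed (use g in simp)
        also have "\<dots> = ?E n \<omega>"
        proof -
          have "?c n powr q = gsize (d n) powr (q - 1)" using q by (simp add: powr_powr)
          then have "(?c n * err n \<omega>) powr q = gsize (d n) powr (q - 1) * err n \<omega> powr q"
            using err_nonneg by (simp add: powr_mult)
          moreover have "(gsize (d n) * err n \<omega>) powr q = gsize (d n) * gsize (d n) powr (q - 1) * err n \<omega> powr q"
            using g err_nonneg by (simp add: powr_mult powr_diff)
          ultimately show ?thesis using g c(1) by (simp add: field_simps)
        qed
        finally show ?thesis .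
      qed
      then show "\<forall>k\<in>{()}. \<forall>\<omega>\<in>space M. (\<Sum>j\<in>half_grid (d n). 1 / ?N n * (I\<^sub>D n \<omega> j / f\<^sub>V n j) powr q) \<le> ?E n \<omega>" by blast
    qed
  qed
  with f0 show ?thesis by blast
qed

lemma averaged_powr_differences_vanish:
  assumes P3: "P3 M V" and q: "q \<ge> 1" and O: "(\<lambda>n. gsize (d n) powr ((q - 1) / q)) \<in> O(\<alpha>)"
    and A: "prob_bounded M A"
    and mom: "\<And>n \<omega>. \<omega> \<in> space M \<Longrightarrow>
      1 / real (card (half_grid (d n))) * (\<Sum>j\<in>half_grid (d n). I\<^sub>V n \<omega> j powr q / f\<^sub>V n j powr q) \<le> A n \<omega>"
    and p: "0 < p" "p \<le> q"
    and F: "\<And>n \<omega> j. f\<^sub>V n j > 0 \<Longrightarrow> F n \<omega> j = (I\<^sub>V n \<omega> j powr p - I\<^sub>H n \<omega> j powr p) / f\<^sub>V n j powr p"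
    and meas: "\<And>n j. (\<lambda>\<omega>. F n \<omega> j) \<in> borel_measurable M"
  shows "small_op M (\<lambda>_. 1) (\<lambda>n \<omega>. 1 / real (card (half_grid (d n))) * (\<Sum>j\<in>half_grid (d n). F n \<omega> j))"
proof -
  obtain E where "perturbed_averages M (\<lambda>_. {()}) (\<lambda>n. half_grid (d n)) (\<lambda>n _ _. 1 / real (card (half_grid (d n))))
     (\<lambda>n _ j \<omega>. I\<^sub>V n \<omega> j / f\<^sub>V n j) (\<lambda>n _ j \<omega>. I\<^sub>H n \<omega> j / f\<^sub>V n j) (\<lambda>n _ j \<omega>. I\<^sub>D n \<omega> j / f\<^sub>V n j) A E q"
    and f0: "\<forall>\<^sub>F n in sequentially. \<forall>j\<in>half_grid (d n). f\<^sub>V n j > 0"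
    using half_grid_perturbed_averages[OF P3 q O A mom] by blast
  then interpret pa: perturbed_averages M "\<lambda>_. {()}" "\<lambda>n. half_grid (d n)" "\<lambda>n _ _. 1 / real (card (half_grid (d n)))"
     "\<lambda>n _ j \<omega>. I\<^sub>V n \<omega> j / f\<^sub>V n j" "\<lambda>n _ j \<omega>. I\<^sub>H n \<omega> j / f\<^sub>V n j" "\<lambda>n _ j \<omega>. I\<^sub>D n \<omega> j / f\<^sub>V n j" A E q by blast
  show ?thesis
  proof (rule prob_vanishing_imp_small_op)
    show "(\<lambda>\<omega>. 1 / real (card (half_grid (d n))) * (\<Sum>j\<in>half_grid (d n). F n \<omega> j)) \<in> borel_measurable M" for n
      by (intro borel_measurable_times borel_measurable_const borel_measurable_sum meas)
    show "prob_vanishing M (\<lambda>n \<omega>. \<bar>1 / real (card (half_grid (d n))) * (\<Sum>j\<in>half_grid (d n). F n \<omega> j)\<bar>)"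
    proof (rule pa.powr_differences_vanish[OF p], rule eventually_mono[OF f0])
      fix n assume f: "\<forall>j\<in>half_grid (d n). f\<^sub>V n j > 0"
      have "(\<Sum>j\<in>half_grid (d n). 1 / real (card (half_grid (d n))) * ((I\<^sub>V n \<omega> j / f\<^sub>V n j) powr p - (I\<^sub>H n \<omega> j / f\<^sub>V n j) powr p))
          = 1 / real (card (half_grid (d n))) * (\<Sum>j\<in>half_grid (d n). F n \<omega> j)" for \<omega>
        unfolding sum_distrib_left using f
        by (intro sum.cong refl) (simp add: F powr_divide less_imp_le diff_divide_distrib)
      then show "\<forall>\<omega>\<in>space M. \<forall>c. (\<forall>k\<in>{()}. \<bar>\<Sum>j\<in>half_grid (d n). 1 / real (card (half_grid (d n))) * ((I\<^sub>V n \<omega> j / f\<^sub>V n j) powr p - (I\<^sub>H n \<omega> j / f\<^sub>V n j) powr p)\<bar> \<le> c)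
         \<longrightarrow> \<bar>1 / real (card (half_grid (d n))) * (\<Sum>j\<in>half_grid (d n). F n \<omega> j)\<bar> \<le> c"
        by simp
    qed
  qed
qed

lemma averaged_coef_differences_vanish:
  assumes P3: "P3 M V" and q: "q \<ge> 1" and O: "(\<lambda>n. gsize (d n) powr ((q - 1) / q)) \<in> O(\<alpha>)"
    and A: "prob_bounded M A"
    and mom: "\<And>n \<omega>. \<omega> \<in> space M \<Longrightarrow>
      1 / real (card (half_grid (d n))) * (\<Sum>j\<in>half_grid (d n). I\<^sub>V n \<omega> j powr q / f\<^sub>V n j powr q) \<le> A n \<omega>"
  shows "small_op M (\<lambda>_. 1) (\<lambda>n \<omega>. 1 / real (card (half_grid (d n))) * (\<Sum>j\<in>half_grid (d n).
        (xcoef (d n) (\<lambda>t. V t \<omega>) j - xcoef (d n) (\<lambda>t. Vhat n t \<omega>) j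
         + ycoef (d n) (\<lambda>t. V t \<omega>) j - ycoef (d n) (\<lambda>t. Vhat n t \<omega>) j) / sqrt (f\<^sub>V n j)))"
    (is "small_op M _ (\<lambda>n \<omega>. 1 / real (card (half_grid (d n))) * (\<Sum>j\<in>half_grid (d n). ?F n \<omega> j / _ n j))")
proof -
  obtain E where "perturbed_averages M (\<lambda>_. {()}) (\<lambda>n. half_grid (d n)) (\<lambda>n _ _. 1 / real (card (half_grid (d n))))
     (\<lambda>n _ j \<omega>. I\<^sub>V n \<omega> j / f\<^sub>V n j) (\<lambda>n _ j \<omega>. I\<^sub>H n \<omega> j / f\<^sub>V n j) (\<lambda>n _ j \<omega>. I\<^sub>D n \<omega> j / f\<^sub>V n j) A E q"
    and f0: "\<forall>\<^sub>F n in sequentially. \<forall>j\<in>half_grid (d n). f\<^sub>V n j > 0"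
    using half_grid_perturbed_averages[OF P3 q O A mom] by blast
  then interpret pa: perturbed_averages M "\<lambda>_. {()}" "\<lambda>n. half_grid (d n)" "\<lambda>n _ _. 1 / real (card (half_grid (d n)))"
     "\<lambda>n _ j \<omega>. I\<^sub>V n \<omega> j / f\<^sub>V n j" "\<lambda>n _ j \<omega>. I\<^sub>H n \<omega> j / f\<^sub>V n j" "\<lambda>n _ j \<omega>. I\<^sub>D n \<omega> j / f\<^sub>V n j" A E q by blast
  show ?thesis
  proof (rule prob_vanishing_imp_small_op)
    show "(\<lambda>\<omega>. 1 / real (card (half_grid (d n))) * (\<Sum>j\<in>half_grid (d n). ?F n \<omega> j / sqrt (f\<^sub>V n j))) \<in> borel_measurable M" for n
      by (intro borel_measurable_times borel_measurable_const borel_measurable_sum borel_measurable_divide borel_measurable_add borel_measurable_diff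
          coef_measurable V_meas Vhat_meas)
    show "prob_vanishing M (\<lambda>n \<omega>. \<bar>1 / real (card (half_grid (d n))) * (\<Sum>j\<in>half_grid (d n). ?F n \<omega> j / sqrt (f\<^sub>V n j))\<bar>)"
    proof (rule pa.root_averages_vanish[where g="\<lambda>n _ j \<omega>. ?F n \<omega> j / sqrt (f\<^sub>V n j)"])
      show "\<forall>\<^sub>F n in sequentially. \<forall>k\<in>{()}. \<forall>j\<in>half_grid (d n). \<forall>\<omega>\<in>space M. \<bar>?F n \<omega> j / sqrt (f\<^sub>V n j)\<bar> \<le> 2 * sqrt (I\<^sub>D n \<omega> j / f\<^sub>V n j)"
        using f0
      proof (rule eventually_mono)
        fix n assume f: "\<forall>j\<in>half_grid (d n). f\<^sub>V n j > 0"
        have "\<bar>?F n \<omega> j / sqrt (f\<^sub>V n j)\<bar> \<le> 2 * sqrt (I\<^sub>D n \<omega> j / f\<^sub>V n j)" if "f\<^sub>V n j > 0" for j \<omega>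
        proof -
          have "?F n \<omega> j = xcoef (d n) (\<lambda>t. V t \<omega> - Vhat n t \<omega>) j + ycoef (d n) (\<lambda>t. V t \<omega> - Vhat n t \<omega>) j"
            unfolding coef_diff by simp
          then have "\<bar>?F n \<omega> j\<bar> \<le> 2 * sqrt (I\<^sub>D n \<omega> j)" using coef_sum_le by simp
          then have "\<bar>?F n \<omega> j\<bar> / sqrt (f\<^sub>V n j) \<le> 2 * sqrt (I\<^sub>D n \<omega> j) / sqrt (f\<^sub>V n j)"
            using that by (intro divide_right_mono) auto
          then show ?thesis using that by (simp add: real_sqrt_divide)
        qed
        with f show "\<forall>k\<in>{()}. \<forall>j\<in>half_grid (d n). \<forall>\<omega>\<in>space M. \<bar>?F n \<omega> j / sqrt (f\<^sub>V n j)\<bar> \<le> 2 * sqrt (I\<^sub>D n \<omega> j / f\<^sub>V n j)" by blast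
      qed
      show "\<forall>\<^sub>F n in sequentially. \<forall>\<omega>\<in>space M. \<forall>c. (\<forall>k\<in>{()}. \<bar>\<Sum>j\<in>half_grid (d n). 1 / real (card (half_grid (d n))) * (?F n \<omega> j / sqrt (f\<^sub>V n j))\<bar> \<le> c)
         \<longrightarrow> \<bar>1 / real (card (half_grid (d n))) * (\<Sum>j\<in>half_grid (d n). ?F n \<omega> j / sqrt (f\<^sub>V n j))\<bar> \<le> c"
        unfolding sum_distrib_left by simp
    qed
  qed
qed

end

section \<open>The transfer of limits from the field to its estimate\<close>

theorem theorem6p1:
  fixes M :: "'w measure"
    and V :: "int \<times> int \<Rightarrow> 'w \<Rightarrow> real" and \<mu> :: real
    and d :: "nat \<Rightarrow> nat \<times> nat"
    and S :: "'y measure" and Y :: "nat \<Rightarrow> int \<times> int \<Rightarrow> 'w \<Rightarrow> 'y"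
    and Vhat :: "nat \<Rightarrow> int \<times> int \<Rightarrow> 'w \<Rightarrow> real"
    and \<alpha> :: "nat \<Rightarrow> real"
    and h :: "nat \<Rightarrow> real \<times> real"
    and K Kp :: "real \<times> real \<Rightarrow> real"
  assumes prob: "prob_space M"
    and stat: "stationary_field M V \<mu>"
    and d1: "filterlim (\<lambda>n. fst (d n)) at_top sequentially"
    and d2: "filterlim (\<lambda>n. snd (d n)) at_top sequentially"
    and data: "\<And>n t. t \<in> grid (d n) \<Longrightarrow> Y n t \<in> M \<rightarrow>\<^sub>M S"
    and estimator: "\<And>n t. t \<in> grid (d n) \<Longrightarrow>
          \<exists>g \<in> borel_measurable (Pi\<^sub>M (grid (d n)) (\<lambda>_. S)).
            \<forall>\<omega> \<in> space M. Vhat n t \<omega> = g (\<lambda>s \<in> grid (d n). Y n s \<omega>)"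
    and alpha: "filterlim \<alpha> at_top sequentially"
    and mse: "small_op M (\<lambda>n. inverse (\<alpha> n))
          (\<lambda>n \<omega>. 1 / gsize (d n) * (\<Sum>t\<in>grid (d n). (V t \<omega> - Vhat n t \<omega>)\<^sup>2))"
    and bandwidth: "bandwidth_cond d h"
    and kernel_f: "K1 d h K" "K2 h K"
    and kernel_p: "K1 d h Kp" "K2 h Kp"
  shows
    "(P1 d \<and> P2 M V \<mu> \<and> K1 d h K \<and>
      ((K3 K \<and> (\<exists>v. 0 < v \<and> v \<le> 1 / 2 \<and> P4 M V \<mu> d v \<and>
           (\<lambda>n. vabs (h n) + inverse (vabs (h n)) * gsize (d n) powr (- v)) \<longlonglongrightarrow> 0)) \<or>
       (K4 K \<and> P3 M V \<and>
         (\<exists>G e. innovation_rep M V \<mu> G e \<and> (\<exists>p\<ge>2. p_stable M V \<mu> G e p) \<and> gmc M V \<mu> G e) \<and>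
         (\<exists>\<phi> \<eta>. 4 < \<phi> \<and> \<phi> \<le> 8 \<and> integrable M (\<lambda>\<omega>. \<bar>V 0 \<omega>\<bar> powr \<phi>) \<and>
           (\<lambda>n. vabs (h n)) \<longlonglongrightarrow> 0 \<and> 0 < \<eta> \<and> \<eta> < (\<phi> - 4) / \<phi> \<and>
           (\<lambda>n. inverse (vabs (h n) * gsize (d n) powr \<eta>)) \<in> O(\<lambda>_. 1)))) \<and>
      (\<lambda>n. inverse (vabs (h n))) \<in> O(\<alpha>)
      \<longrightarrow>
      small_op M (\<lambda>_. 1) (\<lambda>n \<omega>. SUP j\<in>grid (d n).
        \<bar>fhat K (h n) (d n) (\<lambda>t. V t \<omega>) (freq (d n) j)
         - fhat K (h n) (d n) (\<lambda>t. Vhat n t \<omega>) (freq (d n) j)\<bar>)) \<and>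
    (\<forall>q. P1 d \<and> P2 M V \<mu> \<and> P3 M V \<and>
      ((\<exists>r>1/2. linear_field M V \<mu> r) \<or>
       ((\<exists>G e. innovation_rep M V \<mu> G e \<and> gmc M V \<mu> G e) \<and>
         integrable M (\<lambda>\<omega>. \<bar>V 0 \<omega>\<bar> ^ 16))) \<and>
      (\<exists>\<epsilon>. 0 < \<epsilon> \<and> \<epsilon> < 1 \<and> q = 4 + \<epsilon>) \<and>
      (\<exists>C2 R. small_op M (\<lambda>_. 1) R \<and> (\<forall>n. \<forall>\<omega> \<in> space M.
         1 / real (card (half_grid (d n))) * (\<Sum>j\<in>half_grid (d n).
           pgram (d n) (\<lambda>t. V t \<omega>) j powr q / spec_dens M V (freq (d n) j) powr q)
         < C2 + R n \<omega>)) \<and>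
      (\<lambda>n. gsize (d n) powr ((q - 1) / q)) \<in> O(\<alpha>)
      \<longrightarrow>
      small_op M (\<lambda>_. 1) (\<lambda>n \<omega>. 1 / real (card (half_grid (d n))) * (\<Sum>j\<in>half_grid (d n).
        (xcoef (d n) (\<lambda>t. V t \<omega>) j - xcoef (d n) (\<lambda>t. Vhat n t \<omega>) j
         + ycoef (d n) (\<lambda>t. V t \<omega>) j - ycoef (d n) (\<lambda>t. Vhat n t \<omega>) j)
        / sqrt (spec_dens M V (freq (d n) j)))) \<and>
      small_op M (\<lambda>_. 1) (\<lambda>n \<omega>. 1 / real (card (half_grid (d n))) * (\<Sum>j\<in>half_grid (d n).
        (pgram (d n) (\<lambda>t. V t \<omega>) j - pgram (d n) (\<lambda>t. Vhat n t \<omega>) j)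
        / spec_dens M V (freq (d n) j))) \<and>
      small_op M (\<lambda>_. 1) (\<lambda>n \<omega>. 1 / real (card (half_grid (d n))) * (\<Sum>j\<in>half_grid (d n).
        ((pgram (d n) (\<lambda>t. V t \<omega>) j)\<^sup>2 - (pgram (d n) (\<lambda>t. Vhat n t \<omega>) j)\<^sup>2)
        / (spec_dens M V (freq (d n) j))\<^sup>2)) \<and>
      small_op M (\<lambda>_. 1) (\<lambda>n \<omega>. 1 / real (card (half_grid (d n))) * (\<Sum>j\<in>half_grid (d n).
        (pgram (d n) (\<lambda>t. V t \<omega>) j powr q - pgram (d n) (\<lambda>t. Vhat n t \<omega>) j powr q)
        / spec_dens M V (freq (d n) j) powr q))) \<and>
    (\<forall>q. P1 d \<and> P2 M V \<mu> \<and> P3 M V \<and>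
      ((\<exists>r>1/2. linear_field M V \<mu> r) \<or>
       ((\<exists>G e. innovation_rep M V \<mu> G e \<and> gmc M V \<mu> G e) \<and>
         integrable M (\<lambda>\<omega>. \<bar>V 0 \<omega>\<bar> ^ 16))) \<and>
      (\<lambda>n. inverse (vabs (h n) ^ 4 * gsize (d n))) \<longlonglongrightarrow> 0 \<and>
      K1 d h Kp \<and> K5 d h Kp \<and>
      (\<lambda>n. 1 / (gsize (d n) * vabs (h n)) * (\<Sum>\<^sub>\<infinity>j. (Kp (lattice_pt (h n) (d n) j))\<^sup>2))
        \<in> O(\<lambda>_. 1) \<and>
      (\<exists>\<epsilon>. 0 < \<epsilon> \<and> \<epsilon> < 1 \<and> q = 4 + \<epsilon>) \<and>
      (\<exists>C2 R. small_op M (\<lambda>_. 1) R \<and> (\<forall>n. \<forall>\<omega> \<in> space M.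
         (SUP j\<in>half_grid (d n). \<Sum>\<^sub>\<infinity>s. weight Kp (h n) (d n) s *
            pgram (d n) (\<lambda>t. V t \<omega>) (j + s) powr q)
         \<le> C2 + R n \<omega>)) \<and>
      (\<lambda>n. (gsize (d n) powr (q - 1) / vabs (h n)) powr (1 / q)) \<in> O(\<alpha>)
      \<longrightarrow>
      small_op M (\<lambda>_. 1) (\<lambda>n \<omega>. SUP k\<in>half_grid (d n).
        \<bar>\<Sum>\<^sub>\<infinity>j. weight Kp (h n) (d n) j *
          (xcoef (d n) (\<lambda>t. V t \<omega>) (k + j) - xcoef (d n) (\<lambda>t. Vhat n t \<omega>) (k + j)
           + ycoef (d n) (\<lambda>t. V t \<omega>) (k + j) - ycoef (d n) (\<lambda>t. Vhat n t \<omega>) (k + j))\<bar>) \<and>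
      small_op M (\<lambda>_. 1) (\<lambda>n \<omega>. SUP k\<in>half_grid (d n).
        \<bar>\<Sum>\<^sub>\<infinity>j. weight Kp (h n) (d n) j *
          (pgram (d n) (\<lambda>t. V t \<omega>) (k + j) - pgram (d n) (\<lambda>t. Vhat n t \<omega>) (k + j))\<bar>) \<and>
      small_op M (\<lambda>_. 1) (\<lambda>n \<omega>. SUP k\<in>half_grid (d n).
        \<Sum>\<^sub>\<infinity>j. weight Kp (h n) (d n) j *
          ((pgram (d n) (\<lambda>t. V t \<omega>) (k + j))\<^sup>2 - (pgram (d n) (\<lambda>t. Vhat n t \<omega>) (k + j))\<^sup>2)) \<and>
      small_op M (\<lambda>_. 1) (\<lambda>n \<omega>. SUP k\<in>half_grid (d n).
        \<Sum>\<^sub>\<infinity>j. weight Kp (h n) (d n) j *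
          (pgram (d n) (\<lambda>t. V t \<omega>) (k + j) powr q - pgram (d n) (\<lambda>t. Vhat n t \<omega>) (k + j) powr q)))"
proof -
  have Vhat_meas: "Vhat n t \<in> borel_measurable M" if t: "t \<in> grid (d n)" for n t
  proof -
    obtain g where g: "g \<in> borel_measurable (Pi\<^sub>M (grid (d n)) (\<lambda>_. S))"
      "\<forall>\<omega>\<in>space M. Vhat n t \<omega> = g (\<lambda>s\<in>grid (d n). Y n s \<omega>)"
      using estimator[OF t] by blast
    have "(\<lambda>\<omega>. \<lambda>s\<in>grid (d n). Y n s \<omega>) \<in> M \<rightarrow>\<^sub>M Pi\<^sub>M (grid (d n)) (\<lambda>_. S)"
      by (rule measurable_restrict) (rule data)
    from measurable_compose[OF this g(1)] show ?thesis
      using g(2) measurable_cong[of M "Vhat n t" "\<lambda>\<omega>. g (\<lambda>s\<in>grid (d n). Y n s \<omega>)" borel] by simp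
  qed
  interpret estimated_field M V \<mu> d Vhat \<alpha>
    by (intro estimated_field.intro estimated_field_axioms.intro prob stat d1 d2 Vhat_meas alpha mse)
  have bounded: "prob_bounded M (\<lambda>n \<omega>. C2 + \<bar>R n \<omega>\<bar>)" if "small_op M (\<lambda>_. 1) R" for C2 R
  proof -
    have "prob_vanishing M (\<lambda>n \<omega>. 1 * \<bar>R n \<omega>\<bar>)"
      by (rule small_op_imp_vanishing[OF that, where L=1]) auto
    then show ?thesis by (intro prob_bounded_const_add_vanishing) simp
  qed
  have I_meas: "(\<lambda>\<omega>. pgram (d n) (\<lambda>t. V t \<omega>) j) \<in> borel_measurable M" "(\<lambda>\<omega>. pgram (d n) (\<lambda>t. Vhat n t \<omega>) j) \<in> borel_measurable M" for n j
    by (intro pgram_measurable V_meas Vhat_meas; assumption)+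
  show ?thesis
  proof (intro conjI allI impI; (elim conjE)?)
    assume P1: "P1 d" and P2: "P2 M V \<mu>"
      and alt: "(K3 K \<and> (\<exists>v. 0 < v \<and> v \<le> 1 / 2 \<and> P4 M V \<mu> d v \<and>
           (\<lambda>n. vabs (h n) + inverse (vabs (h n)) * gsize (d n) powr (- v)) \<longlonglongrightarrow> 0)) \<or>
       (K4 K \<and> P3 M V \<and>
         (\<exists>G e. innovation_rep M V \<mu> G e \<and> (\<exists>p\<ge>2. p_stable M V \<mu> G e p) \<and> gmc M V \<mu> G e) \<and>
         (\<exists>\<phi> \<eta>. 4 < \<phi> \<and> \<phi> \<le> 8 \<and> integrable M (\<lambda>\<omega>. \<bar>V 0 \<omega>\<bar> powr \<phi>) \<and>
           (\<lambda>n. vabs (h n)) \<longlonglongrightarrow> 0 \<and> 0 < \<eta> \<and> \<eta> < (\<phi> - 4) / \<phi> \<and>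
           (\<lambda>n. inverse (vabs (h n) * gsize (d n) powr \<eta>)) \<in> O(\<lambda>_. 1)))"
      and O: "(\<lambda>n. inverse (vabs (h n))) \<in> O(\<alpha>)"
    have "\<exists>Y. prob_bounded M Y \<and> (\<forall>\<^sub>F n in sequentially. \<forall>k\<in>grid (d n). \<forall>\<omega>\<in>space M.
        smoothing_weights.Q (d n) (weight K (h n) (d n)) k (\<lambda>t. V t \<omega> - \<mu>) \<le> Y n \<omega>)"
      using alt
    proof (elim disjE conjE exE)
      fix v assume "K3 K" "0 < v" "v \<le> 1 / 2" "P4 M V \<mu> d v"
        "(\<lambda>n. vabs (h n) + inverse (vabs (h n)) * gsize (d n) powr (- v)) \<longlonglongrightarrow> 0"
      then show ?thesis using P2 unfolding P2_def
        by (intro smoothed_periodogram_tight_lag_window[OF prob stat _ _ _ kernel_f _ bandwidth d1 d2]) blast+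
    next
      fix G e \<phi> \<eta> assume "innovation_rep M V \<mu> G e" "gmc M V \<mu> G e" "4 < \<phi>" "\<phi> \<le> 8" "integrable M (\<lambda>\<omega>. \<bar>V 0 \<omega>\<bar> powr \<phi>)"
        "0 < \<eta>" "\<eta> < (\<phi> - 4) / \<phi>" "(\<lambda>n. inverse (vabs (h n) * gsize (d n) powr \<eta>)) \<in> O(\<lambda>_. 1)"
      then show ?thesis
        by (intro smoothed_periodogram_tight_gmc[OF prob stat _ _ _ _ _ _ _ _ kernel_f bandwidth d1 d2])
    qed
    then show "small_op M (\<lambda>_. 1) (\<lambda>n \<omega>. SUP j\<in>grid (d n).
        \<bar>fhat K (h n) (d n) (\<lambda>t. V t \<omega>) (freq (d n) j) - fhat K (h n) (d n) (\<lambda>t. Vhat n t \<omega>) (freq (d n) j)\<bar>)"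
      using fhat_difference_vanishes[OF kernel_f bandwidth O] by blast
  next
    fix q assume P3: "P3 M V" and q: "\<exists>\<epsilon>. 0 < \<epsilon> \<and> \<epsilon> < 1 \<and> q = 4 + \<epsilon>"
      and mom: "\<exists>C2 R. small_op M (\<lambda>_. 1) R \<and> (\<forall>n. \<forall>\<omega> \<in> space M.
         1 / real (card (half_grid (d n))) * (\<Sum>j\<in>half_grid (d n).
           pgram (d n) (\<lambda>t. V t \<omega>) j powr q / spec_dens M V (freq (d n) j) powr q)
         < C2 + R n \<omega>)"
      and O: "(\<lambda>n. gsize (d n) powr ((q - 1) / q)) \<in> O(\<alpha>)"
    obtain C2 R where R: "small_op M (\<lambda>_. 1) R" and lt: "\<forall>n. \<forall>\<omega> \<in> space M.
         1 / real (card (half_grid (d n))) * (\<Sum>j\<in>half_grid (d n). I\<^sub>V n \<omega> j powr q / f\<^sub>V n j powr q) < C2 + R n \<omega>"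
      using mom by blast
    have le: "1 / real (card (half_grid (d n))) * (\<Sum>j\<in>half_grid (d n). I\<^sub>V n \<omega> j powr q / f\<^sub>V n j powr q) \<le> C2 + \<bar>R n \<omega>\<bar>"
      if "\<omega> \<in> space M" for n \<omega>
      using lt[rule_format, OF that, of n] by linarith
    have q4: "q \<ge> 1" "2 \<le> q" using q by auto
    note avg = averaged_powr_differences_vanish[OF P3 q4(1) O bounded[OF R] le]
    show "small_op M (\<lambda>_. 1) (\<lambda>n \<omega>. 1 / real (card (half_grid (d n))) * (\<Sum>j\<in>half_grid (d n).
        (xcoef (d n) (\<lambda>t. V t \<omega>) j - xcoef (d n) (\<lambda>t. Vhat n t \<omega>) j
         + ycoef (d n) (\<lambda>t. V t \<omega>) j - ycoef (d n) (\<lambda>t. Vhat n t \<omega>) j) / sqrt (f\<^sub>V n j)))"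
      by (rule averaged_coef_differences_vanish[OF P3 q4(1) O bounded[OF R] le])
    show "small_op M (\<lambda>_. 1) (\<lambda>n \<omega>. 1 / real (card (half_grid (d n))) * (\<Sum>j\<in>half_grid (d n). (I\<^sub>V n \<omega> j - I\<^sub>H n \<omega> j) / f\<^sub>V n j))"
    proof (rule avg[where p=1])
      show "(\<lambda>\<omega>. (I\<^sub>V n \<omega> j - I\<^sub>H n \<omega> j) / f\<^sub>V n j) \<in> borel_measurable M" for n j
        by (intro borel_measurable_divide borel_measurable_diff I_meas borel_measurable_const)
    qed (use q4 in auto)
    show "small_op M (\<lambda>_. 1) (\<lambda>n \<omega>. 1 / real (card (half_grid (d n))) * (\<Sum>j\<in>half_grid (d n). ((I\<^sub>V n \<omega> j)\<^sup>2 - (I\<^sub>H n \<omega> j)\<^sup>2) / (f\<^sub>V n j)\<^sup>2))"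
    proof (rule avg[where p=2])
      show "(\<lambda>\<omega>. ((I\<^sub>V n \<omega> j)\<^sup>2 - (I\<^sub>H n \<omega> j)\<^sup>2) / (f\<^sub>V n j)\<^sup>2) \<in> borel_measurable M" for n j
        by (intro borel_measurable_divide borel_measurable_diff borel_measurable_power I_meas borel_measurable_const)
    qed (use q4 in auto)
    show "small_op M (\<lambda>_. 1) (\<lambda>n \<omega>. 1 / real (card (half_grid (d n))) * (\<Sum>j\<in>half_grid (d n). (I\<^sub>V n \<omega> j powr q - I\<^sub>H n \<omega> j powr q) / f\<^sub>V n j powr q))"
    proof (rule avg[where p=q])
      show "(\<lambda>\<omega>. (I\<^sub>V n \<omega> j powr q - I\<^sub>H n \<omega> j powr q) / f\<^sub>V n j powr q) \<in> borel_measurable M" for n j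
        by (intro borel_measurable_divide borel_measurable_diff powr_real_measurable I_meas borel_measurable_const)
    qed (use q4 in auto)
  next
    fix q assume q: "\<exists>\<epsilon>. 0 < \<epsilon> \<and> \<epsilon> < 1 \<and> q = 4 + \<epsilon>"
      and mom: "\<exists>C2 R. small_op M (\<lambda>_. 1) R \<and> (\<forall>n. \<forall>\<omega> \<in> space M.
         (SUP j\<in>half_grid (d n). \<Sum>\<^sub>\<infinity>s. weight Kp (h n) (d n) s * pgram (d n) (\<lambda>t. V t \<omega>) (j + s) powr q)
         \<le> C2 + R n \<omega>)"
      and O: "(\<lambda>n. (gsize (d n) powr (q - 1) / vabs (h n)) powr (1 / q)) \<in> O(\<alpha>)"
    obtain C2 R where R: "small_op M (\<lambda>_. 1) R" and le: "\<forall>n. \<forall>\<omega> \<in> space M.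
         (SUP j\<in>half_grid (d n). \<Sum>\<^sub>\<infinity>s. weight Kp (h n) (d n) s * I\<^sub>V n \<omega> (j + s) powr q) \<le> C2 + R n \<omega>"
      using mom by blast
    have q4: "q \<ge> 1" "2 \<le> q" using q by auto
    have "(\<Sum>\<^sub>\<infinity>s. weight Kp (h n) (d n) s * I\<^sub>V n \<omega> (k + s) powr q) \<le> C2 + \<bar>R n \<omega>\<bar>"
      if k: "k \<in> half_grid (d n)" and \<omega>: "\<omega> \<in> space M" for k n \<omega>
    proof -
      have "(\<Sum>\<^sub>\<infinity>s. weight Kp (h n) (d n) s * I\<^sub>V n \<omega> (k + s) powr q) \<le> (SUP j\<in>half_grid (d n). \<Sum>\<^sub>\<infinity>s. weight Kp (h n) (d n) s * I\<^sub>V n \<omega> (j + s) powr q)"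
        by (rule cSUP_upper[OF k]) (simp add: finite_half_grid)
      then show ?thesis using le[rule_format, OF \<omega>, of n] by linarith
    qed
    then have ev: "\<forall>\<^sub>F n in sequentially. \<forall>k\<in>half_grid (d n). \<forall>\<omega>\<in>space M.
       (\<Sum>\<^sub>\<infinity>s. weight Kp (h n) (d n) s * I\<^sub>V n \<omega> (k + s) powr q) \<le> C2 + \<bar>R n \<omega>\<bar>" by simp
    have nonempty: "\<forall>\<^sub>F n in sequentially. half_grid (d n) \<noteq> {}"
      using eventually_gsize_ge[OF d1 d2] by (rule eventually_mono) (simp add: half_grid_nonempty)
    note smooth = smoothed_powr_differences_vanish[OF kernel_p bandwidth q4(1) O bounded[OF R] ev]
    have sup_small: "small_op M (\<lambda>_. 1) (\<lambda>n \<omega>. SUP k\<in>half_grid (d n). \<Sum>\<^sub>\<infinity>s. weight Kp (h n) (d n) s * (I\<^sub>V n \<omega> (k + s) powr p - I\<^sub>H n \<omega> (k + s) powr p))"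
      "small_op M (\<lambda>_. 1) (\<lambda>n \<omega>. SUP k\<in>half_grid (d n). \<bar>\<Sum>\<^sub>\<infinity>s. weight Kp (h n) (d n) s * (I\<^sub>V n \<omega> (k + s) powr p - I\<^sub>H n \<omega> (k + s) powr p)\<bar>)"
      if p: "0 < p" "p \<le> q" for p
    proof -
      let ?S = "\<lambda>n k \<omega>. \<Sum>\<^sub>\<infinity>s. weight Kp (h n) (d n) s * (I\<^sub>V n \<omega> (k + s) powr p - I\<^sub>H n \<omega> (k + s) powr p)"
      have S: "?S n k \<in> borel_measurable M" for n k
        by (intro borel_measurable_infsum borel_measurable_times borel_measurable_const borel_measurable_diff powr_real_measurable I_meas)
      have "\<forall>\<^sub>F n in sequentially. \<forall>\<omega>\<in>space M. \<forall>c. (\<forall>k\<in>half_grid (d n). \<bar>?S n k \<omega>\<bar> \<le> c) \<longrightarrow> \<bar>SUP k\<in>half_grid (d n). ?S n k \<omega>\<bar> \<le> c"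
        using nonempty by (rule eventually_mono) (intro ballI allI impI abs_SUP_le finite_half_grid; blast)
      from smooth[OF p this] show "small_op M (\<lambda>_. 1) (\<lambda>n \<omega>. SUP k\<in>half_grid (d n). ?S n k \<omega>)"
        by (intro prob_vanishing_imp_small_op borel_measurable_finite_SUP finite_half_grid S)
      have "\<forall>\<^sub>F n in sequentially. \<forall>\<omega>\<in>space M. \<forall>c. (\<forall>k\<in>half_grid (d n). \<bar>?S n k \<omega>\<bar> \<le> c) \<longrightarrow> \<bar>SUP k\<in>half_grid (d n). \<bar>?S n k \<omega>\<bar>\<bar> \<le> c"
        using nonempty by (rule eventually_mono) (intro ballI allI impI abs_SUP_le finite_half_grid; (simp only: abs_idempotent)?; blast)
      from smooth[OF p this] show "small_op M (\<lambda>_. 1) (\<lambda>n \<omega>. SUP k\<in>half_grid (d n). \<bar>?S n k \<omega>\<bar>)"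
        by (intro prob_vanishing_imp_small_op borel_measurable_finite_SUP borel_measurable_abs finite_half_grid S)
    qed
    show "small_op M (\<lambda>_. 1) (\<lambda>n \<omega>. SUP k\<in>half_grid (d n).
        \<bar>\<Sum>\<^sub>\<infinity>j. weight Kp (h n) (d n) j *
          (xcoef (d n) (\<lambda>t. V t \<omega>) (k + j) - xcoef (d n) (\<lambda>t. Vhat n t \<omega>) (k + j)
           + ycoef (d n) (\<lambda>t. V t \<omega>) (k + j) - ycoef (d n) (\<lambda>t. Vhat n t \<omega>) (k + j))\<bar>)"
      (is "small_op M _ (\<lambda>n \<omega>. SUP k\<in>half_grid (d n). \<bar>?S n k \<omega>\<bar>)")
    proof (rule prob_vanishing_imp_small_op)
      show "(\<lambda>\<omega>. SUP k\<in>half_grid (d n). \<bar>?S n k \<omega>\<bar>) \<in> borel_measurable M" for n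
        by (intro borel_measurable_finite_SUP finite_half_grid borel_measurable_abs borel_measurable_infsum borel_measurable_times
            borel_measurable_const borel_measurable_add borel_measurable_diff coef_measurable V_meas Vhat_meas)
      show "prob_vanishing M (\<lambda>n \<omega>. \<bar>SUP k\<in>half_grid (d n). \<bar>?S n k \<omega>\<bar>\<bar>)"
      proof (rule smoothed_coef_differences_vanish[OF kernel_p bandwidth q4(1) O bounded[OF R] ev])
        show "\<forall>\<^sub>F n in sequentially. \<forall>\<omega>\<in>space M. \<forall>c. (\<forall>k\<in>half_grid (d n). \<bar>?S n k \<omega>\<bar> \<le> c) \<longrightarrow> \<bar>SUP k\<in>half_grid (d n). \<bar>?S n k \<omega>\<bar>\<bar> \<le> c"
          using nonempty by (rule eventually_mono) (intro ballI allI impI abs_SUP_le finite_half_grid; (simp only: abs_idempotent)?; blast)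
      qed
    qed
    show "small_op M (\<lambda>_. 1) (\<lambda>n \<omega>. SUP k\<in>half_grid (d n). \<bar>\<Sum>\<^sub>\<infinity>j. weight Kp (h n) (d n) j * (I\<^sub>V n \<omega> (k + j) - I\<^sub>H n \<omega> (k + j))\<bar>)"
      using sup_small(2)[of 1] q4 by (simp only: powr_one' pgram_nonneg) simp
    show "small_op M (\<lambda>_. 1) (\<lambda>n \<omega>. SUP k\<in>half_grid (d n). \<Sum>\<^sub>\<infinity>j. weight Kp (h n) (d n) j * ((I\<^sub>V n \<omega> (k + j))\<^sup>2 - (I\<^sub>H n \<omega> (k + j))\<^sup>2))"
      using sup_small(1)[of 2] q4 by (simp only: powr_numeral pgram_nonneg)
    show "small_op M (\<lambda>_. 1) (\<lambda>n \<omega>. SUP k\<in>half_grid (d n). \<Sum>\<^sub>\<infinity>j. weight Kp (h n) (d n) j * (I\<^sub>V n \<omega> (k + j) powr q - I\<^sub>H n \<omega> (k + j) powr q))"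
      using q4 by (intro sup_small) auto
  qed
qed

end
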